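(* Let $0<c_0<1$, $c_1>0$, $q>0$. (i) For every $(\beta_0,\beta_1)\in\mathbb H_0$, the output function $y(t)=Ce^{\mathcal A_0t}(\beta_0,\beta_1)$ belongs to $L^2[0,\infty)$; in terms of the solution $\beta$ of $$\beta_{tt}=\beta_{xx},\quad \beta_x(0,t)=\tfrac{c_1}{1-c_0}\beta(0,t)+\tfrac{c_0}{1-c_0}\beta_t(0,t),\quad \beta(1,t)=0,\quad (\beta(\cdot,0),\beta_t(\cdot,0))=(\beta_0,\beta_1),$$ one has $y(t)=\beta_x(1,t)$. (ii) Consequently, for the plant $$w_{tt}=w_{xx},\quad w_x(0,t)=-q\,w(0,t),\quad w_x(1,t)=u(t)+F(t),\qquad F(t)=f(w(\cdot,t),w_t(\cdot,t))+d(t),$$ coupled with the total disturbance estimator $$\begin{aligned} & v_{tt}=v_{xx},\quad v_x(0,t)=-q\,w(0,t)+c_1[v(0,t)-w(0,t)],\quad v_x(1,t)=u(t)-W_x(1,t),\\ & z_{tt}=z_{xx},\quad z_x(0,t)=\tfrac{c_1}{1-c_0}z(0,t)+\tfrac{c_0}{1-c_0}z_t(0,t),\quad z(1,t)=-v(1,t)+w(1,t)-W(1,t),\\ & W_t=-W_x,\quad W(0,t)=-c_0[v(0,t)-w(0,t)], \end{aligned}$$ for any solution with $(w,w_t),(v,v_t),(z,z_t)\in C(0,\infty;\mathbb H)$ and $W\in C(0,\infty;H^1(0,1))$, the estimator output $\widehat F(t)=z_x(1,t)$ satisfies $\widehat F-F\in L^2[0,\infty)$; indeed $\widehat F(t)-F(t)=\beta_x(1,t)$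 with $\beta=z-p$, $p=w-v-W$.
   Context: $\mathbb H=H^1(0,1)\times L^2(0,1)$ with norm $\|(\phi,\psi)\|_{\mathbb H}^2=\int_0^1(|\phi'|^2+|\psi|^2)\,dx+|\phi(0)|^2$; $H^1_R(0,1)=\{\phi\in H^1(0,1):\phi(1)=0\}$; $\mathbb H_0=H^1_R(0,1)\times L^2(0,1)$, a closed subspace of $\mathbb H$. The operator $\mathcal A_0$ on $\mathbb H_0$ is $\mathcal A_0(\phi,\psi)=(\psi,\phi'')$ with domain $\mathcal D(\mathcal A_0)=\{(\phi,\psi)\in H^2(0,1)\times H^1(0,1): \phi(1)=0,\ \psi(1)=0,\ \phi'(0)=\frac{c_1}{1-c_0}\phi(0)+\frac{c_0}{1-c_0}\psi(0)\}$; it generates an exponentially stable operator semigroup $e^{\mathcal A_0t}$ on $\mathbb H_0$. $C:\mathcal D(\mathcal A_0)\to\mathbb R$ is $C(\phi,\psi)=\phi'(1)$; it is an admissible observation operator for $e^{\mathcal A_0t}$, and for general $(\beta_0,\beta_1)\in\mathbb H_0$ the output function $Ce^{\mathcal A_0t}(\beta_0,\beta_1)$ is defined by continuous extension (in $L^2_{loc}[0,\infty)$) from $\mathcal D(\mathcal A_0)$. $f:\mathbb H\to\mathbb R$ and $d$ are the (unknown) internal uncertainty and external disturbance, $u\in L^2_{loc}[0,\infty)$ is the control input. $C(0,\infty;X)$ denotes the continuous functions $[0,\infty)\to X$. Solutions are understood in the usual weak (mild) sense: the PDEs hold in the sense of distributions and the boundary conditions hold for almost every $t$, the boundary traces of the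 first derivatives being in $L^2_{loc}[0,\infty)$. *)

theory Defs
  imports "HOL-Analysis.Analysis"
begin

section \<open>Square-integrable functions\<close>

text \<open>Elements of $L^2$ are represented by functions; equality in $L^2$ is equality
  almost everywhere.\<close>

definition L2 :: "real set \<Rightarrow> (real \<Rightarrow> real) set" where
  "L2 S = {f. f \<in> borel_measurable (lebesgue_on S) \<and> integrable (lebesgue_on S) (\<lambda>x. (f x)\<^sup>2)}"

definition L2norm :: "real set \<Rightarrow> (real \<Rightarrow> real) \<Rightarrow> real" where
  "L2norm S f = sqrt (LINT x|lebesgue_on S. (f x)\<^sup>2)"

definition L2loc :: "(real \<Rightarrow> real) set" where
  "L2loc = {g. \<forall>\<tau>>0. g \<in> L2 {0..\<tau>}}"

definition tendsto_L2loc ::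
    "('i \<Rightarrow> real \<Rightarrow> real) \<Rightarrow> (real \<Rightarrow> real) \<Rightarrow> 'i filter \<Rightarrow> bool" where
  "tendsto_L2loc G g \<FF> \<longleftrightarrow> (\<forall>\<tau>>0.
     (\<forall>\<^sub>F i in \<FF>. (\<lambda>t. G i t - g t) \<in> L2 {0..\<tau>}) \<and>
     ((\<lambda>i. L2norm {0..\<tau>} (\<lambda>t. G i t - g t)) \<longlongrightarrow> 0) \<FF>)"

section \<open>Weak derivatives and Sobolev spaces on the unit interval\<close>

definition test_fun :: "real set \<Rightarrow> (real \<Rightarrow> real) \<Rightarrow> bool" where
  "test_fun S \<eta> \<longleftrightarrow> (\<forall>n x. (deriv ^^ n) \<eta> differentiable (at x)) \<and>
     (\<exists>K. compact K \<and> K \<subseteq> S \<and> (\<forall>x. x \<notin> K \<longrightarrow> \<eta> x = 0))"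

definition weak_deriv :: "real set \<Rightarrow> (real \<Rightarrow> real) \<Rightarrow> (real \<Rightarrow> real) \<Rightarrow> bool" where
  "weak_deriv S \<phi> g \<longleftrightarrow>
     (\<forall>K. compact K \<and> K \<subseteq> S \<longrightarrow> \<phi> absolutely_integrable_on K \<and> g absolutely_integrable_on K) \<and>
     (\<forall>\<eta>. test_fun S \<eta> \<longrightarrow>
        (LINT x|lebesgue_on S. \<phi> x * deriv \<eta> x) = - (LINT x|lebesgue_on S. g x * \<eta> x))"

text \<open>Elements of $H^1(0,1)$ are represented by their representative that is continuous on
  $[0,1]$, so that the boundary values are point values.\<close>

definition H1 :: "(real \<Rightarrow> real) set" where
  "H1 = {\<phi>. continuous_on {0..1} \<phi> \<and> \<phi> \<in> L2 {0..1} \<and> (\<exists>g\<in>L2 {0..1}. weak_deriv {0<..<1} \<phi> g)}"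

text \<open>Of the almost everywhere equal weak derivatives, the one chosen is continuous on $[0,1]$
  whenever there is such a representative. Hence, for $\phi\in H^2(0,1)$, the values of
  \<^term>\<open>wderiv \<phi>\<close> at 0 and 1 are the boundary values $\phi'(0)$ and $\phi'(1)$.\<close>

definition wderiv :: "(real \<Rightarrow> real) \<Rightarrow> real \<Rightarrow> real" where
  "wderiv \<phi> = (SOME g. weak_deriv {0<..<1} \<phi> g \<and>
     ((\<exists>h. weak_deriv {0<..<1} \<phi> h \<and> continuous_on {0..1} h) \<longrightarrow> continuous_on {0..1} g))"

definition H2 :: "(real \<Rightarrow> real) set" where
  "H2 = {\<phi> \<in> H1. wderiv \<phi> \<in> H1}"

definition H1R :: "(real \<Rightarrow> real) set" where
  "H1R = {\<phi> \<in> H1. \<phi> 1 = 0}"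

definition H1norm :: "(real \<Rightarrow> real) \<Rightarrow> real" where
  "H1norm \<phi> = sqrt ((LINT x|lebesgue_on {0..1}. (\<phi> x)\<^sup>2) +
                    (LINT x|lebesgue_on {0..1}. (wderiv \<phi> x)\<^sup>2))"

section \<open>The state spaces\<close>

type_synonym state = "(real \<Rightarrow> real) \<times> (real \<Rightarrow> real)"

definition HH :: "state set" where
  "HH = H1 \<times> L2 {0..1}"

definition HH0 :: "state set" where
  "HH0 = H1R \<times> L2 {0..1}"

text \<open>Equality of the elements represented by two states.\<close>

definition HH_eq :: "state \<Rightarrow> state \<Rightarrow> bool" where
  "HH_eq U V \<longleftrightarrow> (\<forall>x\<in>{0..1}. fst U x = fst V x) \<and> (AE x in lebesgue_on {0..1}. snd U x = snd V x)"

definition HHnorm :: "state \<Rightarrow> real" where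
  "HHnorm U = sqrt ((LINT x|lebesgue_on {0..1}. (wderiv (fst U) x)\<^sup>2 + (snd U x)\<^sup>2) + (fst U 0)\<^sup>2)"

definition lincomb :: "real \<Rightarrow> state \<Rightarrow> real \<Rightarrow> state \<Rightarrow> state" where
  "lincomb a U b V = (\<lambda>x. a * fst U x + b * fst V x, \<lambda>x. a * snd U x + b * snd V x)"

definition HHdist :: "state \<Rightarrow> state \<Rightarrow> real" where
  "HHdist U V = HHnorm (lincomb 1 U (-1) V)"

section \<open>The operator, its semigroup and the output function\<close>

definition dom_A0 :: "real \<Rightarrow> real \<Rightarrow> state set" where
  "dom_A0 c0 c1 = {(\<phi>, \<psi>). \<phi> \<in> H2 \<and> \<psi> \<in> H1 \<and> \<phi> 1 = 0 \<and> \<psi> 1 = 0 \<and>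
     wderiv \<phi> 0 = c1 / (1 - c0) * \<phi> 0 + c0 / (1 - c0) * \<psi> 0}"

definition A0 :: "state \<Rightarrow> state" where
  "A0 = (\<lambda>(\<phi>, \<psi>). (\<psi>, wderiv (wderiv \<phi>)))"

definition Cobs :: "state \<Rightarrow> real" where
  "Cobs = (\<lambda>(\<phi>, \<psi>). wderiv \<phi> 1)"

definition C0_semigroup :: "(real \<Rightarrow> state \<Rightarrow> state) \<Rightarrow> bool" where
  "C0_semigroup T \<longleftrightarrow>
     (\<forall>t\<ge>0. \<forall>U\<in>HH0. T t U \<in> HH0) \<and>
     (\<forall>t\<ge>0. \<forall>U\<in>HH0. \<forall>V\<in>HH0. \<forall>a b.
        HH_eq (T t (lincomb a U b V)) (lincomb a (T t U) b (T t V))) \<and>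
     (\<forall>t\<ge>0. \<exists>M. \<forall>U\<in>HH0. HHnorm (T t U) \<le> M * HHnorm U) \<and>
     (\<forall>U\<in>HH0. HH_eq (T 0 U) U) \<and>
     (\<forall>s\<ge>0. \<forall>t\<ge>0. \<forall>U\<in>HH0. HH_eq (T (s + t) U) (T s (T t U))) \<and>
     (\<forall>U\<in>HH0. ((\<lambda>h. HHdist (T h U) U) \<longlongrightarrow> 0) (at_right 0))"

text \<open>\<open>T\<close> is the semigroup $e^{\mathcal A_0 t}$: a strongly continuous semigroup on
  $\mathbb H_0$ whose infinitesimal generator, domain included, is $\mathcal A_0$.
  The state \<open>U'\<close> accounts for the choice of the representative of the second component.\<close>

definition semigroup_generated_by_A0 ::
    "real \<Rightarrow> real \<Rightarrow> (real \<Rightarrow> state \<Rightarrow> state) \<Rightarrow> bool" where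
  "semigroup_generated_by_A0 c0 c1 T \<longleftrightarrow> C0_semigroup T \<and>
     (\<forall>U\<in>HH0. \<forall>V\<in>HH0.
        ((\<lambda>h. HHdist (lincomb (1 / h) (T h U) (- 1 / h) U) V) \<longlongrightarrow> 0) (at_right 0) \<longleftrightarrow>
        (\<exists>U'\<in>dom_A0 c0 c1. HH_eq U U' \<and> HH_eq V (A0 U')))"

text \<open>\<open>y\<close> is the value at \<open>U\<close> of the extension by continuity of the map
  $V\mapsto Ce^{\mathcal A_0\,\cdot}V$ from $\mathcal D(\mathcal A_0)$ into
  $L^2_{loc}[0,\infty)$: its limit as \<open>V\<close> tends to \<open>U\<close> within $\mathcal D(\mathcal A_0)$.\<close>

definition output_function ::
    "real \<Rightarrow> real \<Rightarrow> (real \<Rightarrow> state \<Rightarrow> state) \<Rightarrow> state \<Rightarrow> (real \<Rightarrow> real) \<Rightarrow> bool" where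
  "output_function c0 c1 T U y \<longleftrightarrow> y \<in> L2loc \<and>
     tendsto_L2loc (\<lambda>V t. Cobs (T t V)) y
       (INF \<delta>\<in>{0<..}. principal {V \<in> dom_A0 c0 c1. HHdist V U < \<delta>})"

section \<open>Weak solutions\<close>

text \<open>A function \<open>w\<close> on $[0,1]\times[0,\infty)$ is applied as \<open>w x t\<close>.\<close>

definition dx :: "(real \<Rightarrow> real \<Rightarrow> real) \<Rightarrow> real \<Rightarrow> real \<Rightarrow> real" where
  "dx \<eta> = (\<lambda>x t. deriv (\<lambda>s. \<eta> s t) x)"

definition dt :: "(real \<Rightarrow> real \<Rightarrow> real) \<Rightarrow> real \<Rightarrow> real \<Rightarrow> real" where
  "dt \<eta> = (\<lambda>x t. deriv (\<lambda>s. \<eta> x s) t)"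

text \<open>Smoothness is the existence and continuity of all partial derivatives,
  \<open>D i j\<close> being $\partial_x^i\partial_t^j\eta$.\<close>

definition test_fun2 :: "(real \<Rightarrow> real \<Rightarrow> real) \<Rightarrow> bool" where
  "test_fun2 \<eta> \<longleftrightarrow>
     (\<exists>D :: nat \<Rightarrow> nat \<Rightarrow> real \<Rightarrow> real \<Rightarrow> real. D 0 0 = \<eta> \<and>
        (\<forall>i j. continuous_on UNIV (\<lambda>(x, t). D i j x t)) \<and>
        (\<forall>i j x t. ((\<lambda>s. D i j s t) has_real_derivative D (Suc i) j x t) (at x) \<and>
                   ((\<lambda>s. D i j x s) has_real_derivative D i (Suc j) x t) (at t))) \<and>
     (\<exists>K. compact K \<and> K \<subseteq> {0<..<1} \<times> {0<..} \<and> (\<forall>x t. (x, t) \<notin> K \<longrightarrow> \<eta> x t = 0))"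

text \<open>The pairing of \<open>w\<close> with a test function. The inner integral is the one over \<open>x\<close>, so that
  \<open>w\<close> in $C(0,\infty;L^2(0,1))$ need not be jointly measurable.\<close>

definition pairing :: "(real \<Rightarrow> real \<Rightarrow> real) \<Rightarrow> (real \<Rightarrow> real \<Rightarrow> real) \<Rightarrow> real" where
  "pairing w \<eta> = (LINT t|lebesgue_on {0..}. (LINT x|lebesgue_on {0..1}. w x t * \<eta> x t))"

definition state_at :: "(real \<Rightarrow> real \<Rightarrow> real) \<Rightarrow> (real \<Rightarrow> real \<Rightarrow> real) \<Rightarrow> real \<Rightarrow> state" where
  "state_at w wt t = (\<lambda>x. w x t, \<lambda>x. wt x t)"

definition continuous_HH :: "(real \<Rightarrow> state) \<Rightarrow> bool" where
  "continuous_HH U \<longleftrightarrow>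
     (\<forall>t\<ge>0. U t \<in> HH \<and> ((\<lambda>s. HHdist (U s) (U t)) \<longlongrightarrow> 0) (at t within {0..}))"

definition continuous_H1 :: "(real \<Rightarrow> real \<Rightarrow> real) \<Rightarrow> bool" where
  "continuous_H1 W \<longleftrightarrow>
     (\<forall>t\<ge>0. (\<lambda>x. W x t) \<in> H1 \<and>
        ((\<lambda>s. H1norm (\<lambda>x. W x s - W x t)) \<longlongrightarrow> 0) (at t within {0..}))"

text \<open>\<open>x_trace w a g\<close> says that $w_x(a,\cdot)=g\in L^2_{loc}[0,\infty)$ for \<open>a\<close> = 0 or 1: the
  one-sided difference quotients of \<open>w\<close> at \<open>a\<close>, which are the means of $w_x$ over the strips
  between \<open>a\<close> and \<open>x\<close>, converge to \<open>g\<close> in $L^2_{loc}$.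
  Both this and \<open>t_trace\<close> depend on \<open>g\<close> only up to null sets, so \<open>x_trace w a g\<close> expresses a
  boundary condition $w_x(a,t)=g(t)$ for almost every \<open>t\<close>.\<close>

definition x_trace :: "(real \<Rightarrow> real \<Rightarrow> real) \<Rightarrow> real \<Rightarrow> (real \<Rightarrow> real) \<Rightarrow> bool" where
  "x_trace w a g \<longleftrightarrow> g \<in> L2loc \<and>
     tendsto_L2loc (\<lambda>x t. (w x t - w a t) / (x - a)) g (at a within {0..1})"

definition t_trace :: "(real \<Rightarrow> real \<Rightarrow> real) \<Rightarrow> real \<Rightarrow> (real \<Rightarrow> real) \<Rightarrow> bool" where
  "t_trace w a g \<longleftrightarrow> g \<in> L2loc \<and> weak_deriv {0<..} (\<lambda>t. w a t) g"

text \<open>$w_{tt}=w_{xx}$ with $(w,w_t)\in C(0,\infty;\mathbb H)$, where \<open>wt\<close> is $w_t$.\<close>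

definition wave_solution :: "(real \<Rightarrow> real \<Rightarrow> real) \<Rightarrow> (real \<Rightarrow> real \<Rightarrow> real) \<Rightarrow> bool" where
  "wave_solution w wt \<longleftrightarrow>
     continuous_HH (state_at w wt) \<and>
     (\<forall>\<eta>. test_fun2 \<eta> \<longrightarrow> pairing w (dt \<eta>) = - pairing wt \<eta>) \<and>
     (\<forall>\<eta>. test_fun2 \<eta> \<longrightarrow> pairing w (dt (dt \<eta>)) = pairing w (dx (dx \<eta>))) \<and>
     (\<forall>a\<in>{0, 1}. (\<exists>g. x_trace w a g) \<and> (\<exists>g. t_trace w a g))"

text \<open>$W_t=-W_x$ with $W\in C(0,\infty;H^1(0,1))$.\<close>

definition transport_solution :: "(real \<Rightarrow> real \<Rightarrow> real) \<Rightarrow> bool" where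
  "transport_solution W \<longleftrightarrow>
     continuous_H1 W \<and>
     (\<forall>\<eta>. test_fun2 \<eta> \<longrightarrow> pairing W (dt \<eta>) = - pairing W (dx \<eta>)) \<and>
     (\<forall>a\<in>{0, 1}. (\<exists>g. x_trace W a g) \<and> (\<exists>g. t_trace W a g))"

definition beta_solution ::
    "real \<Rightarrow> real \<Rightarrow> state \<Rightarrow> (real \<Rightarrow> real \<Rightarrow> real) \<Rightarrow> (real \<Rightarrow> real \<Rightarrow> real) \<Rightarrow> bool" where
  "beta_solution c0 c1 B \<beta> \<beta>t \<longleftrightarrow>
     wave_solution \<beta> \<beta>t \<and>
     (\<exists>b. t_trace \<beta> 0 b \<and> x_trace \<beta> 0 (\<lambda>t. c1 / (1 - c0) * \<beta> 0 t + c0 / (1 - c0) * b t)) \<and>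
     (AE t in lebesgue_on {0..}. \<beta> 1 t = 0) \<and>
     HH_eq (state_at \<beta> \<beta>t 0) B"

text \<open>That a function of representatives is a function on $\mathbb H$.\<close>

definition well_defined_on_HH :: "(state \<Rightarrow> real) \<Rightarrow> bool" where
  "well_defined_on_HH f \<longleftrightarrow> (\<forall>U\<in>HH. \<forall>V\<in>HH. HH_eq U V \<longrightarrow> f U = f V)"

definition total_disturbance ::
    "(state \<Rightarrow> real) \<Rightarrow> (real \<Rightarrow> real) \<Rightarrow> (real \<Rightarrow> real \<Rightarrow> real) \<Rightarrow> (real \<Rightarrow> real \<Rightarrow> real) \<Rightarrow> real \<Rightarrow> real"
  where "total_disturbance f d w wt = (\<lambda>t. f (state_at w wt t) + d t)"

definition plant_solution ::
    "real \<Rightarrow> (state \<Rightarrow> real) \<Rightarrow> (real \<Rightarrow> real) \<Rightarrow> (real \<Rightarrow> real) \<Rightarrow>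
     (real \<Rightarrow> real \<Rightarrow> real) \<Rightarrow> (real \<Rightarrow> real \<Rightarrow> real) \<Rightarrow> bool" where
  "plant_solution q f d u w wt \<longleftrightarrow>
     wave_solution w wt \<and>
     x_trace w 0 (\<lambda>t. - q * w 0 t) \<and>
     x_trace w 1 (\<lambda>t. u t + total_disturbance f d w wt t)"

definition estimator_solution ::
    "real \<Rightarrow> real \<Rightarrow> real \<Rightarrow> (real \<Rightarrow> real) \<Rightarrow> (real \<Rightarrow> real \<Rightarrow> real) \<Rightarrow>
     (real \<Rightarrow> real \<Rightarrow> real) \<Rightarrow> (real \<Rightarrow> real \<Rightarrow> real) \<Rightarrow>
     (real \<Rightarrow> real \<Rightarrow> real) \<Rightarrow> (real \<Rightarrow> real \<Rightarrow> real) \<Rightarrow> (real \<Rightarrow> real \<Rightarrow> real) \<Rightarrow> bool" where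
  "estimator_solution c0 c1 q u w v vt z zt W \<longleftrightarrow>
     wave_solution v vt \<and>
     x_trace v 0 (\<lambda>t. - q * w 0 t + c1 * (v 0 t - w 0 t)) \<and>
     (\<exists>g. x_trace W 1 g \<and> x_trace v 1 (\<lambda>t. u t - g t)) \<and>
     wave_solution z zt \<and>
     (\<exists>b. t_trace z 0 b \<and> x_trace z 0 (\<lambda>t. c1 / (1 - c0) * z 0 t + c0 / (1 - c0) * b t)) \<and>
     (AE t in lebesgue_on {0..}. z 1 t = - v 1 t + w 1 t - W 1 t) \<and>
     transport_solution W \<and>
     (AE t in lebesgue_on {0..}. W 0 t = - c0 * (v 0 t - w 0 t))"

end

theory Submission
 imports Defs
begin

text \<open>The system for \<open>\<beta>\<close> is a string that is fixed at $x=1$ and damped at $x=0$. Its solutions are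
 superpositions of an incoming and an outgoing wave, and reflection at $x=1$ makes the two the same
 function: $\beta(x,t)=\int_{t+x-2}^{t-x}h$. The initial data are the values of \<open>h\<close> on $[-2,0]$, the
 norm of the state at time \<open>t\<close> is equivalent to the norm of \<open>h\<close> in $L^2(t-2,t)$, and the boundary
 condition at $x=0$ is the delay equation
 $h(t)+c_1\int_{t-2}^th+(1-2c_0)h(t-2)=0$ (\<open>delay_solution\<close>). The trace at the other end is
 $\beta_x(1,t)=-2h(t-1)$, so everything rests on $h\in L^2(0,\infty)$.

 Square integrability is the energy balance (\<open>delay_energy\<close>): the energy decreases at the rate
 $\kappa\,b'(t)^2$, where $b=\beta(0,\cdot)$, $b'(t)=h(t)-h(t-2)$ and $\kappa=c_0/(1-c_0)$. This bounds
 $b'$ in $L^2(0,\infty)$ only; \<open>delay_square_integrable\<close> recovers $b$, and with it $h$, by averaging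
 the delay equation over a period.

 For part (i) the given semigroup \<open>T\<close> has to be compared with the explicit flow \<open>S\<close> of the delay
 equation. On the domain of the generator, $s\mapsto T(t-s)S(s)V$ has right derivative zero, and it
 is continuous because a strongly continuous semigroup is locally bounded; so $T(t)V=S(t)V$
 (\<open>semigroup_flow\<close>). Local boundedness is the uniform boundedness principle
 (\<open>uniform_boundedness_L2\<close>), proved for the space $L^2(-2,0)$ of the data \<open>h\<close>. Since solutions of the delay equation depend
 continuously on their data and the domain is dense, the output function of any state is
 $-2h(\cdot-1)$.

 Any weak solution \<open>\<beta>\<close> has the trace of the explicit one, by uniqueness
 (\<open>beta_solution_unique\<close>). The energy balance is not available for the difference of two weak solutions, so the equation is tested with profiles that move along
 characteristics: the Riemann invariants of a solution that vanishes up to time \<open>T\<close> are carried into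
 the interior, where they stay zero for another half unit of time, except for the wave
 that leaves $x=0$. That wave is outgoing, so $w_x=-w_t$ at $x=0$, and the boundary condition
 becomes a linear homogeneous differential equation for the boundary value.

 For part (ii), \<open>W\<close> is itself a solution of the wave equation, outgoing at $x=0$; with
 $W_x(0,\cdot)=-W_t(0,\cdot)$ one checks that $\beta=z-(w-v-W)$ satisfies the boundary conditions of the
 damped string and that $\beta_x(1,\cdot)$ is the error of the estimator (\<open>estimator_error\<close>).\<close>

section \<open>Square-integrable functions\<close>

lemmas integral_cong_on = Henstock_Kurzweil_Integration.integral_cong

lemma integrable_lebesgue_on_nonneg:
 fixes f :: "real \<Rightarrow> real"
 assumes "S \<in> sets lebesgue" "\<And>x. x \<in> S \<Longrightarrow> 0 \<le> f x"
 shows "integrable (lebesgue_on S) f \<longleftrightarrow> f integrable_on S"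
 using assms absolutely_integrable_on_iff_nonneg[of S f]
 by (simp add: set_integrable_def integrable_restrict_space)

lemma integrable_lebesgue_on_iff:
 fixes f :: "real \<Rightarrow> real"
 assumes "S \<in> sets lebesgue"
 shows "integrable (lebesgue_on S) f \<longleftrightarrow> f absolutely_integrable_on S"
 using assms by (simp add: set_integrable_def integrable_restrict_space)

lemma L2_iff:
 assumes "S \<in> sets lebesgue"
 shows "f \<in> L2 S \<longleftrightarrow> f \<in> borel_measurable (lebesgue_on S) \<and> (\<lambda>x. (f x)\<^sup>2) integrable_on S"
 unfolding L2_def using integrable_lebesgue_on_nonneg[OF assms, of "\<lambda>x. (f x)\<^sup>2"] by simp

lemma integral_sq_eq:
 assumes "S \<in> sets lebesgue" "f \<in> L2 S"
 shows "(LINT x|lebesgue_on S. (f x)\<^sup>2) = integral S (\<lambda>x. (f x)\<^sup>2)"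
 using assms lebesgue_integral_eq_integral[of S "\<lambda>x. (f x)\<^sup>2"] by (simp add: L2_def)

lemma L2_mult:
 assumes "S \<in> sets lebesgue" "f \<in> L2 S" "g \<in> L2 S"
 shows "(\<lambda>x. f x * g x) absolutely_integrable_on S"
proof -
 have m: "(\<lambda>x. f x * g x) \<in> borel_measurable (lebesgue_on S)"
  using assms by (auto simp: L2_def)
 have i: "(\<lambda>x. (f x)\<^sup>2 + (g x)\<^sup>2) integrable_on S"
  using assms by (auto simp: L2_iff intro: integrable_add)
 have "norm (f x * g x) \<le> (f x)\<^sup>2 + (g x)\<^sup>2" for x
 proof -
  have "0 \<le> (\<bar>f x\<bar> - \<bar>g x\<bar>)\<^sup>2" by simp
  then have "2 * (\<bar>f x\<bar> * \<bar>g x\<bar>) \<le> (f x)\<^sup>2 + (g x)\<^sup>2" by (simp add: power2_diff)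
  moreover have "0 \<le> \<bar>f x\<bar> * \<bar>g x\<bar>" by simp
  ultimately show ?thesis unfolding real_norm_def abs_mult by linarith
 qed
 then show ?thesis
  using measurable_bounded_by_integrable_imp_absolutely_integrable[OF m assms(1) i] by blast
qed

lemma L2_add:
 assumes "S \<in> sets lebesgue" "f \<in> L2 S" "g \<in> L2 S"
 shows "(\<lambda>x. f x + g x) \<in> L2 S"
proof -
 have "(\<lambda>x. (f x + g x)\<^sup>2) = (\<lambda>x. ((f x)\<^sup>2 + (g x)\<^sup>2) + 2 * (f x * g x))"
  by (simp add: power2_sum fun_eq_iff)
 moreover have "(\<lambda>x. f x * g x) integrable_on S"
  using L2_mult[OF assms] by (rule absolutely_integrable_on_def[THEN iffD1, THEN conjunct1])
 ultimately show ?thesis using assms by (auto simp: L2_iff intro!: integrable_add)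
qed

lemma L2_cmult: "S \<in> sets lebesgue \<Longrightarrow> f \<in> L2 S \<Longrightarrow> (\<lambda>x. c * f x) \<in> L2 S"
 by (auto simp: L2_def power_mult_distrib)

lemma L2_diff:
 assumes "S \<in> sets lebesgue" "f \<in> L2 S" "g \<in> L2 S"
 shows "(\<lambda>x. f x - g x) \<in> L2 S"
 using L2_add[OF assms(1,2) L2_cmult[OF assms(1,3), where c = "-1"]] by simp

lemma L2_cong_AE:
 assumes S: "S \<in> sets lebesgue" and f: "f \<in> L2 S" and e: "AE x in lebesgue_on S. f x = g x"
 shows "g \<in> L2 S" "integral S (\<lambda>x. (g x)\<^sup>2) = integral S (\<lambda>x. (f x)\<^sup>2)"
proof -
 have "AE x in lebesgue. x \<in> S \<longrightarrow> f x = g x"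
  using e S by (simp add: AE_restrict_space_iff)
 then have "AE x in lebesgue. (if x \<in> S then f x else 0) = (if x \<in> S then g x else 0)"
  by (rule AE_mp) (rule AE_I2, simp)
 moreover have "(\<lambda>x. if x \<in> S then f x else 0) \<in> borel_measurable lebesgue"
  using f S by (simp add: L2_def borel_measurable_if)
 ultimately have "(\<lambda>x. if x \<in> S then g x else 0) \<in> borel_measurable lebesgue"
  by (rule borel_measurable_AE[rotated])
 then have m: "g \<in> borel_measurable (lebesgue_on S)"
  using S by (simp add: borel_measurable_if)
 have "AE x in lebesgue_on S. (f x)\<^sup>2 = (g x)\<^sup>2" using e by eventually_elim simp
 note ae = this
 have fi: "integrable (lebesgue_on S) (\<lambda>x. (f x)\<^sup>2)" using f by (simp add: L2_def)
 have mf: "(\<lambda>x. (f x)\<^sup>2) \<in> borel_measurable (lebesgue_on S)"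
  by (rule borel_measurable_integrable[OF fi])
 have mg: "(\<lambda>x. (g x)\<^sup>2) \<in> borel_measurable (lebesgue_on S)" using m by (rule borel_measurable_power)
 have i: "integrable (lebesgue_on S) (\<lambda>x. (g x)\<^sup>2)"
   "(LINT x|lebesgue_on S. (f x)\<^sup>2) = (LINT x|lebesgue_on S. (g x)\<^sup>2)"
  using Bochner_Integration.integrable_cong_AE[OF mf mg ae] fi integral_cong_AE[OF mf mg ae] by blast+
 show 1: "g \<in> L2 S" using m i by (simp add: L2_def)
 show "integral S (\<lambda>x. (g x)\<^sup>2) = integral S (\<lambda>x. (f x)\<^sup>2)"
  using i(2) integral_sq_eq[OF S f] integral_sq_eq[OF S 1] by simp
qed

lemma L2_subset:
 assumes "f \<in> L2 S" "T \<subseteq> S" "S \<in> sets lebesgue" "T \<in> sets lebesgue"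
 shows "f \<in> L2 T"
proof -
 have "(\<lambda>x. (f x)\<^sup>2) absolutely_integrable_on S"
  using assms by (simp add: L2_def integrable_lebesgue_on_iff)
 then have "(\<lambda>x. (f x)\<^sup>2) absolutely_integrable_on T"
  using assms set_integrable_subset by blast
 moreover have "f \<in> borel_measurable (lebesgue_on T)"
  by (rule measurable_restrict_mono[OF _ assms(2)]) (use assms(1) in \<open>simp add: L2_def\<close>)
 ultimately show ?thesis
  using assms(4) by (simp add: L2_def integrable_lebesgue_on_iff)
qed

lemma L2_continuous:
 assumes "continuous_on {a..b::real} f" shows "f \<in> L2 {a..b}"
proof -
 have "f \<in> borel_measurable (lebesgue_on {a..b})"
  using assms by (rule continuous_imp_measurable_on_sets_lebesgue) simp
 moreover have "(\<lambda>x. (f x)\<^sup>2) integrable_on {a..b}"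
  using assms by (intro integrable_continuous_real continuous_on_power)
 ultimately show ?thesis by (simp add: L2_iff)
qed

lemma L2_imp_absint:
 assumes "f \<in> L2 {a..b::real}"
 shows "f absolutely_integrable_on {a..b}"
 using L2_mult[OF _ assms L2_continuous[of a b "\<lambda>_. 1"]] by simp

lemma L2_indicator:
 assumes "S \<in> sets lebesgue" "T \<in> sets lebesgue" "f \<in> L2 T" "S \<inter> U \<subseteq> T" "U \<in> sets lebesgue"
 shows "(\<lambda>x. if x \<in> U then f x else 0) \<in> L2 S"
proof -
 have f: "f \<in> L2 (S \<inter> U)" using L2_subset assms by blast
 have m: "(\<lambda>x. if x \<in> S \<inter> U then f x else 0) \<in> borel_measurable lebesgue"
  using f assms borel_measurable_if[of "S \<inter> U" f] by (auto simp: L2_def)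
 have "(\<lambda>x. if x \<in> S \<inter> U then (f x)\<^sup>2 else 0) integrable_on UNIV"
  using f assms by (simp only: integrable_restrict_UNIV L2_iff sets.Int)
 then have "(\<lambda>x. if x \<in> S then (if x \<in> U then f x else 0)\<^sup>2 else 0) integrable_on UNIV"
  by (rule integrable_eq) auto
 moreover have "(\<lambda>x. if x \<in> S then (if x \<in> U then f x else 0) else 0) \<in> borel_measurable lebesgue"
  by (rule measurable_cong[THEN iffD1, OF _ m]) auto
 ultimately show ?thesis
  using assms borel_measurable_if[of S "\<lambda>x. if x \<in> U then f x else 0"] by (simp only: integrable_restrict_UNIV L2_iff)
qed

subsection \<open>Locally square-integrable functions on the line\<close>

definition locL2 :: "(real \<Rightarrow> real) set" where
 "locL2 = {h. \<forall>a b. h \<in> L2 {a..b}}"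

definition sqint :: "real \<Rightarrow> real \<Rightarrow> (real \<Rightarrow> real) \<Rightarrow> real" where
 "sqint a b h = integral {a..b} (\<lambda>t. (h t)\<^sup>2)"

lemma locL2_D: "h \<in> locL2 \<Longrightarrow> h \<in> L2 {a..b}" by (simp add: locL2_def)

lemma locL2_absint: "h \<in> locL2 \<Longrightarrow> h absolutely_integrable_on {a..b}"
 by (rule L2_imp_absint, rule locL2_D)

lemma locL2_int: "h \<in> locL2 \<Longrightarrow> h integrable_on {a..b}"
 by (rule set_lebesgue_integral_eq_integral(1), rule locL2_absint)

lemma locL2_sq_int: "h \<in> locL2 \<Longrightarrow> (\<lambda>t. (h t)\<^sup>2) integrable_on {a..b}"
 using locL2_D[of h a b] by (simp add: L2_iff)

lemma locL2_add [intro]: "h \<in> locL2 \<Longrightarrow> k \<in> locL2 \<Longrightarrow> (\<lambda>t. h t + k t) \<in> locL2"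
 by (simp add: locL2_def L2_add)
lemma locL2_diff [intro]: "h \<in> locL2 \<Longrightarrow> k \<in> locL2 \<Longrightarrow> (\<lambda>t. h t - k t) \<in> locL2"
 by (simp add: locL2_def L2_diff)
lemma locL2_cmult [intro]: "h \<in> locL2 \<Longrightarrow> (\<lambda>t. c * h t) \<in> locL2"
 by (simp add: locL2_def L2_cmult)
lemma locL2_minus [intro]: "h \<in> locL2 \<Longrightarrow> (\<lambda>t. - h t) \<in> locL2"
 using locL2_cmult[of h "-1"] by simp
lemma locL2_continuous: "continuous_on UNIV h \<Longrightarrow> h \<in> locL2"
 unfolding locL2_def using L2_continuous continuous_on_subset[of UNIV h] by simp
lemma locL2_if:
 assumes "h \<in> locL2" "k \<in> locL2" "{t. P t} \<in> sets lebesgue"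
 shows "(\<lambda>t. if P t then h t else k t) \<in> locL2"
proof -
 have c: "{t. \<not> P t} \<in> sets lebesgue"
 proof -
  have "{t. \<not> P t} = space lebesgue - {t. P t}" by auto
  then show ?thesis using assms(3) by (metis sets.compl_sets)
 qed
 have "(\<lambda>t. (if t \<in> {t. P t} then h t else 0) + (if t \<in> {t. \<not> P t} then k t else 0)) \<in> L2 {a..b}" for a b
  using assms c by (intro L2_add L2_indicator[where T = "{a..b}"]) (auto simp: locL2_D)
 moreover have "(\<lambda>t. (if t \<in> {t. P t} then h t else 0) + (if t \<in> {t. \<not> P t} then k t else 0))
   = (\<lambda>t. if P t then h t else k t)" by auto
 ultimately show ?thesis by (simp add: locL2_def)
qed

lemma locL2_extend:
 assumes "h \<in> L2 {a..b}"
 shows "(\<lambda>t. if t \<in> {a..b} then h t else 0) \<in> locL2"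
 unfolding locL2_def mem_Collect_eq using assms
 by (intro allI L2_indicator[where T = "{a..b}"]) auto

lemma locL2_measurable:
 assumes "h \<in> locL2" shows "h \<in> borel_measurable lebesgue"
proof (rule borel_measurable_LIMSEQ_real)
 fix n :: nat
 have "h \<in> borel_measurable (lebesgue_on {- real n..real n})"
  using locL2_D[OF assms] by (simp add: L2_def)
 then show "(\<lambda>x. if x \<in> {- real n..real n} then h x else 0) \<in> borel_measurable lebesgue"
  by (rule borel_measurable_if_I) simp
next
 fix x :: real
 have "eventually (\<lambda>n. real n \<ge> \<bar>x\<bar>) sequentially"
  using eventually_ge_at_top[of "nat \<lceil>\<bar>x\<bar>\<rceil>"] by eventually_elim linarith
 then have "eventually (\<lambda>n. (if x \<in> {- real n..real n} then h x else 0) = h x) sequentially"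
  by eventually_elim auto
 then show "(\<lambda>n. if x \<in> {- real n..real n} then h x else 0) \<longlonglongrightarrow> h x" by (rule tendsto_eventually)
qed

lemma locL2_affine:
 assumes h: "h \<in> locL2" and e: "e \<noteq> 0"
 shows "(\<lambda>t. h (c + e * t)) \<in> locL2"
proof -
 have "(\<lambda>t. h (c + e * t)) \<in> L2 {a..b}" for a b
 proof -
  have "(\<lambda>t. h (c + e *\<^sub>R t)) \<in> borel_measurable lebesgue"
   by (rule borel_measurable_affine[OF locL2_measurable[OF h] e])
  then have m: "(\<lambda>t. h (c + e * t)) \<in> borel_measurable (lebesgue_on {a..b})"
   unfolding real_scaleR_def by (rule measurable_restrict_space1)
  have "bounded ((\<lambda>t. c + e * t) ` {a..b})"
   by (intro compact_imp_bounded compact_continuous_image continuous_intros) auto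
  then obtain M where M: "\<And>t. t \<in> {a..b} \<Longrightarrow> \<bar>c + e * t\<bar> \<le> M"
   unfolding bounded_iff by (metis imageI real_norm_def)
  define F where "F = (\<lambda>t. if t \<in> {-M..M} then (h t)\<^sup>2 else 0)"
  have "set_integrable lebesgue {-M..M} (\<lambda>t. (h t)\<^sup>2)"
   using locL2_D[OF h, of "-M" M] by (simp add: L2_def integrable_lebesgue_on_iff)
  moreover have "F = (\<lambda>t. indicat_real {-M..M} t *\<^sub>R (h t)\<^sup>2)"
   by (auto simp: F_def indicator_def fun_eq_iff)
  ultimately have "integrable lebesgue F" by (simp add: set_integrable_def)
  then have "integrable lebesgue (\<lambda>t. F (c + e * t))"
   by (rule lebesgue_integrable_real_affine[OF _ e])
  then have "(\<lambda>t. F (c + e * t)) integrable_on UNIV" by (rule integrable_on_lebesgue)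
  then have "(\<lambda>t. F (c + e * t)) integrable_on {a..b}" by (rule integrable_on_subinterval) simp
  then have "(\<lambda>t. (h (c + e * t))\<^sup>2) integrable_on {a..b}"
  proof (rule integrable_eq)
   fix t assume "t \<in> {a..b}"
   then have "c + e * t \<in> {-M..M}" using M[of t] by (simp add: abs_le_iff)
   then show "F (c + e * t) = (h (c + e * t))\<^sup>2" by (simp add: F_def)
  qed
  then show ?thesis using m by (simp add: L2_iff)
 qed
 then show ?thesis by (simp add: locL2_def)
qed

lemma sqint_nonneg: "0 \<le> sqint a b h"
 unfolding sqint_def by (cases "(\<lambda>t. (h t)\<^sup>2) integrable_on {a..b}") (auto intro: integral_nonneg simp: not_integrable_integral)

lemma sqint_mono:
 assumes "h \<in> locL2" "c \<le> a" "b \<le> d" shows "sqint a b h \<le> sqint c d h"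
 unfolding sqint_def using assms by (intro integral_subset_le locL2_sq_int) auto

lemma sqint_add_le:
 assumes "h \<in> locL2" "k \<in> locL2"
 shows "sqint a b (\<lambda>t. h t + k t) \<le> 2 * sqint a b h + 2 * sqint a b k"
proof -
 have "sqint a b (\<lambda>t. h t + k t) \<le> integral {a..b} (\<lambda>t. 2 * (h t)\<^sup>2 + 2 * (k t)\<^sup>2)"
  unfolding sqint_def
 proof (intro integral_le locL2_sq_int locL2_add assms integrable_add)
  fix t
  have "0 \<le> (h t - k t)\<^sup>2" by simp
  then show "(h t + k t)\<^sup>2 \<le> 2 * (h t)\<^sup>2 + 2 * (k t)\<^sup>2" by (simp add: power2_sum power2_diff)
 qed (use locL2_sq_int[OF assms(1)] locL2_sq_int[OF assms(2)] in auto)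
 then show ?thesis
  using locL2_sq_int[OF assms(1), of a b] locL2_sq_int[OF assms(2), of a b] by (simp add: sqint_def integral_add)
qed

lemma sqint_cmult: "sqint a b (\<lambda>t. c * h t) = c\<^sup>2 * sqint a b h"
 by (simp add: sqint_def power_mult_distrib)

lemma sqint_diff_le:
 assumes "h \<in> locL2" "k \<in> locL2"
 shows "sqint a b (\<lambda>t. h t - k t) \<le> 2 * sqint a b h + 2 * sqint a b k"
 using sqint_add_le[OF assms(1) locL2_minus[OF assms(2)], of a b] sqint_cmult[of a b "-1" k] by simp

lemma sqint_combine:
 assumes "h \<in> locL2" "a \<le> c" "c \<le> b" shows "sqint a c h + sqint c b h = sqint a b h"
 unfolding sqint_def using assms by (intro Henstock_Kurzweil_Integration.integral_combine locL2_sq_int) auto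

text \<open>The inequality of Cauchy and Schwarz, from the discriminant of
 $s\mapsto\int(sf+g)^2$.\<close>

lemma Cauchy_Schwarz_L2:
 assumes S: "S \<in> sets lebesgue" and f: "f \<in> L2 S" and g: "g \<in> L2 S"
 shows "(integral S (\<lambda>x. f x * g x))\<^sup>2 \<le> integral S (\<lambda>x. (f x)\<^sup>2) * integral S (\<lambda>x. (g x)\<^sup>2)"
proof -
 define A B C where "A = integral S (\<lambda>x. (f x)\<^sup>2)" and "B = integral S (\<lambda>x. f x * g x)"
  and "C = integral S (\<lambda>x. (g x)\<^sup>2)"
 have i: "(\<lambda>x. (f x)\<^sup>2) integrable_on S" "(\<lambda>x. (g x)\<^sup>2) integrable_on S" "(\<lambda>x. f x * g x) integrable_on S"
  using f g S L2_mult[OF S f g] set_lebesgue_integral_eq_integral(1) by (auto simp: L2_iff)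
 have q: "0 \<le> s\<^sup>2 * A + 2 * s * B + C" for s
 proof -
  have "((\<lambda>x. s\<^sup>2 * (f x)\<^sup>2 + 2 * s * (f x * g x) + (g x)\<^sup>2) has_integral (s\<^sup>2 * A + 2 * s * B + C)) S"
   unfolding A_def B_def C_def using i by (intro has_integral_add has_integral_mult_right integrable_integral)
  moreover have "0 \<le> s\<^sup>2 * (f x)\<^sup>2 + 2 * s * (f x * g x) + (g x)\<^sup>2" for x
  proof -
   have "0 \<le> (s * f x + g x)\<^sup>2" by simp
   then show ?thesis by (simp add: power2_sum power_mult_distrib algebra_simps)
  qed
  ultimately show ?thesis using has_integral_nonneg by blast
 qed
 have A0: "0 \<le> A" unfolding A_def using i by (intro integral_nonneg) auto
 have "B\<^sup>2 \<le> A * C"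
 proof (cases "A = 0")
  case True
  have "B = 0"
  proof (rule ccontr)
   assume "B \<noteq> 0"
   then have "2 * (- (C + 1) / (2 * B)) * B = - (C + 1)" by simp
   then show False using q[of "- (C + 1) / (2 * B)"] True by simp
  qed
  then show ?thesis using True by simp
 next
  case False
  then have "0 < A" using A0 by simp
  have "0 \<le> (- B / A)\<^sup>2 * A + 2 * (- B / A) * B + C" by (rule q)
  also have "\<dots> = C - B\<^sup>2 / A" using \<open>0 < A\<close> by (simp add: power2_eq_square field_simps)
  finally show ?thesis using \<open>0 < A\<close> by (simp add: field_simps)
 qed
 then show ?thesis unfolding A_def B_def C_def .
qed

lemma Cauchy_Schwarz_interval:
 assumes "f \<in> L2 {a..b}" "a \<le> b"
 shows "(integral {a..b} f)\<^sup>2 \<le> (b - a) * integral {a..b} (\<lambda>x. (f x)\<^sup>2)"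
 using Cauchy_Schwarz_L2[of "{a..b}" f "\<lambda>_. 1"] assms L2_continuous[of a b "\<lambda>_. 1"] by (simp add: mult.commute)

lemma L2norm_triangle:
 assumes S: "S \<in> sets lebesgue" and f: "f \<in> L2 S" and g: "g \<in> L2 S"
 shows "L2norm S (\<lambda>x. f x + g x) \<le> L2norm S f + L2norm S g"
proof -
 define A B C where "A = integral S (\<lambda>x. (f x)\<^sup>2)" and "B = integral S (\<lambda>x. f x * g x)"
  and "C = integral S (\<lambda>x. (g x)\<^sup>2)"
 have i: "(\<lambda>x. (f x)\<^sup>2) integrable_on S" "(\<lambda>x. (g x)\<^sup>2) integrable_on S" "(\<lambda>x. f x * g x) integrable_on S"
  using f g S L2_mult[OF S f g] set_lebesgue_integral_eq_integral(1) by (auto simp: L2_iff)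
 have AC: "0 \<le> A" "0 \<le> C" unfolding A_def C_def using i by (auto intro: integral_nonneg)
 have "((\<lambda>x. (f x)\<^sup>2 + 2 * (f x * g x) + (g x)\<^sup>2) has_integral (A + 2 * B + C)) S"
  unfolding A_def B_def C_def using i by (intro has_integral_add has_integral_mult_right integrable_integral)
 then have e: "integral S (\<lambda>x. (f x + g x)\<^sup>2) = A + 2 * B + C"
  by (intro integral_unique) (simp add: power2_sum algebra_simps)
 have "B \<le> sqrt A * sqrt C"
  using Cauchy_Schwarz_L2[OF S f g] AC real_le_rsqrt[of B "A * C"]
  unfolding A_def[symmetric] B_def[symmetric] C_def[symmetric] by (simp add: real_sqrt_mult)
 then have "A + 2 * B + C \<le> (sqrt A + sqrt C)\<^sup>2" using AC by (simp add: power2_sum)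
 then have "sqrt (A + 2 * B + C) \<le> sqrt A + sqrt C" using AC by (intro real_le_lsqrt) auto
 then show ?thesis
  unfolding L2norm_def integral_sq_eq[OF S f] integral_sq_eq[OF S g] integral_sq_eq[OF S L2_add[OF S f g]] e
  by (simp add: A_def C_def)
qed

section \<open>Primitives of locally integrable functions\<close>

definition prim :: "(real \<Rightarrow> real) \<Rightarrow> (real \<Rightarrow> real) \<Rightarrow> bool" where
 "prim G h \<longleftrightarrow> (\<forall>a b. h absolutely_integrable_on {a..b}) \<and>
   (\<forall>a b. a \<le> b \<longrightarrow> integral {a..b} h = G b - G a)"

lemma absint_int: "f absolutely_integrable_on S \<Longrightarrow> (f :: real \<Rightarrow> real) integrable_on S"
 by (rule set_lebesgue_integral_eq_integral(1))

lemma prim_absint: "prim G h \<Longrightarrow> h absolutely_integrable_on {a..b}"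
 by (simp add: prim_def)

lemma prim_int: "prim G h \<Longrightarrow> h integrable_on {a..b}"
 by (rule absint_int, rule prim_absint)

lemma prim_integral: "prim G h \<Longrightarrow> a \<le> b \<Longrightarrow> integral {a..b} h = G b - G a"
 by (simp add: prim_def)

lemma prim_has_integral: "prim G h \<Longrightarrow> a \<le> b \<Longrightarrow> (h has_integral (G b - G a)) {a..b}"
 using prim_int[of G h a b] prim_integral[of G h a b] by (simp add: has_integral_iff)

lemma primI:
 assumes "\<And>a b. h absolutely_integrable_on {a..b}" "\<And>a b. a \<le> b \<Longrightarrow> (h has_integral (G b - G a)) {a..b}"
 shows "prim G h"
 using assms by (simp add: prim_def integral_unique)

lemma prim_continuous:
 assumes "prim G h" shows "continuous_on S G"
proof -
 have "isCont G x" for x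
 proof -
  have "continuous_on {x-1..x+1} (\<lambda>t. integral {x-1..t} h)"
   using prim_int[OF assms] by (rule indefinite_integral_continuous_1)
  then have "continuous_on {x-1..x+1} (\<lambda>t. G (x-1) + integral {x-1..t} h)"
   by (intro continuous_intros)
  then have "continuous_on {x-1..x+1} G"
   by (rule continuous_on_eq) (use prim_integral[OF assms] in auto)
  then show ?thesis by (rule continuous_on_interior) simp
 qed
 then show ?thesis by (simp add: continuous_at_imp_continuous_on)
qed

lemma prim_add: "prim G h \<Longrightarrow> prim K k \<Longrightarrow> prim (\<lambda>t. G t + K t) (\<lambda>t. h t + k t)"
 by (simp add: prim_def integral_add absint_int)

lemma prim_cmult: "prim G h \<Longrightarrow> prim (\<lambda>t. c * G t) (\<lambda>t. c * h t)"
 by (simp add: prim_def right_diff_distrib)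

lemma prim_diff: "prim G h \<Longrightarrow> prim K k \<Longrightarrow> prim (\<lambda>t. G t - K t) (\<lambda>t. h t - k t)"
 using prim_add[OF _ prim_cmult[of K k "-1"], of G h] by simp

lemma prim_shift_const: "prim G h \<Longrightarrow> prim (\<lambda>t. G t + c) h"
 by (simp add: prim_def)

lemma prim_affine:
 assumes p: "prim G h" and e: "e \<noteq> 0"
 shows "prim (\<lambda>t. G (c + e * t)) (\<lambda>t. e * h (c + e * t))"
proof -
 have aff: "((\<lambda>t. f (c + e * t)) has_integral (integral {min (c+e*a) (c+e*b)..max (c+e*a) (c+e*b)} f / \<bar>e\<bar>)) {a..b}"
  if f: "f integrable_on {min (c+e*a) (c+e*b)..max (c+e*a) (c+e*b)}" and ab: "a \<le> b" for f :: "real \<Rightarrow> real" and a b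
 proof -
  let ?l = "min (c+e*a) (c+e*b)" and ?u = "max (c+e*a) (c+e*b)"
  have "(f has_integral integral {?l..?u} f) (cbox ?l ?u)"
   using f by (simp add: integrable_integral)
  from has_integral_affinity[OF this e, of c]
  have "((\<lambda>x. f (e * x + c)) has_integral (integral {?l..?u} f / \<bar>e\<bar>)) ((\<lambda>x. x / e - c / e) ` {?l..?u})"
   by (simp add: divide_inverse mult.commute)
  moreover have "(\<lambda>x. x / e - c / e) ` {?l..?u} = {a..b}"
  proof (intro set_eqI iffI)
   fix t assume "t \<in> (\<lambda>x. x / e - c / e) ` {?l..?u}"
   then obtain x where x: "?l \<le> x" "x \<le> ?u" "t = x / e - c / e" by auto
   then have te: "c + e * t = x" using e by (simp add: field_simps)
   show "t \<in> {a..b}"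
   proof (cases "e > 0")
    case True
    then have "c + e * a \<le> c + e * b" using ab by simp
    then have "c + e * a \<le> c + e * t" "c + e * t \<le> c + e * b" using x te by auto
    then show ?thesis using True by simp
   next
    case False
    then have e': "e < 0" using e by simp
    then have "c + e * b \<le> c + e * a" using ab by simp
    then have "c + e * b \<le> c + e * t" "c + e * t \<le> c + e * a" using x te by auto
    then show ?thesis using e' by simp
   qed
  next
   fix t assume t: "t \<in> {a..b}"
   have "c + e * t \<in> {?l..?u}"
   proof (cases "e > 0")
    case True
    then have "c + e * a \<le> c + e * t" "c + e * t \<le> c + e * b" using t by auto
    then show ?thesis by auto
   next
    case False
    then have "e < 0" using e by simp
    then have "c + e * b \<le> c + e * t" "c + e * t \<le> c + e * a" using t by auto
    then show ?thesis by auto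
   qed
   moreover have "t = (c + e * t) / e - c / e" using e by (simp add: field_simps)
   ultimately show "t \<in> (\<lambda>x. x / e - c / e) ` {?l..?u}" by blast
  qed
  ultimately show ?thesis by (simp add: add.commute)
 qed
 have ai: "(\<lambda>t. e * h (c + e * t)) absolutely_integrable_on {a..b}" for a b
 proof (cases "a \<le> b")
  case True
  have "h absolutely_integrable_on {min (c+e*a) (c+e*b)..max (c+e*a) (c+e*b)}"
   by (rule prim_absint[OF p])
  then have "(\<lambda>t. h (c + e * t)) integrable_on {a..b}" "(\<lambda>t. norm (h (c + e * t))) integrable_on {a..b}"
   using aff[OF _ True, of h] aff[OF _ True, of "\<lambda>t. norm (h t)"] unfolding absolutely_integrable_on_def by blast+
  then have "(\<lambda>t. h (c + e * t)) absolutely_integrable_on {a..b}"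
   unfolding absolutely_integrable_on_def by blast
  then show ?thesis by (rule set_integrable_mult_right)
 next
  case False then show ?thesis by simp
 qed
 show ?thesis
 proof (rule primI[OF ai])
  fix a b :: real assume ab: "a \<le> b"
  show "((\<lambda>t. e * h (c + e * t)) has_integral (G (c + e * b) - G (c + e * a))) {a..b}"
  proof (cases "e > 0")
   case True
   then have le: "c + e * a \<le> c + e * b" using ab by simp
   then show ?thesis
    using has_integral_mult_right[OF aff[OF prim_int[OF p] ab], of e] prim_integral[OF p le] True by simp
  next
   case False
   then have e': "e < 0" using e by simp
   then have le: "c + e * b \<le> c + e * a" using ab by simp
   then show ?thesis
    using has_integral_mult_right[OF aff[OF prim_int[OF p] ab], of e] prim_integral[OF p le] e' by (simp add: min_def max_def split: if_splits)
  qed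
 qed
qed

lemma prim_exists:
 assumes "\<And>a b. h absolutely_integrable_on {a..b}"
 shows "\<exists>G. prim G h"
proof -
 define G where "G = (\<lambda>t. if 0 \<le> t then integral {0..t} h else - integral {t..0} h)"
 have i: "h integrable_on {a..b}" for a b using assms by (rule absint_int)
 have "integral {a..b} h = G b - G a" if "a \<le> b" for a b
 proof -
  consider "0 \<le> a" | "a < 0" "0 \<le> b" | "b < 0" by linarith
  then show ?thesis
  proof cases
   case 1
   then show ?thesis
    using Henstock_Kurzweil_Integration.integral_combine[OF 1 that i] that by (simp add: G_def)
  next
   case 2
   then show ?thesis
    using Henstock_Kurzweil_Integration.integral_combine[OF _ 2(2) i, of a] by (simp add: G_def)
  next
   case 3
   then show ?thesis
    using Henstock_Kurzweil_Integration.integral_combine[OF that _ i, of 0] that by (simp add: G_def)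
  qed
 qed
 then show ?thesis using assms by (auto simp: prim_def)
qed

lemma continuous_absint:
 fixes h :: "real \<Rightarrow> real"
 assumes "continuous_on UNIV h"
 shows "h absolutely_integrable_on {a..b}"
 by (rule absolutely_integrable_continuous_real) (rule continuous_on_subset[OF assms], simp)

lemma prim_C1:
 assumes "\<And>t. (f has_real_derivative f' t) (at t)" "continuous_on UNIV f'"
 shows "prim f f'"
proof (rule primI)
 fix a b :: real assume "a \<le> b"
 then show "(f' has_integral (f b - f a)) {a..b}"
  by (rule fundamental_theorem_of_calculus)
   (metis assms(1) has_field_derivative_at_within has_real_derivative_iff_has_vector_derivative)
qed (rule continuous_absint[OF assms(2)])

lemma prim_deriv:
 assumes p: "prim G h" and c: "continuous_on UNIV h"
 shows "(G has_real_derivative h t) (at t)"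
proof -
 have "((\<lambda>u. integral {t-1..u} h) has_real_derivative h t) (at t within {t-1..t+1})"
  using continuous_on_subset[OF c] by (intro integral_has_real_derivative) auto
 then have "((\<lambda>u. integral {t-1..u} h) has_real_derivative h t) (at t)"
  using at_within_interior[of t "{t-1..t+1}"] by simp
 then have "((\<lambda>u. G (t-1) + integral {t-1..u} h) has_real_derivative h t) (at t)"
  by (auto intro!: derivative_eq_intros)
 moreover have "\<forall>\<^sub>F u in nhds t. G (t-1) + integral {t-1..u} h = G u"
  by (rule eventually_nhds_in_open[of "{t-1<..}", THEN eventually_mono]) (use prim_integral[OF p] in auto)
 ultimately show ?thesis
  using DERIV_cong_ev[OF refl _ refl] by fast
qed

lemma prim_locL2: "h \<in> locL2 \<Longrightarrow> \<exists>G. prim G h"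
 by (rule prim_exists) (rule locL2_absint)

lemma prim_sq: "h \<in> locL2 \<Longrightarrow> \<exists>Q. prim Q (\<lambda>t. (h t)\<^sup>2)"
proof (rule prim_exists)
 fix a b assume "h \<in> locL2"
 then show "(\<lambda>t. (h t)\<^sup>2) absolutely_integrable_on {a..b}"
  using L2_mult[of "{a..b}" h h] locL2_D by (simp add: power2_eq_square)
qed

lemma sqint_prim: "prim Q (\<lambda>t. (h t)\<^sup>2) \<Longrightarrow> a \<le> b \<Longrightarrow> sqint a b h = Q b - Q a"
 by (simp add: sqint_def prim_integral)

lemma sqint_shift:
 assumes "h \<in> locL2" shows "sqint a b (\<lambda>t. h (t + c)) = sqint (a + c) (b + c) h"
proof (cases "a \<le> b")
 case True
 obtain Q where Q: "prim Q (\<lambda>t. (h t)\<^sup>2)" using prim_sq[OF assms] by blast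
 have "prim (\<lambda>t. Q (c + 1 * t)) (\<lambda>t. 1 * (h (c + 1 * t))\<^sup>2)" by (rule prim_affine[OF Q]) simp
 then have "prim (\<lambda>t. Q (t + c)) (\<lambda>t. (h (t + c))\<^sup>2)" by (simp add: add.commute)
 then show ?thesis using True Q by (simp add: sqint_prim)
qed (simp add: sqint_def)

lemma sqint_reflect:
 assumes "h \<in> locL2" shows "sqint a b (\<lambda>t. h (c - t)) = sqint (c - b) (c - a) h"
proof (cases "a \<le> b")
 case True
 obtain Q where Q: "prim Q (\<lambda>t. (h t)\<^sup>2)" using prim_sq[OF assms] by blast
 have "prim (\<lambda>t. -1 * Q (c + (-1) * t)) (\<lambda>t. -1 * (-1 * (h (c + (-1) * t))\<^sup>2))"
  by (rule prim_cmult, rule prim_affine[OF Q]) simp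
 then have "prim (\<lambda>t. - Q (c - t)) (\<lambda>t. (h (c - t))\<^sup>2)" by simp
 then show ?thesis using True Q by (simp add: sqint_prim)
qed (simp add: sqint_def)

text \<open>The supremum of the set of points up to which $f\le f(a)$ must be \<open>b\<close>: continuity puts it into
 the set, and the local condition on the right would push it further.\<close>

lemma right_nonincreasing:
 fixes f :: "real \<Rightarrow> real"
 assumes ab: "a \<le> b" and c: "continuous_on {a..b} f"
  and r: "\<And>s. a \<le> s \<Longrightarrow> s < b \<Longrightarrow> \<exists>d>0. \<forall>t. s < t \<and> t < s + d \<and> t \<le> b \<longrightarrow> f t \<le> f s"
 shows "f b \<le> f a"
proof -
 define S where "S = {t\<in>{a..b}. \<forall>s\<in>{a..t}. f s \<le> f a}"
 define m where "m = Sup S"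
 have aS: "a \<in> S" using ab by (auto simp: S_def)
 have bdd: "bdd_above S" by (auto simp: S_def intro!: bdd_aboveI[of _ b])
 have m: "a \<le> m" "m \<le> b"
 proof -
  show "a \<le> m" unfolding m_def using aS bdd by (rule cSup_upper)
  show "m \<le> b" unfolding m_def using aS by (intro cSup_least) (auto simp: S_def)
 qed
 have less: "f s \<le> f a" if "a \<le> s" "s < m" for s
 proof -
  obtain t where "t \<in> S" "s < t" using \<open>s < m\<close> less_cSup_iff[OF _ bdd] aS unfolding m_def by blast
  then show ?thesis using that by (auto simp: S_def)
 qed
 have fm: "f m \<le> f a"
 proof -
  have cl: "closed {t\<in>{a..b}. f t \<le> f a}"
   using continuous_closed_preimage[OF c, of "{..f a}"] by (simp add: vimage_def Int_def conj_commute)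
  have "S \<subseteq> {t\<in>{a..b}. f t \<le> f a}" by (auto simp: S_def)
  then have "closure S \<subseteq> {t\<in>{a..b}. f t \<le> f a}" using cl by (rule closure_minimal)
  moreover have "m \<in> closure S" unfolding m_def using aS bdd by (intro closure_contains_Sup) auto
  ultimately show ?thesis by auto
 qed
 have "m = b"
 proof (rule ccontr)
  assume "m \<noteq> b"
  then have "m < b" using m by simp
  then obtain d where d: "d > 0" "\<And>t. m < t \<Longrightarrow> t < m + d \<Longrightarrow> t \<le> b \<Longrightarrow> f t \<le> f m"
   using r[of m] m by blast
  define t where "t = min b (m + d/2)"
  have t: "m < t" "t \<le> b" "t < m + d" using \<open>m < b\<close> d by (auto simp: t_def)
  have "f s \<le> f a" if "s \<in> {a..t}" for s
   using less[of s] fm d(2)[of s] that t by (cases "s < m"; cases "s = m") auto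
  then have "t \<in> S" using t m by (auto simp: S_def)
  then have "t \<le> m" unfolding m_def using bdd by (rule cSup_upper)
  then show False using t by simp
 qed
 then show ?thesis using fm by simp
qed

lemma mult_le_abs:
 fixes x y c :: real
 assumes "\<bar>x\<bar> \<le> c" shows "x * y \<le> c * \<bar>y\<bar>"
proof -
 have "x * y \<le> \<bar>x\<bar> * \<bar>y\<bar>" by (metis abs_ge_self abs_mult)
 also have "\<dots> \<le> c * \<bar>y\<bar>" using assms by (rule mult_right_mono) simp
 finally show ?thesis .
qed

text \<open>For primitives \<open>K\<close>, \<open>L\<close> the error of the product rule on an interval is quadratic in
 the integral of $|k|+|l|$ over it, hence it vanishes.\<close>

lemma prim_mult_absint:
 assumes K: "prim K k" and L: "prim L l"
 shows "(\<lambda>t. K t * l t) absolutely_integrable_on {a..b}"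
proof (rule absolutely_integrable_bounded_measurable_product_real)
 show "K \<in> borel_measurable (lebesgue_on {a..b})"
  by (rule continuous_imp_measurable_on_sets_lebesgue[OF prim_continuous[OF K]]) simp
 show "bounded (K ` {a..b})"
  by (intro compact_imp_bounded compact_continuous_image prim_continuous[OF K]) auto
qed (use prim_absint[OF L] in auto)

lemma prim_product_aux:
 assumes K: "prim K k" and L: "prim L l" and ab: "a \<le> b"
 shows "K b * L b - K a * L a - integral {a..b} (\<lambda>t. K t * l t + k t * L t) \<le> 0"
proof -
 obtain V where V: "prim V (\<lambda>t. \<bar>k t\<bar> + \<bar>l t\<bar>)"
 proof -
  have "(\<lambda>t. \<bar>k t\<bar> + \<bar>l t\<bar>) absolutely_integrable_on {a..b}" for a b
   using prim_absint[OF K] prim_absint[OF L] by (intro set_integral_add(1) set_integrable_abs)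
  then show ?thesis using prim_exists that by blast
 qed
 have ki: "(\<lambda>t. \<bar>k t\<bar>) integrable_on {s..t}" and li: "(\<lambda>t. \<bar>l t\<bar>) integrable_on {s..t}" for s t
  using prim_absint[OF K] prim_absint[OF L] set_integrable_abs absint_int by blast+
 have Kl: "(\<lambda>t. K t * l t) integrable_on {s..t}" for s t
  by (rule absint_int, rule prim_mult_absint[OF K L])
 have kL: "(\<lambda>t. k t * L t) integrable_on {s..t}" for s t
  using absint_int[OF prim_mult_absint[OF L K]] by (simp add: mult.commute)
 have KV: "\<bar>K v - K u\<bar> \<le> V v - V u" and LV: "\<bar>L v - L u\<bar> \<le> V v - V u" if "u \<le> v" for u v
 proof -
  have "\<bar>K v - K u\<bar> = norm (integral {u..v} k)" using prim_integral[OF K that] by simp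
  also have "\<dots> \<le> integral {u..v} (\<lambda>t. \<bar>k t\<bar> + \<bar>l t\<bar>)"
   by (rule integral_norm_bound_integral[OF prim_int[OF K] prim_int[OF V]]) auto
  finally show "\<bar>K v - K u\<bar> \<le> V v - V u" using prim_integral[OF V that] by simp
  have "\<bar>L v - L u\<bar> = norm (integral {u..v} l)" using prim_integral[OF L that] by simp
  also have "\<dots> \<le> integral {u..v} (\<lambda>t. \<bar>k t\<bar> + \<bar>l t\<bar>)"
   by (rule integral_norm_bound_integral[OF prim_int[OF L] prim_int[OF V]]) auto
  finally show "\<bar>L v - L u\<bar> \<le> V v - V u" using prim_integral[OF V that] by simp
 qed
 have Vmono: "V u \<le> V v" if "u \<le> v" for u v using KV[OF that] by linarith
 define D where "D t = K t * L t - integral {a..t} (\<lambda>t. K t * l t + k t * L t)" for t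
 have step: "D t - D s \<le> (V t - V s) * (V t - V s)" if st: "a \<le> s" "s \<le> t" for s t
 proof -
  have int: "(\<lambda>t. K t * l t + k t * L t) integrable_on {u..v}" for u v
   by (rule integrable_add[OF Kl kL])
  have "integral {a..t} (\<lambda>t. K t * l t + k t * L t) - integral {a..s} (\<lambda>t. K t * l t + k t * L t)
    = integral {s..t} (\<lambda>t. K t * l t + k t * L t)"
   using Henstock_Kurzweil_Integration.integral_combine[OF st int] by simp
  moreover have "((\<lambda>u. K t * l u + L s * k u - (K u * l u + k u * L u)) has_integral
    (K t * (L t - L s) + L s * (K t - K s) - integral {s..t} (\<lambda>t. K t * l t + k t * L t))) {s..t}"
   by (intro has_integral_diff has_integral_add has_integral_mult_right prim_has_integral K L st integrable_integral int)
  ultimately have "((\<lambda>u. (K t - K u) * l u + (L s - L u) * k u) has_integral (D t - D s)) {s..t}"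
   by (simp add: D_def algebra_simps)
  then have DD: "D t - D s = integral {s..t} (\<lambda>u. (K t - K u) * l u + (L s - L u) * k u)"
    and iD: "(\<lambda>u. (K t - K u) * l u + (L s - L u) * k u) integrable_on {s..t}"
   by (auto simp: has_integral_iff)
  have "integral {s..t} (\<lambda>u. (K t - K u) * l u + (L s - L u) * k u)
    \<le> integral {s..t} (\<lambda>u. (V t - V s) * (\<bar>k u\<bar> + \<bar>l u\<bar>))"
  proof (rule integral_le)
   show "(\<lambda>u. (V t - V s) * (\<bar>k u\<bar> + \<bar>l u\<bar>)) integrable_on {s..t}"
    by (rule integrable_on_mult_right[OF prim_int[OF V]])
   fix u assume u: "u \<in> {s..t}"
   have "\<bar>K t - K u\<bar> \<le> V t - V s" using KV[of u t] Vmono[of s u] u by auto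
   then have "(K t - K u) * l u \<le> (V t - V s) * \<bar>l u\<bar>"
    by (rule mult_le_abs)
   moreover have "\<bar>L s - L u\<bar> \<le> V t - V s" using LV[of s u] Vmono[of u t] u by (auto simp: abs_minus_commute)
   then have "(L s - L u) * k u \<le> (V t - V s) * \<bar>k u\<bar>"
    by (rule mult_le_abs)
   ultimately show "(K t - K u) * l u + (L s - L u) * k u \<le> (V t - V s) * (\<bar>k u\<bar> + \<bar>l u\<bar>)"
    by (simp add: algebra_simps)
  qed (rule iD)
  then show ?thesis using prim_integral[OF V st(2)] by (simp add: DD)
 qed
 have Dc: "continuous_on {a..b} D"
  unfolding D_def
  by (intro continuous_intros prim_continuous[OF K] prim_continuous[OF L] indefinite_integral_continuous_1
    integrable_add[OF Kl kL])
 have "D b - D a \<le> e * (V b - V a)" if e: "e > 0" for e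
 proof -
  have "D b - e * V b \<le> D a - e * V a"
  proof (rule right_nonincreasing[OF ab, where f = "\<lambda>t. D t - e * V t"])
   show "continuous_on {a..b} (\<lambda>t. D t - e * V t)"
    by (intro continuous_intros Dc prim_continuous[OF V])
   fix s assume s: "a \<le> s" "s < b"
   have "isCont V s" using prim_continuous[OF V, of UNIV] by (simp add: continuous_on_eq_continuous_at)
   then obtain d where d: "d > 0" "\<And>t. \<bar>t - s\<bar> < d \<Longrightarrow> \<bar>V t - V s\<bar> < e"
    using e unfolding continuous_at_eps_delta dist_real_def by blast
   have "D t - e * V t \<le> D s - e * V s" if "s < t" "t < s + d" for t
   proof -
    have "V t - V s \<le> e" "0 \<le> V t - V s" using d(2)[of t] that Vmono[of s t] by auto
    then have "(V t - V s) * (V t - V s) \<le> e * (V t - V s)" by (rule mult_right_mono)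
    then show ?thesis using step[OF s(1), of t] that by (simp add: algebra_simps)
   qed
   then show "\<exists>d>0. \<forall>t. s < t \<and> t < s + d \<and> t \<le> b \<longrightarrow> D t - e * V t \<le> D s - e * V s"
    using d(1) by blast
  qed
  then show ?thesis by (simp add: algebra_simps)
 qed
 moreover have "0 \<le> V b - V a" using Vmono[OF ab] by simp
 ultimately have "D b - D a \<le> 0"
 proof -
  assume *: "\<And>e. e > 0 \<Longrightarrow> D b - D a \<le> e * (V b - V a)" and V0: "0 \<le> V b - V a"
  show ?thesis
  proof (rule field_le_epsilon)
   fix e :: real assume "e > 0"
   then have "D b - D a \<le> e / (V b - V a + 1) * (V b - V a)" using V0 by (intro *) auto
   also have "\<dots> \<le> e" using V0 \<open>e > 0\<close> by (simp add: field_simps)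
   finally show "D b - D a \<le> 0 + e" by simp
  qed
 qed
 then show ?thesis by (simp add: D_def)
qed

lemma prim_product:
 assumes K: "prim K k" and L: "prim L l"
 shows "prim (\<lambda>t. K t * L t) (\<lambda>t. K t * l t + k t * L t)"
proof -
 have ai: "(\<lambda>t. K t * l t + k t * L t) absolutely_integrable_on {a..b}" for a b
  using prim_mult_absint[OF K L] prim_mult_absint[OF L K]
  by (intro set_integral_add(1)) (auto simp: mult.commute)
 show ?thesis
  unfolding prim_def
 proof (intro conjI allI impI ai)
  fix a b :: real assume ab: "a \<le> b"
  have "prim (\<lambda>t. - K t) (\<lambda>t. - k t)" using prim_cmult[OF K, of "-1"] by simp
  from prim_product_aux[OF this L ab]
  have "integral {a..b} (\<lambda>t. K t * l t + k t * L t) \<le> K b * L b - K a * L a"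
   using integral_neg[of "{a..b}" "\<lambda>t. K t * l t + k t * L t"] by simp
  then show "integral {a..b} (\<lambda>t. K t * l t + k t * L t) = K b * L b - K a * L a"
   using prim_product_aux[OF K L ab] by simp
 qed
qed

section \<open>Approximation in the mean square\<close>

lemma sqint_LINT: "h \<in> locL2 \<Longrightarrow> sqint a b h = (LINT t|lebesgue_on {a..b}. (h t)\<^sup>2)"
 by (simp add: sqint_def integral_sq_eq locL2_D)

lemma sqint_dominated:
 assumes "\<And>n. f n \<in> locL2" "g \<in> locL2"
  and "\<And>n t. \<bar>f n t\<bar> \<le> \<bar>g t\<bar>" "AE t in lebesgue. (\<lambda>n. f n t) \<longlonglongrightarrow> 0"
 shows "(\<lambda>n. sqint a b (f n)) \<longlonglongrightarrow> 0"
proof -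
 have "(\<lambda>n. LINT t|lebesgue_on {a..b}. (f n t)\<^sup>2) \<longlonglongrightarrow> (LINT t|lebesgue_on {a..b}. 0)"
 proof (rule integral_dominated_convergence[where w = "\<lambda>t. (g t)\<^sup>2"])
  show "integrable (lebesgue_on {a..b}) (\<lambda>t. (g t)\<^sup>2)"
   using locL2_D[OF assms(2), of a b] by (simp add: L2_def)
  have "(f n) \<in> borel_measurable (lebesgue_on {a..b})" for n
   using locL2_D[OF assms(1), of n a b] by (simp add: L2_def)
  then show "(\<lambda>t. (f n t)\<^sup>2) \<in> borel_measurable (lebesgue_on {a..b})" for n
   by (rule borel_measurable_power)
  have "AE t in lebesgue. t \<in> {a..b} \<longrightarrow> (\<lambda>n. (f n t)\<^sup>2) \<longlonglongrightarrow> 0"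
   using assms(4) by eventually_elim (auto intro: tendsto_eq_intros)
  then show "AE t in lebesgue_on {a..b}. (\<lambda>n. (f n t)\<^sup>2) \<longlonglongrightarrow> 0"
   by (simp add: AE_restrict_space_iff)
  show "AE t in lebesgue_on {a..b}. norm ((f n t)\<^sup>2) \<le> (g t)\<^sup>2" for n
   using assms(3) by (simp add: abs_le_square_iff)
 qed simp
 then show ?thesis by (simp add: sqint_LINT assms)
qed

lemma locL2_bounded:
 assumes h: "h \<in> locL2" and k: "k \<in> borel_measurable lebesgue" and le: "\<And>t. \<bar>k t\<bar> \<le> \<bar>h t\<bar>"
 shows "k \<in> locL2"
proof -
 have "k \<in> L2 {a..b}" for a b
 proof -
  have m: "k \<in> borel_measurable (lebesgue_on {a..b})" using k by (rule measurable_restrict_space1)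
  have "(\<lambda>t. (k t)\<^sup>2) absolutely_integrable_on {a..b}"
  proof (rule measurable_bounded_by_integrable_imp_absolutely_integrable[OF _ _ locL2_sq_int[OF h]])
   show "(\<lambda>t. (k t)\<^sup>2) \<in> borel_measurable (lebesgue_on {a..b})" using m by (rule borel_measurable_power)
  qed (use le in \<open>auto simp: abs_le_square_iff\<close>)
  then show ?thesis using m by (simp add: L2_iff absint_int)
 qed
 then show ?thesis by (simp add: locL2_def)
qed

definition clamp_real :: "real \<Rightarrow> real \<Rightarrow> real" where
 "clamp_real m x = max (- m) (min m x)"

lemma clamp_real_measurable: "f \<in> borel_measurable M \<Longrightarrow> (\<lambda>t. clamp_real m (f t)) \<in> borel_measurable M"
 unfolding clamp_real_def by (intro borel_measurable_max borel_measurable_min borel_measurable_const)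

text \<open>Truncation reduces to bounded functions, and bounded measurable functions are almost everywhere
 limits of uniformly bounded continuous ones; both limits are dominated.\<close>

lemma locL2_approx:
 assumes h: "h \<in> locL2" and e: "e > 0"
 shows "\<exists>p. continuous_on UNIV p \<and> sqint a b (\<lambda>t. h t - p t) < e"
proof -
 define hm where "hm n t = clamp_real (real n) (h t)" for n t
 have hmeas: "h \<in> borel_measurable lebesgue" using h by (rule locL2_measurable)
 have hmL: "hm n \<in> locL2" for n
 proof (rule locL2_bounded[OF h])
  show "hm n \<in> borel_measurable lebesgue"
   using clamp_real_measurable[OF hmeas, of "real n"] by (simp add: hm_def[abs_def])
 qed (auto simp: hm_def clamp_real_def)
 have "(\<lambda>n. sqint a b (\<lambda>t. h t - hm n t)) \<longlonglongrightarrow> 0"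
 proof (rule sqint_dominated[OF locL2_diff[OF h hmL] h])
  show "\<bar>h t - hm n t\<bar> \<le> \<bar>h t\<bar>" for n t by (auto simp: hm_def clamp_real_def)
  have "(\<lambda>n. h t - hm n t) \<longlonglongrightarrow> 0" for t
  proof (rule tendsto_eventually)
   show "\<forall>\<^sub>F n in sequentially. h t - hm n t = 0"
    using eventually_ge_at_top[of "nat \<lceil>\<bar>h t\<bar>\<rceil>"]
   proof eventually_elim
    case (elim n)
    then have "\<bar>h t\<bar> \<le> real n" by linarith
    then show ?case by (auto simp: hm_def clamp_real_def)
   qed
  qed
  then show "AE t in lebesgue. (\<lambda>n. h t - hm n t) \<longlonglongrightarrow> 0" by simp
 qed
 then have "\<forall>\<^sub>F n in sequentially. sqint a b (\<lambda>t. h t - hm n t) < e / 4"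
  using e by (intro order_tendstoD(2)) auto
 then obtain m where m: "sqint a b (\<lambda>t. h t - hm m t) < e / 4"
  by (auto simp: eventually_sequentially)
 have "h measurable_on UNIV"
  using hmeas measurable_on_iff_borel_measurable[of UNIV h] by (simp add: lebesgue_on_UNIV_eq)
 then obtain N g where N: "negligible N" and g: "\<And>n. continuous_on UNIV (g n)"
   "\<And>x. x \<notin> N \<Longrightarrow> (\<lambda>n. g n x) \<longlonglongrightarrow> h x"
  by (auto simp: measurable_on_def)
 define p where "p n t = clamp_real (real m) (g n t)" for n :: nat and t
 have pc: "continuous_on UNIV (p n)" for n
  unfolding p_def clamp_real_def by (intro continuous_intros g)
 have "(\<lambda>n. sqint a b (\<lambda>t. hm m t - p n t)) \<longlonglongrightarrow> 0"
 proof (rule sqint_dominated)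
  show "(\<lambda>t. hm m t - p n t) \<in> locL2" for n by (intro locL2_diff hmL locL2_continuous pc)
  show "(\<lambda>t. 2 * real m) \<in> locL2" by (intro locL2_continuous continuous_intros)
  show "\<bar>hm m t - p n t\<bar> \<le> \<bar>2 * real m\<bar>" for n t
   by (auto simp: hm_def p_def clamp_real_def)
  have "(\<lambda>n. hm m t - p n t) \<longlonglongrightarrow> 0" if "t \<notin> N" for t
  proof -
   have "(\<lambda>n. p n t) \<longlonglongrightarrow> hm m t"
    unfolding p_def hm_def clamp_real_def by (intro tendsto_intros g(2) that)
   from tendsto_diff[OF tendsto_const this, of "hm m t"] show ?thesis by simp
  qed
  then show "AE t in lebesgue. (\<lambda>n. hm m t - p n t) \<longlonglongrightarrow> 0"
   using N by (intro AE_I'[of N]) (auto simp: negligible_iff_null_sets)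
 qed
 then have "\<forall>\<^sub>F n in sequentially. sqint a b (\<lambda>t. hm m t - p n t) < e / 4"
  using e by (intro order_tendstoD(2)) auto
 then obtain n where n: "sqint a b (\<lambda>t. hm m t - p n t) < e / 4"
  by (auto simp: eventually_sequentially)
 have "sqint a b (\<lambda>t. (h t - hm m t) + (hm m t - p n t)) < e"
  using sqint_add_le[OF locL2_diff[OF h hmL[of m]] locL2_diff[OF hmL[of m] locL2_continuous[OF pc[of n]]], of a b]
   m n by linarith
 then show ?thesis using pc[of n] by (intro exI[of _ "p n"]) simp
qed

text \<open>The translates and the Steklov means of \<open>h\<close> tend to \<open>h\<close>: both are averaging schemes that
 are bounded in the mean square and converge locally uniformly for continuous functions.\<close>

lemma approximation_scheme:
 assumes h: "h \<in> locL2"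
  and bd: "\<And>k q. k \<noteq> 0 \<Longrightarrow> \<bar>k\<bar> \<le> 1 \<Longrightarrow> q \<in> locL2 \<Longrightarrow> A k q \<in> locL2 \<and> sqint a b (A k q) \<le> sqint (a - 1) (b + 1) q"
  and lin: "\<And>k f g t. f \<in> locL2 \<Longrightarrow> g \<in> locL2 \<Longrightarrow> k \<noteq> 0 \<Longrightarrow> A k (\<lambda>t. f t - g t) t = A k f t - A k g t"
  and cont: "\<And>p d. continuous_on UNIV p \<Longrightarrow> d > 0 \<Longrightarrow> \<forall>\<^sub>F k in at 0. \<forall>t\<in>{a..b}. \<bar>A k p t - p t\<bar> \<le> d"
 shows "((\<lambda>k. sqint a b (\<lambda>t. A k h t - h t)) \<longlongrightarrow> 0) (at (0::real))"
proof (rule tendstoI)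
 fix e :: real assume e: "e > 0"
 obtain p where p: "continuous_on UNIV p" "sqint (a - 1) (b + 1) (\<lambda>t. h t - p t) < e / 16"
  using locL2_approx[OF h, of "e/16"] e by auto
 have pL: "p \<in> locL2" using p(1) by (rule locL2_continuous)
 \<comment> \<open>a uniform error \<open>d\<close> contributes at most $d^2(b-a)\le e/8$ to the mean square\<close>
 define d where "d = sqrt (e / (8 * (\<bar>b - a\<bar> + 1)))"
 have d: "d > 0" "d\<^sup>2 = e / (8 * (\<bar>b - a\<bar> + 1))" using e by (auto simp: d_def intro!: divide_pos_pos add_nonneg_pos)
 have "\<forall>\<^sub>F k in at 0. \<bar>k\<bar> \<le> (1::real) \<and> k \<noteq> 0"
  unfolding eventually_at by (intro exI[of _ 1]) (auto simp: dist_real_def)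
 then show "\<forall>\<^sub>F k in at 0. dist (sqint a b (\<lambda>t. A k h t - h t)) 0 < e"
  using cont[OF p(1) d(1)]
 proof eventually_elim
  case (elim k)
  let ?q = "\<lambda>t. h t - p t"
  have q: "?q \<in> locL2" by (rule locL2_diff[OF h pL])
  have Aq: "A k ?q \<in> locL2" "sqint a b (A k ?q) \<le> sqint (a - 1) (b + 1) ?q"
   using bd[OF _ _ q, of k] elim by auto
  have Ap: "A k p \<in> locL2" using bd[OF _ _ pL, of k] elim by auto
  have pp: "(\<lambda>t. A k p t - p t) \<in> locL2" by (rule locL2_diff[OF Ap pL])
  have s3: "sqint a b (\<lambda>t. A k p t - p t) \<le> e / 8"
  proof -
   have "sqint a b (\<lambda>t. A k p t - p t) \<le> integral {a..b} (\<lambda>t. d\<^sup>2)"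
    unfolding sqint_def
   proof (rule integral_le[OF locL2_sq_int[OF pp]])
    fix t assume "t \<in> {a..b}"
    then have "\<bar>A k p t - p t\<bar> \<le> \<bar>d\<bar>" using elim d(1) by auto
    then show "(A k p t - p t)\<^sup>2 \<le> d\<^sup>2" by (simp only: abs_le_square_iff)
   qed auto
   also have "\<dots> \<le> (\<bar>b - a\<bar> + 1) * d\<^sup>2" by (cases "a \<le> b") (auto intro!: mult_right_mono)
   also have "\<dots> = e / 8"
   proof -
    have "w * (e / (8 * w)) = e / 8" if "w > 0" for w using that by (simp add: field_simps)
    from this[of "\<bar>b - a\<bar> + 1"] show ?thesis unfolding d(2) by (metis abs_ge_zero add_nonneg_pos zero_less_one)
   qed
   finally show ?thesis .
  qed
  have eq: "(\<lambda>t. A k h t - h t) = (\<lambda>t. (A k ?q t - ?q t) + (A k p t - p t))"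
   using lin[OF h pL, of k] elim by (simp add: fun_eq_iff)
  have "sqint a b (\<lambda>t. A k h t - h t) \<le> 2 * sqint a b (\<lambda>t. A k ?q t - ?q t) + 2 * sqint a b (\<lambda>t. A k p t - p t)"
   unfolding eq by (rule sqint_add_le[OF locL2_diff[OF Aq(1) q] pp])
  moreover have "sqint a b (\<lambda>t. A k ?q t - ?q t) \<le> 2 * sqint a b (A k ?q) + 2 * sqint a b ?q"
   by (rule sqint_diff_le[OF Aq(1) q])
  moreover have "sqint a b ?q \<le> sqint (a - 1) (b + 1) ?q" by (rule sqint_mono[OF q]) auto
  ultimately have "sqint a b (\<lambda>t. A k h t - h t) < e" using Aq(2) p(2) s3 e by linarith
  then show ?case using sqint_nonneg[of a b "\<lambda>t. A k h t - h t"] by simp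
 qed
qed

lemma continuous_uniform_small:
 assumes p: "continuous_on UNIV (p :: real \<Rightarrow> real)" and d: "d > 0"
 shows "\<exists>r>0. \<forall>t\<in>{a..b}. \<forall>s. \<bar>s - t\<bar> < r \<longrightarrow> \<bar>p s - p t\<bar> < d"
proof -
 have "uniformly_continuous_on {a - 1..b + 1} p"
  by (rule compact_uniformly_continuous[OF continuous_on_subset[OF p]]) auto
 then obtain r where r: "r > 0" "\<And>s t. s \<in> {a - 1..b + 1} \<Longrightarrow> t \<in> {a - 1..b + 1} \<Longrightarrow> \<bar>s - t\<bar> < r \<Longrightarrow> \<bar>p s - p t\<bar> < d"
  using d unfolding uniformly_continuous_on_def dist_real_def by meson
 then show ?thesis
  by (intro exI[of _ "min r 1"] conjI ballI allI impI r(2)) (auto simp: abs_le_iff)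
qed

lemma translation_L2:
 assumes h: "h \<in> locL2"
 shows "((\<lambda>k. sqint a b (\<lambda>t. h (t + k) - h t)) \<longlongrightarrow> 0) (at 0)"
proof (rule approximation_scheme[where A = "\<lambda>k h t. h (t + k)", OF h])
 fix k :: real and q assume "k \<noteq> 0" "\<bar>k\<bar> \<le> 1" and q: "q \<in> locL2"
 then have "sqint (a + k) (b + k) q \<le> sqint (a - 1) (b + 1) q" by (intro sqint_mono) auto
 then show "(\<lambda>t. q (t + k)) \<in> locL2 \<and> sqint a b (\<lambda>t. q (t + k)) \<le> sqint (a - 1) (b + 1) q"
  using locL2_affine[OF q, of 1 k] sqint_shift[OF q, of a b k] by (simp add: add.commute)
next
 fix p :: "real \<Rightarrow> real" and d :: real assume "continuous_on UNIV p" "d > 0"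
 then obtain r where "r > 0" "\<forall>t\<in>{a..b}. \<forall>s. \<bar>s - t\<bar> < r \<longrightarrow> \<bar>p s - p t\<bar> < d"
  using continuous_uniform_small by blast
 then show "\<forall>\<^sub>F k in at 0. \<forall>t\<in>{a..b}. \<bar>p (t + k) - p t\<bar> \<le> d"
  unfolding eventually_at by (intro exI[of _ r]) (auto simp: dist_real_def intro: less_imp_le)
qed simp

definition steklov :: "real \<Rightarrow> (real \<Rightarrow> real) \<Rightarrow> real \<Rightarrow> real" where
 "steklov k h t = (if k > 0 then integral {t..t + k} h / k else - integral {t + k..t} h / k)"

lemma steklov_prim: "prim G h \<Longrightarrow> steklov k h t = (G (t + k) - G t) / k"
 using prim_integral[of G h t "t + k"] prim_integral[of G h "t + k" t]
 by (cases "k > 0") (auto simp: steklov_def diff_divide_distrib)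

text \<open>Steklov means commute with differentiation.\<close>

lemma prim_steklov:
 assumes P: "prim F f" and Q: "prim K F" shows "prim (steklov k F) (steklov k f)"
proof -
 have "steklov k F = (\<lambda>u. 1 / k * (K (k + 1 * u) - K u))" "steklov k f = (\<lambda>u. 1 / k * (F (k + 1 * u) - F u))"
  using steklov_prim[OF Q, of k] steklov_prim[OF P, of k] by (simp_all add: fun_eq_iff add.commute)
 moreover have "prim (\<lambda>u. 1 / k * (K (k + 1 * u) - K u)) (\<lambda>u. 1 / k * (1 * F (k + 1 * u) - F u))"
  by (intro prim_cmult prim_diff prim_affine Q) auto
 ultimately show ?thesis by simp
qed

lemma steklov_bound_pos:
 assumes h: "h \<in> locL2" and k: "k > 0"
 shows "sqint a b (steklov k h) \<le> sqint a (b + k) h"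
proof (cases "a \<le> b")
 case False then show ?thesis by (simp add: sqint_def[of a b] sqint_nonneg)
next
 case ab: True
 obtain G where G: "prim G h" using prim_locL2[OF h] by blast
 obtain Q where Q: "prim Q (\<lambda>t. (h t)\<^sup>2)" using prim_sq[OF h] by blast
 have Qc: "continuous_on UNIV Q" by (rule prim_continuous[OF Q])
 have Qmono: "Q s \<le> Q t" if "s \<le> t" for s t
  using sqint_prim[OF Q that] sqint_nonneg[of s t h] by simp
 obtain R where R: "prim R Q" using prim_exists[of Q] continuous_absint[OF Qc] by blast
 have pw: "(steklov k h t)\<^sup>2 \<le> (Q (t + k) - Q t) / k" for t
 proof -
  have "(integral {t..t + k} h)\<^sup>2 \<le> (t + k - t) * integral {t..t + k} (\<lambda>x. (h x)\<^sup>2)"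
   by (rule Cauchy_Schwarz_interval[OF locL2_D[OF h]]) (use k in auto)
  then have "(integral {t..t + k} h)\<^sup>2 \<le> k * (Q (t + k) - Q t)"
   using prim_integral[OF Q, of t "t + k"] k by simp
  then show ?thesis using k by (simp add: steklov_def power_divide power2_eq_square field_simps)
 qed
 have Rk: "prim (\<lambda>t. R (k + 1 * t)) (\<lambda>t. 1 * Q (k + 1 * t))" by (rule prim_affine[OF R]) simp
 have pr: "prim (\<lambda>t. 1 / k * (R (k + t) - R t)) (\<lambda>t. 1 / k * (Q (k + t) - Q t))"
  using prim_cmult[OF prim_diff[OF Rk R], of "1 / k"] by simp
 have "sqint a b (steklov k h) \<le> integral {a..b} (\<lambda>t. 1 / k * (Q (k + t) - Q t))"
  unfolding sqint_def
 proof (rule integral_le[OF _ prim_int[OF pr]])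
  have "continuous_on {a..b} (\<lambda>t. ((G (t + k) - G t) / k)\<^sup>2)"
   using k by (intro continuous_intros continuous_on_compose2[OF prim_continuous[OF G, of UNIV]] prim_continuous[OF G]) auto
  then show "(\<lambda>t. (steklov k h t)\<^sup>2) integrable_on {a..b}"
   unfolding steklov_prim[OF G] by (rule integrable_continuous_real)
 qed (use pw in \<open>simp add: add.commute\<close>)
 also have "\<dots> = 1 / k * ((R (b + k) - R b) - (R (a + k) - R a))"
  using prim_integral[OF pr ab] by (simp add: algebra_simps)
 also have "\<dots> \<le> 1 / k * (k * Q (b + k) - k * Q a)"
 proof (rule mult_left_mono)
  have "R (b + k) - R b = integral {b..b + k} Q" using prim_integral[OF R, of b "b + k"] k by simp
  also have "\<dots> \<le> integral {b..b + k} (\<lambda>_. Q (b + k))"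
   by (rule integral_le[OF prim_int[OF R]]) (auto intro: Qmono)
  finally have 1: "R (b + k) - R b \<le> k * Q (b + k)" using k by simp
  have "k * Q a = integral {a..a + k} (\<lambda>_. Q a)" using k by simp
  also have "\<dots> \<le> integral {a..a + k} Q"
   by (rule integral_le[OF _ prim_int[OF R]]) (auto intro: Qmono)
  also have "\<dots> = R (a + k) - R a" using prim_integral[OF R, of a "a + k"] k by simp
  finally show "(R (b + k) - R b) - (R (a + k) - R a) \<le> k * Q (b + k) - k * Q a" using 1 by simp
 qed (use k in auto)
 also have "\<dots> = Q (b + k) - Q a" using k by (simp flip: right_diff_distrib)
 also have "\<dots> = sqint a (b + k) h" using sqint_prim[OF Q, of a "b + k"] ab k by simp
 finally show ?thesis .
qed

lemma steklov_locL2: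
 assumes h: "h \<in> locL2" shows "steklov k h \<in> locL2"
proof -
 obtain G where G: "prim G h" using prim_locL2[OF h] by blast
 have "continuous_on UNIV (\<lambda>t. (G (t + k) - G t) / k)"
  unfolding divide_inverse
  by (intro continuous_intros continuous_on_compose2[OF prim_continuous[OF G, of UNIV]] prim_continuous[OF G]) auto
 then show ?thesis unfolding steklov_prim[OF G, abs_def] by (rule locL2_continuous)
qed

lemma steklov_L2:
 assumes h: "h \<in> locL2"
 shows "((\<lambda>k. sqint a b (\<lambda>t. steklov k h t - h t)) \<longlongrightarrow> 0) (at 0)"
proof (rule approximation_scheme[where A = steklov, OF h])
 fix k :: real and q assume k: "k \<noteq> 0" "\<bar>k\<bar> \<le> 1" and q: "q \<in> locL2"
 have "sqint a b (steklov k q) \<le> sqint (a - 1) (b + 1) q"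
 proof (cases "k > 0")
  case True
  have "sqint a (b + k) q \<le> sqint (a - 1) (b + 1) q" using k by (intro sqint_mono[OF q]) auto
  then show ?thesis using steklov_bound_pos[OF q True, of a b] by simp
 next
  case False
  then have k': "- k > 0" using k by simp
  have "steklov k q = (\<lambda>t. steklov (- k) q (t + k))" using k' by (simp add: steklov_def fun_eq_iff)
  then have "sqint a b (steklov k q) = sqint (a + k) (b + k) (steklov (- k) q)"
   using sqint_shift[OF steklov_locL2[OF q, of "-k"], of a b k] by simp
  also have "\<dots> \<le> sqint (a + k) (b + k + - k) q" by (rule steklov_bound_pos[OF q k'])
  also have "\<dots> \<le> sqint (a - 1) (b + 1) q" using k by (intro sqint_mono[OF q]) auto
  finally show ?thesis .
 qed
 then show "steklov k q \<in> locL2 \<and> sqint a b (steklov k q) \<le> sqint (a - 1) (b + 1) q"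
  using steklov_locL2[OF q] by simp
next
 fix k t :: real and f g assume f: "f \<in> locL2" and g: "g \<in> locL2"
 show "steklov k (\<lambda>t. f t - g t) t = steklov k f t - steklov k g t"
  using integral_diff[OF locL2_int[OF f] locL2_int[OF g]] by (simp add: steklov_def diff_divide_distrib)
next
 fix p :: "real \<Rightarrow> real" and d :: real assume p: "continuous_on UNIV p" and "d > 0"
 then obtain r where r: "r > 0" "\<And>t s. t \<in> {a..b} \<Longrightarrow> \<bar>s - t\<bar> < r \<Longrightarrow> \<bar>p s - p t\<bar> < d"
  using continuous_uniform_small[of p d a b] by blast
 obtain P where P: "prim P p" using prim_exists[of p] continuous_absint[OF p] by blast
 have mean: "\<bar>(P v - P u) / (v - u) - c\<bar> \<le> d"
  if "u < v" "\<And>s. u \<le> s \<Longrightarrow> s \<le> v \<Longrightarrow> \<bar>p s - c\<bar> \<le> d" for u v c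
 proof -
  have "prim (\<lambda>t. P t - c * t) (\<lambda>t. p t - c)"
   using prim_diff[OF P prim_C1[of "\<lambda>t. c * t" "\<lambda>_. c"]] by (auto intro!: derivative_eq_intros)
  from prim_has_integral[OF this, of u v]
  have "((\<lambda>t. p t - c) has_integral (P v - P u - c * (v - u))) {u..v}" using that by (simp add: algebra_simps)
  then have "norm (P v - P u - c * (v - u)) \<le> d * (v - u)"
   using has_integral_bound_real[of d "{}" "\<lambda>t. p t - c" _ u v] that \<open>d > 0\<close> by auto
  moreover have "(P v - P u) / (v - u) - c = (P v - P u - c * (v - u)) / (v - u)"
   using that(1) by (simp add: field_simps)
  ultimately show ?thesis using that(1) by (simp add: field_simps)
 qed
 have "\<bar>steklov k p t - p t\<bar> \<le> d" if "k \<noteq> 0" "\<bar>k\<bar> < r" "t \<in> {a..b}" for k t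
 proof (cases "k > 0")
  case True
  have "\<bar>(P (t + k) - P t) / (t + k - t) - p t\<bar> \<le> d"
   using True that by (intro mean less_imp_le[OF r(2)]) auto
  then show ?thesis by (simp add: steklov_prim[OF P])
 next
  case False
  have "\<bar>(P t - P (t + k)) / (t - (t + k)) - p t\<bar> \<le> d"
   using False that by (intro mean less_imp_le[OF r(2)]) auto
  moreover have "(P t - P (t + k)) / (t - (t + k)) = (P (t + k) - P t) / k"
   using that(1) by (simp add: field_simps)
  ultimately show ?thesis by (simp add: steklov_prim[OF P])
 qed
 then show "\<forall>\<^sub>F k in at 0. \<forall>t\<in>{a..b}. \<bar>steklov k p t - p t\<bar> \<le> d"
  unfolding eventually_at using r(1) by (intro exI[of _ r]) (auto simp: dist_real_def)
qed

section \<open>Smooth functions and mollifiers\<close>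

text \<open>A smooth function is handled together with the sequence of its derivatives.\<close>

definition smooth_seq :: "(nat \<Rightarrow> real \<Rightarrow> real) \<Rightarrow> bool" where
 "smooth_seq D \<longleftrightarrow> (\<forall>n x. (D n has_real_derivative D (Suc n) x) (at x))"

lemma smooth_seqD: "smooth_seq D \<Longrightarrow> (D n has_real_derivative D (Suc n) x) (at x)"
 by (simp add: smooth_seq_def)

lemma smooth_seq_continuous: "smooth_seq D \<Longrightarrow> continuous_on S (D n)"
 by (meson DERIV_isCont continuous_at_imp_continuous_on smooth_seqD)

lemma smooth_seq_deriv: "smooth_seq D \<Longrightarrow> (deriv ^^ n) (D 0) = D n"
proof (induction n)
 case (Suc n)
 have "deriv (D n) = D (Suc n)"
  by (rule ext, rule DERIV_imp_deriv, rule smooth_seqD[OF Suc.prems])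
 then show ?case using Suc by simp
qed simp

lemma test_fun_iff:
 "test_fun S \<eta> \<longleftrightarrow> (\<exists>D. smooth_seq D \<and> D 0 = \<eta>) \<and> (\<exists>K. compact K \<and> K \<subseteq> S \<and> (\<forall>x. x \<notin> K \<longrightarrow> \<eta> x = 0))"
proof -
 have "(\<exists>D. smooth_seq D \<and> D 0 = \<eta>) \<longleftrightarrow> (\<forall>n x. (deriv ^^ n) \<eta> differentiable (at x))"
 proof
  assume "\<exists>D. smooth_seq D \<and> D 0 = \<eta>"
  then obtain D where D: "smooth_seq D" "D 0 = \<eta>" by blast
  then have "(deriv ^^ n) \<eta> = D n" for n using smooth_seq_deriv by blast
  then show "\<forall>n x. (deriv ^^ n) \<eta> differentiable (at x)"
   using smooth_seqD[OF D(1)] real_differentiable_def by simp blast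
 next
  assume "\<forall>n x. (deriv ^^ n) \<eta> differentiable (at x)"
  then have "smooth_seq (\<lambda>n. (deriv ^^ n) \<eta>)"
   by (auto simp: smooth_seq_def DERIV_deriv_iff_real_differentiable)
  then show "\<exists>D. smooth_seq D \<and> D 0 = \<eta>" by (intro exI[of _ "\<lambda>n. (deriv ^^ n) \<eta>"]) simp
 qed
 then show ?thesis by (simp add: test_fun_def)
qed

lemma smooth_seq_affine:
 assumes "smooth_seq D" shows "smooth_seq (\<lambda>n x. e ^ n * D n (c + e * x))"
 unfolding smooth_seq_def
proof (intro allI)
 fix n x
 have "((\<lambda>x. D n (c + e * x)) has_real_derivative D (Suc n) (c + e * x) * e) (at x)"
  by (rule DERIV_chain2[OF smooth_seqD[OF assms]]) (auto intro!: derivative_eq_intros)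
 from DERIV_cmult[OF this, of "e ^ n"]
 show "((\<lambda>x. e ^ n * D n (c + e * x)) has_real_derivative e ^ Suc n * D (Suc n) (c + e * x)) (at x)"
  by (simp add: mult_ac)
qed

lemma smooth_seq_cmult: "smooth_seq D \<Longrightarrow> smooth_seq (\<lambda>n x. c * D n x)"
 unfolding smooth_seq_def by (auto intro!: DERIV_cmult)

lemma smooth_seq_Suc: "smooth_seq D \<Longrightarrow> smooth_seq (\<lambda>n. D (Suc n))"
 by (simp add: smooth_seq_def)

lemma smooth_seq_shift: "smooth_seq D \<Longrightarrow> smooth_seq (\<lambda>n x. D n (x - c))"
 using smooth_seq_affine[of D 1 "-c"] by (simp add: add.commute)

primrec leibniz :: "(nat \<Rightarrow> real \<Rightarrow> real) \<Rightarrow> (nat \<Rightarrow> real \<Rightarrow> real) \<Rightarrow> nat \<Rightarrow> nat \<Rightarrow> nat \<Rightarrow> real \<Rightarrow> real" where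
 "leibniz A B 0 m n x = A m x * B n x"
| "leibniz A B (Suc k) m n x = leibniz A B k (Suc m) n x + leibniz A B k m (Suc n) x"

lemma leibniz_derivative:
 assumes "smooth_seq A" "smooth_seq B"
 shows "(leibniz A B k m n has_real_derivative leibniz A B (Suc k) m n x) (at x)"
proof (induction k arbitrary: m n)
 case 0
 have "((\<lambda>x. A m x * B n x) has_real_derivative A (Suc m) x * B n x + B (Suc n) x * A m x) (at x)"
  by (rule DERIV_mult[OF smooth_seqD[OF assms(1)] smooth_seqD[OF assms(2)]])
 then show ?case by (simp add: leibniz.simps(1)[abs_def] mult.commute)
next
 case (Suc k)
 have "((\<lambda>x. leibniz A B k (Suc m) n x + leibniz A B k m (Suc n) x) has_real_derivative
   leibniz A B (Suc k) (Suc m) n x + leibniz A B (Suc k) m (Suc n) x) (at x)"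
  by (rule DERIV_add[OF Suc.IH Suc.IH])
 moreover have "leibniz A B (Suc k) m n = (\<lambda>x. leibniz A B k (Suc m) n x + leibniz A B k m (Suc n) x)"
  by (rule ext) simp
 ultimately show ?case by simp
qed

lemma leibniz_zero:
 assumes "\<And>m. A m x = 0 \<or> (\<forall>n. B n x = 0)"
 shows "leibniz A B k m n x = 0"
 using assms by (induction k arbitrary: m n) auto

text \<open>The derivatives of $e^{-1/x}$, continued by zero, are $p_n(1/x)e^{-1/x}$.\<close>

primrec flat_poly :: "nat \<Rightarrow> real poly" where
 "flat_poly 0 = 1"
| "flat_poly (Suc n) = [:0, 0, 1:] * (flat_poly n - pderiv (flat_poly n))"

definition flat :: "nat \<Rightarrow> real \<Rightarrow> real" where
 "flat n x = (if 0 < x then poly (flat_poly n) (1 / x) * exp (- 1 / x) else 0)"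

lemma poly_exp_tendsto_0: "((\<lambda>y. poly p y * exp (- y)) \<longlongrightarrow> (0::real)) at_top"
proof -
 have "((\<lambda>y. \<Sum>i\<le>degree p. coeff p i * (y ^ i / exp y)) \<longlongrightarrow> (\<Sum>i\<le>degree p. coeff p i * 0)) at_top"
  by (intro tendsto_intros tendsto_power_div_exp_0)
 moreover have "poly p y * exp (- y) = (\<Sum>i\<le>degree p. coeff p i * (y ^ i / exp y))" for y
  by (simp add: poly_altdef sum_distrib_right exp_minus divide_inverse mult.assoc)
 ultimately show ?thesis by simp
qed

lemma flat_smooth: "smooth_seq flat"
 unfolding smooth_seq_def
proof (intro allI)
 fix n and x :: real
 consider "x < 0" | "x = 0" | "x > 0" by linarith
 then show "(flat n has_real_derivative flat (Suc n) x) (at x)"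
 proof cases
  case 1
  have "((\<lambda>_. 0) has_real_derivative flat (Suc n) x) (at x)" using 1 by (simp add: flat_def)
  moreover have "\<forall>\<^sub>F u in nhds x. 0 = flat n u"
   by (rule eventually_nhds_in_open[of "{..<0}", THEN eventually_mono]) (use 1 in \<open>auto simp: flat_def\<close>)
  ultimately show ?thesis using DERIV_cong_ev[OF refl _ refl] by fast
 next
  case 3
  have "((\<lambda>x. poly (flat_poly n) (1 / x) * exp (- 1 / x)) has_real_derivative flat (Suc n) x) (at x)"
   using 3 by (auto intro!: derivative_eq_intros DERIV_chain2[OF poly_DERIV] simp: flat_def power2_eq_square field_simps)
  moreover have "\<forall>\<^sub>F u in nhds x. poly (flat_poly n) (1 / u) * exp (- 1 / u) = flat n u"
   by (rule eventually_nhds_in_open[of "{0<..}", THEN eventually_mono]) (use 3 in \<open>auto simp: flat_def\<close>)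
  ultimately show ?thesis using DERIV_cong_ev[OF refl _ refl] by fast
 next
  case 2
  have r: "((\<lambda>h. flat n h / h) \<longlongrightarrow> 0) (at_right 0)"
  proof -
   have "((\<lambda>h. poly ([:0, 1:] * flat_poly n) (inverse h) * exp (- inverse h)) \<longlongrightarrow> (0::real)) (at_right 0)"
    by (rule filterlim_compose[OF poly_exp_tendsto_0 filterlim_inverse_at_top_right])
   moreover have "\<forall>\<^sub>F h in at_right 0. poly ([:0, 1:] * flat_poly n) (inverse h) * exp (- inverse h) = flat n h / h"
    unfolding eventually_at_right_field
    by (intro exI[of _ 1]) (auto simp: flat_def divide_inverse)
   ultimately show ?thesis by (rule Lim_transform_eventually)
  qed
  have l: "((\<lambda>h. flat n h / h) \<longlongrightarrow> 0) (at_left 0)"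
  proof -
   have "\<forall>\<^sub>F h in at_left 0. 0 = flat n h / h"
    unfolding eventually_at_left_field by (intro exI[of _ "-1"]) (auto simp: flat_def)
   then show ?thesis by (rule Lim_transform_eventually[OF tendsto_const])
  qed
  have "((\<lambda>h. (flat n (0 + h) - flat n 0) / h) \<longlongrightarrow> 0) (at 0)"
   using filterlim_split_at[OF l r] by (simp add: flat_def[of n 0])
  then show ?thesis using 2 by (simp add: DERIV_def flat_def[of "Suc n" 0])
 qed
qed

lemma mollifier:
 assumes d: "d > 0"
 obtains M where "smooth_seq M" "\<And>x. 0 \<le> M 0 x" "\<And>n x. \<bar>x\<bar> \<ge> d \<Longrightarrow> M n x = 0"
  "(M 0 has_integral 1) {-d..d}"
proof -
 define A where "A n x = 1 ^ n * flat n (d + 1 * x)" for n x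
 define B where "B n x = (-1) ^ n * flat n (d + (-1) * x)" for n x
 define L where "L k = leibniz A B k 0 0" for k
 have sA: "smooth_seq A" and sB: "smooth_seq B"
  using smooth_seq_affine[OF flat_smooth, of 1 d] smooth_seq_affine[OF flat_smooth, of "-1" d]
  by (simp_all add: A_def[abs_def] B_def[abs_def])
 have sL: "smooth_seq L"
  using leibniz_derivative[OF sA sB] by (simp add: smooth_seq_def L_def)
 have L0: "0 \<le> L 0 x" for x by (simp add: L_def A_def B_def flat_def)
 have Lz: "L n x = 0" if "\<bar>x\<bar> \<ge> d" for n x
  unfolding L_def
 proof (rule leibniz_zero)
  fix m
  have "x \<ge> d \<or> x \<le> - d" using that by linarith
  then show "A m x = 0 \<or> (\<forall>n. B n x = 0)" by (auto simp: A_def B_def flat_def)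
 qed
 define I where "I = integral {-d..d} (L 0)"
 have "I \<noteq> 0"
 proof
  assume "I = 0"
  then have "L 0 0 = 0"
   unfolding I_def
   using integral_cbox_eq_0_iff[of "-d" d "L 0"] smooth_seq_continuous[OF sL] L0 d by (auto simp: content_pos_lt)
  moreover have "L 0 0 > 0" using d by (simp add: L_def A_def B_def flat_def)
  ultimately show False by simp
 qed
 moreover have "0 \<le> I" unfolding I_def
  by (intro integral_nonneg integrable_continuous_real smooth_seq_continuous[OF sL]) (simp add: L0)
 ultimately have I: "I > 0" by simp
 show ?thesis
 proof (rule that[of "\<lambda>n x. inverse I * L n x"])
  have "(L 0 has_integral I) {-d..d}"
   unfolding I_def by (intro integrable_integral integrable_continuous_real smooth_seq_continuous[OF sL])
  from has_integral_mult_right[OF this, of "inverse I"]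
  show "((\<lambda>x. inverse I * L 0 x) has_integral 1) {-d..d}" using I by simp
 qed (use smooth_seq_cmult[OF sL] L0 Lz I in auto)
qed

lemma mollifier_close:
 assumes M: "smooth_seq M" "\<And>x. 0 \<le> M 0 x" "\<And>n x. \<bar>x\<bar> \<ge> d \<Longrightarrow> M n x = 0" "(M 0 has_integral 1) {-d..d}"
  and d: "d > 0" "lo \<le> y - d" "y + d \<le> hi" and u: "continuous_on {lo..hi} u"
  and close: "\<And>z. \<bar>z - y\<bar> \<le> d \<Longrightarrow> \<bar>u z - v\<bar> \<le> e"
 shows "\<bar>integral {lo..hi} (\<lambda>z. u z * M 0 (z - y)) - v\<bar> \<le> e"
proof -
 have cM: "continuous_on S (\<lambda>z. M 0 (z - y))" for S
  by (rule smooth_seq_continuous[OF smooth_seq_shift[OF M(1)]])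
 have one: "((\<lambda>z. M 0 (z - y)) has_integral 1) {lo..hi}"
 proof -
  obtain P where P: "prim P (M 0)"
   using prim_exists[of "M 0"] continuous_absint[OF smooth_seq_continuous[OF M(1)]] by blast
  have PP: "prim (\<lambda>z. P (- y + 1 * z)) (\<lambda>z. 1 * M 0 (- y + 1 * z))" by (rule prim_affine[OF P]) simp
  have "integral {y-d..y+d} (\<lambda>z. M 0 (z - y)) = P d - P (-d)"
   using prim_integral[OF PP, of "y-d" "y+d"] d by simp
  also have "\<dots> = 1" using prim_integral[OF P, of "-d" d] M(4) d by (simp add: integral_unique)
  finally have "((\<lambda>z. M 0 (z - y)) has_integral 1) {y-d..y+d}"
   using integrable_integral[OF integrable_continuous_real[OF cM]] by metis
  then show ?thesis by (rule has_integral_on_superset) (use d M(3) in auto)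
 qed
 have "((\<lambda>z. u z * M 0 (z - y) - v * M 0 (z - y)) has_integral
   (integral {lo..hi} (\<lambda>z. u z * M 0 (z - y)) - v * 1)) {lo..hi}"
  by (intro has_integral_diff has_integral_mult_right one integrable_integral integrable_continuous_real continuous_intros u cM)
 then have "norm (integral {lo..hi} (\<lambda>z. u z * M 0 (z - y)) - v) = norm (integral {lo..hi} (\<lambda>z. u z * M 0 (z - y) - v * M 0 (z - y)))"
  by (simp add: integral_unique)
 also have "\<dots> \<le> integral {lo..hi} (\<lambda>z. e * M 0 (z - y))"
 proof (rule integral_norm_bound_integral)
  fix z assume "z \<in> {lo..hi}"
  have "\<bar>u z - v\<bar> * M 0 (z - y) \<le> e * M 0 (z - y)"
  proof (cases "\<bar>z - y\<bar> \<le> d")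
   case True then show ?thesis using close M(2) by (intro mult_right_mono) auto
  next
   case False then show ?thesis using M(3) by simp
  qed
  then show "norm (u z * M 0 (z - y) - v * M 0 (z - y)) \<le> e * M 0 (z - y)"
   using M(2)[of "z - y"] by (simp flip: left_diff_distrib add: abs_mult)
 qed (intro integrable_continuous_real continuous_intros u cM)+
 also have "\<dots> = e" by (rule trans[OF integral_unique[OF has_integral_mult_right[OF one, of e]]]) simp
 finally show ?thesis by simp
qed

section \<open>Weak derivatives on an interval\<close>

definition open_interval :: "real set \<Rightarrow> bool" where
 "open_interval S \<longleftrightarrow> open S \<and> is_interval S \<and> S \<noteq> {}"

lemma open_interval_simps [simp]:
 "a < b \<Longrightarrow> open_interval {a<..<b}" "open_interval {a<..}"
 by (auto simp: open_interval_def is_interval_convex_1 convex_real_interval)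

lemma open_interval_Icc: "open_interval S \<Longrightarrow> a \<in> S \<Longrightarrow> b \<in> S \<Longrightarrow> {a..b} \<subseteq> S"
 unfolding open_interval_def is_interval_1 by (meson atLeastAtMost_iff subsetI)

lemma open_interval_enlarge:
 assumes S: "open_interval S" and xy: "x \<in> S" "y \<in> S"
 obtains d where "d > 0" "{x - d..y + d} \<subseteq> S"
proof -
 obtain e1 where e1: "e1 > 0" "ball x e1 \<subseteq> S" using S xy(1) unfolding open_interval_def open_contains_ball by blast
 obtain e2 where e2: "e2 > 0" "ball y e2 \<subseteq> S" using S xy(2) unfolding open_interval_def open_contains_ball by blast
 define d where "d = min e1 e2 / 2"
 have "x - d \<in> S" "y + d \<in> S" using e1 e2 by (auto simp: d_def dist_real_def subset_iff)
 then have "{x - d..y + d} \<subseteq> S" using open_interval_Icc[OF S] by blast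
 then show ?thesis using e1 e2 by (intro that[of d]) (auto simp: d_def)
qed

lemma compact_in_open_interval:
 assumes S: "open_interval S" and K: "compact K" "K \<subseteq> S"
 obtains c d where "c < d" "{c..d} \<subseteq> S" "K \<subseteq> {c<..<d}"
proof -
 obtain s where s: "s \<in> S" using S by (auto simp: open_interval_def)
 have c: "compact (insert s K)" using K by auto
 obtain m where m: "m \<in> insert s K" "\<And>x. x \<in> insert s K \<Longrightarrow> m \<le> x" using compact_attains_inf[OF c] by blast
 obtain M where M: "M \<in> insert s K" "\<And>x. x \<in> insert s K \<Longrightarrow> x \<le> M" using compact_attains_sup[OF c] by blast
 obtain e where e: "e > 0" "{m - e..M + e} \<subseteq> S"
  using open_interval_enlarge[OF S, of m M] m(1) M(1) s K(2) by blast
 have "m \<le> s" "s \<le> M" using m(2) M(2) by auto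
 moreover have "K \<subseteq> {m - e<..<M + e}"
 proof
  fix x assume "x \<in> K"
  then show "x \<in> {m - e<..<M + e}" using m(2)[of x] M(2)[of x] e(1) by auto
 qed
 ultimately show ?thesis using e by (intro that[of "m - e" "M + e"]) auto
qed

lemma LINT_support:
 fixes F :: "real \<Rightarrow> real"
 assumes "S \<in> sets lebesgue" "{c..d} \<subseteq> S" "F absolutely_integrable_on {c..d}" "\<And>x. x \<in> S \<Longrightarrow> x \<notin> {c..d} \<Longrightarrow> F x = 0"
 shows "(LINT x|lebesgue_on S. F x) = integral {c..d} F"
proof -
 have "(LINT x|lebesgue_on S. F x) = (LINT x|lebesgue. indicat_real S x *\<^sub>R F x)"
  using assms(1) by (simp add: integral_restrict_space)
 also have "\<dots> = (LINT x|lebesgue. indicat_real {c..d} x *\<^sub>R F x)"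
  by (rule Bochner_Integration.integral_cong) (use assms(2,4) in \<open>auto simp: indicator_def\<close>)
 also have "\<dots> = integral {c..d} F"
  using set_lebesgue_integral_eq_integral(2)[OF assms(3)] by (simp add: set_lebesgue_integral_def)
 finally show ?thesis .
qed

text \<open>The lemma of du Bois-Reymond, by testing with primitives of differences of two
 translated mollifiers.\<close>

lemma du_Bois_Reymond:
 assumes S: "open_interval S" and u: "continuous_on S u"
  and test: "\<And>D c d. smooth_seq D \<Longrightarrow> c < d \<Longrightarrow> {c..d} \<subseteq> S \<Longrightarrow> (\<And>n x. x \<notin> {c<..<d} \<Longrightarrow> D n x = 0)
   \<Longrightarrow> integral {c..d} (\<lambda>x. u x * D 1 x) = 0"
  and xy: "x \<in> S" "y \<in> S"
 shows "u x = u y"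
proof -
 have main: "u x = u y" if xy: "x \<in> S" "y \<in> S" "x < y" for x y
 proof (rule ccontr)
  assume ne: "u x \<noteq> u y"
  define e where "e = \<bar>u x - u y\<bar> / 3"
  have e: "e > 0" using ne by (simp add: e_def)
  obtain d0 where d0: "d0 > 0" "{x - d0..y + d0} \<subseteq> S" using open_interval_enlarge[OF S xy(1,2)] .
  have ct: "isCont u z" if "z \<in> S" for z
   using u S that by (simp add: open_interval_def continuous_on_eq_continuous_at)
  obtain d1 where d1: "d1 > 0" "\<And>z. \<bar>z - x\<bar> < d1 \<Longrightarrow> \<bar>u z - u x\<bar> < e"
   using ct[OF xy(1)] e unfolding continuous_at_eps_delta dist_real_def by blast
  obtain d2 where d2: "d2 > 0" "\<And>z. \<bar>z - y\<bar> < d2 \<Longrightarrow> \<bar>u z - u y\<bar> < e"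
   using ct[OF xy(2)] e unfolding continuous_at_eps_delta dist_real_def by blast
  define d where "d = min d0 (min d1 d2) / 2"
  have d: "d > 0" "d < d0" "d < d1" "d < d2" using d0 d1 d2 by (auto simp: d_def min_def)
  obtain M where M: "smooth_seq M" "\<And>x. 0 \<le> M 0 x" "\<And>n x. \<bar>x\<bar> \<ge> d \<Longrightarrow> M n x = 0" "(M 0 has_integral 1) {-d..d}"
   using mollifier[OF d(1)] by blast
  have cM: "continuous_on T (M 0)" for T by (rule smooth_seq_continuous[OF M(1)])
  obtain P where P: "prim P (M 0)" using prim_exists[of "M 0"] continuous_absint[OF cM] by blast
  have Pc: "P s = P t" if "(s \<le> - d \<and> t \<le> - d) \<or> (s \<ge> d \<and> t \<ge> d)" for s t
  proof -
   have *: "P t - P s = 0" if "s \<le> t" "(s \<le> - d \<and> t \<le> - d) \<or> (s \<ge> d \<and> t \<ge> d)" for s t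
   proof -
    have "integral {s..t} (M 0) = integral {s..t} (\<lambda>_. 0)"
     by (rule integral_cong_on) (use that M(3) in auto)
    then show ?thesis using prim_integral[OF P that(1)] by simp
   qed
   then show ?thesis using *[of s t] *[of t s] that by (cases "s \<le> t") auto
  qed
  define D where "D n z = (case n of 0 \<Rightarrow> P (z - x) - P (z - y) | Suc m \<Rightarrow> M m (z - x) - M m (z - y))" for n z
  have sD: "smooth_seq D"
   unfolding smooth_seq_def
  proof (intro allI)
   fix n z
   show "(D n has_real_derivative D (Suc n) z) (at z)"
   proof (cases n)
    case 0
    have "((\<lambda>z. P (z - c)) has_real_derivative M 0 (z - c) * 1) (at z)" for c
     by (rule DERIV_chain2[OF prim_deriv[OF P cM]]) (auto intro!: derivative_eq_intros)
    moreover have "D 0 = (\<lambda>z. P (z - x) - P (z - y))" by (simp add: D_def fun_eq_iff)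
    ultimately show ?thesis using DERIV_diff[of "\<lambda>z. P (z - x)" _ z UNIV "\<lambda>z. P (z - y)"] by (simp add: D_def 0)
   next
    case (Suc m)
    have "((\<lambda>z. M m (z - c)) has_real_derivative M (Suc m) (z - c)) (at z)" for c
     by (rule smooth_seqD[OF smooth_seq_shift[OF M(1)]])
    moreover have "D n = (\<lambda>z. M m (z - x) - M m (z - y))" by (simp add: D_def fun_eq_iff Suc)
    ultimately show ?thesis using DERIV_diff[of "\<lambda>z. M m (z - x)" _ z UNIV "\<lambda>z. M m (z - y)"] by (simp add: D_def Suc)
   qed
  qed
  have "integral {x - d0..y + d0} (\<lambda>z. u z * D 1 z) = 0"
  proof (rule test[OF sD])
   fix n z assume z: "z \<notin> {x - d0<..<y + d0}"
   show "D n z = 0"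
   proof (cases n)
    case 0 then show ?thesis using z d(2) xy(3) Pc[of "z - x" "z - y"] by (auto simp: D_def)
   next
    case (Suc m) then show ?thesis using z d(2) xy(3) M(3)[of "z - x" m] M(3)[of "z - y" m] by (auto simp: D_def)
   qed
  qed (use d0 xy in auto)
  moreover have uc: "continuous_on {x - d0..y + d0} u" by (rule continuous_on_subset[OF u d0(2)])
  have cMs: "continuous_on T (\<lambda>z. M 0 (z - c))" for T c
   by (rule smooth_seq_continuous[OF smooth_seq_shift[OF M(1)]])
  have "integral {x - d0..y + d0} (\<lambda>z. u z * D 1 z)
    = integral {x - d0..y + d0} (\<lambda>z. u z * M 0 (z - x)) - integral {x - d0..y + d0} (\<lambda>z. u z * M 0 (z - y))"
   unfolding D_def
   by (subst integral_diff[symmetric]) (auto intro!: integrable_continuous_real continuous_intros uc cMs simp: right_diff_distrib)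
  moreover have "\<bar>integral {x - d0..y + d0} (\<lambda>z. u z * M 0 (z - x)) - u x\<bar> \<le> e"
   by (rule mollifier_close[OF M d(1) _ _ uc less_imp_le[OF d1(2)]]) (use d xy in auto)
  moreover have "\<bar>integral {x - d0..y + d0} (\<lambda>z. u z * M 0 (z - y)) - u y\<bar> \<le> e"
   by (rule mollifier_close[OF M d(1) _ _ uc less_imp_le[OF d2(2)]]) (use d xy in auto)
  ultimately have "\<bar>u x - u y\<bar> \<le> 2 * e" by linarith
  then show False using e by (simp add: e_def)
 qed
 then show ?thesis using xy by (metis linorder_neqE)
qed

lemma test_fun_support:
 assumes S: "open_interval S" and t: "test_fun S \<eta>"
 obtains D c d where "smooth_seq D" "D 0 = \<eta>" "deriv \<eta> = D 1" "c < d" "{c..d} \<subseteq> S" "\<And>n x. x \<notin> {c<..<d} \<Longrightarrow> D n x = 0"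
proof -
 obtain D K where D: "smooth_seq D" "D 0 = \<eta>" and K: "compact K" "K \<subseteq> S" "\<And>x. x \<notin> K \<Longrightarrow> \<eta> x = 0"
  using t unfolding test_fun_iff by blast
 obtain c d where cd: "c < d" "{c..d} \<subseteq> S" "K \<subseteq> {c<..<d}"
  using compact_in_open_interval[OF S K(1,2)] by blast
 have z: "D n x = 0" if "x \<notin> K" for n x
  using that
 proof (induction n arbitrary: x)
  case 0 then show ?case using K(3) D(2) by simp
 next
  case (Suc n)
  have "\<forall>\<^sub>F u in nhds x. D n u = 0"
   using Suc K(1) by (intro eventually_nhds_in_open[of "- K", THEN eventually_mono]) (auto intro: compact_imp_closed)
  then have "(D n has_real_derivative 0) (at x)"
   using DERIV_cong_ev[OF refl _ refl, of "D n" "\<lambda>_. 0" x 0] by simp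
  then show ?case using smooth_seqD[OF D(1), of n x] DERIV_unique by blast
 qed
 have "deriv \<eta> = D 1" using smooth_seq_deriv[OF D(1), of 1] D(2) by simp
 then show ?thesis using that[OF D _ cd(1,2) z] cd(3) by blast
qed

lemma test_fun_I:
 assumes "smooth_seq D" "{c..d} \<subseteq> S" "\<And>x. x \<notin> {c<..<d} \<Longrightarrow> D 0 x = 0"
 shows "test_fun S (D 0)"
 unfolding test_fun_iff using assms
 by (intro conjI exI[of _ D] exI[of _ "{c..d}"]) auto

lemma weak_deriv_test:
 assumes w: "weak_deriv S \<phi> g" and S: "S \<in> sets lebesgue" and D: "smooth_seq D" "{c..d} \<subseteq> S" "\<And>n x. x \<notin> {c<..<d} \<Longrightarrow> D n x = 0"
 shows "integral {c..d} (\<lambda>x. \<phi> x * D 1 x) = - integral {c..d} (\<lambda>x. g x * D 0 x)"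
  "(\<lambda>x. \<phi> x * D n x) absolutely_integrable_on {c..d}" "(\<lambda>x. g x * D n x) absolutely_integrable_on {c..d}"
proof -
 have ai: "\<phi> absolutely_integrable_on {c..d}" "g absolutely_integrable_on {c..d}"
  using w D(2) by (auto simp: weak_deriv_def)
 have pr: "(\<lambda>x. f x * D n x) absolutely_integrable_on {c..d}" if "f absolutely_integrable_on {c..d}" for f n
 proof -
  have "(\<lambda>x. D n x * f x) absolutely_integrable_on {c..d}"
  proof (rule absolutely_integrable_bounded_measurable_product_real[OF _ _ _ that])
   show "D n \<in> borel_measurable (lebesgue_on {c..d})"
    by (rule continuous_imp_measurable_on_sets_lebesgue[OF smooth_seq_continuous[OF D(1)]]) simp
   show "bounded (D n ` {c..d})"
    by (intro compact_imp_bounded compact_continuous_image smooth_seq_continuous[OF D(1)]) auto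
  qed simp
  then show ?thesis by (simp add: mult.commute)
 qed
 show "(\<lambda>x. \<phi> x * D n x) absolutely_integrable_on {c..d}" "(\<lambda>x. g x * D n x) absolutely_integrable_on {c..d}"
  using pr ai by auto
 have "test_fun S (D 0)" using test_fun_I[OF D(1,2)] D(3) by blast
 then have "(LINT x|lebesgue_on S. \<phi> x * deriv (D 0) x) = - (LINT x|lebesgue_on S. g x * D 0 x)"
  using w by (simp add: weak_deriv_def)
 moreover have "deriv (D 0) = D 1" using smooth_seq_deriv[OF D(1), of 1] by simp
 ultimately have *: "(LINT x|lebesgue_on S. \<phi> x * D 1 x) = - (LINT x|lebesgue_on S. g x * D 0 x)" by simp
 have z: "D n x = 0" if "x \<notin> {c..d}" for n x using D(3) that by auto
 have "(LINT x|lebesgue_on S. \<phi> x * D 1 x) = integral {c..d} (\<lambda>x. \<phi> x * D 1 x)"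
  by (rule LINT_support[OF S D(2) pr[OF ai(1)]]) (simp add: z)
 moreover have "(LINT x|lebesgue_on S. g x * D 0 x) = integral {c..d} (\<lambda>x. g x * D 0 x)"
  by (rule LINT_support[OF S D(2) pr[OF ai(2)]]) (simp add: z)
 ultimately show "integral {c..d} (\<lambda>x. \<phi> x * D 1 x) = - integral {c..d} (\<lambda>x. g x * D 0 x)" using * by simp
qed

lemma prim_test:
 assumes P: "prim \<Phi> g" and D: "smooth_seq D" "c < d" "\<And>n x. x \<notin> {c<..<d} \<Longrightarrow> D n x = 0"
 shows "integral {c..d} (\<lambda>x. \<Phi> x * D 1 x) = - integral {c..d} (\<lambda>x. g x * D 0 x)"
proof -
 have PD: "prim (D 0) (D 1)" using prim_C1[of "D 0" "D 1"] smooth_seqD[OF D(1), of 0] smooth_seq_continuous[OF D(1)] by simp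
 have "integral {c..d} (\<lambda>x. \<Phi> x * D 1 x + g x * D 0 x) = 0"
  using prim_integral[OF prim_product[OF P PD], of c d] D(2) D(3)[of c 0] D(3)[of d 0] by simp
 moreover have "(\<lambda>x. \<Phi> x * D 1 x) integrable_on {c..d}" by (rule absint_int, rule prim_mult_absint[OF P PD])
 moreover have "(\<lambda>x. g x * D 0 x) integrable_on {c..d}"
  using absint_int[OF prim_mult_absint[OF PD P]] by (simp add: mult.commute)
 ultimately show ?thesis by (simp add: integral_add)
qed

lemma open_interval_sets: "open_interval S \<Longrightarrow> S \<in> sets lebesgue"
 by (simp add: open_interval_def borel_open)

lemma weak_deriv_prim:
 assumes S: "open_interval S" and P: "prim \<Phi> g" and eq: "\<And>x. x \<in> S \<Longrightarrow> \<phi> x = \<Phi> x" "\<And>x. x \<in> S \<Longrightarrow> \<gamma> x = g x"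
 shows "weak_deriv S \<phi> \<gamma>"
 unfolding weak_deriv_def
proof (intro conjI allI impI)
 fix K assume K: "compact K \<and> K \<subseteq> S"
 obtain c d where cd: "c < d" "{c..d} \<subseteq> S" "K \<subseteq> {c<..<d}"
  using compact_in_open_interval[OF S] K by blast
 have Ks: "K \<in> sets lebesgue" using K by (simp add: borel_compact)
 have sub: "K \<subseteq> {c..d}" using cd(3) by auto
 have "\<Phi> absolutely_integrable_on K" "g absolutely_integrable_on K"
  using set_integrable_subset[OF _ Ks sub] prim_absint[OF P] continuous_absint[OF prim_continuous[OF P]] by blast+
 moreover have "set_integrable lebesgue K \<phi> = set_integrable lebesgue K \<Phi>" "set_integrable lebesgue K \<gamma> = set_integrable lebesgue K g"
  by (rule set_integrable_cong[OF refl refl], use eq K in blast)+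
 ultimately show "\<phi> absolutely_integrable_on K" "\<gamma> absolutely_integrable_on K" by auto
next
 fix \<eta> assume "test_fun S \<eta>"
 then obtain D c d where D: "smooth_seq D" "D 0 = \<eta>" "deriv \<eta> = D 1" and cd: "c < d" "{c..d} \<subseteq> S"
  and z: "\<And>n x. x \<notin> {c<..<d} \<Longrightarrow> D n x = 0"
  using test_fun_support[OF S] by blast
 have z': "D n x = 0" if "x \<notin> {c..d}" for n x using z that by auto
 have PD: "prim (D n) (D (Suc n))" for n
  using prim_C1[of "D n" "D (Suc n)"] smooth_seqD[OF D(1)] smooth_seq_continuous[OF D(1)] by simp
 have i1: "(\<lambda>x. \<Phi> x * D 1 x) absolutely_integrable_on {c..d}"
  using prim_mult_absint[OF P PD[of 0]] by simp
 have i2: "(\<lambda>x. g x * D 0 x) absolutely_integrable_on {c..d}"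
  using prim_mult_absint[OF PD[of 0] P] by (simp add: mult.commute)
 have "(LINT x|lebesgue_on S. \<phi> x * deriv \<eta> x) = (LINT x|lebesgue_on S. \<Phi> x * D 1 x)"
  by (rule Bochner_Integration.integral_cong) (use eq D(3) in auto)
 also have "\<dots> = integral {c..d} (\<lambda>x. \<Phi> x * D 1 x)"
  by (rule LINT_support[OF open_interval_sets[OF S] cd(2) i1]) (simp add: z')
 also have "\<dots> = - integral {c..d} (\<lambda>x. g x * D 0 x)"
  by (rule prim_test[OF P D(1) cd(1) z])
 also have "integral {c..d} (\<lambda>x. g x * D 0 x) = (LINT x|lebesgue_on S. g x * D 0 x)"
  by (rule LINT_support[OF open_interval_sets[OF S] cd(2) i2, symmetric]) (simp add: z')
 also have "\<dots> = (LINT x|lebesgue_on S. \<gamma> x * \<eta> x)"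
  by (rule Bochner_Integration.integral_cong) (use eq D(2) in auto)
 finally show "(LINT x|lebesgue_on S. \<phi> x * deriv \<eta> x) = - (LINT x|lebesgue_on S. \<gamma> x * \<eta> x)" .
qed

lemma weak_deriv_imp_prim:
 assumes S: "open_interval S" and w: "weak_deriv S \<phi> g" and c: "continuous_on S \<phi>"
  and P: "prim \<Phi> h" and eq: "\<And>x. x \<in> S \<Longrightarrow> h x = g x" and xy: "x \<in> S" "y \<in> S"
 shows "\<phi> x - \<Phi> x = \<phi> y - \<Phi> y"
proof (rule du_Bois_Reymond[OF S _ _ xy, of "\<lambda>x. \<phi> x - \<Phi> x"])
 show "continuous_on S (\<lambda>x. \<phi> x - \<Phi> x)" by (intro continuous_intros c prim_continuous[OF P])
 fix D c d assume D: "smooth_seq D" "c < d" "{c..d} \<subseteq> S" "\<And>n x. x \<notin> {c<..<d} \<Longrightarrow> D n x = 0"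
 have PD: "prim (D 0) (D 1)" using prim_C1[of "D 0" "D 1"] smooth_seqD[OF D(1), of 0] smooth_seq_continuous[OF D(1)] by simp
 note wt = weak_deriv_test[OF w open_interval_sets[OF S] D(1,3,4)]
 have "integral {c..d} (\<lambda>x. g x * D 0 x) = integral {c..d} (\<lambda>x. h x * D 0 x)"
  by (rule integral_cong_on) (use eq D(3) in auto)
 then have "integral {c..d} (\<lambda>x. \<phi> x * D 1 x) = integral {c..d} (\<lambda>x. \<Phi> x * D 1 x)"
  using wt(1) prim_test[OF P D(1,2,4)] by simp
 moreover have "(\<lambda>x. \<phi> x * D 1 x) integrable_on {c..d}" by (rule absint_int, rule wt(2))
 moreover have "(\<lambda>x. \<Phi> x * D 1 x) integrable_on {c..d}" by (rule absint_int, rule prim_mult_absint[OF P PD])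
 ultimately show "integral {c..d} (\<lambda>x. (\<phi> x - \<Phi> x) * D 1 x) = 0"
  by (simp add: left_diff_distrib integral_diff)
qed

text \<open>The differentiation theorem of Lebesgue.\<close>

lemma prim_zero_negligible:
 assumes P: "prim U u" and c: "\<And>x. U x = c"
 shows "negligible {x. u x \<noteq> 0}"
proof -
 obtain N where N: "negligible N" "\<And>x e. x \<notin> N \<Longrightarrow> 0 < e \<Longrightarrow>
   \<exists>d>0. \<forall>h. 0 < h \<and> h < d \<longrightarrow> norm (integral (cbox x (x + h *\<^sub>R One)) u /\<^sub>R h ^ DIM(real) - u x) < e"
  using integrable_ccontinuous_explicit[of u] prim_int[OF P] by auto
 have "u x = 0" if xN: "x \<notin> N" for x
 proof (rule ccontr)
  assume "u x \<noteq> 0"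
  then obtain d where d: "d > 0" "\<And>h. 0 < h \<Longrightarrow> h < d \<Longrightarrow> norm (integral (cbox x (x + h *\<^sub>R One)) u /\<^sub>R h ^ DIM(real) - u x) < \<bar>u x\<bar>"
   using N(2)[OF xN, of "\<bar>u x\<bar>"] by auto
  have "integral {x..x + d/2} u = 0" using prim_integral[OF P, of x "x + d/2"] c d(1) by simp
  then show False using d(2)[of "d/2"] d(1) by simp
 qed
 then have "{x. u x \<noteq> 0} \<subseteq> N" by auto
 then show ?thesis using N(1) negligible_subset by blast
qed

text \<open>The primitive of the difference of two weak derivatives, truncated to a compact interval, is
 orthogonal to the derivatives of all test functions, hence constant there.\<close>

lemma weak_deriv_unique:
 assumes S: "open_interval S" and w1: "weak_deriv S \<phi> g1" and w2: "weak_deriv S \<phi> g2"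
 shows "AE x in lebesgue_on S. g1 x = g2 x"
proof -
 have loc: "negligible {x\<in>{p..q}. g1 x \<noteq> g2 x}" if pq: "{p..q} \<subseteq> S" "p < q" for p q
 proof -
  define u where "u x = (if x \<in> {p..q} then g1 x - g2 x else 0)" for x
  have ai: "g1 absolutely_integrable_on {p..q}" "g2 absolutely_integrable_on {p..q}"
   using w1 w2 pq by (auto simp: weak_deriv_def)
  have "(\<lambda>x. g1 x - g2 x) absolutely_integrable_on {p..q}" using ai by (rule set_integral_diff(1))
  then have "u absolutely_integrable_on UNIV"
   unfolding u_def by (simp only: absolutely_integrable_restrict_UNIV)
  then have uai: "u absolutely_integrable_on {a..b}" for a b
   by (rule set_integrable_subset) auto
  then obtain U where U: "prim U u" using prim_exists by blast
  have S': "open_interval {p<..<q}" using pq by simp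
  have "U x = U y" if "x \<in> {p<..<q}" "y \<in> {p<..<q}" for x y
  proof (rule du_Bois_Reymond[OF S' prim_continuous[OF U] _ that])
   fix D c d assume D: "smooth_seq D" "c < d" "{c..d} \<subseteq> {p<..<q}" "\<And>n x. x \<notin> {c<..<d} \<Longrightarrow> D n x = 0"
   have cd: "{c..d} \<subseteq> S"
   proof
    fix x assume "x \<in> {c..d}"
    then have "x \<in> {p<..<q}" using D(3) by blast
    then show "x \<in> S" using pq(1) by auto
   qed
   have cdp: "x \<in> {p..q}" if "x \<in> {c..d}" for x using subsetD[OF D(3) that] by simp
   note t1 = weak_deriv_test[OF w1 open_interval_sets[OF S] D(1) cd D(4)]
   note t2 = weak_deriv_test[OF w2 open_interval_sets[OF S] D(1) cd D(4)]
   have "integral {c..d} (\<lambda>x. u x * D 0 x) = integral {c..d} (\<lambda>x. g1 x * D 0 x - g2 x * D 0 x)"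
    by (rule integral_cong_on) (use cdp in \<open>auto simp: u_def left_diff_distrib\<close>)
   also have "\<dots> = 0" using t1(1) t2(1) integral_diff[OF absint_int[OF t1(3)[of 0]] absint_int[OF t2(3)[of 0]]] by simp
   finally show "integral {c..d} (\<lambda>x. U x * D 1 x) = 0"
    using prim_test[OF U D(1,2,4)] by simp
  qed
  then obtain k where k: "\<And>x. x \<in> {p<..<q} \<Longrightarrow> U x = k" using dense[OF pq(2)] by (metis greaterThanLessThan_iff)
  have Uc: "U x = k" for x
  proof -
   have cl: "U y = k" if y: "y \<in> {p..q}" for y
   proof (rule continuous_constant_on_closure[of "{p<..<q}" U k y])
    show "continuous_on (closure {p<..<q}) U" by (rule prim_continuous[OF U])
    show "y \<in> closure {p<..<q}" using y pq(2) by simp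
   qed (use k in auto)
   have out: "U s = U t" if "s \<le> t" "t \<le> p \<or> q \<le> s" for s t
   proof -
    have "(u has_integral 0) {s..t}"
    proof (rule has_integral_spike[where S = "{p, q}" and f = "\<lambda>_. 0"])
     show "u x = 0" if "x \<in> {s..t} - {p, q}" for x using that \<open>t \<le> p \<or> q \<le> s\<close> by (auto simp: u_def)
    qed auto
    then show ?thesis using prim_integral[OF U that(1)] by (simp add: integral_unique)
   qed
   consider "x < p" | "x \<in> {p..q}" | "x > q" by fastforce
   then show ?thesis using cl[of p] cl[of q] cl[of x] out[of x p] out[of q x] pq(2) by cases auto
  qed
  have "negligible {x. u x \<noteq> 0}" by (rule prim_zero_negligible[OF U Uc])
  then show ?thesis by (rule negligible_subset) (auto simp: u_def)
 qed
 define I where "I = {(p, q). p \<in> \<rat> \<and> q \<in> \<rat> \<and> p < q \<and> {p..q} \<subseteq> S}"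
 define N where "N = (\<Union>(p, q)\<in>I. {x\<in>{p..q}. g1 x \<noteq> g2 x})"
 have "countable I" unfolding I_def by (rule countable_subset[of _ "\<rat> \<times> \<rat>"]) (auto intro: countable_rat)
 moreover have "negligible (case i of (p, q) \<Rightarrow> {x\<in>{p..q}. g1 x \<noteq> g2 x})" if "i \<in> I" for i
  using loc that by (auto simp: I_def)
 ultimately have "negligible N"
  unfolding N_def by (intro negligible_countable_Union countable_image) auto
 moreover have "{x\<in>S. g1 x \<noteq> g2 x} \<subseteq> N"
 proof
  fix x assume x: "x \<in> {x\<in>S. g1 x \<noteq> g2 x}"
  then obtain e where e: "e > 0" "{x - e..x + e} \<subseteq> S" using open_interval_enlarge[OF S, of x x] by auto
  obtain p where p: "p \<in> \<rat>" "x - e < p" "p < x" using Rats_dense_in_real[of "x - e" x] e by auto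
  obtain q where q: "q \<in> \<rat>" "x < q" "q < x + e" using Rats_dense_in_real[of x "x + e"] e by auto
  have "{p..q} \<subseteq> {x - e..x + e}" using p q by auto
  then have "(p, q) \<in> I" using e(2) p q by (auto simp: I_def)
  then show "x \<in> N" unfolding N_def using x p q by (intro UN_I[of "(p, q)"]) auto
 qed
 ultimately have "negligible {x\<in>S. g1 x \<noteq> g2 x}" using negligible_subset by blast
 then have "AE x in lebesgue. x \<in> S \<longrightarrow> g1 x = g2 x"
  by (intro AE_I'[of "{x\<in>S. g1 x \<noteq> g2 x}"]) (auto simp: negligible_iff_null_sets)
 then show ?thesis using open_interval_sets[OF S] by (simp add: AE_restrict_space_iff)
qed

section \<open>Representation of the states\<close>

lemma interval01_sets [simp]: "{0..1::real} \<in> sets lebesgue" by simp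

lemma AE_Ioo_Icc:
 assumes "AE x in lebesgue_on {0<..<1::real}. P x" shows "AE x in lebesgue_on {0..1}. P x"
proof -
 have 1: "AE x in lebesgue. x \<in> {0<..<1} \<longrightarrow> P x" using assms by (simp add: AE_restrict_space_iff)
 have "negligible {0, 1::real}" by (rule negligible_finite) simp
 then have 2: "AE x in lebesgue. x \<notin> {0, 1::real}"
  by (intro AE_I'[of "{0, 1}"]) (auto simp: negligible_iff_null_sets)
 have "AE x in lebesgue. x \<in> {0..1} \<longrightarrow> P x"
  using 1 2 by eventually_elim auto
 then show ?thesis by (simp add: AE_restrict_space_iff)
qed

lemma AE_continuous_eq:
 fixes f g :: "real \<Rightarrow> real"
 assumes S: "closed S" "S \<subseteq> closure (interior S)"
  and ae: "AE x in lebesgue_on S. f x = g x" and c: "continuous_on S f" "continuous_on S g" and x: "x \<in> S"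
 shows "f x = g x"
proof -
 define Z where "Z = {x\<in>S. f x - g x = 0}"
 have cl: "closed Z"
  unfolding Z_def by (rule continuous_closed_preimage_constant) (auto intro!: continuous_intros c S)
 have "AE x in lebesgue. x \<in> S \<longrightarrow> f x = g x"
  using ae S(1) by (simp add: AE_restrict_space_iff borel_closed)
 then obtain N where N: "N \<in> null_sets lebesgue" "{x. \<not> (x \<in> S \<longrightarrow> f x = g x)} \<subseteq> N"
  unfolding eventually_ae_filter by auto
 have neg: "negligible (S - Z)"
  by (rule negligible_subset[of N]) (use N in \<open>auto simp: negligible_iff_null_sets Z_def\<close>)
 have "interior S - Z = {}"
 proof (rule ccontr)
  assume ne: "interior S - Z \<noteq> {}"
  have "open (interior S - Z)" using cl by (intro open_Diff) auto
  then have "\<not> negligible (interior S - Z)" using ne by (rule open_not_negligible)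
  moreover have "negligible (interior S - Z)"
   by (rule negligible_subset[OF neg]) (use interior_subset in auto)
  ultimately show False by simp
 qed
 then have "interior S \<subseteq> Z" by blast
 then have "closure (interior S) \<subseteq> Z" using cl by (rule closure_minimal)
 then show ?thesis using S(2) x by (auto simp: Z_def)
qed

lemma weak_deriv_cong:
 assumes S: "S \<in> sets lebesgue" and eq: "\<And>x. x \<in> S \<Longrightarrow> \<phi> x = \<phi>' x"
 shows "weak_deriv S \<phi> g \<longleftrightarrow> weak_deriv S \<phi>' g"
proof -
 have 1: "set_integrable lebesgue K \<phi> = set_integrable lebesgue K \<phi>'" if "K \<subseteq> S" for K
  by (rule set_integrable_cong[OF refl refl], use eq that in blast)
 have 2: "(LINT x|lebesgue_on S. \<phi> x * deriv \<eta> x) = (LINT x|lebesgue_on S. \<phi>' x * deriv \<eta> x)" for \<eta>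
  by (rule Bochner_Integration.integral_cong) (use eq in auto)
 show ?thesis unfolding weak_deriv_def using 1 2 by auto
qed

lemma wderiv_cong:
 assumes "\<And>x. x \<in> {0..1} \<Longrightarrow> \<phi> x = \<phi>' x" shows "wderiv \<phi> = wderiv \<phi>'"
 unfolding wderiv_def using weak_deriv_cong[of "{0<..<1}" \<phi> \<phi>'] assms by simp

lemma wderiv_spec:
 assumes "weak_deriv {0<..<1} \<phi> g"
 shows "weak_deriv {0<..<1} \<phi> (wderiv \<phi>)"
  "weak_deriv {0<..<1} \<phi> h \<Longrightarrow> continuous_on {0..1} h \<Longrightarrow> continuous_on {0..1} (wderiv \<phi>)"
proof -
 let ?P = "\<lambda>g. weak_deriv {0<..<1} \<phi> g \<and>
   ((\<exists>h. weak_deriv {0<..<1} \<phi> h \<and> continuous_on {0..1} h) \<longrightarrow> continuous_on {0..1} g)"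
 have "\<exists>g. ?P g" using assms by blast
 then have "?P (wderiv \<phi>)" unfolding wderiv_def by (rule someI_ex)
 then show "weak_deriv {0<..<1} \<phi> (wderiv \<phi>)"
  "weak_deriv {0<..<1} \<phi> h \<Longrightarrow> continuous_on {0..1} h \<Longrightarrow> continuous_on {0..1} (wderiv \<phi>)" by blast+
qed

lemma H1_intro:
 assumes P: "prim \<Phi> g" and g: "g \<in> locL2" and eq: "\<And>x. x \<in> {0..1} \<Longrightarrow> \<phi> x = \<Phi> x"
 shows "\<phi> \<in> H1" "AE x in lebesgue_on {0..1}. wderiv \<phi> x = g x"
  "continuous_on {0..1} g \<Longrightarrow> x \<in> {0..1} \<Longrightarrow> wderiv \<phi> x = g x"
proof -
 have w: "weak_deriv {0<..<1} \<phi> g" by (rule weak_deriv_prim[OF _ P]) (use eq in auto)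
 have c: "continuous_on {0..1} \<phi>"
  by (rule continuous_on_eq[OF prim_continuous[OF P]]) (use eq in auto)
 show "\<phi> \<in> H1" using w c L2_continuous[OF c] locL2_D[OF g] by (auto simp: H1_def)
 show ae: "AE x in lebesgue_on {0..1}. wderiv \<phi> x = g x"
  by (rule AE_Ioo_Icc, rule weak_deriv_unique[OF _ wderiv_spec(1)[OF w] w]) simp
 show "wderiv \<phi> x = g x" if "continuous_on {0..1} g" "x \<in> {0..1}"
  by (rule AE_continuous_eq[OF _ _ ae wderiv_spec(2)[OF w w that(1)] that]) auto
qed

definition ext01 :: "(real \<Rightarrow> real) \<Rightarrow> real \<Rightarrow> real" where
 "ext01 g x = (if x \<in> {0..1} then g x else 0)"

lemma ext01_locL2: "g \<in> L2 {0..1} \<Longrightarrow> ext01 g \<in> locL2"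
 using locL2_extend[of g 0 1] by (simp add: ext01_def[abs_def])

lemma H1_prim:
 assumes "\<phi> \<in> H1"
 obtains \<Phi> where "prim \<Phi> (ext01 (wderiv \<phi>))" "wderiv \<phi> \<in> L2 {0..1}" "\<And>x. x \<in> {0..1} \<Longrightarrow> \<phi> x = \<Phi> x"
proof -
 obtain g where g: "g \<in> L2 {0..1}" "weak_deriv {0<..<1} \<phi> g" and c: "continuous_on {0..1} \<phi>"
  using assms by (auto simp: H1_def)
 note w = wderiv_spec(1)[OF g(2)]
 have S: "open_interval {0<..<1::real}" by simp
 have "AE x in lebesgue_on {0..1}. g x = wderiv \<phi> x"
  by (rule AE_Ioo_Icc, rule weak_deriv_unique[OF S g(2) w])
 then have L: "wderiv \<phi> \<in> L2 {0..1}" by (rule L2_cong_AE(1)[OF interval01_sets g(1)])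
 obtain \<Phi>0 where P: "prim \<Phi>0 (ext01 (wderiv \<phi>))" using prim_locL2[OF ext01_locL2[OF L]] by blast
 define k where "k = \<phi> (1/2) - \<Phi>0 (1/2)"
 have k: "\<phi> x - \<Phi>0 x = k" if "x \<in> {0<..<1}" for x
  unfolding k_def
  by (rule weak_deriv_imp_prim[OF S w continuous_on_subset[OF c] P]) (use that in \<open>auto simp: ext01_def\<close>)
 have "\<phi> x - \<Phi>0 x = k" if x: "x \<in> {0..1}" for x
 proof (rule continuous_constant_on_closure[of "{0<..<1}" "\<lambda>x. \<phi> x - \<Phi>0 x" k x])
  show "continuous_on (closure {0<..<1}) (\<lambda>x. \<phi> x - \<Phi>0 x)"
   using c by (auto intro!: continuous_intros prim_continuous[OF P])
 qed (use k x in auto)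
 then have "\<phi> x = \<Phi>0 x + k" if "x \<in> {0..1}" for x using that by (metis add.commute diff_add_cancel)
 then show ?thesis using that[OF prim_shift_const[OF P] L] by blast
qed

text \<open>Replaces a state, which is only given up to null sets and only on $[0,1]$, by functions on the
 whole line: the first component by an absolutely continuous function with derivative \<open>g\<close>, the
 second by \<open>k\<close>.\<close>

definition state_repr :: "state \<Rightarrow> (real \<Rightarrow> real) \<Rightarrow> (real \<Rightarrow> real) \<Rightarrow> (real \<Rightarrow> real) \<Rightarrow> bool" where
 "state_repr U \<Phi> g k \<longleftrightarrow> prim \<Phi> g \<and> g \<in> locL2 \<and> k \<in> locL2 \<and> (\<forall>x\<in>{0..1}. fst U x = \<Phi> x) \<and>
   (AE x in lebesgue_on {0..1}. snd U x = k x)"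

lemma state_repr_exists:
 assumes "U \<in> HH" obtains \<Phi> g k where "state_repr U \<Phi> g k"
proof -
 have U: "fst U \<in> H1" "snd U \<in> L2 {0..1}" using assms by (auto simp: HH_def)
 obtain \<Phi> where "prim \<Phi> (ext01 (wderiv (fst U)))" "wderiv (fst U) \<in> L2 {0..1}" "\<And>x. x \<in> {0..1} \<Longrightarrow> fst U x = \<Phi> x"
  using H1_prim[OF U(1)] by blast
 then have "state_repr U \<Phi> (ext01 (wderiv (fst U))) (ext01 (snd U))"
  using ext01_locL2 U(2) by (auto simp: state_repr_def ext01_def[of "snd U"] intro!: AE_I2)
 then show ?thesis by (rule that)
qed

lemma state_repr_HH:
 assumes "state_repr U \<Phi> g k" shows "U \<in> HH"
proof -
 have "fst U \<in> H1" using assms by (intro H1_intro(1)[of \<Phi> g]) (auto simp: state_repr_def)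
 moreover have "k \<in> L2 {0..1}" "AE x in lebesgue_on {0..1}. k x = snd U x"
  using assms by (auto simp: state_repr_def locL2_D eq_commute)
 then have "snd U \<in> L2 {0..1}" by (rule L2_cong_AE(1)[OF interval01_sets])
 ultimately show ?thesis by (simp add: HH_def mem_Times_iff)
qed

lemma state_repr_norm:
 assumes r: "state_repr U \<Phi> g k"
 shows "HHnorm U = sqrt (sqint 0 1 g + sqint 0 1 k + (\<Phi> 0)\<^sup>2)"
proof -
 have P: "prim \<Phi> g" and g: "g \<in> locL2" and k: "k \<in> locL2" and eq: "\<And>x. x \<in> {0..1} \<Longrightarrow> fst U x = \<Phi> x"
  and ae: "AE x in lebesgue_on {0..1}. snd U x = k x"
  using r by (auto simp: state_repr_def)
 have ae1: "AE x in lebesgue_on {0..1}. wderiv (fst U) x = g x" by (rule H1_intro(2)[OF P g eq])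
 have ae1': "AE x in lebesgue_on {0..1}. g x = wderiv (fst U) x" using ae1 by eventually_elim simp
 have ae': "AE x in lebesgue_on {0..1}. k x = snd U x" using ae by eventually_elim simp
 have w: "wderiv (fst U) \<in> L2 {0..1}" by (rule L2_cong_AE(1)[OF interval01_sets locL2_D[OF g] ae1'])
 have s: "snd U \<in> L2 {0..1}" by (rule L2_cong_AE(1)[OF interval01_sets locL2_D[OF k] ae'])
 have "(LINT x|lebesgue_on {0..1}. (wderiv (fst U) x)\<^sup>2 + (snd U x)\<^sup>2)
   = integral {0..1} (\<lambda>x. (wderiv (fst U) x)\<^sup>2) + integral {0..1} (\<lambda>x. (snd U x)\<^sup>2)"
  using w s integral_sq_eq[OF interval01_sets w] integral_sq_eq[OF interval01_sets s] by (simp add: L2_def)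
 also have "\<dots> = sqint 0 1 g + sqint 0 1 k"
  unfolding sqint_def L2_cong_AE(2)[OF interval01_sets locL2_D[OF g] ae1', symmetric]
   L2_cong_AE(2)[OF interval01_sets locL2_D[OF k] ae', symmetric] by simp
 finally show ?thesis using eq[of 0] by (simp add: HHnorm_def)
qed

lemma state_repr_norm_sq:
 assumes "state_repr U \<Phi> g k"
 shows "(HHnorm U)\<^sup>2 = sqint 0 1 g + sqint 0 1 k + (\<Phi> 0)\<^sup>2" "0 \<le> HHnorm U"
 using state_repr_norm[OF assms] sqint_nonneg[of 0 1 g] sqint_nonneg[of 0 1 k] by simp_all

lemma state_repr_lincomb:
 assumes "state_repr U \<Phi> g k" "state_repr V \<Psi> h l"
 shows "state_repr (lincomb a U b V) (\<lambda>x. a * \<Phi> x + b * \<Psi> x) (\<lambda>x. a * g x + b * h x) (\<lambda>x. a * k x + b * l x)"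
proof -
 have "AE x in lebesgue_on {0..1}. snd U x = k x" "AE x in lebesgue_on {0..1}. snd V x = l x"
  using assms by (auto simp: state_repr_def)
 then have "AE x in lebesgue_on {0..1}. a * snd U x + b * snd V x = a * k x + b * l x"
  by eventually_elim simp
 then show ?thesis
  using assms by (auto simp: state_repr_def lincomb_def prim_add prim_cmult)
qed

lemma state_repr_eq:
 assumes "state_repr U \<Phi> g k" "HH_eq U V" shows "state_repr V \<Phi> g k"
proof -
 have "AE x in lebesgue_on {0..1}. snd U x = snd V x" "AE x in lebesgue_on {0..1}. snd U x = k x"
  using assms by (auto simp: state_repr_def HH_eq_def)
 then have "AE x in lebesgue_on {0..1}. snd V x = k x" by eventually_elim simp
 then show ?thesis using assms by (auto simp: state_repr_def HH_eq_def)
qed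

lemma state_repr_dist:
 assumes "state_repr U \<Phi> g k" "state_repr V \<Psi> h l"
 shows "(HHdist U V)\<^sup>2 = sqint 0 1 (\<lambda>x. g x - h x) + sqint 0 1 (\<lambda>x. k x - l x) + (\<Phi> 0 - \<Psi> 0)\<^sup>2" "0 \<le> HHdist U V"
 using state_repr_norm_sq[OF state_repr_lincomb[OF assms, of 1 "-1"]] by (simp_all add: HHdist_def)

lemma state_repr_sup:
 assumes "state_repr U \<Phi> g k" "x \<in> {0..1}"
 shows "(fst U x)\<^sup>2 \<le> 2 * (HHnorm U)\<^sup>2"
proof -
 have P: "prim \<Phi> g" and g: "g \<in> locL2" and eq: "fst U x = \<Phi> x"
  using assms by (auto simp: state_repr_def)
 have "(integral {0..x} g)\<^sup>2 \<le> (x - 0) * sqint 0 x g"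
  unfolding sqint_def by (rule Cauchy_Schwarz_interval[OF locL2_D[OF g]]) (use assms in auto)
 also have "\<dots> \<le> 1 * sqint 0 1 g"
  using assms(2) by (intro mult_mono sqint_mono[OF g] sqint_nonneg) auto
 finally have 1: "(\<Phi> x - \<Phi> 0)\<^sup>2 \<le> sqint 0 1 g" using prim_integral[OF P, of 0 x] assms(2) by simp
 have "0 \<le> (\<Phi> x - 2 * \<Phi> 0)\<^sup>2" by simp
 then have "(\<Phi> x)\<^sup>2 \<le> 2 * (\<Phi> x - \<Phi> 0)\<^sup>2 + 2 * (\<Phi> 0)\<^sup>2" by (simp add: power2_eq_square algebra_simps)
 then show ?thesis
  using 1 state_repr_norm_sq(1)[OF assms(1)] sqint_nonneg[of 0 1 k] eq by simp
qed

lemma HH_lincomb: "U \<in> HH \<Longrightarrow> V \<in> HH \<Longrightarrow> lincomb a U b V \<in> HH"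
 by (meson state_repr_exists state_repr_HH state_repr_lincomb)

lemma HHdist_bounds:
 assumes "U \<in> HH" "V \<in> HH"
 shows "x \<in> {0..1} \<Longrightarrow> (fst U x - fst V x)\<^sup>2 \<le> 2 * (HHdist U V)\<^sup>2"
  "integral {0..1} (\<lambda>x. (snd U x - snd V x)\<^sup>2) \<le> (HHdist U V)\<^sup>2" "0 \<le> HHdist U V"
proof -
 obtain \<Phi> g k where r: "state_repr U \<Phi> g k" using state_repr_exists[OF assms(1)] by blast
 obtain \<Psi> h l where s: "state_repr V \<Psi> h l" using state_repr_exists[OF assms(2)] by blast
 show "x \<in> {0..1} \<Longrightarrow> (fst U x - fst V x)\<^sup>2 \<le> 2 * (HHdist U V)\<^sup>2"
  using state_repr_sup[OF state_repr_lincomb[OF r s, of 1 "-1"], of x] by (simp add: HHdist_def lincomb_def)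
 have L: "(\<lambda>x. k x - l x) \<in> L2 {0..1}" using r s by (auto simp: state_repr_def intro!: L2_diff locL2_D)
 have "AE x in lebesgue_on {0..1}. snd U x = k x" "AE x in lebesgue_on {0..1}. snd V x = l x"
  using r s by (auto simp: state_repr_def)
 then have ae: "AE x in lebesgue_on {0..1}. k x - l x = snd U x - snd V x" by eventually_elim simp
 show "integral {0..1} (\<lambda>x. (snd U x - snd V x)\<^sup>2) \<le> (HHdist U V)\<^sup>2"
  unfolding L2_cong_AE(2)[OF interval01_sets L ae]
  using state_repr_dist(1)[OF r s] sqint_nonneg[of 0 1 "\<lambda>x. g x - h x"] by (simp add: sqint_def)
 show "0 \<le> HHdist U V" by (rule state_repr_dist(2)[OF r s])
qed

section \<open>The delay equation\<close>

text \<open>\<open>h\<close> solves $h(t)+c_1\int_{t-2}^th+(1-2c_0)h(t-2)=0$ for $t\ge0$. It is the equation of the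
 incoming wave of \<open>\<beta>\<close>: $\beta(x,t)=\int_{t+x-2}^{t-x}h$.\<close>

definition delay_solution :: "real \<Rightarrow> real \<Rightarrow> (real \<Rightarrow> real) \<Rightarrow> (real \<Rightarrow> real) \<Rightarrow> bool" where
 "delay_solution c0 c1 G h \<longleftrightarrow> h \<in> locL2 \<and> prim G h \<and>
   (\<forall>t\<ge>0. h t + c1 * (G t - G (t - 2)) + (1 - 2 * c0) * h (t - 2) = 0)"

lemma less_twice_ceiling: "t < 2 * real (nat \<lceil>\<bar>t\<bar>\<rceil> + 1)"
proof -
 define k where "k = nat \<lceil>\<bar>t\<bar>\<rceil>"
 have "\<bar>t\<bar> \<le> real k" unfolding k_def by (rule real_nat_ceiling_ge)
 then have "t < 2 * real (k + 1)" by simp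
 then show ?thesis unfolding k_def .
qed

text \<open>On $[0,2]$ the terms at time $t-2$ are given and the equation is a linear differential equation of
 first order for the primitive, solved by variation of constants. Each application of the solution
 operator \<open>\<Theta>\<close> to an arbitrary continuation of the data makes it correct on one more interval of
 length 2, so on bounded intervals the iterates become stationary.\<close>

lemma delay_existence:
 assumes k: "k \<in> locL2"
 shows "\<exists>G h. delay_solution c0 c1 G h \<and> (\<forall>t<0. h t = k t)"
proof -
 define r where "r = 1 - 2 * c0"
 define PG where "PG h = (SOME G. prim G h \<and> G (-2) = 0)" for h :: "real \<Rightarrow> real"
 have PG: "prim (PG h) h \<and> PG h (-2) = 0" if hL: "h \<in> locL2" for h
 proof -
  obtain G where "prim G h" using prim_locL2[OF hL] by blast
  then have "prim (\<lambda>t. G t + - G (-2)) h \<and> G (-2) + - G (-2) = 0" using prim_shift_const[of G h "- G (-2)"] by simp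
  then have "\<exists>G. prim G h \<and> G (-2) = 0" by blast
  then show ?thesis unfolding PG_def by (rule someI_ex)
 qed
 define K where "K h t = PG h 0 - (1 + r) * PG h (t - 2)" for h t
 have Kc: "continuous_on UNIV (K h)" if "h \<in> locL2" for h
  unfolding K_def using PG[OF that]
  by (intro continuous_intros continuous_on_compose2[OF prim_continuous[of "PG h" h UNIV]]) auto
 define PE where "PE h = (SOME P. prim P (\<lambda>s. exp (c1 * s) * K h s))" for h
 have PE: "prim (PE h) (\<lambda>s. exp (c1 * s) * K h s)" if "h \<in> locL2" for h
 proof -
  have "continuous_on UNIV (\<lambda>s. exp (c1 * s) * K h s)" by (intro continuous_intros Kc that)
  then have "\<exists>P. prim P (\<lambda>s. exp (c1 * s) * K h s)" by (intro prim_exists continuous_absint)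
  then show ?thesis unfolding PE_def by (rule someI_ex)
 qed
 define J where "J h t = exp (- c1 * t) * (PE h t - PE h 0)" for h t
 define \<Theta> where "\<Theta> h t = (if t < 0 then k t else - c1 * (K h t - c1 * J h t) - r * h (t - 2))" for h t
 have Jc: "continuous_on UNIV (J h)" if "h \<in> locL2" for h
  unfolding J_def using prim_continuous[OF PE[OF that]] by (intro continuous_intros) auto
 have \<Theta>L: "\<Theta> h \<in> locL2" if h: "h \<in> locL2" for h
  unfolding \<Theta>_def
 proof (rule locL2_if[OF k])
  have "continuous_on UNIV (\<lambda>t. - c1 * (K h t - c1 * J h t))"
   by (intro continuous_intros Kc Jc h)
  then show "(\<lambda>t. - c1 * (K h t - c1 * J h t) - r * h (t - 2)) \<in> locL2"
   using locL2_affine[OF h, of 1 "-2"] by (intro locL2_diff[OF locL2_continuous locL2_cmult]) auto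
  show "{t. t < (0::real)} \<in> sets lebesgue" by (simp flip: lessThan_def)
 qed
 have local: "\<Theta> h t = \<Theta> h' t"
  if h: "h \<in> locL2" and h': "h' \<in> locL2" and T: "T \<ge> 0" and eq: "\<And>s. s < T \<Longrightarrow> h s = h' s" and t: "t < T + 2" for h h' T t
 proof -
  have PGeq: "PG h u = PG h' u" if "- 2 \<le> u" "u \<le> T" for u
  proof -
   have "integral {-2..u} h = integral {-2..u} h'"
    by (rule integral_spike[of "{T}"]) (use eq that in auto)
   then show ?thesis using prim_integral[of "PG h" h "-2" u] prim_integral[of "PG h'" h' "-2" u] PG[OF h] PG[OF h'] that by simp
  qed
  have Keq: "K h u = K h' u" if "0 \<le> u" "u \<le> T + 2" for u
   using PGeq[of 0] PGeq[of "u - 2"] that T by (simp add: K_def)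
  have Jeq: "J h u = J h' u" if "0 \<le> u" "u \<le> T + 2" for u
  proof -
   have "integral {0..u} (\<lambda>s. exp (c1 * s) * K h s) = integral {0..u} (\<lambda>s. exp (c1 * s) * K h' s)"
    by (rule integral_cong_on) (use Keq that in auto)
   then show ?thesis using prim_integral[OF PE[OF h] that(1)] prim_integral[OF PE[OF h'] that(1)] by (simp add: J_def)
  qed
  show ?thesis using Keq[of t] Jeq[of t] eq[of "t - 2"] t by (simp add: \<Theta>_def)
 qed
 define H where "H n = (\<Theta> ^^ n) k" for n
 have HL: "H n \<in> locL2" for n by (induction n) (auto simp: H_def k \<Theta>L)
 have HS: "H (Suc n) = \<Theta> (H n)" for n by (simp add: H_def)
 have stab: "H (Suc n) t = H n t" if "t < 2 * real n" for n t
  using that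
 proof (induction n arbitrary: t)
  case 0 then show ?case by (simp add: H_def \<Theta>_def)
 next
  case (Suc n)
  have "\<Theta> (H (Suc n)) t = \<Theta> (H n) t"
   by (rule local[OF HL HL, of "2 * real n"]) (use Suc in auto)
  then show ?case by (simp only: HS)
 qed
 have stab': "H (n + m) t = H n t" if "t < 2 * real n" for n m t
 proof (induction m)
  case (Suc m)
  have "t < 2 * real (n + m)" using that by simp
  then show ?case using stab[of t "n + m"] Suc by simp
 qed simp
 define h where "h t = H (nat \<lceil>\<bar>t\<bar>\<rceil> + 1) t" for t
 have hH: "h t = H n t" if "t < 2 * real n" for t n
 proof -
  define m where "m = nat \<lceil>\<bar>t\<bar>\<rceil> + 1"
  have m: "t < 2 * real m" unfolding m_def by (rule less_twice_ceiling)
  have "H (n + m) t = H n t" "H (m + n) t = H m t" using stab' that m by blast+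
  then show ?thesis by (simp add: h_def m_def add.commute)
 qed
 have hL: "h \<in> locL2"
  unfolding locL2_def mem_Collect_eq
 proof (intro allI)
  fix a b :: real
  define n where "n = nat \<lceil>\<bar>b\<bar>\<rceil> + 1"
  have n: "b < 2 * real n" unfolding n_def by (rule less_twice_ceiling)
  have "AE x in lebesgue_on {a..b}. H n x = h x"
   by (rule AE_I2, rule hH[symmetric]) (use n in \<open>auto simp: space_restrict_space\<close>)
  then show "h \<in> L2 {a..b}" by (intro L2_cong_AE(1)[OF _ locL2_D[OF HL]]) auto
 qed
 have fp: "\<Theta> h t = h t" for t
 proof -
  define n where "n = nat \<lceil>\<bar>t\<bar>\<rceil> + 1"
  have n: "t < 2 * real n" unfolding n_def by (rule less_twice_ceiling)
  have "\<Theta> h t = \<Theta> (H n) t"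
   by (rule local[OF hL HL, of "2 * real n"]) (use n in \<open>auto intro: hH\<close>)
  also have "\<dots> = H (Suc n) t" by (simp only: HS)
  also have "\<dots> = h t" using hH[of t "Suc n"] n by simp
  finally show ?thesis .
 qed
 have neg: "\<forall>t<0. h t = k t" using fp unfolding \<Theta>_def by metis
 have P: "prim (PG h) h" and P2: "PG h (-2) = 0" using PG[OF hL] by auto
 have dJ: "prim (J h) (\<lambda>t. K h t - c1 * J h t)"
 proof (rule prim_C1)
  fix t
  have "continuous_on UNIV (\<lambda>s. exp (c1 * s) * K h s)" by (intro continuous_intros Kc hL)
  then have "(PE h has_real_derivative exp (c1 * t) * K h t) (at t)" by (rule prim_deriv[OF PE[OF hL]])
  then show "(J h has_real_derivative K h t - c1 * J h t) (at t)"
   unfolding J_def by (auto intro!: derivative_eq_intros simp: algebra_simps simp flip: exp_add)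
 qed (intro continuous_intros Kc Jc hL)
 have "h t + c1 * (PG h t - PG h (t - 2)) + (1 - 2 * c0) * h (t - 2) = 0" if t: "t \<ge> 0" for t
 proof -
  have sh: "prim (\<lambda>t. PG h (-2 + 1 * t)) (\<lambda>t. 1 * h (-2 + 1 * t))" by (rule prim_affine[OF P]) simp
  have "((\<lambda>s. - c1 * (K h s - c1 * J h s) - r * (1 * h (-2 + 1 * s))) has_integral
    (- c1 * (J h t - J h 0) - r * (PG h (-2 + 1 * t) - PG h (-2 + 1 * 0)))) {0..t}"
   by (intro has_integral_diff has_integral_mult_right prim_has_integral[OF dJ t] prim_has_integral[OF sh t])
  moreover have "(\<lambda>s. - c1 * (K h s - c1 * J h s) - r * (1 * h (-2 + 1 * s))) s = h s" if "s \<in> {0..t}" for s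
   using fp[of s] that by (simp add: \<Theta>_def)
  ultimately have "(h has_integral (- c1 * (J h t - J h 0) - r * (PG h (-2 + 1 * t) - PG h (-2 + 1 * 0)))) {0..t}"
   by (rule has_integral_eq[rotated])
  then have "PG h t - PG h 0 = - c1 * J h t - r * PG h (t - 2)"
   using prim_integral[OF P t] P2 by (simp add: integral_unique J_def)
  then have "PG h t - PG h (t - 2) = K h t - c1 * J h t" by (simp add: K_def algebra_simps)
  then show ?thesis using fp[of t] t by (simp add: \<Theta>_def r_def)
 qed
 then have "delay_solution c0 c1 (PG h) h" using hL P by (simp add: delay_solution_def)
 then show ?thesis using neg by blast
qed

text \<open>With $b=\beta(0,\cdot)$ the equation reads $h(t)+h(t-2)=-\gamma b(t)-\kappa b'(t)$,
 where $b'(t)=h(t)-h(t-2)$; multiplication by $b'$ is the energy balance of $\beta$.\<close>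

lemma delay_energy:
 assumes c: "0 < c0" "c0 < 1" and h: "delay_solution c0 c1 G h" and T: "T \<ge> 0"
 defines "\<kappa> \<equiv> c0 / (1 - c0)" and "\<gamma> \<equiv> c1 / (1 - c0)"
 shows "sqint (T - 2) T h + \<gamma> / 2 * (G T - G (T - 2))\<^sup>2 + \<kappa> * sqint 0 T (\<lambda>t. h t - h (t - 2))
  = sqint (-2) 0 h + \<gamma> / 2 * (G 0 - G (-2))\<^sup>2"
proof -
 have hL: "h \<in> locL2" and P: "prim G h" using h by (auto simp: delay_solution_def)
 have h2: "(\<lambda>t. h (t - 2)) \<in> locL2" using locL2_affine[OF hL, of 1 "-2"] by simp
 have P2: "prim (\<lambda>t. G (t - 2)) (\<lambda>t. h (t - 2))" using prim_affine[OF P, of 1 "-2"] by simp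
 define B where "B t = G t - G (t - 2)" for t
 define d where "d t = h t - h (t - 2)" for t
 have PB: "prim B d" unfolding B_def d_def by (rule prim_diff[OF P P2])
 have dL: "d \<in> locL2" unfolding d_def by (rule locL2_diff[OF hL h2])
 have PBB: "prim (\<lambda>t. B t * B t) (\<lambda>t. B t * d t + d t * B t)" by (rule prim_product[OF PB PB])
 have pt: "(h (t - 2))\<^sup>2 - (h t)\<^sup>2 = \<gamma> / 2 * (B t * d t + d t * B t) + \<kappa> * (d t)\<^sup>2" if "t \<ge> 0" for t
 proof -
  have "h t + c1 * B t + (1 - 2 * c0) * h (t - 2) = 0" using h that by (simp add: delay_solution_def B_def)
  then have e: "(1 - c0) * (h t + h (t - 2)) = - (c1 * B t + c0 * d t)" by (simp add: d_def algebra_simps)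
  have "h t + h (t - 2) = (1 - c0) * (h t + h (t - 2)) / (1 - c0)" using c by simp
  also have "\<dots> = - (\<gamma> * B t + \<kappa> * d t)" unfolding e by (simp add: \<gamma>_def \<kappa>_def add_divide_distrib diff_divide_distrib)
  finally have s: "h (t - 2) + h t = - (\<gamma> * B t + \<kappa> * d t)" by simp
  have "(h (t - 2))\<^sup>2 - (h t)\<^sup>2 = (h (t - 2) + h t) * (- d t)"
   by (simp add: d_def power2_eq_square algebra_simps)
  then show ?thesis unfolding s by (simp add: power2_eq_square algebra_simps)
 qed
 have "((\<lambda>t. \<gamma> / 2 * (B t * d t + d t * B t) + \<kappa> * (d t)\<^sup>2) has_integral
   (\<gamma> / 2 * (B T * B T - B 0 * B 0) + \<kappa> * sqint 0 T d)) {0..T}"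
  unfolding sqint_def
  by (intro has_integral_add has_integral_mult_right prim_has_integral[OF PBB T] integrable_integral locL2_sq_int[OF dL])
 then have 1: "((\<lambda>t. (h (t - 2))\<^sup>2 - (h t)\<^sup>2) has_integral
   (\<gamma> / 2 * (B T * B T - B 0 * B 0) + \<kappa> * sqint 0 T d)) {0..T}"
  by (rule has_integral_eq[rotated]) (use pt in auto)
 have "((\<lambda>t. (h (t - 2))\<^sup>2 - (h t)\<^sup>2) has_integral (sqint 0 T (\<lambda>t. h (t - 2)) - sqint 0 T h)) {0..T}"
  unfolding sqint_def by (intro has_integral_diff integrable_integral locL2_sq_int hL h2)
 then have "\<gamma> / 2 * (B T * B T - B 0 * B 0) + \<kappa> * sqint 0 T d = sqint 0 T (\<lambda>t. h (t - 2)) - sqint 0 T h"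
  using 1 has_integral_unique by blast
 moreover have "sqint 0 T (\<lambda>t. h (t - 2)) = sqint (-2) (T - 2) h"
  using sqint_shift[OF hL, of 0 T "-2"] by simp
 moreover have "sqint (-2) (T - 2) h + sqint (T - 2) T h = sqint (-2) 0 h + sqint 0 T h"
  using sqint_combine[OF hL, of "-2" "T - 2" T] sqint_combine[OF hL, of "-2" 0 T] T by simp
 ultimately show ?thesis by (simp add: B_def d_def[abs_def] power2_eq_square algebra_simps)
qed

lemma delay_initial_bound:
 assumes h: "h \<in> locL2" and P: "prim G h"
 shows "(G 0 - G (-2))\<^sup>2 \<le> 2 * sqint (-2) 0 h"
 using Cauchy_Schwarz_interval[OF locL2_D[OF h], of "-2" 0] prim_integral[OF P, of "-2" 0]
 by (simp add: sqint_def)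

lemma delay_energy_bounds:
 assumes c: "0 < c0" "c0 < 1" "0 < c1" and h: "delay_solution c0 c1 G h" and T: "T \<ge> 0"
 defines "\<kappa> \<equiv> c0 / (1 - c0)" and "\<gamma> \<equiv> c1 / (1 - c0)"
 shows "sqint (T - 2) T h \<le> (1 + \<gamma>) * sqint (-2) 0 h"
  "\<kappa> * sqint 0 T (\<lambda>t. h t - h (t - 2)) \<le> (1 + \<gamma>) * sqint (-2) 0 h"
proof -
 have hL: "h \<in> locL2" and P: "prim G h" using h by (auto simp: delay_solution_def)
 have k: "0 < \<kappa>" "0 < \<gamma>" using c by (auto simp: \<kappa>_def \<gamma>_def)
 have "\<gamma> / 2 * (G 0 - G (-2))\<^sup>2 \<le> \<gamma> / 2 * (2 * sqint (-2) 0 h)"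
  using delay_initial_bound[OF hL P] k by (intro mult_left_mono) auto
 then have "sqint (T - 2) T h + \<gamma> / 2 * (G T - G (T - 2))\<^sup>2 + \<kappa> * sqint 0 T (\<lambda>t. h t - h (t - 2)) \<le> (1 + \<gamma>) * sqint (-2) 0 h"
  using delay_energy[OF c(1,2) h T] unfolding \<kappa>_def[symmetric] \<gamma>_def[symmetric] by (simp add: algebra_simps)
 moreover have "0 \<le> \<gamma> / 2 * (G T - G (T - 2))\<^sup>2" "0 \<le> \<kappa> * sqint 0 T (\<lambda>t. h t - h (t - 2))" "0 \<le> sqint (T - 2) T h"
  using k by (auto intro!: mult_nonneg_nonneg simp: sqint_nonneg)
 ultimately show "sqint (T - 2) T h \<le> (1 + \<gamma>) * sqint (-2) 0 h"
  "\<kappa> * sqint 0 T (\<lambda>t. h t - h (t - 2)) \<le> (1 + \<gamma>) * sqint (-2) 0 h" by linarith+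
qed

text \<open>The energy bounds \<open>h\<close> on each of the $n$ windows of length 2.\<close>

lemma delay_local_bound:
 assumes c: "0 < c0" "c0 < 1" "0 < c1" and h: "delay_solution c0 c1 G h"
 shows "sqint (-2) (2 * real n) h \<le> (1 + real n) * (1 + c1 / (1 - c0)) * sqint (-2) 0 h"
proof (induction n)
 case 0
 have "1 * sqint (-2) 0 h \<le> (1 + c1 / (1 - c0)) * sqint (-2) 0 h"
  using c by (intro mult_right_mono sqint_nonneg) auto
 then show ?case by simp
next
 case (Suc n)
 have hL: "h \<in> locL2" using h by (auto simp: delay_solution_def)
 have "sqint (2 * real n) (2 * real (Suc n)) h \<le> (1 + c1 / (1 - c0)) * sqint (-2) 0 h"
  using delay_energy_bounds(1)[OF c h, of "2 * real (Suc n)"] by (simp add: algebra_simps)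
 moreover have "sqint (-2) (2 * real n) h + sqint (2 * real n) (2 * real (Suc n)) h = sqint (-2) (2 * real (Suc n)) h"
  by (rule sqint_combine[OF hL]) auto
 moreover have "(1 + real n) * w * s + w * s = (1 + real (Suc n)) * w * s" for w s :: real
  by (simp add: algebra_simps)
 ultimately show ?case using Suc by (metis add_mono)
qed

lemma delay_diff:
 assumes "delay_solution c0 c1 G h" "delay_solution c0 c1 K k"
 shows "delay_solution c0 c1 (\<lambda>t. G t - K t) (\<lambda>t. h t - k t)"
 unfolding delay_solution_def
proof (intro conjI allI impI)
 fix t :: real assume "t \<ge> 0"
 then have "h t + c1 * (G t - G (t - 2)) + (1 - 2 * c0) * h (t - 2) = 0"
  "k t + c1 * (K t - K (t - 2)) + (1 - 2 * c0) * k (t - 2) = 0" using assms by (auto simp: delay_solution_def)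
 then show "h t - k t + c1 * (G t - K t - (G (t - 2) - K (t - 2))) + (1 - 2 * c0) * (h (t - 2) - k (t - 2)) = 0"
  by (simp add: algebra_simps)
qed (use assms in \<open>auto simp: delay_solution_def intro: prim_diff locL2_diff\<close>)

text \<open>Only $b'\in L^2(0,\infty)$ is immediate from the energy balance. Integrating
 $2h=(1-\kappa)b'-\gamma b$ over $[t-2,t]$, where $\int_{t-2}^th=b(t)$, bounds $(1+\gamma)b(t)$ by
 oscillations of \<open>b\<close> on that interval, that is by $b'$.\<close>

lemma delay_square_integrable:
 assumes c: "0 < c0" "c0 < 1" "0 < c1" and h: "delay_solution c0 c1 G h"
 shows "\<exists>M. \<forall>T\<ge>2. sqint 0 T h \<le> M"
proof -
 define \<kappa> \<gamma> where "\<kappa> = c0 / (1 - c0)" and "\<gamma> = c1 / (1 - c0)"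
 have k: "0 < \<kappa>" "0 < \<gamma>" using c by (auto simp: \<kappa>_def \<gamma>_def)
 have hL: "h \<in> locL2" and P: "prim G h" using h by (auto simp: delay_solution_def)
 have h2: "(\<lambda>t. h (t - 2)) \<in> locL2" using locL2_affine[OF hL, of 1 "-2"] by simp
 have P2: "prim (\<lambda>t. G (t - 2)) (\<lambda>t. h (t - 2))" using prim_affine[OF P, of 1 "-2"] by simp
 define B where "B t = G t - G (t - 2)" for t
 define d where "d t = h t - h (t - 2)" for t
 have PB: "prim B d" unfolding B_def d_def by (rule prim_diff[OF P P2])
 have dL: "d \<in> locL2" unfolding d_def by (rule locL2_diff[OF hL h2])
 have BL: "B \<in> locL2" by (rule locL2_continuous[OF prim_continuous[OF PB]])
 define S where "S = (1 + \<gamma>) * sqint (-2) 0 h / \<kappa>"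
 have dS: "sqint 0 T d \<le> S" if "T \<ge> 0" for T
  using delay_energy_bounds(2)[OF c h that] k unfolding \<kappa>_def[symmetric] \<gamma>_def[symmetric]
  by (simp add: S_def d_def[abs_def] field_simps)
 have two: "2 * h t = (1 - \<kappa>) * d t - \<gamma> * B t" if "t \<ge> 0" for t
 proof -
  have "h t + c1 * B t + (1 - 2 * c0) * h (t - 2) = 0" using h that by (simp add: delay_solution_def B_def)
  then have e: "(1 - c0) * (h t + h (t - 2)) = - (c1 * B t + c0 * d t)" by (simp add: d_def algebra_simps)
  have "h t + h (t - 2) = (1 - c0) * (h t + h (t - 2)) / (1 - c0)" using c by simp
  also have "\<dots> = - (\<gamma> * B t + \<kappa> * d t)" unfolding e by (simp add: \<gamma>_def \<kappa>_def add_divide_distrib diff_divide_distrib)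
  finally show ?thesis by (simp add: d_def algebra_simps)
 qed
 obtain R where R: "prim R (\<lambda>t. (d t)\<^sup>2)" using prim_sq[OF dL] by blast
 have Rmono: "R s \<le> R t" if "s \<le> t" for s t
  using sqint_prim[OF R that] sqint_nonneg[of s t d] by simp
 have osc: "(B t - B s)\<^sup>2 \<le> 2 * (R t - R (t - 2))" if s: "t - 2 \<le> s" "s \<le> t" for s t
 proof -
  have "(integral {s..t} d)\<^sup>2 \<le> (t - s) * integral {s..t} (\<lambda>t. (d t)\<^sup>2)"
   by (rule Cauchy_Schwarz_interval[OF locL2_D[OF dL] s(2)])
  also have "\<dots> = (t - s) * (R t - R s)" by (simp add: prim_integral[OF R s(2)])
  also have "\<dots> \<le> 2 * (R t - R (t - 2))"
   using s Rmono[OF s(1)] Rmono[OF s(2)] by (intro mult_mono) auto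
  finally show ?thesis by (simp add: prim_integral[OF PB s(2)])
 qed
 define q where "q = \<bar>1 - \<kappa>\<bar> + 2 * \<gamma>"
 have q0: "0 \<le> q" using k by (simp add: q_def)
 have Bb: "(B t)\<^sup>2 \<le> q\<^sup>2 * (R t - R (t - 2))" if t: "t \<ge> 2" for t
 proof -
  define w where "w = sqrt (2 * (R t - R (t - 2)))"
  have w: "w \<ge> 0" "w\<^sup>2 = 2 * (R t - R (t - 2))" using Rmono[of "t - 2" t] by (auto simp: w_def)
  have osc': "\<bar>B t - B s\<bar> \<le> w" if "t - 2 \<le> s" "s \<le> t" for s
   using osc[OF that] w(2) abs_le_square_iff[of "B t - B s" w] w(1) by simp
  have le: "t - 2 \<le> t" by simp
  have "((\<lambda>s. (1 - \<kappa>) * d s + \<gamma> * (B t - B s) - \<gamma> * B t) has_integral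
    ((1 - \<kappa>) * (B t - B (t - 2)) + \<gamma> * integral {t-2..t} (\<lambda>s. B t - B s) - \<gamma> * B t * 2)) {t-2..t}"
  proof (intro has_integral_diff has_integral_add has_integral_mult_right prim_has_integral[OF PB le] integrable_integral)
   show "(\<lambda>s. B t - B s) integrable_on {t-2..t}"
    by (intro integrable_continuous_real continuous_intros prim_continuous[OF PB])
   show "((\<lambda>s. \<gamma> * B t) has_integral \<gamma> * B t * 2) {t-2..t}"
    using has_integral_const_real[of "\<gamma> * B t" "t-2" t] by (simp add: mult.commute)
  qed
  moreover have "((\<lambda>s. 2 * h s) has_integral 2 * (G t - G (t - 2))) {t-2..t}"
   by (intro has_integral_mult_right prim_has_integral[OF P le])
  then have "((\<lambda>s. (1 - \<kappa>) * d s + \<gamma> * (B t - B s) - \<gamma> * B t) has_integral 2 * B t) {t-2..t}"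
   unfolding B_def[of t, symmetric] by (rule has_integral_eq[rotated]) (use two t in \<open>auto simp: algebra_simps\<close>)
  ultimately have "2 * B t = (1 - \<kappa>) * (B t - B (t - 2)) + \<gamma> * integral {t-2..t} (\<lambda>s. B t - B s) - \<gamma> * B t * 2"
   using has_integral_unique by blast
  then have e: "2 * (1 + \<gamma>) * B t = (1 - \<kappa>) * (B t - B (t - 2)) + \<gamma> * integral {t-2..t} (\<lambda>s. B t - B s)"
   by (simp add: algebra_simps)
  have "\<bar>(1 - \<kappa>) * (B t - B (t - 2))\<bar> \<le> \<bar>1 - \<kappa>\<bar> * w"
   unfolding abs_mult using osc'[of "t - 2"] by (intro mult_left_mono) auto
  moreover have "norm (integral {t-2..t} (\<lambda>s. B t - B s)) \<le> w * (t - (t - 2))"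
   by (rule integral_bound) (use osc' in \<open>auto intro!: continuous_intros prim_continuous[OF PB]\<close>)
  then have "\<bar>\<gamma> * integral {t-2..t} (\<lambda>s. B t - B s)\<bar> \<le> \<gamma> * (w * 2)"
   unfolding abs_mult using k by (intro mult_mono) auto
  ultimately have "\<bar>2 * (1 + \<gamma>) * B t\<bar> \<le> q * w" unfolding e q_def by (simp add: algebra_simps)
  moreover have "\<bar>2 * B t\<bar> \<le> \<bar>2 * (1 + \<gamma>) * B t\<bar>"
  proof -
   have "\<bar>2 * B t\<bar> = 1 * (2 * \<bar>B t\<bar>)" by (simp add: abs_mult)
   also have "\<dots> \<le> (1 + \<gamma>) * (2 * \<bar>B t\<bar>)" using k by (intro mult_right_mono) auto
   also have "\<dots> = \<bar>2 * (1 + \<gamma>)\<bar> * \<bar>B t\<bar>" using k by (subst abs_of_nonneg) auto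
   also have "\<dots> = \<bar>2 * (1 + \<gamma>) * B t\<bar>" by (rule abs_mult[symmetric])
   finally show ?thesis .
  qed
  ultimately have "\<bar>2 * B t\<bar> \<le> \<bar>q * w\<bar>" by simp
  then have "(2 * B t)\<^sup>2 \<le> (q * w)\<^sup>2" by (simp only: abs_le_square_iff)
  then have "4 * (B t)\<^sup>2 \<le> q\<^sup>2 * (2 * (R t - R (t - 2)))" by (simp add: power_mult_distrib w(2))
  moreover have "q\<^sup>2 * (2 * (R t - R (t - 2))) = 2 * (q\<^sup>2 * (R t - R (t - 2)))" by (rule mult.left_commute)
  moreover have "0 \<le> q\<^sup>2 * (R t - R (t - 2))" using Rmono[of "t - 2" t] by simp
  ultimately show ?thesis by linarith
 qed
 have Rc: "continuous_on UNIV R" by (rule prim_continuous[OF R])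
 obtain Z where Z: "prim Z R" using prim_exists[of R] continuous_absint[OF Rc] by blast
 have Z2: "prim (\<lambda>t. Z (t - 2)) (\<lambda>t. R (t - 2))" using prim_affine[OF Z, of 1 "-2"] by simp
 have BS: "sqint 2 T B \<le> q\<^sup>2 * (2 * S)" if T: "T \<ge> 2" for T
 proof -
  have "sqint 2 T B \<le> integral {2..T} (\<lambda>t. q\<^sup>2 * (R t - R (t - 2)))"
   unfolding sqint_def
   by (rule integral_le[OF locL2_sq_int[OF BL] prim_int[OF prim_cmult[OF prim_diff[OF Z Z2]]]]) (use Bb in auto)
  also have "\<dots> = q\<^sup>2 * ((Z T - Z (T - 2)) - (Z 2 - Z 0))"
   using prim_integral[OF prim_cmult[OF prim_diff[OF Z Z2]] T, of "q\<^sup>2"] by (simp add: algebra_simps)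
  also have "\<dots> \<le> q\<^sup>2 * (2 * S)"
  proof (rule mult_left_mono)
   have "Z T - Z (T - 2) = integral {T-2..T} R" using prim_integral[OF Z, of "T-2" T] by simp
   also have "\<dots> \<le> integral {T-2..T} (\<lambda>_. R T)"
    by (rule integral_le[OF prim_int[OF Z]]) (auto intro: Rmono)
   finally have 1: "Z T - Z (T - 2) \<le> 2 * R T" by simp
   have "integral {0..2::real} (\<lambda>_. R 0) \<le> integral {0..2} R"
    by (rule integral_le[OF _ prim_int[OF Z]]) (auto intro: Rmono)
   then have "2 * R 0 \<le> Z 2 - Z 0" using prim_integral[OF Z, of 0 2] by simp
   moreover have "R T - R 0 \<le> S" using dS[of T] sqint_prim[OF R, of 0 T] T by simp
   ultimately show "Z T - Z (T - 2) - (Z 2 - Z 0) \<le> 2 * S" using 1 by simp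
  qed simp
  finally show ?thesis .
 qed
 define M where "M = sqint 0 2 h + (2 * ((1 - \<kappa>) / 2)\<^sup>2 * S + 2 * (\<gamma> / 2)\<^sup>2 * (q\<^sup>2 * (2 * S)))"
 have "sqint 0 T h \<le> M" if T: "T \<ge> 2" for T
 proof -
  have "sqint 2 T h = sqint 2 T (\<lambda>t. (1 - \<kappa>) / 2 * d t - \<gamma> / 2 * B t)"
   unfolding sqint_def
  proof (rule integral_cong_on)
   fix t assume "t \<in> {2..T}"
   then have "h t = (1 - \<kappa>) / 2 * d t - \<gamma> / 2 * B t" using two[of t] by (simp add: field_simps)
   then show "(h t)\<^sup>2 = ((1 - \<kappa>) / 2 * d t - \<gamma> / 2 * B t)\<^sup>2" by simp
  qed
  also have "\<dots> \<le> 2 * (((1 - \<kappa>) / 2)\<^sup>2 * sqint 2 T d) + 2 * ((\<gamma> / 2)\<^sup>2 * sqint 2 T B)"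
   using sqint_diff_le[OF locL2_cmult[OF dL] locL2_cmult[OF BL], of 2 T "(1 - \<kappa>) / 2" "\<gamma> / 2"]
   by (simp only: sqint_cmult)
  also have "\<dots> \<le> 2 * (((1 - \<kappa>) / 2)\<^sup>2 * S) + 2 * ((\<gamma> / 2)\<^sup>2 * (q\<^sup>2 * (2 * S)))"
  proof -
   have "sqint 2 T d \<le> S" using sqint_mono[OF dL, of 0 2 T T] dS[of T] T by simp
   then show ?thesis using BS[OF T] by (intro add_mono mult_left_mono) auto
  qed
  finally show ?thesis using sqint_combine[OF hL, of 0 2 T] T by (simp add: M_def)
 qed
 then show ?thesis by blast
qed

lemma L2_halfline:
 assumes h: "h \<in> locL2" and M: "\<And>T. T \<ge> 0 \<Longrightarrow> sqint 0 T h \<le> M"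
 shows "h \<in> L2 {0..}"
proof -
 define f where "f n t = (if t \<in> {0..real n} then (h t)\<^sup>2 else 0)" for n :: nat and t
 have fi: "(f n has_integral sqint 0 (real n) h) {0..}" for n
 proof -
  have "((\<lambda>t. (h t)\<^sup>2) has_integral sqint 0 (real n) h) {0..real n}"
   unfolding sqint_def by (intro integrable_integral locL2_sq_int h)
  then show ?thesis
   unfolding f_def by (subst has_integral_restrict) auto
 qed
 have "(\<lambda>t. (h t)\<^sup>2) integrable_on {0..} \<and> (\<lambda>n. integral {0..} (f n)) \<longlonglongrightarrow> integral {0..} (\<lambda>t. (h t)\<^sup>2)"
 proof (rule monotone_convergence_increasing)
  show "f n integrable_on {0..}" for n using fi by blast
  show "f n t \<le> f (Suc n) t" for n t by (simp add: f_def)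
  show "(\<lambda>n. f n t) \<longlonglongrightarrow> (h t)\<^sup>2" if t: "t \<in> {0..}" for t
  proof (rule tendsto_eventually)
   show "\<forall>\<^sub>F n in sequentially. f n t = (h t)\<^sup>2"
    using eventually_ge_at_top[of "nat \<lceil>t\<rceil>"]
   proof eventually_elim
    case (elim n)
    then have "t \<le> real n" by linarith
    then show ?case using t by (simp add: f_def)
   qed
  qed
  have "integral {0..} (f n) = sqint 0 (real n) h" for n using fi by (rule integral_unique)
  moreover have "\<bar>sqint 0 (real n) h\<bar> \<le> M" for n using M[of "real n"] sqint_nonneg[of 0 "real n" h] by simp
  ultimately show "bounded (range (\<lambda>n. integral {0..} (f n)))"
   by (intro boundedI[of _ M]) auto
 qed
 moreover have "h \<in> borel_measurable (lebesgue_on {0..})"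
  using locL2_measurable[OF h] by (rule measurable_restrict_space1)
 ultimately show ?thesis by (simp add: L2_iff)
qed

lemma delay_output_L2:
 assumes c: "0 < c0" "c0 < 1" "0 < c1" and h: "delay_solution c0 c1 G h"
 shows "(\<lambda>t. - 2 * h (t - 1)) \<in> L2 {0..}"
proof -
 have hL: "h \<in> locL2" using h by (auto simp: delay_solution_def)
 obtain M where M: "\<And>T. T \<ge> 2 \<Longrightarrow> sqint 0 T h \<le> M" using delay_square_integrable[OF c h] by blast
 have h1: "(\<lambda>t. h (t - 1)) \<in> locL2" using locL2_affine[OF hL, of 1 "-1"] by simp
 have "(\<lambda>t. h (t - 1)) \<in> L2 {0..}"
 proof (rule L2_halfline[OF h1])
  fix T :: real assume T: "T \<ge> 0"
  have "sqint 0 T (\<lambda>t. h (t - 1)) = sqint (-1) (T - 1) h" using sqint_shift[OF hL, of 0 T "-1"] by simp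
  also have "\<dots> \<le> sqint (-1) (T + 2) h" by (rule sqint_mono[OF hL]) auto
  also have "\<dots> = sqint (-1) 0 h + sqint 0 (T + 2) h" using sqint_combine[OF hL, of "-1" 0 "T + 2"] T by simp
  also have "\<dots> \<le> sqint (-1) 0 h + M" using M[of "T + 2"] T by simp
  finally show "sqint 0 T (\<lambda>t. h (t - 1)) \<le> sqint (-1) 0 h + M" .
 qed
 then show ?thesis by (intro L2_cmult) auto
qed

section \<open>Test functions of two variables and the pairing\<close>

definition smooth2 :: "(nat \<Rightarrow> nat \<Rightarrow> real \<Rightarrow> real \<Rightarrow> real) \<Rightarrow> bool" where
 "smooth2 D \<longleftrightarrow> (\<forall>i j. continuous_on UNIV (\<lambda>(x, t). D i j x t)) \<and>
    (\<forall>i j x t. ((\<lambda>s. D i j s t) has_real_derivative D (Suc i) j x t) (at x) \<and>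
          ((\<lambda>s. D i j x s) has_real_derivative D i (Suc j) x t) (at t))"

definition supported :: "(nat \<Rightarrow> nat \<Rightarrow> real \<Rightarrow> real \<Rightarrow> real) \<Rightarrow> real \<Rightarrow> real \<Rightarrow> real \<Rightarrow> real \<Rightarrow> bool" where
 "supported D a b p q \<longleftrightarrow> 0 < a \<and> a < b \<and> b < 1 \<and> 0 < p \<and> p < q \<and>
   (\<forall>i j x t. x \<notin> {a<..<b} \<or> t \<notin> {p<..<q} \<longrightarrow> D i j x t = 0)"

lemma smooth2_deriv:
 assumes "smooth2 D"
 shows "dx (D i j) = D (Suc i) j" "dt (D i j) = D i (Suc j)"
 using assms unfolding smooth2_def dx_def dt_def by (auto simp: fun_eq_iff intro!: DERIV_imp_deriv)

lemma test_fun2_support: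
 assumes "test_fun2 \<eta>"
 obtains D a b p q where "smooth2 D" "D 0 0 = \<eta>" "supported D a b p q"
proof -
 obtain D where D0: "D 0 0 = \<eta>" and D: "smooth2 D"
  using assms unfolding test_fun2_def smooth2_def by blast
 obtain K where K: "compact K" "K \<subseteq> {0<..<1} \<times> {0<..}" "\<And>x t. (x, t) \<notin> K \<Longrightarrow> \<eta> x t = 0"
  using assms unfolding test_fun2_def by blast
 have S1: "open_interval {0<..<1::real}" and S2: "open_interval {0::real<..}" by simp_all
 have K1: "compact (fst ` K)" "fst ` K \<subseteq> {0<..<1}" and K2: "compact (snd ` K)" "snd ` K \<subseteq> {0<..}"
  using K by (auto intro!: compact_continuous_image continuous_intros)
 obtain a b where ab: "a < b" "{a..b} \<subseteq> {0<..<1}" "fst ` K \<subseteq> {a<..<b}"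
  by (rule compact_in_open_interval[OF S1 K1])
 obtain p q where pq: "p < q" "{p..q} \<subseteq> {0<..}" "snd ` K \<subseteq> {p<..<q}"
  by (rule compact_in_open_interval[OF S2 K2])
 have cl: "closed K" using K(1) by (rule compact_imp_closed)
 have zi: "D i 0 x t = 0" if "(x, t) \<notin> K" for i x t
  using that
 proof (induction i arbitrary: x t)
  case 0 then show ?case using K(3) D0 by simp
 next
  case (Suc i)
  have "open ((\<lambda>s. (s, t)) -` (- K))"
   using cl by (intro open_vimage open_Compl continuous_intros)
  then have "open {s. (s, t) \<notin> K}" by (simp add: vimage_def)
  then have "\<forall>\<^sub>F s in nhds x. D i 0 s t = 0"
   using Suc by (auto elim!: eventually_nhds_in_open[THEN eventually_mono])
  then have "((\<lambda>s. D i 0 s t) has_real_derivative 0) (at x)"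
   using DERIV_cong_ev[OF refl _ refl, of "\<lambda>s. D i 0 s t" "\<lambda>_. 0" x 0] by simp
  moreover have "((\<lambda>s. D i 0 s t) has_real_derivative D (Suc i) 0 x t) (at x)" using D by (simp add: smooth2_def)
  ultimately show ?case using DERIV_unique by blast
 qed
 have z: "D i j x t = 0" if "(x, t) \<notin> K" for i j x t
  using that
 proof (induction j arbitrary: x t)
  case 0 then show ?case using zi by simp
 next
  case (Suc j)
  have "open ((\<lambda>s. (x, s)) -` (- K))"
   using cl by (intro open_vimage open_Compl continuous_intros)
  then have "open {s. (x, s) \<notin> K}" by (simp add: vimage_def)
  then have "\<forall>\<^sub>F s in nhds t. D i j x s = 0"
   using Suc by (auto elim!: eventually_nhds_in_open[THEN eventually_mono])
  then have "((\<lambda>s. D i j x s) has_real_derivative 0) (at t)"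
   using DERIV_cong_ev[OF refl _ refl, of "\<lambda>s. D i j x s" "\<lambda>_. 0" t 0] by simp
  moreover have "((\<lambda>s. D i j x s) has_real_derivative D i (Suc j) x t) (at t)" using D by (simp add: smooth2_def)
  ultimately show ?case using DERIV_unique by blast
 qed
 have "supported D a b p q"
  unfolding supported_def
 proof (intro conjI allI impI)
  show "0 < a" "b < 1" "0 < p"
   using subsetD[OF ab(2), of a] subsetD[OF ab(2), of b] subsetD[OF pq(2), of p] ab(1) pq(1) by auto
  fix i j x t assume "x \<notin> {a<..<b} \<or> t \<notin> {p<..<q}"
  then have "(x, t) \<notin> K" using ab(3) pq(3) by force
  then show "D i j x t = 0" by (rule z)
 qed (use ab pq in auto)
 then show ?thesis using that D D0 by blast
qed

lemma test_fun2_I: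
 assumes D: "smooth2 D" and s: "supported D a b p q"
 shows "test_fun2 (D i j)"
 unfolding test_fun2_def
proof (intro conjI)
 show "\<exists>E :: nat \<Rightarrow> nat \<Rightarrow> real \<Rightarrow> real \<Rightarrow> real. E 0 0 = D i j \<and>
    (\<forall>i j. continuous_on UNIV (\<lambda>(x, t). E i j x t)) \<and>
    (\<forall>i j x t. ((\<lambda>s. E i j s t) has_real_derivative E (Suc i) j x t) (at x) \<and>
          ((\<lambda>s. E i j x s) has_real_derivative E i (Suc j) x t) (at t))"
  using D unfolding smooth2_def by (intro exI[of _ "\<lambda>m n. D (i + m) (j + n)"]) simp
 show "\<exists>K. compact K \<and> K \<subseteq> {0<..<1} \<times> {0<..} \<and> (\<forall>x t. (x, t) \<notin> K \<longrightarrow> D i j x t = 0)"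
  using s unfolding supported_def by (intro exI[of _ "{a..b} \<times> {p..q}"]) (auto intro!: compact_Times)
qed

lemma smooth2_cont: "smooth2 D \<Longrightarrow> continuous_on UNIV (\<lambda>z. D i j (fst z) (snd z))"
 unfolding smooth2_def by (simp add: case_prod_beta')

lemma smooth2_cont_comp:
 assumes "smooth2 D" "continuous_on S f" "continuous_on S g"
 shows "continuous_on S (\<lambda>z. D i j (f z) (g z))"
 using continuous_on_compose2[OF smooth2_cont[OF assms(1)] continuous_on_Pair[OF assms(2,3)]] by simp

text \<open>Continuity of $t\mapsto w(\cdot,t)$ in $L^2(0,1)$.\<close>

definition L2cont :: "(real \<Rightarrow> real \<Rightarrow> real) \<Rightarrow> bool" where
 "L2cont w \<longleftrightarrow> (\<forall>t\<ge>0. (\<lambda>x. w x t) \<in> L2 {0..1} \<and>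
   ((\<lambda>s. integral {0..1} (\<lambda>x. (w x s - w x t)\<^sup>2)) \<longlongrightarrow> 0) (at t within {0..}))"

text \<open>The inner product is jointly continuous: \<open>w\<close> varies continuously in $L^2(0,1)$ and \<open>\<eta>\<close>, being
 uniformly continuous on a compact strip, varies uniformly.\<close>

lemma L2cont_pairing_continuous:
 assumes w: "L2cont w" and e: "continuous_on UNIV (\<lambda>z. \<eta> (fst z) (snd z))"
 shows "continuous_on {0..} (\<lambda>t. integral {0..1} (\<lambda>x. w x t * \<eta> x t))"
  "\<And>t. t \<ge> 0 \<Longrightarrow> (\<lambda>x. w x t * \<eta> x t) absolutely_integrable_on {0..1}"
proof -
 have L: "(\<lambda>x. w x t) \<in> L2 {0..1}" if "t \<ge> 0" for t using w that by (simp add: L2cont_def)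
 have ec: "continuous_on S (\<lambda>x. \<eta> x t)" for t S
 proof -
  have "continuous_on S (\<lambda>x. (x, t))" by (intro continuous_intros)
  from continuous_on_compose2[OF e this] show ?thesis by simp
 qed
 have eL: "(\<lambda>x. \<eta> x t) \<in> L2 {0..1}" for t by (rule L2_continuous[OF ec])
 show ai: "(\<lambda>x. w x t * \<eta> x t) absolutely_integrable_on {0..1}" if "t \<ge> 0" for t
  by (rule L2_mult[OF interval01_sets L[OF that] eL])
 show "continuous_on {0..} (\<lambda>t. integral {0..1} (\<lambda>x. w x t * \<eta> x t))"
  unfolding continuous_on_def
 proof
  fix t :: real assume t: "t \<in> {0..}"
  define A where "A s = integral {0..1} (\<lambda>x. (w x s - w x t)\<^sup>2)" for s
  define C where "C = integral {0..1} (\<lambda>x. (w x t)\<^sup>2)"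
  have C0: "0 \<le> C" unfolding C_def using L[of t] t by (intro integral_nonneg) (auto simp: L2_iff)
  have A: "(A \<longlongrightarrow> 0) (at t within {0..})" using w t by (simp add: L2cont_def A_def[abs_def])
  define Q where "Q = {0..1::real} \<times> {t - 1..t + 1}"
  have Qc: "compact Q" unfolding Q_def by (intro compact_Times) auto
  have eQ: "continuous_on Q (\<lambda>z. \<eta> (fst z) (snd z))" by (rule continuous_on_subset[OF e]) simp
  have "bounded ((\<lambda>z. \<eta> (fst z) (snd z)) ` Q)"
   by (intro compact_imp_bounded compact_continuous_image eQ Qc)
  then obtain M where M: "\<And>z. z \<in> Q \<Longrightarrow> \<bar>\<eta> (fst z) (snd z)\<bar> \<le> M"
   unfolding bounded_iff by (metis imageI real_norm_def)
  have uc: "uniformly_continuous_on Q (\<lambda>z. \<eta> (fst z) (snd z))"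
   by (rule compact_uniformly_continuous[OF eQ Qc])
  show "((\<lambda>t. integral {0..1} (\<lambda>x. w x t * \<eta> x t)) \<longlongrightarrow> integral {0..1} (\<lambda>x. w x t * \<eta> x t)) (at t within {0..})"
  proof (rule tendstoI)
   fix \<epsilon> :: real assume \<epsilon>: "\<epsilon> > 0"
   define d where "d = sqrt (\<epsilon>\<^sup>2 / (8 * (C + 1)))"
   have d: "d > 0" "d\<^sup>2 = \<epsilon>\<^sup>2 / (8 * (C + 1))" using \<epsilon> C0 by (auto simp: d_def)
   obtain r where r: "r > 0" "\<And>z z'. z \<in> Q \<Longrightarrow> z' \<in> Q \<Longrightarrow> dist z' z < r \<Longrightarrow> \<bar>\<eta> (fst z') (snd z') - \<eta> (fst z) (snd z)\<bar> < d"
    using uc d(1) unfolding uniformly_continuous_on_def dist_real_def by meson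
   have "0 < \<epsilon>\<^sup>2 / (8 * (M\<^sup>2 + 1))" using \<epsilon> by (intro divide_pos_pos) (auto intro: add_nonneg_pos)
   then have "\<forall>\<^sub>F s in at t within {0..}. A s < \<epsilon>\<^sup>2 / (8 * (M\<^sup>2 + 1))"
    using A by (intro order_tendstoD(2))
   moreover have "\<forall>\<^sub>F s in at t within {0..}. s \<in> {0..} \<and> \<bar>s - t\<bar> < min r 1"
    unfolding eventually_at using r(1) by (intro exI[of _ "min r 1"]) (auto simp: dist_real_def)
   ultimately show "\<forall>\<^sub>F s in at t within {0..}. dist (integral {0..1} (\<lambda>x. w x s * \<eta> x s)) (integral {0..1} (\<lambda>x. w x t * \<eta> x t)) < \<epsilon>"
   proof eventually_elim
    case (elim s)
    have s: "s \<ge> 0" "\<bar>s - t\<bar> < r" "\<bar>s - t\<bar> < 1" using elim by auto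
    have Ls: "(\<lambda>x. w x s - w x t) \<in> L2 {0..1}" using L s t by (intro L2_diff) auto
    have Le: "(\<lambda>x. \<eta> x s - \<eta> x t) \<in> L2 {0..1}" using eL by (intro L2_diff) auto
    define I1 I2 where "I1 = integral {0..1} (\<lambda>x. (w x s - w x t) * \<eta> x s)" and "I2 = integral {0..1} (\<lambda>x. w x t * (\<eta> x s - \<eta> x t))"
    have ii: "(\<lambda>x. (w x s - w x t) * \<eta> x s) integrable_on {0..1}" "(\<lambda>x. w x t * (\<eta> x s - \<eta> x t)) integrable_on {0..1}"
     using absint_int[OF L2_mult[OF interval01_sets Ls eL]] absint_int[OF L2_mult[OF interval01_sets L[of t] Le]] t by auto
    have "integral {0..1} (\<lambda>x. w x s * \<eta> x s) - integral {0..1} (\<lambda>x. w x t * \<eta> x t)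
      = integral {0..1} (\<lambda>x. w x s * \<eta> x s - w x t * \<eta> x t)"
     using ai[of s] ai[of t] s t by (intro integral_diff[symmetric] absint_int) auto
    also have "\<dots> = I1 + I2"
     unfolding I1_def I2_def integral_add[OF ii, symmetric]
     by (rule integral_cong_on) (simp add: algebra_simps)
    finally have eq: "integral {0..1} (\<lambda>x. w x s * \<eta> x s) - integral {0..1} (\<lambda>x. w x t * \<eta> x t) = I1 + I2" .
    have inQ: "(x, s) \<in> Q" "(x, t) \<in> Q" if "x \<in> {0..1}" for x using that s by (auto simp: Q_def)
    have b1: "I1\<^sup>2 \<le> A s * M\<^sup>2"
    proof -
     have "I1\<^sup>2 \<le> A s * integral {0..1} (\<lambda>x. (\<eta> x s)\<^sup>2)"
      unfolding I1_def A_def by (rule Cauchy_Schwarz_L2[OF interval01_sets Ls eL])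
     also have "\<dots> \<le> A s * integral {0..1::real} (\<lambda>x. M\<^sup>2)"
     proof (intro mult_left_mono integral_le)
      show "(\<lambda>x. (\<eta> x s)\<^sup>2) integrable_on {0..1}" using eL[of s] by (simp add: L2_iff)
      show "(\<eta> x s)\<^sup>2 \<le> M\<^sup>2" if "x \<in> {0..1}" for x
       using M[OF inQ(1)[OF that]] by (metis abs_le_square_iff abs_of_nonneg abs_ge_zero order_trans fst_conv snd_conv)
      show "0 \<le> A s" unfolding A_def using Ls by (intro integral_nonneg) (auto simp: L2_iff)
     qed auto
     finally show ?thesis by simp
    qed
    have b2: "I2\<^sup>2 \<le> C * d\<^sup>2"
    proof -
     have "I2\<^sup>2 \<le> C * integral {0..1} (\<lambda>x. (\<eta> x s - \<eta> x t)\<^sup>2)"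
      unfolding I2_def C_def using L[of t] t by (intro Cauchy_Schwarz_L2[OF interval01_sets _ Le]) auto
     also have "\<dots> \<le> C * integral {0..1::real} (\<lambda>x. d\<^sup>2)"
     proof (intro mult_left_mono integral_le)
      show "(\<lambda>x. (\<eta> x s - \<eta> x t)\<^sup>2) integrable_on {0..1}" using Le by (simp add: L2_iff)
      fix x :: real assume x: "x \<in> {0..1}"
      have "\<bar>\<eta> x s - \<eta> x t\<bar> < d"
       using r(2)[OF inQ(2)[OF x] inQ(1)[OF x]] s by (simp add: dist_Pair_Pair dist_real_def)
      then show "(\<eta> x s - \<eta> x t)\<^sup>2 \<le> d\<^sup>2" using d(1) abs_le_square_iff[of "\<eta> x s - \<eta> x t" d] by simp
     qed (use C0 in auto)
     finally show ?thesis by simp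
    qed
    have "C * d\<^sup>2 \<le> \<epsilon>\<^sup>2 / 8" unfolding d(2) using C0 \<epsilon> by (simp add: field_simps)
    moreover have "A s * M\<^sup>2 \<le> \<epsilon>\<^sup>2 / 8"
    proof -
     have "A s * M\<^sup>2 \<le> \<epsilon>\<^sup>2 / (8 * (M\<^sup>2 + 1)) * M\<^sup>2" using elim by (intro mult_right_mono) auto
     also have "\<dots> = \<epsilon>\<^sup>2 / 8 * (M\<^sup>2 / (M\<^sup>2 + 1))" by simp
     also have "\<dots> \<le> \<epsilon>\<^sup>2 / 8 * 1" by (intro mult_left_mono) (auto simp: divide_le_eq_1 add_nonneg_pos)
     also have "\<dots> = \<epsilon>\<^sup>2 / 8" by simp
     finally show ?thesis .
    qed
    moreover have "(I1 + I2)\<^sup>2 \<le> 2 * I1\<^sup>2 + 2 * I2\<^sup>2"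
    proof -
     have "0 \<le> (I1 - I2)\<^sup>2" by simp
     then show ?thesis by (simp add: power2_sum power2_diff)
    qed
    moreover have "0 < \<epsilon>\<^sup>2" using \<epsilon> by simp
    ultimately have "(I1 + I2)\<^sup>2 < \<epsilon>\<^sup>2" using b1 b2 by linarith
    then have "\<bar>I1 + I2\<bar> < \<epsilon>" using \<epsilon> power2_less_imp_less[of "\<bar>I1 + I2\<bar>" \<epsilon>] by simp
    then show ?case using eq by (simp add: dist_real_def)
   qed
  qed
 qed
qed

lemma pairing_eq:
 assumes w: "L2cont w" and D: "smooth2 D" and s: "supported D a b p q"
 shows "pairing w (D i j) = integral {p..q} (\<lambda>t. integral {0..1} (\<lambda>x. w x t * D i j x t))"
  "continuous_on {p..q} (\<lambda>t. integral {0..1} (\<lambda>x. w x t * D i j x t))"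
  "\<And>t. t \<ge> 0 \<Longrightarrow> (\<lambda>x. w x t * D i j x t) absolutely_integrable_on {0..1}"
proof -
 have pq: "0 < p" "p < q" using s by (auto simp: supported_def)
 note c = L2cont_pairing_continuous[OF w smooth2_cont[OF D, of i j]]
 show ai: "\<And>t. t \<ge> 0 \<Longrightarrow> (\<lambda>x. w x t * D i j x t) absolutely_integrable_on {0..1}" by (rule c(2))
 show cc: "continuous_on {p..q} (\<lambda>t. integral {0..1} (\<lambda>x. w x t * D i j x t))"
  by (rule continuous_on_subset[OF c(1)]) (use pq in auto)
 have "pairing w (D i j) = (LINT t|lebesgue_on {0..}. integral {0..1} (\<lambda>x. w x t * D i j x t))"
  unfolding pairing_def
 proof (rule Bochner_Integration.integral_cong)
  fix t :: real assume "t \<in> space (lebesgue_on {0..})"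
  then have "t \<ge> 0" by simp
  from ai[OF this] show "(LINT x|lebesgue_on {0..1}. w x t * D i j x t) = integral {0..1} (\<lambda>x. w x t * D i j x t)"
   by (intro lebesgue_integral_eq_integral) (auto simp: integrable_lebesgue_on_iff)
 qed simp
 also have "\<dots> = integral {p..q} (\<lambda>t. integral {0..1} (\<lambda>x. w x t * D i j x t))"
 proof (rule LINT_support)
  show "(\<lambda>t. integral {0..1} (\<lambda>x. w x t * D i j x t)) absolutely_integrable_on {p..q}"
   by (rule absolutely_integrable_continuous_real[OF cc])
  fix t assume "t \<notin> {p..q}"
  then have "w x t * D i j x t = 0" for x using s by (auto simp: supported_def)
  then have "(\<lambda>x. w x t * D i j x t) = (\<lambda>x. 0)" by (rule ext)
  then show "integral {0..1} (\<lambda>x. w x t * D i j x t) = 0" by simp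
 qed (use pq in auto)
 finally show "pairing w (D i j) = integral {p..q} (\<lambda>t. integral {0..1} (\<lambda>x. w x t * D i j x t))" .
qed

lemma L2cont_lincomb:
 assumes "L2cont w" "L2cont v" shows "L2cont (\<lambda>x t. c * w x t + e * v x t)"
 unfolding L2cont_def
proof (intro allI impI conjI)
 fix t :: real assume t: "t \<ge> 0"
 have L: "(\<lambda>x. w x s) \<in> L2 {0..1}" "(\<lambda>x. v x s) \<in> L2 {0..1}" if "s \<ge> 0" for s
  using assms that by (auto simp: L2cont_def)
 show "(\<lambda>x. c * w x t + e * v x t) \<in> L2 {0..1}" using L t by (intro L2_add L2_cmult) auto
 let ?A = "\<lambda>s. integral {0..1} (\<lambda>x. (w x s - w x t)\<^sup>2)" and ?B = "\<lambda>s. integral {0..1} (\<lambda>x. (v x s - v x t)\<^sup>2)"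
 have "((\<lambda>s. 2 * c\<^sup>2 * ?A s + 2 * e\<^sup>2 * ?B s) \<longlongrightarrow> 2 * c\<^sup>2 * 0 + 2 * e\<^sup>2 * 0) (at t within {0..})"
  using assms t by (intro tendsto_intros) (auto simp: L2cont_def)
 then have lim: "((\<lambda>s. 2 * c\<^sup>2 * ?A s + 2 * e\<^sup>2 * ?B s) \<longlongrightarrow> 0) (at t within {0..})" by simp
 show "((\<lambda>s. integral {0..1} (\<lambda>x. (c * w x s + e * v x s - (c * w x t + e * v x t))\<^sup>2)) \<longlongrightarrow> 0) (at t within {0..})"
 proof (rule tendsto_sandwich[OF _ _ tendsto_const lim])
  have ev: "\<forall>\<^sub>F s in at t within {0..}. s \<in> {0..}" by (simp add: eventually_at_filter)
  have Ls: "(\<lambda>x. w x s - w x t) \<in> L2 {0..1}" "(\<lambda>x. v x s - v x t) \<in> L2 {0..1}"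
   "(\<lambda>x. c * w x s + e * v x s - (c * w x t + e * v x t)) \<in> L2 {0..1}" if "s \<ge> 0" for s
   using L that t by (auto intro!: L2_add L2_cmult L2_diff)
  show "\<forall>\<^sub>F s in at t within {0..}. 0 \<le> integral {0..1} (\<lambda>x. (c * w x s + e * v x s - (c * w x t + e * v x t))\<^sup>2)"
   using ev by eventually_elim (use Ls in \<open>auto simp: L2_iff intro!: integral_nonneg\<close>)
  show "\<forall>\<^sub>F s in at t within {0..}. integral {0..1} (\<lambda>x. (c * w x s + e * v x s - (c * w x t + e * v x t))\<^sup>2)
    \<le> 2 * c\<^sup>2 * ?A s + 2 * e\<^sup>2 * ?B s"
   using ev
  proof eventually_elim
   case (elim s)
   then have s: "s \<ge> 0" by simp
   have i: "(\<lambda>x. (w x s - w x t)\<^sup>2) integrable_on {0..1}" "(\<lambda>x. (v x s - v x t)\<^sup>2) integrable_on {0..1}"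
    using Ls(1,2)[OF s] by (auto simp: L2_iff)
   have "((\<lambda>x. 2 * c\<^sup>2 * (w x s - w x t)\<^sup>2 + 2 * e\<^sup>2 * (v x s - v x t)\<^sup>2) has_integral (2 * c\<^sup>2 * ?A s + 2 * e\<^sup>2 * ?B s)) {0..1}"
    by (intro has_integral_add has_integral_mult_right integrable_integral i)
   moreover have "((\<lambda>x. (c * w x s + e * v x s - (c * w x t + e * v x t))\<^sup>2) has_integral
     integral {0..1} (\<lambda>x. (c * w x s + e * v x s - (c * w x t + e * v x t))\<^sup>2)) {0..1}"
    using Ls(3)[OF s] by (intro integrable_integral) (auto simp: L2_iff)
   moreover have "(c * w x s + e * v x s - (c * w x t + e * v x t))\<^sup>2 \<le> 2 * c\<^sup>2 * (w x s - w x t)\<^sup>2 + 2 * e\<^sup>2 * (v x s - v x t)\<^sup>2" for x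
   proof -
    have "0 \<le> (c * (w x s - w x t) - e * (v x s - v x t))\<^sup>2" by simp
    then show ?thesis by (simp add: power2_eq_square algebra_simps)
   qed
   ultimately show ?case using has_integral_le by blast
  qed
 qed
qed

lemma pairing_lincomb:
 assumes w: "L2cont w" and v: "L2cont v" and t: "test_fun2 \<eta>"
 shows "pairing (\<lambda>x t. c * w x t + e * v x t) \<eta> = c * pairing w \<eta> + e * pairing v \<eta>"
proof -
 obtain D a b p q where D: "smooth2 D" "D 0 0 = \<eta>" "supported D a b p q" using test_fun2_support[OF t] .
 have p0: "p > 0" using D(3) by (simp add: supported_def)
 note e1 = pairing_eq[OF w D(1,3), where i = 0 and j = 0, unfolded D(2)] and e2 = pairing_eq[OF v D(1,3), where i = 0 and j = 0, unfolded D(2)]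
  and e3 = pairing_eq[OF L2cont_lincomb[OF w v] D(1,3), where i = 0 and j = 0, unfolded D(2)]
 have "integral {0..1} (\<lambda>x. (c * w x t + e * v x t) * \<eta> x t)
   = c * integral {0..1} (\<lambda>x. w x t * \<eta> x t) + e * integral {0..1} (\<lambda>x. v x t * \<eta> x t)" if "t \<ge> 0" for t
 proof -
  have "((\<lambda>x. c * (w x t * \<eta> x t) + e * (v x t * \<eta> x t)) has_integral
   (c * integral {0..1} (\<lambda>x. w x t * \<eta> x t) + e * integral {0..1} (\<lambda>x. v x t * \<eta> x t))) {0..1}"
   by (intro has_integral_add has_integral_mult_right integrable_integral absint_int e1(3) e2(3) that)
  then show ?thesis by (intro integral_unique) (simp add: algebra_simps)
 qed
 then have "pairing (\<lambda>x t. c * w x t + e * v x t) \<eta>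
   = integral {p..q} (\<lambda>t. c * integral {0..1} (\<lambda>x. w x t * \<eta> x t) + e * integral {0..1} (\<lambda>x. v x t * \<eta> x t))"
  unfolding e3(1) using p0 by (intro integral_cong_on) auto
 also have "\<dots> = c * pairing w \<eta> + e * pairing v \<eta>"
  unfolding e1(1) e2(1)
  by (intro integral_unique has_integral_add has_integral_mult_right integrable_integral integrable_continuous_real e1(2) e2(2))
 finally show ?thesis .
qed

section \<open>Travelling waves\<close>

lemma travelling_sqint:
 assumes h: "h \<in> locL2" and s: "\<sigma> = 1 \<or> \<sigma> = - 1"
 shows "sqint 0 1 (\<lambda>x. h (t + \<sigma> * x)) = sqint (min t (t + \<sigma>)) (max t (t + \<sigma>)) h"
 using s sqint_shift[OF h, of 0 1 t] sqint_reflect[OF h, of 0 1 t] by (auto simp: add.commute)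

lemma travelling_L2cont:
 assumes h: "h \<in> locL2" and s: "\<sigma> = 1 \<or> \<sigma> = - 1"
 shows "L2cont (\<lambda>x t. h (t + \<sigma> * x))"
 unfolding L2cont_def
proof (intro allI impI conjI)
 fix t :: real
 have s0: "\<sigma> \<noteq> 0" using s by auto
 show "(\<lambda>x. h (t + \<sigma> * x)) \<in> L2 {0..1}" by (rule locL2_D[OF locL2_affine[OF h s0]])
 have "((\<lambda>k. sqint (t - 1) (t + 1) (\<lambda>u. h (u + k) - h u)) \<longlongrightarrow> 0) (at 0)" by (rule translation_L2[OF h])
 then have "((\<lambda>r. sqint (t - 1) (t + 1) (\<lambda>u. h (u + (r - t)) - h u)) \<longlongrightarrow> 0) (at t)"
  by (auto dest: LIM_offset[where k = "- t"])
 then have lim: "((\<lambda>r. sqint (t - 1) (t + 1) (\<lambda>u. h (u + (r - t)) - h u)) \<longlongrightarrow> 0) (at t within {0..})"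
  by (rule tendsto_mono[OF at_le, rotated]) simp
 show "((\<lambda>r. integral {0..1} (\<lambda>x. (h (r + \<sigma> * x) - h (t + \<sigma> * x))\<^sup>2)) \<longlongrightarrow> 0) (at t within {0..})"
 proof (rule tendsto_sandwich[OF _ _ tendsto_const lim]; intro always_eventually allI)
  fix r :: real
  have L: "(\<lambda>u. h (u + (r - t)) - h u) \<in> locL2"
   using locL2_affine[OF h, of 1 "r - t"] h by (intro locL2_diff) (auto simp: add.commute)
  have eq: "integral {0..1} (\<lambda>x. (h (r + \<sigma> * x) - h (t + \<sigma> * x))\<^sup>2) = sqint 0 1 (\<lambda>x. h ((t + \<sigma> * x) + (r - t)) - h (t + \<sigma> * x))"
   by (simp add: sqint_def algebra_simps)
  show "0 \<le> integral {0..1} (\<lambda>x. (h (r + \<sigma> * x) - h (t + \<sigma> * x))\<^sup>2)" unfolding eq by (rule sqint_nonneg)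
  show "integral {0..1} (\<lambda>x. (h (r + \<sigma> * x) - h (t + \<sigma> * x))\<^sup>2) \<le> sqint (t - 1) (t + 1) (\<lambda>u. h (u + (r - t)) - h u)"
   unfolding eq travelling_sqint[OF L s, of t] using s by (intro sqint_mono[OF L]) auto
 qed
qed

text \<open>In the coordinate $y=t+\sigma x$ the pairing with \<open>\<phi>\<close> depends on \<open>t\<close> through the test function
 only, and integration of its derivative over all times gives zero.\<close>

lemma transport_pairing:
 assumes c: "continuous_on UNIV \<phi>" and s: "\<sigma> = 1 \<or> \<sigma> = - 1" and t: "test_fun2 \<eta>"
 shows "pairing (\<lambda>x t. \<phi> (t + \<sigma> * x)) (dt \<eta>) = \<sigma> * pairing (\<lambda>x t. \<phi> (t + \<sigma> * x)) (dx \<eta>)"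
proof -
 obtain D a b p q where D: "smooth2 D" "D 0 0 = \<eta>" "supported D a b p q" using test_fun2_support[OF t] .
 have sp: "0 < a" "a < b" "b < 1" "0 < p" "p < q" "\<And>i j x t. x \<notin> {a<..<b} \<or> t \<notin> {p<..<q} \<Longrightarrow> D i j x t = 0"
  using D(3) unfolding supported_def by blast+
 let ?w = "\<lambda>x t. \<phi> (t + \<sigma> * x)"
 have s2: "\<sigma> * \<sigma> = 1" and s0: "\<sigma> \<noteq> 0" using s by auto
 have wL: "L2cont ?w" by (rule travelling_L2cont[OF locL2_continuous[OF c] s])
 have cv: "integral {0..1} (\<lambda>x. \<phi> (t + \<sigma> * x) * e x) = integral {p - 1..q + 1} (\<lambda>y. \<phi> y * e (\<sigma> * (y - t)))"
  if t: "t \<in> {p..q}" and e: "continuous_on UNIV e" "\<And>x. x \<notin> {0<..<1} \<Longrightarrow> e x = 0" for t e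
 proof -
  define f where "f y = \<phi> y * e (\<sigma> * (y - t))" for y
  have fc: "continuous_on UNIV f"
   unfolding f_def by (intro continuous_intros c continuous_on_compose2[OF e(1)]) auto
  obtain P where P: "prim P f" using prim_exists[of f] continuous_absint[OF fc] by blast
  have P': "prim (\<lambda>x. P (t + \<sigma> * x)) (\<lambda>x. \<sigma> * f (t + \<sigma> * x))" by (rule prim_affine[OF P s0])
  have fx: "f (t + \<sigma> * x) = \<phi> (t + \<sigma> * x) * e x" for x
  proof -
   have "\<sigma> * (t + \<sigma> * x - t) = x" using s by auto
   then show ?thesis unfolding f_def by (simp only:)
  qed
  have "(\<lambda>x. \<sigma> * (\<sigma> * f (t + \<sigma> * x))) = (\<lambda>x. \<phi> (t + \<sigma> * x) * e x)"
   unfolding fx using s by auto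
  then have "prim (\<lambda>x. \<sigma> * P (t + \<sigma> * x)) (\<lambda>x. \<phi> (t + \<sigma> * x) * e x)"
   using prim_cmult[OF P', of \<sigma>] by (simp only:)
  from prim_integral[OF this, of 0 1]
  have 1: "integral {0..1} (\<lambda>x. \<phi> (t + \<sigma> * x) * e x) = \<sigma> * P (t + \<sigma>) - \<sigma> * P t" by simp
  define lo where "lo = min t (t + \<sigma>)"
  have lo: "{lo..lo + 1} \<subseteq> {p - 1..q + 1}" "p - 1 \<le> lo" "lo + 1 \<le> q + 1" using s t by (auto simp: lo_def)
  have 2: "\<sigma> * P (t + \<sigma>) - \<sigma> * P t = integral {lo..lo + 1} f"
   using s prim_integral[OF P, of lo "lo + 1"] by (auto simp: lo_def)
  have "(f has_integral integral {lo..lo + 1} f) {p - 1..q + 1}"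
  proof (rule has_integral_on_superset[OF integrable_integral[OF prim_int[OF P]] _ lo(1)])
   fix y assume "y \<notin> {lo..lo + 1}"
   then have "\<sigma> * (y - t) \<notin> {0<..<1}" using s by (auto simp: lo_def)
   then show "f y = 0" using e(2) by (simp add: f_def)
  qed
  then show ?thesis using 1 2 unfolding f_def by (simp add: integral_unique)
 qed
 have Dx: "continuous_on UNIV (\<lambda>x. D i j x t)" for i j t
  by (intro smooth2_cont_comp[OF D(1)] continuous_intros)
 have Dz: "D i j x t = 0" if "x \<notin> {0<..<1}" for i j x t using sp that by force
 define F where "F t = integral (cbox (p - 1) (q + 1)) (\<lambda>y. \<phi> y * D 0 0 (\<sigma> * (y - t)) t)" for t
 have dF: "(F has_real_derivative integral (cbox (p - 1) (q + 1))
   (\<lambda>y. \<phi> y * (D 0 1 (\<sigma> * (y - t)) t - \<sigma> * D 1 0 (\<sigma> * (y - t)) t))) (at t within UNIV)" for t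
  unfolding F_def
 proof (rule leibniz_rule_field_derivative)
  fix t y :: real
  have d1: "((\<lambda>z. D 0 0 (fst z) (snd z)) has_derivative (\<lambda>h. fst h * D 1 0 x t + snd h * D 0 1 x t)) (at (x, t))" for x t
  proof -
   have fx: "((\<lambda>x. D 0 0 x t) has_derivative (\<lambda>h. D 1 0 x t * h)) (at x)"
    using D(1) unfolding smooth2_def has_field_derivative_def by simp
   have fy: "((\<lambda>t. D 0 0 x t) has_derivative blinfun_apply (blinfun_mult_right (D 0 1 x t))) (at t)" for x t
    using D(1) unfolding smooth2_def has_field_derivative_def by simp
   have "isCont (\<lambda>z. D 0 1 (fst z) (snd z)) (x, t)"
    using smooth2_cont[OF D(1), of 0 1] by (simp add: continuous_on_eq_continuous_at)
   then have cont: "((\<lambda>z. blinfun_mult_right (D 0 1 (fst z) (snd z))) \<longlongrightarrow> blinfun_mult_right (D 0 1 x t)) (at (x, t))"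
    unfolding isCont_def by (auto intro!: tendsto_intros bounded_linear.tendsto[OF bounded_linear_blinfun_mult_right])
   have "((\<lambda>(x, t). D 0 0 x t) has_derivative (\<lambda>(hx, ht). D 1 0 x t * hx + blinfun_apply (blinfun_mult_right (D 0 1 x t)) ht)) (at (x, t) within UNIV \<times> UNIV)"
    by (rule has_derivative_partialsI[where fy = "\<lambda>x t. blinfun_mult_right (D 0 1 x t)"])
     (use fx fy cont in \<open>simp_all add: case_prod_beta' isCont_def\<close>)
   then show ?thesis by (simp add: case_prod_beta' mult.commute)
  qed
  have "((\<lambda>t. (\<sigma> * (y - t), t)) has_derivative (\<lambda>h. (- \<sigma> * h, h))) (at t)"
   by (auto intro!: derivative_eq_intros)
  from has_derivative_compose[OF this d1]
  have "((\<lambda>t. D 0 0 (\<sigma> * (y - t)) t) has_derivative (\<lambda>h. - \<sigma> * h * D 1 0 (\<sigma> * (y - t)) t + h * D 0 1 (\<sigma> * (y - t)) t)) (at t)"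
   by simp
  then have "((\<lambda>t. D 0 0 (\<sigma> * (y - t)) t) has_real_derivative (D 0 1 (\<sigma> * (y - t)) t - \<sigma> * D 1 0 (\<sigma> * (y - t)) t)) (at t)"
   unfolding has_field_derivative_def by (rule has_derivative_eq_rhs) (auto simp: fun_eq_iff algebra_simps)
  then show "((\<lambda>t. \<phi> y * D 0 0 (\<sigma> * (y - t)) t) has_real_derivative \<phi> y * (D 0 1 (\<sigma> * (y - t)) t - \<sigma> * D 1 0 (\<sigma> * (y - t)) t)) (at t within UNIV)"
   by (rule DERIV_cmult)
 next
  fix t :: real
  show "(\<lambda>y. \<phi> y * D 0 0 (\<sigma> * (y - t)) t) integrable_on cbox (p - 1) (q + 1)"
   by (rule integrable_continuous)
    (intro continuous_intros smooth2_cont_comp[OF D(1)] continuous_on_subset[OF c] subset_UNIV)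
 next
  have "continuous_on (UNIV \<times> cbox (p - 1) (q + 1)) (\<lambda>z. \<phi> (snd z) * (D 0 1 (\<sigma> * (snd z - fst z)) (fst z) - \<sigma> * D 1 0 (\<sigma> * (snd z - fst z)) (fst z)))"
   by (intro continuous_intros smooth2_cont_comp[OF D(1)] continuous_on_compose2[OF c]) auto
  then show "continuous_on (UNIV \<times> cbox (p - 1) (q + 1)) (\<lambda>(t, y). \<phi> y * (D 0 1 (\<sigma> * (y - t)) t - \<sigma> * D 1 0 (\<sigma> * (y - t)) t))"
   by (simp add: case_prod_beta')
 qed auto
 have iD: "(\<lambda>x. ?w x t * D i j x t) integrable_on {0..1}" if "t \<in> {p..q}" for i j t
  using pairing_eq(3)[OF wL D(1,3), of t i j] that sp(4) by (intro absint_int) auto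
 have inner: "integral (cbox (p - 1) (q + 1)) (\<lambda>y. \<phi> y * (D 0 1 (\<sigma> * (y - t)) t - \<sigma> * D 1 0 (\<sigma> * (y - t)) t))
   = integral {0..1} (\<lambda>x. ?w x t * D 0 1 x t) - \<sigma> * integral {0..1} (\<lambda>x. ?w x t * D 1 0 x t)" if t: "t \<in> {p..q}" for t
 proof -
  have "integral {0..1} (\<lambda>x. \<phi> (t + \<sigma> * x) * (D 0 1 x t - \<sigma> * D 1 0 x t))
    = integral {p - 1..q + 1} (\<lambda>y. \<phi> y * (D 0 1 (\<sigma> * (y - t)) t - \<sigma> * D 1 0 (\<sigma> * (y - t)) t))"
   by (rule cv[OF t]) (auto intro!: continuous_intros Dx simp: Dz)
  moreover have "((\<lambda>x. ?w x t * D 0 1 x t - \<sigma> * (?w x t * D 1 0 x t)) has_integral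
    (integral {0..1} (\<lambda>x. ?w x t * D 0 1 x t) - \<sigma> * integral {0..1} (\<lambda>x. ?w x t * D 1 0 x t))) {0..1}"
   by (intro has_integral_diff has_integral_mult_right integrable_integral iD t)
  then have "integral {0..1} (\<lambda>x. \<phi> (t + \<sigma> * x) * (D 0 1 x t - \<sigma> * D 1 0 x t))
    = integral {0..1} (\<lambda>x. ?w x t * D 0 1 x t) - \<sigma> * integral {0..1} (\<lambda>x. ?w x t * D 1 0 x t)"
   by (intro integral_unique) (simp add: algebra_simps)
  ultimately show ?thesis by simp
 qed
 have FTC: "((\<lambda>t. integral (cbox (p - 1) (q + 1)) (\<lambda>y. \<phi> y * (D 0 1 (\<sigma> * (y - t)) t - \<sigma> * D 1 0 (\<sigma> * (y - t)) t)))
   has_integral (F q - F p)) {p..q}"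
  using sp(5) dF by (intro fundamental_theorem_of_calculus)
   (auto simp: has_real_derivative_iff_has_vector_derivative[symmetric] intro: has_field_derivative_at_within)
 have F0: "F q - F p = 0" using sp(6) by (auto simp: F_def)
 have "((\<lambda>t. integral {0..1} (\<lambda>x. ?w x t * D 0 1 x t) - \<sigma> * integral {0..1} (\<lambda>x. ?w x t * D 1 0 x t)) has_integral 0) {p..q}"
  by (rule has_integral_eq[OF inner FTC[unfolded F0]])
 moreover have "((\<lambda>t. integral {0..1} (\<lambda>x. ?w x t * D 0 1 x t) - \<sigma> * integral {0..1} (\<lambda>x. ?w x t * D 1 0 x t)) has_integral
   (pairing ?w (D 0 1) - \<sigma> * pairing ?w (D 1 0))) {p..q}"
  unfolding pairing_eq(1)[OF wL D(1,3)]
  by (intro has_integral_diff has_integral_mult_right integrable_integral integrable_continuous_real pairing_eq(2)[OF wL D(1,3)])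
 ultimately have "pairing ?w (D 0 1) - \<sigma> * pairing ?w (D 1 0) = 0" using has_integral_unique by blast
 moreover have "dt \<eta> = D 0 1" "dx \<eta> = D 1 0" using smooth2_deriv[OF D(1), of 0 0] D(2) by auto
 ultimately show ?thesis by simp
qed

text \<open>The weak derivative in \<open>x\<close> under the pairing.\<close>

lemma pairing_dx:
 assumes w: "L2cont w" and v: "L2cont v" and t: "test_fun2 \<eta>"
  and wd: "\<And>t. t \<ge> 0 \<Longrightarrow> \<exists>\<Phi> g. prim \<Phi> g \<and> (\<forall>x\<in>{0..1}. w x t = \<Phi> x) \<and> (AE x in lebesgue_on {0..1}. v x t = g x)"
 shows "pairing w (dx \<eta>) = - pairing v \<eta>"
proof -
 obtain D a b p q where D: "smooth2 D" "D 0 0 = \<eta>" "supported D a b p q" using test_fun2_support[OF t] .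
 have sp: "0 < a" "a < b" "b < 1" "0 < p" "p < q" "\<And>i j x t. x \<notin> {a<..<b} \<or> t \<notin> {p<..<q} \<Longrightarrow> D i j x t = 0"
  using D(3) unfolding supported_def by blast+
 have inner: "integral {0..1} (\<lambda>x. w x t * D 1 0 x t) = - integral {0..1} (\<lambda>x. v x t * D 0 0 x t)" if t0: "t \<ge> 0" for t
 proof -
  obtain \<Phi> g where P: "prim \<Phi> g" and eq: "\<forall>x\<in>{0..1}. w x t = \<Phi> x" and ae: "AE x in lebesgue_on {0..1}. v x t = g x"
   using wd[OF t0] by blast
  have sm: "smooth_seq (\<lambda>i x. D i 0 x t)" using D(1) by (simp add: smooth_seq_def smooth2_def)
  have "integral {0..1} (\<lambda>x. \<Phi> x * D 1 0 x t) = - integral {0..1} (\<lambda>x. g x * D 0 0 x t)"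
   by (rule prim_test[OF P sm]) (use sp in force)+
  moreover have "integral {0..1} (\<lambda>x. \<Phi> x * D 1 0 x t) = integral {0..1} (\<lambda>x. w x t * D 1 0 x t)"
   by (rule integral_cong_on) (use eq in auto)
  moreover have "integral {0..1} (\<lambda>x. g x * D 0 0 x t) = integral {0..1} (\<lambda>x. v x t * D 0 0 x t)"
  proof -
   have "AE x in lebesgue. x \<in> {0..1} \<longrightarrow> v x t = g x" using ae by (simp add: AE_restrict_space_iff)
   then obtain N where N: "N \<in> null_sets lebesgue" "{x. \<not> (x \<in> {0..1} \<longrightarrow> v x t = g x)} \<subseteq> N"
    unfolding eventually_ae_filter by auto
   show ?thesis by (rule integral_spike[of N]) (use N in \<open>auto simp: negligible_iff_null_sets\<close>)
  qed
  ultimately show ?thesis by simp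
 qed
 have "pairing w (D 1 0) = integral {p..q} (\<lambda>t. - integral {0..1} (\<lambda>x. v x t * D 0 0 x t))"
  unfolding pairing_eq(1)[OF w D(1,3)]
  by (rule integral_cong_on) (use inner sp(4) in auto)
 then show ?thesis
  unfolding D(2)[symmetric] smooth2_deriv(1)[OF D(1)] by (simp add: pairing_eq(1)[OF v D(1,3)])
qed

section \<open>Traces\<close>

lemma L2norm_integral: "S \<in> sets lebesgue \<Longrightarrow> f \<in> L2 S \<Longrightarrow> L2norm S f = sqrt (integral S (\<lambda>x. (f x)\<^sup>2))"
 by (simp add: L2norm_def integral_sq_eq)

lemma L2norm_nonneg: "S \<in> sets lebesgue \<Longrightarrow> f \<in> L2 S \<Longrightarrow> 0 \<le> L2norm S f"
 by (auto simp: L2norm_integral L2_iff intro: integral_nonneg)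

lemma L2norm_cmult: "L2norm S (\<lambda>x. c * f x) = \<bar>c\<bar> * L2norm S f"
 by (simp add: L2norm_def power_mult_distrib real_sqrt_mult)

lemma L2norm_cong_AE:
 assumes "S \<in> sets lebesgue" "f \<in> L2 S" "AE x in lebesgue_on S. f x = g x"
 shows "g \<in> L2 S" "L2norm S g = L2norm S f"
 using L2_cong_AE[OF assms] assms by (simp_all add: L2norm_integral)

lemma AE_halfline_subset:
 assumes "AE t in lebesgue_on {0::real..}. P t" shows "AE t in lebesgue_on {0..\<tau>}. P t"
proof -
 have "AE t in lebesgue. t \<in> {0..} \<longrightarrow> P t" using assms by (simp add: AE_restrict_space_iff)
 then have "AE t in lebesgue. t \<in> {0..\<tau>} \<longrightarrow> P t" by eventually_elim auto
 then show ?thesis by (simp add: AE_restrict_space_iff)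
qed

lemma AE_halfline_I:
 assumes "\<And>\<tau>. \<tau> > 0 \<Longrightarrow> AE t in lebesgue_on {0::real..\<tau>}. P t" shows "AE t in lebesgue_on {0..}. P t"
proof -
 have "AE t in lebesgue. t \<in> {0..real (Suc n)} \<longrightarrow> P t" for n
  using assms[of "real (Suc n)"] by (simp add: AE_restrict_space_iff)
 then have "AE t in lebesgue. \<forall>n. t \<in> {0..real (Suc n)} \<longrightarrow> P t" unfolding AE_all_countable by blast
 then have "AE t in lebesgue. t \<in> {0..} \<longrightarrow> P t"
 proof eventually_elim
  case (elim t)
  obtain n where "t < real n" using reals_Archimedean2 by blast
  then show ?case using elim[rule_format, of n] by auto
 qed
 then show ?thesis by (simp add: AE_restrict_space_iff)
qed

lemma L2loc_D: "g \<in> L2loc \<Longrightarrow> \<tau> > 0 \<Longrightarrow> g \<in> L2 {0..\<tau>}" by (simp add: L2loc_def)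

lemma locL2_L2loc: "h \<in> locL2 \<Longrightarrow> h \<in> L2loc" by (simp add: L2loc_def locL2_D)

lemma L2loc_lincomb: "g \<in> L2loc \<Longrightarrow> k \<in> L2loc \<Longrightarrow> (\<lambda>t. c * g t + e * k t) \<in> L2loc"
 by (auto simp: L2loc_def intro!: L2_add L2_cmult)

lemma L2loc_cong_AE:
 assumes "g \<in> L2loc" "AE t in lebesgue_on {0..}. g t = k t" shows "k \<in> L2loc"
 unfolding L2loc_def mem_Collect_eq
proof (intro allI impI)
 fix \<tau> :: real assume "\<tau> > 0"
 then show "k \<in> L2 {0..\<tau>}" by (intro L2_cong_AE(1)[OF _ L2loc_D[OF assms(1)] AE_halfline_subset[OF assms(2)]]) auto
qed

lemma L2loc_extend:
 assumes "g \<in> L2loc" shows "(\<lambda>t. if t \<in> {0..} then g t else 0) \<in> locL2"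
 unfolding locL2_def mem_Collect_eq
proof (intro allI)
 fix a b :: real
 have "(\<lambda>t. if t \<in> {0..} then g t else 0) \<in> L2 {-(\<bar>a\<bar> + \<bar>b\<bar> + 1)..\<bar>a\<bar> + \<bar>b\<bar> + 1}"
  by (rule L2_indicator[OF _ _ L2loc_D[OF assms]]) auto
 then show "(\<lambda>t. if t \<in> {0..} then g t else 0) \<in> L2 {a..b}" by (rule L2_subset) auto
qed

lemma tendsto_L2loc_I:
 assumes "\<forall>\<^sub>F i in F. (\<lambda>t. G i t - g t) \<in> locL2" "\<And>\<tau>. \<tau> > 0 \<Longrightarrow> ((\<lambda>i. sqint 0 \<tau> (\<lambda>t. G i t - g t)) \<longlongrightarrow> 0) F"
 shows "tendsto_L2loc G g F"
 unfolding tendsto_L2loc_def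
proof (intro allI impI conjI)
 fix \<tau> :: real assume "\<tau> > 0"
 show "\<forall>\<^sub>F i in F. (\<lambda>t. G i t - g t) \<in> L2 {0..\<tau>}" using assms(1) by eventually_elim (rule locL2_D)
 have "((\<lambda>i. sqrt (sqint 0 \<tau> (\<lambda>t. G i t - g t))) \<longlongrightarrow> 0) F"
  using tendsto_real_sqrt[OF assms(2)[OF \<open>\<tau> > 0\<close>]] by simp
 moreover have "\<forall>\<^sub>F i in F. sqrt (sqint 0 \<tau> (\<lambda>t. G i t - g t)) = L2norm {0..\<tau>} (\<lambda>t. G i t - g t)"
  using assms(1) by eventually_elim (simp add: sqint_def L2norm_integral locL2_D)
 ultimately show "((\<lambda>i. L2norm {0..\<tau>} (\<lambda>t. G i t - g t)) \<longlongrightarrow> 0) F" by (rule Lim_transform_eventually)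
qed

lemma tendsto_L2loc_cong:
 assumes T: "tendsto_L2loc G g F" and e1: "\<forall>\<^sub>F i in F. AE t in lebesgue_on {0..}. G i t = G' i t"
  and e2: "AE t in lebesgue_on {0..}. g t = g' t"
 shows "tendsto_L2loc G' g' F"
 unfolding tendsto_L2loc_def
proof (intro allI impI conjI)
 fix \<tau> :: real assume "\<tau> > 0"
 then have 1: "\<forall>\<^sub>F i in F. (\<lambda>t. G i t - g t) \<in> L2 {0..\<tau>}" and 2: "((\<lambda>i. L2norm {0..\<tau>} (\<lambda>t. G i t - g t)) \<longlongrightarrow> 0) F"
  using T by (auto simp: tendsto_L2loc_def)
 have "\<forall>\<^sub>F i in F. AE t in lebesgue_on {0..\<tau>}. G i t - g t = G' i t - g' t"
  using e1
 proof eventually_elim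
  case (elim i)
  from AE_halfline_subset[OF elim, of \<tau>] AE_halfline_subset[OF e2, of \<tau>] show ?case by eventually_elim simp
 qed
 with 1 have *: "\<forall>\<^sub>F i in F. (\<lambda>t. G' i t - g' t) \<in> L2 {0..\<tau>} \<and> L2norm {0..\<tau>} (\<lambda>t. G' i t - g' t) = L2norm {0..\<tau>} (\<lambda>t. G i t - g t)"
 proof eventually_elim
  case (elim i)
  show ?case using L2norm_cong_AE[OF _ elim] by simp
 qed
 from * show "\<forall>\<^sub>F i in F. (\<lambda>t. G' i t - g' t) \<in> L2 {0..\<tau>}" by eventually_elim simp
 from * have "\<forall>\<^sub>F i in F. L2norm {0..\<tau>} (\<lambda>t. G i t - g t) = L2norm {0..\<tau>} (\<lambda>t. G' i t - g' t)" by eventually_elim simp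
 from Lim_transform_eventually[OF 2 this] show "((\<lambda>i. L2norm {0..\<tau>} (\<lambda>t. G' i t - g' t)) \<longlongrightarrow> 0) F" .
qed

lemma tendsto_L2loc_lincomb:
 assumes "tendsto_L2loc G g F" "tendsto_L2loc K k F"
 shows "tendsto_L2loc (\<lambda>i t. c * G i t + e * K i t) (\<lambda>t. c * g t + e * k t) F"
 unfolding tendsto_L2loc_def
proof (intro allI impI conjI)
 fix \<tau> :: real assume \<tau>: "\<tau> > 0"
 let ?f = "\<lambda>i t. G i t - g t" and ?k = "\<lambda>i t. K i t - k t"
 have eq: "(\<lambda>t. c * G i t + e * K i t - (c * g t + e * k t)) = (\<lambda>t. c * ?f i t + e * ?k i t)" for i
  by (simp add: fun_eq_iff algebra_simps)
 have ev: "\<forall>\<^sub>F i in F. ?f i \<in> L2 {0..\<tau>}" "\<forall>\<^sub>F i in F. ?k i \<in> L2 {0..\<tau>}"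
  and lim: "((\<lambda>i. L2norm {0..\<tau>} (?f i)) \<longlongrightarrow> 0) F" "((\<lambda>i. L2norm {0..\<tau>} (?k i)) \<longlongrightarrow> 0) F"
  using assms \<tau> by (auto simp: tendsto_L2loc_def)
 show "\<forall>\<^sub>F i in F. (\<lambda>t. c * G i t + e * K i t - (c * g t + e * k t)) \<in> L2 {0..\<tau>}"
  unfolding eq using ev by eventually_elim (auto intro!: L2_add L2_cmult)
 have "((\<lambda>i. \<bar>c\<bar> * L2norm {0..\<tau>} (?f i) + \<bar>e\<bar> * L2norm {0..\<tau>} (?k i)) \<longlongrightarrow> \<bar>c\<bar> * 0 + \<bar>e\<bar> * 0) F"
  by (intro tendsto_intros lim)
 then have l0: "((\<lambda>i. \<bar>c\<bar> * L2norm {0..\<tau>} (?f i) + \<bar>e\<bar> * L2norm {0..\<tau>} (?k i)) \<longlongrightarrow> 0) F" by simp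
 show "((\<lambda>i. L2norm {0..\<tau>} (\<lambda>t. c * G i t + e * K i t - (c * g t + e * k t))) \<longlongrightarrow> 0) F"
  unfolding eq
 proof (rule tendsto_sandwich[OF _ _ tendsto_const l0])
  show "\<forall>\<^sub>F i in F. 0 \<le> L2norm {0..\<tau>} (\<lambda>t. c * ?f i t + e * ?k i t)"
   using ev by eventually_elim (auto intro!: L2norm_nonneg L2_add L2_cmult)
  show "\<forall>\<^sub>F i in F. L2norm {0..\<tau>} (\<lambda>t. c * ?f i t + e * ?k i t) \<le> \<bar>c\<bar> * L2norm {0..\<tau>} (?f i) + \<bar>e\<bar> * L2norm {0..\<tau>} (?k i)"
   using ev
  proof eventually_elim
   case (elim i)
   show ?case
    using L2norm_triangle[OF _ L2_cmult[OF _ elim(1)] L2_cmult[OF _ elim(2)], of c e] by (simp add: L2norm_cmult)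
  qed
 qed
qed

lemma tendsto_L2loc_unique:
 assumes F: "F \<noteq> bot" and g: "tendsto_L2loc G g F" and k: "tendsto_L2loc G k F"
 shows "AE t in lebesgue_on {0..}. g t = k t"
proof (rule AE_halfline_I)
 fix \<tau> :: real assume \<tau>: "\<tau> > 0"
 let ?S = "{0..\<tau>}"
 have 1: "tendsto_L2loc (\<lambda>i t. 1 * G i t + (-1) * G i t) (\<lambda>t. 1 * g t + (-1) * k t) F"
  by (rule tendsto_L2loc_lincomb[OF g k])
 then have "\<forall>\<^sub>F i in F. (\<lambda>t. - (g t - k t)) \<in> L2 ?S" "((\<lambda>i. L2norm ?S (\<lambda>t. - (g t - k t))) \<longlongrightarrow> 0) F"
  using \<tau> by (auto simp: tendsto_L2loc_def)
 then have L: "(\<lambda>t. - (g t - k t)) \<in> L2 ?S" and n: "L2norm ?S (\<lambda>t. - (g t - k t)) = 0"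
  using F by (auto simp: tendsto_const_iff)
 have L': "(\<lambda>t. g t - k t) \<in> L2 ?S" using L2_cmult[OF _ L, of "-1"] by simp
 have "(LINT t|lebesgue_on ?S. (g t - k t)\<^sup>2) = 0" using n by (simp only: L2norm_def power2_minus real_sqrt_eq_zero_cancel_iff)
 then have "AE t in lebesgue_on ?S. (g t - k t)\<^sup>2 = 0"
  using L' integral_nonneg_eq_0_iff_AE[of "lebesgue_on ?S" "\<lambda>t. (g t - k t)\<^sup>2"] by (auto simp: L2_def)
 then show "AE t in lebesgue_on ?S. g t = k t" by eventually_elim simp
qed

lemma at_within_01_nontrivial: "a \<in> {0, 1::real} \<Longrightarrow> at a within {0..1} \<noteq> bot"
 by (auto simp: trivial_limit_within islimpt_Icc)

lemma x_trace_lincomb: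
 assumes "x_trace w a g" "x_trace v a k"
 shows "x_trace (\<lambda>x t. c * w x t + e * v x t) a (\<lambda>t. c * g t + e * k t)"
proof -
 have "tendsto_L2loc (\<lambda>x t. c * ((w x t - w a t) / (x - a)) + e * ((v x t - v a t) / (x - a))) (\<lambda>t. c * g t + e * k t) (at a within {0..1})"
  using assms by (intro tendsto_L2loc_lincomb) (auto simp: x_trace_def)
 moreover have "(\<lambda>x t. c * ((w x t - w a t) / (x - a)) + e * ((v x t - v a t) / (x - a)))
   = (\<lambda>x t. (c * w x t + e * v x t - (c * w a t + e * v a t)) / (x - a))"
  by (simp add: fun_eq_iff algebra_simps add_divide_distrib diff_divide_distrib)
 ultimately show ?thesis using assms by (simp add: x_trace_def L2loc_lincomb)
qed

lemma x_trace_cong: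
 assumes "x_trace w a g" "AE t in lebesgue_on {0..}. g t = k t"
  and "\<And>x t. x \<in> {0..1} \<Longrightarrow> t \<ge> 0 \<Longrightarrow> w x t = v x t" "a \<in> {0, 1}"
 shows "x_trace v a k"
 unfolding x_trace_def
proof
 show "k \<in> L2loc" using assms by (auto simp: x_trace_def intro: L2loc_cong_AE)
 have "\<forall>\<^sub>F x in at a within {0..1}. x \<in> {0..1::real}" by (simp add: eventually_at_filter)
 then have "\<forall>\<^sub>F x in at a within {0..1}. AE t in lebesgue_on {0..}. (w x t - w a t) / (x - a) = (v x t - v a t) / (x - a)"
 proof eventually_elim
  case (elim x)
  show ?case by (rule AE_I2) (use elim assms(3,4) in auto)
 qed
 then show "tendsto_L2loc (\<lambda>x t. (v x t - v a t) / (x - a)) k (at a within {0..1})"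
  using assms(1,2) unfolding x_trace_def by (blast intro: tendsto_L2loc_cong)
qed

lemma x_trace_unique:
 assumes "x_trace w a g" "x_trace w a k" "a \<in> {0, 1}"
 shows "AE t in lebesgue_on {0..}. g t = k t"
 using assms tendsto_L2loc_unique[OF at_within_01_nontrivial[OF assms(3)]] unfolding x_trace_def by blast

lemma weak_deriv_lincomb:
 assumes S: "open_interval S" and a: "weak_deriv S \<phi> g" and b: "weak_deriv S \<psi> k"
 shows "weak_deriv S (\<lambda>x. c * \<phi> x + e * \<psi> x) (\<lambda>x. c * g x + e * k x)"
 unfolding weak_deriv_def
proof (intro conjI allI impI)
 fix K assume "compact K \<and> K \<subseteq> S"
 then show "(\<lambda>x. c * \<phi> x + e * \<psi> x) absolutely_integrable_on K" "(\<lambda>x. c * g x + e * k x) absolutely_integrable_on K"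
  using a b by (auto simp: weak_deriv_def intro!: set_integral_add(1) set_integrable_mult_right)
next
 fix \<eta> assume "test_fun S \<eta>"
 then obtain D p q where D: "smooth_seq D" "D 0 = \<eta>" "deriv \<eta> = D 1" and pq: "p < q" "{p..q} \<subseteq> S"
  and z: "\<And>n x. x \<notin> {p<..<q} \<Longrightarrow> D n x = 0"
  using test_fun_support[OF S] by blast
 have z': "D n x = 0" if "x \<notin> {p..q}" for n x using z that by auto
 note A = weak_deriv_test[OF a open_interval_sets[OF S] D(1) pq(2) z] and B = weak_deriv_test[OF b open_interval_sets[OF S] D(1) pq(2) z]
 have *: "(LINT x|lebesgue_on S. (c * f x + e * f' x) * D n x) = c * integral {p..q} (\<lambda>x. f x * D n x) + e * integral {p..q} (\<lambda>x. f' x * D n x)"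
  if "(\<lambda>x. f x * D n x) absolutely_integrable_on {p..q}" "(\<lambda>x. f' x * D n x) absolutely_integrable_on {p..q}" for f f' n
 proof -
  have i: "(\<lambda>x. c * (f x * D n x) + e * (f' x * D n x)) absolutely_integrable_on {p..q}"
   using that by (intro set_integral_add(1) set_integrable_mult_right)
  have eq: "(\<lambda>x. c * (f x * D n x) + e * (f' x * D n x)) = (\<lambda>x. (c * f x + e * f' x) * D n x)"
   by (simp add: algebra_simps)
  have "(LINT x|lebesgue_on S. (c * f x + e * f' x) * D n x) = integral {p..q} (\<lambda>x. (c * f x + e * f' x) * D n x)"
   by (rule LINT_support[OF open_interval_sets[OF S] pq(2) i[unfolded eq]]) (simp add: z')
  also have "\<dots> = c * integral {p..q} (\<lambda>x. f x * D n x) + e * integral {p..q} (\<lambda>x. f' x * D n x)"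
   unfolding eq[symmetric]
   by (intro integral_unique has_integral_add has_integral_mult_right integrable_integral absint_int that)
  finally show ?thesis .
 qed
 show "(LINT x|lebesgue_on S. (c * \<phi> x + e * \<psi> x) * deriv \<eta> x) = - (LINT x|lebesgue_on S. (c * g x + e * k x) * \<eta> x)"
  using *[OF A(2)[of 1] B(2)[of 1]] *[OF A(3)[of 0] B(3)[of 0]] A(1) B(1) D(3) unfolding D(2)[symmetric] by simp
qed

lemma t_trace_lincomb:
 assumes "t_trace w a g" "t_trace v a k"
 shows "t_trace (\<lambda>x t. c * w x t + e * v x t) a (\<lambda>t. c * g t + e * k t)"
 using assms by (auto simp: t_trace_def L2loc_lincomb intro: weak_deriv_lincomb)

lemma AE_halfline_open:
 assumes "AE t in lebesgue_on {0::real<..}. P t" shows "AE t in lebesgue_on {0..}. P t"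
proof -
 have 1: "AE t in lebesgue. t \<in> {0<..} \<longrightarrow> P t" using assms by (simp add: AE_restrict_space_iff)
 have 2: "AE t in lebesgue. t \<notin> {0::real}"
  by (rule AE_I'[of "{0}"]) (auto simp: negligible_iff_null_sets[symmetric])
 from 1 2 have "AE t in lebesgue. t \<in> {0..} \<longrightarrow> P t" by eventually_elim auto
 then show ?thesis by (simp add: AE_restrict_space_iff)
qed

lemma t_trace_unique:
 assumes "t_trace w a g" "t_trace v a k" "\<And>t. t > 0 \<Longrightarrow> w a t = v a t"
 shows "AE t in lebesgue_on {0..}. g t = k t"
proof -
 have S: "{0::real<..} \<in> sets lebesgue" by simp
 have "weak_deriv {0<..} (\<lambda>t. w a t) k"
  using assms(2,3) weak_deriv_cong[OF S, of "\<lambda>t. w a t" "\<lambda>t. v a t"] by (auto simp: t_trace_def)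
 then have "AE t in lebesgue_on {0<..}. g t = k t"
  using assms(1) weak_deriv_unique[of "{0<..}"] by (auto simp: t_trace_def)
 then show ?thesis by (rule AE_halfline_open)
qed

lemma t_trace_prim:
 assumes P: "prim \<Phi> g" and g: "g \<in> locL2" and eq: "\<And>t. t > 0 \<Longrightarrow> w a t = \<Phi> t"
 shows "t_trace w a g"
 using weak_deriv_prim[of "{0<..}" \<Phi> g "\<lambda>t. w a t" g] assms by (auto simp: t_trace_def locL2_L2loc)

section \<open>The metric of the state space\<close>

text \<open>The norm is that of the triple $(\|\phi'\|,\|\psi\|,|\phi(0)|)$ in Euclidean space, and each entry is
 subadditive.\<close>

lemma HHnorm_triangle:
 assumes "U \<in> HH" "V \<in> HH" shows "HHnorm (lincomb 1 U 1 V) \<le> HHnorm U + HHnorm V"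
proof -
 obtain \<Phi> g k where u: "state_repr U \<Phi> g k" using state_repr_exists[OF assms(1)] .
 obtain \<Psi> h l where v: "state_repr V \<Psi> h l" using state_repr_exists[OF assms(2)] .
 have L: "g \<in> locL2" "k \<in> locL2" "h \<in> locL2" "l \<in> locL2" using u v by (auto simp: state_repr_def)
 have t: "sqint 0 1 (\<lambda>x. f x + m x) \<le> (sqrt (sqint 0 1 f) + sqrt (sqint 0 1 m))\<^sup>2" if "f \<in> locL2" "m \<in> locL2" for f m
 proof -
  have "L2norm {0..1} (\<lambda>x. f x + m x) \<le> L2norm {0..1} f + L2norm {0..1} m"
   by (rule L2norm_triangle[OF interval01_sets locL2_D[OF that(1)] locL2_D[OF that(2)]])
  then have "sqrt (sqint 0 1 (\<lambda>x. f x + m x)) \<le> sqrt (sqint 0 1 f) + sqrt (sqint 0 1 m)"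
   using that by (simp add: L2norm_integral locL2_D locL2_add sqint_def)
  then have "(sqrt (sqint 0 1 (\<lambda>x. f x + m x)))\<^sup>2 \<le> (sqrt (sqint 0 1 f) + sqrt (sqint 0 1 m))\<^sup>2"
   by (rule power_mono) (simp add: sqint_nonneg)
  then show ?thesis by (simp add: sqint_nonneg)
 qed
 define a where "a = (sqrt (sqint 0 1 g), sqrt (sqint 0 1 k), \<Phi> 0)"
 define b where "b = (sqrt (sqint 0 1 h), sqrt (sqint 0 1 l), \<Psi> 0)"
 have n: "HHnorm U = norm a" "HHnorm V = norm b"
  unfolding state_repr_norm[OF u] state_repr_norm[OF v] a_def b_def norm_Pair by (simp_all add: sqint_nonneg add.assoc)
 have "HHnorm (lincomb 1 U 1 V) = sqrt (sqint 0 1 (\<lambda>x. g x + h x) + sqint 0 1 (\<lambda>x. k x + l x) + (\<Phi> 0 + \<Psi> 0)\<^sup>2)"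
  using state_repr_norm[OF state_repr_lincomb[OF u v, of 1 1]] by simp
 also have "\<dots> \<le> norm (a + b)"
  unfolding a_def b_def norm_Pair using t[OF L(1,3)] t[OF L(2,4)] by (simp add: norm_Pair)
 also have "\<dots> \<le> norm a + norm b" by (rule norm_triangle_ineq)
 finally show ?thesis by (simp add: n)
qed

lemma HHnorm_scale:
 assumes "U \<in> HH" "V \<in> HH" shows "HHnorm (lincomb c U 0 V) = \<bar>c\<bar> * HHnorm U"
proof -
 obtain \<Phi> g k where u: "state_repr U \<Phi> g k" using state_repr_exists[OF assms(1)] .
 obtain \<Psi> h l where v: "state_repr V \<Psi> h l" using state_repr_exists[OF assms(2)] .
 have "(HHnorm (lincomb c U 0 V))\<^sup>2 = (\<bar>c\<bar> * HHnorm U)\<^sup>2"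
  using state_repr_norm_sq(1)[OF state_repr_lincomb[OF u v, of c 0]] state_repr_norm_sq(1)[OF u]
  by (simp add: sqint_cmult power_mult_distrib algebra_simps)
 then show ?thesis
  using state_repr_norm_sq(2)[OF state_repr_lincomb[OF u v, of c 0]] state_repr_norm_sq(2)[OF u]
  by (metis abs_ge_zero mult_nonneg_nonneg power2_eq_imp_eq)
qed

lemma HH_eq_refl [simp]: "HH_eq U U" by (simp add: HH_eq_def)

lemma HH_eq_sym: "HH_eq U V \<Longrightarrow> HH_eq V U" by (auto simp: HH_eq_def eq_commute)

lemma HH_eq_trans:
 assumes "HH_eq U V" "HH_eq V W" shows "HH_eq U W"
proof -
 have "AE x in lebesgue_on {0..1}. snd U x = snd V x" "AE x in lebesgue_on {0..1}. snd V x = snd W x"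
  using assms by (auto simp: HH_eq_def)
 then have "AE x in lebesgue_on {0..1}. snd U x = snd W x" by eventually_elim simp
 then show ?thesis using assms by (auto simp: HH_eq_def)
qed

lemma HH_eq_HH: "HH_eq U V \<Longrightarrow> U \<in> HH \<Longrightarrow> V \<in> HH"
 by (meson state_repr_exists state_repr_HH state_repr_eq)

lemma HHnorm_eq: "HH_eq U V \<Longrightarrow> U \<in> HH \<Longrightarrow> HHnorm U = HHnorm V"
 by (metis state_repr_exists state_repr_eq state_repr_norm)

lemma HH_eq_lincomb:
 assumes "HH_eq U U'" "HH_eq V V'" shows "HH_eq (lincomb a U b V) (lincomb a U' b V')"
proof -
 have "AE x in lebesgue_on {0..1}. snd U x = snd U' x" "AE x in lebesgue_on {0..1}. snd V x = snd V' x"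
  using assms by (auto simp: HH_eq_def)
 then have "AE x in lebesgue_on {0..1}. a * snd U x + b * snd V x = a * snd U' x + b * snd V' x" by eventually_elim simp
 then show ?thesis using assms by (auto simp: HH_eq_def lincomb_def)
qed

lemma HHdist_nonneg: "U \<in> HH \<Longrightarrow> V \<in> HH \<Longrightarrow> 0 \<le> HHdist U V" by (rule HHdist_bounds(3))

lemma HHnorm_nonneg: "U \<in> HH \<Longrightarrow> 0 \<le> HHnorm U"
 by (meson state_repr_exists state_repr_norm_sq(2))

lemma HHdist_cong:
 assumes "HH_eq U U'" "HH_eq V V'" "U \<in> HH" "V \<in> HH" shows "HHdist U V = HHdist U' V'"
 unfolding HHdist_def by (rule HHnorm_eq[OF HH_eq_lincomb[OF assms(1,2)] HH_lincomb[OF assms(3,4)]])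

lemma HHdist_self [simp]: "HHdist U U = 0"
proof -
 have "lincomb 1 U (-1) U = (\<lambda>x. 0, \<lambda>x. 0)" by (simp add: lincomb_def)
 moreover have "prim (\<lambda>x. 0) (\<lambda>x. 0)" "(\<lambda>x. 0) \<in> locL2" by (auto intro: prim_C1 locL2_continuous)
 then have "state_repr (\<lambda>x. 0, \<lambda>x. 0) (\<lambda>x. 0) (\<lambda>x. 0) (\<lambda>x. 0)" by (simp add: state_repr_def)
 ultimately show ?thesis using state_repr_norm by (simp add: HHdist_def sqint_def)
qed

lemma HHdist_eq0:
 assumes "U \<in> HH" "V \<in> HH" shows "HHdist U V = 0 \<longleftrightarrow> HH_eq U V"
proof
 assume 0: "HHdist U V = 0"
 have 1: "fst U x = fst V x" if "x \<in> {0..1}" for x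
  using HHdist_bounds(1)[OF assms that] 0 by simp
 have L: "(\<lambda>x. snd U x - snd V x) \<in> L2 {0..1}" using assms by (auto simp: HH_def intro!: L2_diff)
 have "integral {0..1} (\<lambda>x. (snd U x - snd V x)\<^sup>2) \<le> 0" using HHdist_bounds(2)[OF assms] 0 by simp
 moreover have "0 \<le> integral {0..1} (\<lambda>x. (snd U x - snd V x)\<^sup>2)" using L by (intro integral_nonneg) (auto simp: L2_iff)
 ultimately have "(LINT x|lebesgue_on {0..1}. (snd U x - snd V x)\<^sup>2) = 0"
  using integral_sq_eq[OF interval01_sets L] by simp
 then have "AE x in lebesgue_on {0..1}. (snd U x - snd V x)\<^sup>2 = 0"
  using L integral_nonneg_eq_0_iff_AE[of "lebesgue_on {0..1}" "\<lambda>x. (snd U x - snd V x)\<^sup>2"] by (auto simp: L2_def)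
 then have "AE x in lebesgue_on {0..1}. snd U x = snd V x" by eventually_elim simp
 then show "HH_eq U V" using 1 by (simp add: HH_eq_def)
next
 assume "HH_eq U V"
 then show "HHdist U V = 0" using HHdist_cong[of U V V V] assms by simp
qed

lemma HHdist_lincomb_le:
 assumes "U \<in> HH" "U' \<in> HH" "V \<in> HH" "V' \<in> HH"
 shows "HHdist (lincomb a U b V) (lincomb a U' b V') \<le> \<bar>a\<bar> * HHdist U U' + \<bar>b\<bar> * HHdist V V'"
proof -
 let ?D = "lincomb 1 U (-1) U'" and ?E = "lincomb 1 V (-1) V'"
 have D: "?D \<in> HH" "?E \<in> HH" using HH_lincomb assms by auto
 have "lincomb 1 (lincomb a U b V) (-1) (lincomb a U' b V') = lincomb 1 (lincomb a ?D 0 ?D) 1 (lincomb b ?E 0 ?E)"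
  by (simp add: lincomb_def fun_eq_iff algebra_simps)
 then have "HHdist (lincomb a U b V) (lincomb a U' b V') \<le> HHnorm (lincomb a ?D 0 ?D) + HHnorm (lincomb b ?E 0 ?E)"
  using HHnorm_triangle[OF HH_lincomb[OF D(1,1)] HH_lincomb[OF D(2,2)], of a 0 b 0] by (simp add: HHdist_def)
 then show ?thesis using HHnorm_scale[OF D(1,1)] HHnorm_scale[OF D(2,2)] by (simp add: HHdist_def)
qed

lemma HHdist_sym: "U \<in> HH \<Longrightarrow> V \<in> HH \<Longrightarrow> HHdist U V = HHdist V U"
proof -
 assume a: "U \<in> HH" "V \<in> HH"
 have "lincomb 1 V (-1) U = lincomb (-1) (lincomb 1 U (-1) V) 0 U" by (simp add: lincomb_def fun_eq_iff)
 then show ?thesis using HHnorm_scale[OF HH_lincomb[OF a] a(1), of "-1" 1 "-1"] by (simp add: HHdist_def)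
qed

lemma HHdist_triangle:
 assumes "U \<in> HH" "V \<in> HH" "W \<in> HH" shows "HHdist U W \<le> HHdist U V + HHdist V W"
proof -
 have "lincomb 1 U (-1) W = lincomb 1 (lincomb 1 U (-1) V) 1 (lincomb 1 V (-1) W)"
  by (simp add: lincomb_def fun_eq_iff)
 then show ?thesis
  using HHnorm_triangle[OF HH_lincomb[OF assms(1,2)] HH_lincomb[OF assms(2,3)], of 1 "-1" 1 "-1"] by (simp add: HHdist_def)
qed

lemma HH0_HH: "U \<in> HH0 \<Longrightarrow> U \<in> HH" by (auto simp: HH0_def HH_def H1R_def)

lemma HH0_iff: "U \<in> HH0 \<longleftrightarrow> U \<in> HH \<and> fst U 1 = 0"
 by (auto simp: HH0_def HH_def H1R_def)

lemma HH0_lincomb: "U \<in> HH0 \<Longrightarrow> V \<in> HH0 \<Longrightarrow> lincomb a U b V \<in> HH0"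
 by (simp add: HH0_iff HH_lincomb) (simp add: lincomb_def)

section \<open>Linear combinations of wave solutions\<close>

lemma test_fun2_derivs:
 assumes "test_fun2 \<eta>" shows "test_fun2 (dx \<eta>)" "test_fun2 (dt \<eta>)" "dx (dt \<eta>) = dt (dx \<eta>)"
proof -
 obtain D a b p q where D: "smooth2 D" "D 0 0 = \<eta>" "supported D a b p q" using test_fun2_support[OF assms] .
 note d = smooth2_deriv[OF D(1)]
 have "dx \<eta> = D 1 0" "dt \<eta> = D 0 1" using d[of 0 0] D(2) by auto
 then show "test_fun2 (dx \<eta>)" "test_fun2 (dt \<eta>)" "dx (dt \<eta>) = dt (dx \<eta>)"
  using test_fun2_I[OF D(1,3)] d by auto
qed

text \<open>The norm of the state space controls the supremum of the first component and the mean square of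
 the second.\<close>

lemma continuous_HH_imp:
 assumes c: "continuous_HH (state_at w wt)"
 shows "\<And>t. t \<ge> 0 \<Longrightarrow> state_at w wt t \<in> HH" "L2cont w" "L2cont wt" "\<And>x. x \<in> {0..1} \<Longrightarrow> continuous_on {0..} (\<lambda>t. w x t)"
proof -
 show HH: "state_at w wt t \<in> HH" if "t \<ge> 0" for t using c that by (simp add: continuous_HH_def)
 have d: "((\<lambda>s. (HHdist (state_at w wt s) (state_at w wt t))\<^sup>2) \<longlongrightarrow> 0) (at t within {0..})" if "t \<ge> 0" for t
  using c that tendsto_power[of "\<lambda>s. HHdist (state_at w wt s) (state_at w wt t)" 0 "at t within {0..}" 2]
  by (simp add: continuous_HH_def)
 have ev: "\<forall>\<^sub>F s in at t within {0..}. s \<in> {0::real..}" for t by (simp add: eventually_at_filter)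
 have sup: "(w x s - w x t)\<^sup>2 \<le> 2 * (HHdist (state_at w wt s) (state_at w wt t))\<^sup>2" if "s \<ge> 0" "t \<ge> 0" "x \<in> {0..1}" for x s t
  using HHdist_bounds(1)[OF HH HH, of s t x] that by (simp add: state_at_def)
 have L: "(\<lambda>x. w x t) \<in> L2 {0..1}" "(\<lambda>x. wt x t) \<in> L2 {0..1}" if "t \<ge> 0" for t
  using HH[OF that] by (auto simp: HH_def state_at_def H1_def)
 have lim2: "((\<lambda>s. 2 * (HHdist (state_at w wt s) (state_at w wt t))\<^sup>2) \<longlongrightarrow> 0) (at t within {0..})" if "t \<ge> 0" for t
  using tendsto_mult_right_zero[OF d[OF that], of 2] by simp
 show "L2cont w"
  unfolding L2cont_def
 proof (intro allI impI conjI)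
  fix t :: real assume t: "t \<ge> 0"
  show "((\<lambda>s. integral {0..1} (\<lambda>x. (w x s - w x t)\<^sup>2)) \<longlongrightarrow> 0) (at t within {0..})"
  proof (rule tendsto_sandwich[OF _ _ tendsto_const lim2[OF t]])
   have i: "(\<lambda>x. (w x s - w x t)\<^sup>2) integrable_on {0..1}" if "s \<ge> 0" for s
    using L2_diff[OF interval01_sets L(1)[OF that] L(1)[OF t]] by (simp add: L2_iff)
   show "\<forall>\<^sub>F s in at t within {0..}. 0 \<le> integral {0..1} (\<lambda>x. (w x s - w x t)\<^sup>2)"
    using ev by eventually_elim (auto intro!: integral_nonneg i)
   show "\<forall>\<^sub>F s in at t within {0..}. integral {0..1} (\<lambda>x. (w x s - w x t)\<^sup>2) \<le> 2 * (HHdist (state_at w wt s) (state_at w wt t))\<^sup>2"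
    using ev
   proof eventually_elim
    case (elim s)
    have "integral {0..1} (\<lambda>x. (w x s - w x t)\<^sup>2) \<le> integral {0..1::real} (\<lambda>x. 2 * (HHdist (state_at w wt s) (state_at w wt t))\<^sup>2)"
     by (rule integral_le[OF i]) (use elim sup t in auto)
    then show ?case by simp
   qed
  qed
 qed (use L in auto)
 show "L2cont wt"
  unfolding L2cont_def
 proof (intro allI impI conjI)
  fix t :: real assume t: "t \<ge> 0"
  show "((\<lambda>s. integral {0..1} (\<lambda>x. (wt x s - wt x t)\<^sup>2)) \<longlongrightarrow> 0) (at t within {0..})"
  proof (rule tendsto_sandwich[OF _ _ tendsto_const d[OF t]])
   show "\<forall>\<^sub>F s in at t within {0..}. 0 \<le> integral {0..1} (\<lambda>x. (wt x s - wt x t)\<^sup>2)"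
    using ev
   proof eventually_elim
    case (elim s)
    then have "(\<lambda>x. (wt x s - wt x t)\<^sup>2) integrable_on {0..1}"
     using L2_diff[OF interval01_sets L(2) L(2)[OF t], of s] by (simp add: L2_iff)
    then show ?case by (auto intro!: integral_nonneg)
   qed
   show "\<forall>\<^sub>F s in at t within {0..}. integral {0..1} (\<lambda>x. (wt x s - wt x t)\<^sup>2) \<le> (HHdist (state_at w wt s) (state_at w wt t))\<^sup>2"
    using ev by eventually_elim (use HHdist_bounds(2)[OF HH HH[OF t]] in \<open>auto simp: state_at_def\<close>)
  qed
 qed (use L in auto)
 show "continuous_on {0..} (\<lambda>t. w x t)" if x: "x \<in> {0..1}" for x
  unfolding continuous_on_def
 proof
  fix t :: real assume t: "t \<in> {0..}"
  have "((\<lambda>s. (w x s - w x t)\<^sup>2) \<longlongrightarrow> 0) (at t within {0..})"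
  proof (rule tendsto_sandwich[OF _ _ tendsto_const lim2])
   show "\<forall>\<^sub>F s in at t within {0..}. (w x s - w x t)\<^sup>2 \<le> 2 * (HHdist (state_at w wt s) (state_at w wt t))\<^sup>2"
    using ev by eventually_elim (rule sup, use t x in auto)
  qed (use t in auto)
  then have "((\<lambda>s. sqrt ((w x s - w x t)\<^sup>2)) \<longlongrightarrow> sqrt 0) (at t within {0..})" by (rule tendsto_real_sqrt)
  then have "((\<lambda>s. \<bar>w x s - w x t\<bar>) \<longlongrightarrow> 0) (at t within {0..})" by simp
  then show "((\<lambda>t. w x t) \<longlongrightarrow> w x t) (at t within {0..})"
   by (simp only: tendsto_rabs_zero_iff LIM_zero_iff)
 qed
qed

lemma state_at_lincomb:
 "state_at (\<lambda>x t. c * w x t + e * v x t) (\<lambda>x t. c * wt x t + e * vt x t) t = lincomb c (state_at w wt t) e (state_at v vt t)"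
 by (simp add: state_at_def lincomb_def)

lemma wave_solution_lincomb:
 assumes w: "wave_solution w wt" and v: "wave_solution v vt"
 shows "wave_solution (\<lambda>x t. c * w x t + e * v x t) (\<lambda>x t. c * wt x t + e * vt x t)"
proof -
 have cw: "continuous_HH (state_at w wt)" and cv: "continuous_HH (state_at v vt)"
  using w v by (auto simp: wave_solution_def)
 note iw = continuous_HH_imp[OF cw] and iv = continuous_HH_imp[OF cv]
 have "continuous_HH (state_at (\<lambda>x t. c * w x t + e * v x t) (\<lambda>x t. c * wt x t + e * vt x t))"
  unfolding continuous_HH_def state_at_lincomb
 proof (intro allI impI conjI)
  fix t :: real assume t: "t \<ge> 0"
  let ?dw = "\<lambda>s. HHdist (state_at w wt s) (state_at w wt t)" and ?dv = "\<lambda>s. HHdist (state_at v vt s) (state_at v vt t)"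
  let ?d = "\<lambda>s. HHdist (lincomb c (state_at w wt s) e (state_at v vt s)) (lincomb c (state_at w wt t) e (state_at v vt t))"
  show "lincomb c (state_at w wt t) e (state_at v vt t) \<in> HH" by (rule HH_lincomb[OF iw(1)[OF t] iv(1)[OF t]])
  have "((\<lambda>s. \<bar>c\<bar> * ?dw s + \<bar>e\<bar> * ?dv s) \<longlongrightarrow> \<bar>c\<bar> * 0 + \<bar>e\<bar> * 0) (at t within {0..})"
   using cw cv t by (intro tendsto_intros) (auto simp: continuous_HH_def)
  then have lim: "((\<lambda>s. \<bar>c\<bar> * ?dw s + \<bar>e\<bar> * ?dv s) \<longlongrightarrow> 0) (at t within {0..})" by simp
  have ev: "\<forall>\<^sub>F s in at t within {0..}. s \<in> {0::real..}" by (simp add: eventually_at_filter)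
  show "(?d \<longlongrightarrow> 0) (at t within {0..})"
  proof (rule tendsto_sandwich[OF _ _ tendsto_const lim])
   show "\<forall>\<^sub>F s in at t within {0..}. 0 \<le> ?d s"
    using ev by eventually_elim (auto intro!: HHdist_nonneg HH_lincomb iw(1) iv(1) t)
   show "\<forall>\<^sub>F s in at t within {0..}. ?d s \<le> \<bar>c\<bar> * ?dw s + \<bar>e\<bar> * ?dv s"
    using ev by eventually_elim (auto intro!: HHdist_lincomb_le iw(1) iv(1) t)
  qed
 qed
 moreover have "pairing (\<lambda>x t. c * w x t + e * v x t) (dt \<eta>) = - pairing (\<lambda>x t. c * wt x t + e * vt x t) \<eta>" if "test_fun2 \<eta>" for \<eta>
  using pairing_lincomb[OF iw(2) iv(2) test_fun2_derivs(2)[OF that]] pairing_lincomb[OF iw(3) iv(3) that] w v that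
  by (simp add: wave_solution_def)
 moreover have "pairing (\<lambda>x t. c * w x t + e * v x t) (dt (dt \<eta>)) = pairing (\<lambda>x t. c * w x t + e * v x t) (dx (dx \<eta>))" if "test_fun2 \<eta>" for \<eta>
  using pairing_lincomb[OF iw(2) iv(2) test_fun2_derivs(2)[OF test_fun2_derivs(2)[OF that]]]
   pairing_lincomb[OF iw(2) iv(2) test_fun2_derivs(1)[OF test_fun2_derivs(1)[OF that]]] w v that
  by (simp add: wave_solution_def)
 moreover have "(\<exists>g. x_trace (\<lambda>x t. c * w x t + e * v x t) a g) \<and> (\<exists>g. t_trace (\<lambda>x t. c * w x t + e * v x t) a g)" if "a \<in> {0, 1}" for a
 proof -
  have "(\<exists>g. x_trace w a g) \<and> (\<exists>g. t_trace w a g)" "(\<exists>g. x_trace v a g) \<and> (\<exists>g. t_trace v a g)"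
   using w v that by (auto simp: wave_solution_def)
  then show ?thesis using x_trace_lincomb t_trace_lincomb by blast
 qed
 ultimately show ?thesis by (simp add: wave_solution_def)
qed

section \<open>The solution given by the delay equation\<close>

text \<open>The solution of the wave equation with $w(1,\cdot)=0$ whose wave travelling to the right is \<open>G\<close>; it
 is linear in \<open>G\<close>, and \<open>disp h\<close> is its time derivative if \<open>G\<close> is a primitive of \<open>h\<close>.\<close>

definition disp :: "(real \<Rightarrow> real) \<Rightarrow> real \<Rightarrow> real \<Rightarrow> real" where
 "disp G x t = G (t - x) - G (t + x - 2)"

lemma disp_repr:
 assumes h: "h \<in> locL2" and P: "prim G h"
 shows "state_repr (state_at (disp G) (disp h) t) (\<lambda>x. disp G x t) (\<lambda>x. - h (t - x) - h (t + x - 2)) (\<lambda>x. disp h x t)"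
proof -
 have "prim (\<lambda>x. disp G x t) (\<lambda>x. - h (t - x) - h (t + x - 2))"
  using prim_diff[OF prim_affine[OF P, of "-1" t] prim_affine[OF P, of 1 "t - 2"]] by (simp add: disp_def add.commute add_diff_eq diff_add_eq)
 moreover have a: "(\<lambda>x. h (t - x)) \<in> locL2" "(\<lambda>x. h (t + x - 2)) \<in> locL2"
  using locL2_affine[OF h, of "-1" t] locL2_affine[OF h, of 1 "t - 2"] by (simp_all add: add.commute add_diff_eq diff_add_eq)
 ultimately show ?thesis
  using locL2_diff[OF locL2_minus[OF a(1)] a(2)] locL2_diff[OF a]
  by (simp add: state_repr_def state_at_def disp_def[abs_def])
qed

text \<open>A time step of a travelling wave is a translation, which is continuous in the mean square.\<close>

lemma disp_dist:
 assumes h: "h \<in> locL2" and P: "prim G h"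
 shows "(HHdist (state_at (disp G) (disp h) s) (state_at (disp G) (disp h) t))\<^sup>2
  \<le> 4 * sqint (t - 2) t (\<lambda>u. h (u + (s - t)) - h u) + (disp G 0 s - disp G 0 t)\<^sup>2"
proof -
 define f where "f u = h (u + (s - t)) - h u" for u
 have f: "f \<in> locL2"
  unfolding f_def using locL2_affine[OF h, of 1 "s - t"] h by (intro locL2_diff) (auto simp: add.commute)
 have fa: "(\<lambda>x. f (t - x)) \<in> locL2" "(\<lambda>x. f (x + (t - 2))) \<in> locL2"
  using locL2_affine[OF f, of "-1" t] locL2_affine[OF f, of 1 "t - 2"] by (simp_all add: add.commute)
 have "sqint 0 1 (\<lambda>x. f (t - x)) = sqint (t - 1) t f" "sqint 0 1 (\<lambda>x. f (x + (t - 2))) = sqint (t - 2) (t - 1) f"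
  using sqint_reflect[OF f, of 0 1 t] sqint_shift[OF f, of 0 1 "t - 2"] by simp_all
 then have s: "sqint 0 1 (\<lambda>x. f (t - x)) + sqint 0 1 (\<lambda>x. f (x + (t - 2))) = sqint (t - 2) t f"
  using sqint_combine[OF f, of "t - 2" "t - 1" t] by simp
 have "(\<lambda>x. - h (s - x) - h (s + x - 2) - (- h (t - x) - h (t + x - 2))) = (\<lambda>x. - f (t - x) - f (x + (t - 2)))"
  by (simp add: f_def fun_eq_iff algebra_simps)
 then have 1: "sqint 0 1 (\<lambda>x. - h (s - x) - h (s + x - 2) - (- h (t - x) - h (t + x - 2))) \<le> 2 * sqint (t - 2) t f"
  using sqint_diff_le[OF locL2_minus[OF fa(1)] fa(2), of 0 1] s sqint_cmult[of 0 1 "-1" "\<lambda>x. f (t - x)"] by simp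
 have "(\<lambda>x. disp h x s - disp h x t) = (\<lambda>x. f (t - x) - f (x + (t - 2)))"
  by (simp add: f_def disp_def fun_eq_iff algebra_simps)
 then have 2: "sqint 0 1 (\<lambda>x. disp h x s - disp h x t) \<le> 2 * sqint (t - 2) t f"
  using sqint_diff_le[OF fa, of 0 1] s by simp
 show ?thesis
  unfolding state_repr_dist(1)[OF disp_repr[OF h P] disp_repr[OF h P]] using 1 2 by (simp add: f_def[abs_def])
qed

lemma steklov_trace:
 assumes h: "h \<in> locL2" and e: "e = 1 \<or> e = - 1"
 shows "((\<lambda>x. sqint 0 \<tau> (\<lambda>t. steklov (e * (x - a)) h (t - c) - h (t - c))) \<longlongrightarrow> 0) (at a within {0..1})"
proof -
 have "sqint 0 \<tau> (\<lambda>t. steklov k h (t - c) - h (t - c)) = sqint (- c) (\<tau> - c) (\<lambda>t. steklov k h t - h t)" for k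
  using sqint_shift[OF locL2_diff[OF steklov_locL2[OF h, of k] h], of 0 \<tau> "- c"] by simp
 moreover have "((\<lambda>k. sqint (- c) (\<tau> - c) (\<lambda>t. steklov k h t - h t)) \<longlongrightarrow> 0) (at 0)" by (rule steklov_L2[OF h])
 moreover have "filterlim (\<lambda>x. e * (x - a)) (at 0) (at a within {0..1})"
  unfolding filterlim_at
 proof
  have "((\<lambda>x. e * (x - a)) \<longlongrightarrow> e * (a - a)) (at a within {0..1})" by (intro tendsto_intros)
  then show "((\<lambda>x. e * (x - a)) \<longlongrightarrow> 0) (at a within {0..1})" by simp
  show "\<forall>\<^sub>F x in at a within {0..1}. e * (x - a) \<in> UNIV \<and> e * (x - a) \<noteq> 0"
   using e by (auto simp: eventually_at_filter)
 qed
 ultimately show ?thesis using filterlim_compose by fastforce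
qed

text \<open>The difference quotients in \<open>x\<close> of a travelling wave are Steklov means of \<open>h\<close>.\<close>

lemma x_trace_disp:
 assumes h: "h \<in> locL2" and P: "prim G h"
 shows "x_trace (disp G) 0 (\<lambda>t. - h t - h (t - 2))" "x_trace (disp G) 1 (\<lambda>t. - 2 * h (t - 1))"
proof -
 have hs: "(\<lambda>t. h (t - c)) \<in> locL2" for c using locL2_affine[OF h, of 1 "- c"] by simp
 have ss: "(\<lambda>t. steklov k h (t - c)) \<in> locL2" for k c using locL2_affine[OF steklov_locL2[OF h, of k], of 1 "- c"] by simp
 have *: "x_trace (disp G) a (\<lambda>t. - h (t - c) - h (t - c'))"
  if q: "\<And>x t. x \<noteq> a \<Longrightarrow> (disp G x t - disp G a t) / (x - a) = - steklov (- (x - a)) h (t - c) - steklov (x - a) h (t - c')" for a c c'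
  unfolding x_trace_def
 proof
  show "(\<lambda>t. - h (t - c) - h (t - c')) \<in> L2loc" by (intro locL2_L2loc locL2_diff locL2_minus hs)
  let ?A = "\<lambda>x t. steklov (- 1 * (x - a)) h (t - c) - h (t - c)" and ?B = "\<lambda>x t. steklov (1 * (x - a)) h (t - c') - h (t - c')"
  have ne: "\<forall>\<^sub>F x in at a within {0..1}. x \<noteq> a" by (simp add: eventually_at_filter)
  have eq: "(\<lambda>t. (disp G x t - disp G a t) / (x - a) - (- h (t - c) - h (t - c'))) = (\<lambda>t. - ?A x t - ?B x t)" if "x \<noteq> a" for x
   using q[OF that] by (simp add: fun_eq_iff)
  have AB: "?A x \<in> locL2" "?B x \<in> locL2" for x using ss hs by auto
  show "tendsto_L2loc (\<lambda>x t. (disp G x t - disp G a t) / (x - a)) (\<lambda>t. - h (t - c) - h (t - c')) (at a within {0..1})"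
  proof (rule tendsto_L2loc_I)
   show "\<forall>\<^sub>F x in at a within {0..1}. (\<lambda>t. (disp G x t - disp G a t) / (x - a) - (- h (t - c) - h (t - c'))) \<in> locL2"
    using ne
   proof eventually_elim
    case (elim x)
    show ?case unfolding eq[OF elim] by (intro locL2_diff locL2_minus AB)
   qed
   fix \<tau> :: real
   have "((\<lambda>x. 2 * sqint 0 \<tau> (?A x) + 2 * sqint 0 \<tau> (?B x)) \<longlongrightarrow> 2 * 0 + 2 * 0) (at a within {0..1})"
    by (intro tendsto_intros steklov_trace[OF h]) auto
   then have lim: "((\<lambda>x. 2 * sqint 0 \<tau> (?A x) + 2 * sqint 0 \<tau> (?B x)) \<longlongrightarrow> 0) (at a within {0..1})" by simp
   show "((\<lambda>x. sqint 0 \<tau> (\<lambda>t. (disp G x t - disp G a t) / (x - a) - (- h (t - c) - h (t - c')))) \<longlongrightarrow> 0) (at a within {0..1})"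
   proof (rule tendsto_sandwich[OF _ _ tendsto_const lim])
    show "\<forall>\<^sub>F x in at a within {0..1}. sqint 0 \<tau> (\<lambda>t. (disp G x t - disp G a t) / (x - a) - (- h (t - c) - h (t - c'))) \<le> 2 * sqint 0 \<tau> (?A x) + 2 * sqint 0 \<tau> (?B x)"
     using ne
    proof eventually_elim
     case (elim x)
     show ?case unfolding eq[OF elim]
      using sqint_diff_le[OF locL2_minus[OF AB(1)] AB(2), of 0 \<tau> x x] sqint_cmult[of 0 \<tau> "-1" "?A x"] by simp
    qed
   qed (simp add: sqint_nonneg)
  qed
 qed
 have "x_trace (disp G) 0 (\<lambda>t. - h (t - 0) - h (t - 2))"
  by (rule *) (simp add: steklov_prim[OF P] disp_def field_simps)
 then show "x_trace (disp G) 0 (\<lambda>t. - h t - h (t - 2))" by simp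
 have "x_trace (disp G) 1 (\<lambda>t. - h (t - 1) - h (t - 1))"
 proof (rule *)
  fix x t :: real
  have e: "t - 1 + - (x - 1) = t - x" "t - 1 + (x - 1) = t + x - 2" "t + 1 - 2 = t - 1" by simp_all
  have id: "(A - B - (C - C)) / k = - ((A - C) / (- k)) - (B - C) / k" for A B C k :: real
   by (simp add: diff_divide_distrib)
  show "(disp G x t - disp G 1 t) / (x - 1) = - steklov (- (x - 1)) h (t - 1) - steklov (x - 1) h (t - 1)"
   unfolding steklov_prim[OF P] disp_def e by (rule id)
 qed
 moreover have "(\<lambda>t. - h (t - 1) - h (t - 1)) = (\<lambda>t. - 2 * h (t - 1))" by auto
 ultimately show "x_trace (disp G) 1 (\<lambda>t. - 2 * h (t - 1))" by simp
qed

text \<open>Two applications of the transport identity, with signs $\sigma$ and $\sigma^2=1$.\<close>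

lemma travelling_wave_equation:
 assumes P: "prim \<phi> h" and h: "h \<in> locL2" and s: "\<sigma> = 1 \<or> \<sigma> = - 1" and t: "test_fun2 \<eta>"
 shows "pairing (\<lambda>x t. \<phi> (t + \<sigma> * x)) (dt \<eta>) = - pairing (\<lambda>x t. h (t + \<sigma> * x)) \<eta>"
  "pairing (\<lambda>x t. \<phi> (t + \<sigma> * x)) (dt (dt \<eta>)) = pairing (\<lambda>x t. \<phi> (t + \<sigma> * x)) (dx (dx \<eta>))"
proof -
 have s2: "\<sigma> * \<sigma> = 1" and s0: "\<sigma> \<noteq> 0" using s by auto
 have c: "continuous_on UNIV \<phi>" by (rule prim_continuous[OF P])
 note tp = transport_pairing[OF c s]
 have "pairing (\<lambda>x t. \<phi> (t + \<sigma> * x)) (dt (dt \<eta>)) = \<sigma> * pairing (\<lambda>x t. \<phi> (t + \<sigma> * x)) (dt (dx \<eta>))"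
  using tp[OF test_fun2_derivs(2)[OF t]] test_fun2_derivs(3)[OF t] by simp
 also have "\<dots> = (\<sigma> * \<sigma>) * pairing (\<lambda>x t. \<phi> (t + \<sigma> * x)) (dx (dx \<eta>))"
  using tp[OF test_fun2_derivs(1)[OF t]] by simp
 finally show "pairing (\<lambda>x t. \<phi> (t + \<sigma> * x)) (dt (dt \<eta>)) = pairing (\<lambda>x t. \<phi> (t + \<sigma> * x)) (dx (dx \<eta>))" by (simp add: s2)
 have w: "L2cont (\<lambda>x t. \<phi> (t + \<sigma> * x))" by (rule travelling_L2cont[OF locL2_continuous[OF c] s])
 have v: "L2cont (\<lambda>x t. \<sigma> * h (t + \<sigma> * x) + 0 * h (t + \<sigma> * x))"
  by (intro L2cont_lincomb travelling_L2cont[OF h s])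
 have "pairing (\<lambda>x t. \<phi> (t + \<sigma> * x)) (dx \<eta>) = - pairing (\<lambda>x t. \<sigma> * h (t + \<sigma> * x) + 0 * h (t + \<sigma> * x)) \<eta>"
 proof (rule pairing_dx[OF w v t])
  fix t :: real
  show "\<exists>\<Phi> g. prim \<Phi> g \<and> (\<forall>x\<in>{0..1}. \<phi> (t + \<sigma> * x) = \<Phi> x) \<and> (AE x in lebesgue_on {0..1}. \<sigma> * h (t + \<sigma> * x) + 0 * h (t + \<sigma> * x) = g x)"
   using prim_affine[OF P s0, of t] by (intro exI[of _ "\<lambda>x. \<phi> (t + \<sigma> * x)"] exI[of _ "\<lambda>x. \<sigma> * h (t + \<sigma> * x)"]) simp
 qed
 also have "\<dots> = - \<sigma> * pairing (\<lambda>x t. h (t + \<sigma> * x)) \<eta>"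
  using pairing_lincomb[OF travelling_L2cont[OF h s] travelling_L2cont[OF h s] t, of \<sigma> 0] by simp
 finally have "pairing (\<lambda>x t. \<phi> (t + \<sigma> * x)) (dt \<eta>) = - (\<sigma> * \<sigma>) * pairing (\<lambda>x t. h (t + \<sigma> * x)) \<eta>"
  unfolding tp[OF t] by simp
 then show "pairing (\<lambda>x t. \<phi> (t + \<sigma> * x)) (dt \<eta>) = - pairing (\<lambda>x t. h (t + \<sigma> * x)) \<eta>" by (simp add: s2)
qed

lemma disp_wave_solution:
 assumes h: "h \<in> locL2" and P: "prim G h"
 shows "wave_solution (disp G) (disp h)"
proof -
 have P2: "prim (\<lambda>u. G (u - 2)) (\<lambda>u. h (u - 2))" using prim_affine[OF P, of 1 "-2"] by simp
 have h2: "(\<lambda>u. h (u - 2)) \<in> locL2" using locL2_affine[OF h, of 1 "-2"] by simp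
 have sg: "(-1::real) = 1 \<or> (-1::real) = -1" "(1::real) = 1 \<or> (1::real) = -1" by auto
 have dG: "disp G = (\<lambda>x t. 1 * G (t + (-1) * x) + (-1) * G (t + 1 * x - 2))" for G by (simp add: disp_def fun_eq_iff)
 note G1 = travelling_L2cont[OF locL2_continuous[OF prim_continuous[OF P]] sg(1)]
  and G2 = travelling_L2cont[OF locL2_continuous[OF prim_continuous[OF P2]] sg(2)]
  and h1 = travelling_L2cont[OF h sg(1)] and h2' = travelling_L2cont[OF h2 sg(2)]
 have "continuous_HH (state_at (disp G) (disp h))"
  unfolding continuous_HH_def
 proof (intro allI impI conjI)
  fix t :: real
  show "state_at (disp G) (disp h) t \<in> HH" by (rule state_repr_HH[OF disp_repr[OF h P]])
  let ?d = "\<lambda>s. HHdist (state_at (disp G) (disp h) s) (state_at (disp G) (disp h) t)"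
  let ?b = "\<lambda>s. 4 * sqint (t - 2) t (\<lambda>u. h (u + (s - t)) - h u) + (disp G 0 s - disp G 0 t)\<^sup>2"
  have "((\<lambda>k. sqint (t - 2) t (\<lambda>u. h (u + k) - h u)) \<longlongrightarrow> 0) (at 0)" by (rule translation_L2[OF h])
  then have a: "((\<lambda>s. sqint (t - 2) t (\<lambda>u. h (u + (s - t)) - h u)) \<longlongrightarrow> 0) (at t)"
   by (auto dest: LIM_offset[where k = "- t"])
  have "isCont (\<lambda>s. disp G 0 s) t"
   unfolding disp_def using prim_continuous[OF P, of UNIV] prim_continuous[OF P2, of UNIV]
   by (auto intro!: continuous_intros simp: continuous_on_eq_continuous_at)
  then have "((\<lambda>s. disp G 0 s) \<longlongrightarrow> disp G 0 t) (at t)" by (simp add: isCont_def)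
  then have "(?b \<longlongrightarrow> 4 * 0 + (disp G 0 t - disp G 0 t)\<^sup>2) (at t)" by (intro tendsto_intros a)
  then have b: "(?b \<longlongrightarrow> 0) (at t)" by simp
  have "((\<lambda>s. (?d s)\<^sup>2) \<longlongrightarrow> 0) (at t)"
   by (rule tendsto_sandwich[OF _ _ tendsto_const b]) (auto intro!: always_eventually disp_dist[OF h P])
  from tendsto_real_sqrt[OF this] have "((\<lambda>s. \<bar>?d s\<bar>) \<longlongrightarrow> 0) (at t)" by simp
  then have "(?d \<longlongrightarrow> 0) (at t)" by (simp only: tendsto_rabs_zero_iff)
  then show "(?d \<longlongrightarrow> 0) (at t within {0..})" by (rule tendsto_mono[OF at_le, rotated]) simp
 qed
 moreover have "pairing (disp G) (dt \<eta>) = - pairing (disp h) \<eta>" if t: "test_fun2 \<eta>" for \<eta>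
  unfolding dG using pairing_lincomb[OF G1 G2 test_fun2_derivs(2)[OF t], of 1 "-1"] pairing_lincomb[OF h1 h2' t, of 1 "-1"]
   travelling_wave_equation(1)[OF P h sg(1) t] travelling_wave_equation(1)[OF P2 h2 sg(2) t] by simp
 moreover have "pairing (disp G) (dt (dt \<eta>)) = pairing (disp G) (dx (dx \<eta>))" if t: "test_fun2 \<eta>" for \<eta>
  unfolding dG using pairing_lincomb[OF G1 G2 test_fun2_derivs(2)[OF test_fun2_derivs(2)[OF t]], of 1 "-1"]
   pairing_lincomb[OF G1 G2 test_fun2_derivs(1)[OF test_fun2_derivs(1)[OF t]], of 1 "-1"]
   travelling_wave_equation(2)[OF P h sg(1) t] travelling_wave_equation(2)[OF P2 h2 sg(2) t] by simp
 moreover have "t_trace (disp G) 0 (\<lambda>t. h t - h (t - 2))"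
  by (rule t_trace_prim[OF prim_diff[OF P P2] locL2_diff[OF h h2]]) (simp add: disp_def)
 moreover have "t_trace (disp G) 1 (\<lambda>t. 0)"
 proof (rule t_trace_prim)
  show "prim (\<lambda>_. 0) (\<lambda>_. 0)" by (rule prim_C1) auto
  show "(\<lambda>_. 0) \<in> locL2" by (rule locL2_continuous) simp
 qed (simp add: disp_def)
 ultimately show ?thesis using x_trace_disp[OF h P] unfolding wave_solution_def by blast
qed

lemma delay_boundary:
 assumes c: "c0 < 1" and d: "delay_solution c0 c1 G h" and t: "t \<ge> 0"
 shows "- h t - h (t - 2) = c1 / (1 - c0) * (G t - G (t - 2)) + c0 / (1 - c0) * (h t - h (t - 2))"
proof -
 have "h t + c1 * (G t - G (t - 2)) + (1 - 2 * c0) * h (t - 2) = 0" using d t by (simp add: delay_solution_def)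
 then have "(1 - c0) * (- h t - h (t - 2)) = c1 * (G t - G (t - 2)) + c0 * (h t - h (t - 2))" by (simp add: algebra_simps)
 then have "- h t - h (t - 2) = (c1 * (G t - G (t - 2)) + c0 * (h t - h (t - 2))) / (1 - c0)"
  using c by (simp add: field_simps)
 then show ?thesis by (simp add: add_divide_distrib)
qed

text \<open>The delay equation is the boundary condition at $x=0$ written in terms of the travelling wave.\<close>

lemma disp_beta_solution:
 assumes c: "0 < c0" "c0 < 1" and d: "delay_solution c0 c1 G h" and B: "HH_eq (state_at (disp G) (disp h) 0) B"
 shows "beta_solution c0 c1 B (disp G) (disp h)"
proof -
 have h: "h \<in> locL2" and P: "prim G h" using d by (auto simp: delay_solution_def)
 have P2: "prim (\<lambda>u. G (u - 2)) (\<lambda>u. h (u - 2))" using prim_affine[OF P, of 1 "-2"] by simp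
 have h2: "(\<lambda>u. h (u - 2)) \<in> locL2" using locL2_affine[OF h, of 1 "-2"] by simp
 have t: "t_trace (disp G) 0 (\<lambda>t. h t - h (t - 2))"
  by (rule t_trace_prim[OF prim_diff[OF P P2] locL2_diff[OF h h2]]) (simp add: disp_def)
 have "x_trace (disp G) 0 (\<lambda>t. c1 / (1 - c0) * disp G 0 t + c0 / (1 - c0) * (h t - h (t - 2)))"
 proof (rule x_trace_cong[OF x_trace_disp(1)[OF h P]])
  show "AE t in lebesgue_on {0..}. - h t - h (t - 2) = c1 / (1 - c0) * disp G 0 t + c0 / (1 - c0) * (h t - h (t - 2))"
   using delay_boundary[OF c(2) d] by (intro AE_I2) (simp add: disp_def)
 qed auto
 then show ?thesis
  using t disp_wave_solution[OF h P] B unfolding beta_solution_def by (auto simp: disp_def)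
qed

section \<open>Testing along characteristics\<close>

text \<open>The derivatives of $X(x-\sigma t)\Theta(t)$.\<close>

primrec moving :: "(nat \<Rightarrow> real \<Rightarrow> real) \<Rightarrow> (nat \<Rightarrow> real \<Rightarrow> real) \<Rightarrow> real \<Rightarrow> nat \<Rightarrow> nat \<Rightarrow> nat \<Rightarrow> real \<Rightarrow> real \<Rightarrow> real" where
 "moving X \<Theta> \<sigma> 0 m n x t = X m (x - \<sigma> * t) * \<Theta> n t"
| "moving X \<Theta> \<sigma> (Suc j) m n x t = - \<sigma> * moving X \<Theta> \<sigma> j (Suc m) n x t + moving X \<Theta> \<sigma> j m (Suc n) x t"

lemma moving_smooth2:
 assumes X: "smooth_seq X" and \<Theta>: "smooth_seq \<Theta>"
 shows "smooth2 (\<lambda>i j. moving X \<Theta> \<sigma> j i 0)"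
proof -
 have dx: "((\<lambda>s. moving X \<Theta> \<sigma> j m n s t) has_real_derivative moving X \<Theta> \<sigma> j (Suc m) n x t) (at x)" for j m n x t
 proof (induction j arbitrary: m n)
  case 0
  have "((\<lambda>s. X m (s - \<sigma> * t)) has_real_derivative X (Suc m) (x - \<sigma> * t) * 1) (at x)"
   by (rule DERIV_chain2[OF smooth_seqD[OF X]]) (auto intro!: derivative_eq_intros)
  from DERIV_cmult_right[OF this, of "\<Theta> n t"] show ?case by simp
 next
  case (Suc j)
  have "((\<lambda>s. - \<sigma> * moving X \<Theta> \<sigma> j (Suc m) n s t + moving X \<Theta> \<sigma> j m (Suc n) s t) has_real_derivative
    - \<sigma> * moving X \<Theta> \<sigma> j (Suc (Suc m)) n x t + moving X \<Theta> \<sigma> j (Suc m) (Suc n) x t) (at x)"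
   by (intro DERIV_add DERIV_cmult Suc.IH)
  then show ?case by simp
 qed
 have dt: "((\<lambda>s. moving X \<Theta> \<sigma> j m n x s) has_real_derivative moving X \<Theta> \<sigma> (Suc j) m n x t) (at t)" for j m n x t
 proof (induction j arbitrary: m n)
  case 0
  have "((\<lambda>s. X m (x - \<sigma> * s)) has_real_derivative X (Suc m) (x - \<sigma> * t) * (- \<sigma>)) (at t)"
   by (rule DERIV_chain2[OF smooth_seqD[OF X]]) (auto intro!: derivative_eq_intros)
  from DERIV_mult[OF this smooth_seqD[OF \<Theta>, of n t]] show ?case by (simp add: algebra_simps)
 next
  case (Suc j)
  have "((\<lambda>s. - \<sigma> * moving X \<Theta> \<sigma> j (Suc m) n x s + moving X \<Theta> \<sigma> j m (Suc n) x s) has_real_derivative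
    - \<sigma> * moving X \<Theta> \<sigma> (Suc j) (Suc m) n x t + moving X \<Theta> \<sigma> (Suc j) m (Suc n) x t) (at t)"
   by (intro DERIV_add DERIV_cmult Suc.IH)
  moreover have "moving X \<Theta> \<sigma> (Suc j) m n x = (\<lambda>s. - \<sigma> * moving X \<Theta> \<sigma> j (Suc m) n x s + moving X \<Theta> \<sigma> j m (Suc n) x s)"
   by (rule ext) simp
  ultimately show ?case by simp
 qed
 have ct: "continuous_on UNIV (\<lambda>z. moving X \<Theta> \<sigma> j m n (fst z) (snd z))" for j m n
 proof (induction j arbitrary: m n)
  case 0
  show ?case unfolding moving.simps
   by (intro continuous_intros continuous_on_compose2[OF smooth_seq_continuous[OF X, of UNIV]]
     continuous_on_compose2[OF smooth_seq_continuous[OF \<Theta>, of UNIV]]) auto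
 next
  case (Suc j)
  show ?case unfolding moving.simps by (intro continuous_intros Suc.IH)
 qed
 show ?thesis unfolding smooth2_def using dx dt ct by (auto simp: case_prod_beta')
qed

lemma moving_zero:
 assumes "(\<forall>m. X m (x - \<sigma> * t) = 0) \<or> (\<forall>n. \<Theta> n t = 0)"
 shows "moving X \<Theta> \<sigma> j m n x t = 0"
 using assms by (induction j arbitrary: m n) auto

lemma moving_supported:
 assumes X: "\<And>n z. z \<notin> {a<..<b} \<Longrightarrow> X n z = 0" and \<Theta>: "\<And>n t. t \<notin> {c<..<d} \<Longrightarrow> \<Theta> n t = 0"
  and ab: "a < b" and cd: "0 < c" "c < d" and path: "\<And>t. t \<in> {c..d} \<Longrightarrow> 0 < a + \<sigma> * t \<and> b + \<sigma> * t < 1"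
 shows "\<exists>a' b'. supported (\<lambda>i j. moving X \<Theta> \<sigma> j i 0) a' b' c d"
proof -
 define a' b' where "a' = min (a + \<sigma> * c) (a + \<sigma> * d)" and "b' = max (b + \<sigma> * c) (b + \<sigma> * d)"
 have "0 < a'" "b' < 1" using path[of c] path[of d] cd by (auto simp: a'_def b'_def)
 moreover have "a' < b'" using ab by (auto simp: a'_def b'_def)
 moreover have "moving X \<Theta> \<sigma> j i 0 x t = 0" if "x \<notin> {a'<..<b'} \<or> t \<notin> {c<..<d}" for i j x t
 proof (rule moving_zero, cases "t \<in> {c<..<d}")
  case True
  then have x: "x \<notin> {a'<..<b'}" using that by simp
  have "a' \<le> a + \<sigma> * t \<and> b + \<sigma> * t \<le> b'"
  proof (cases "\<sigma> \<ge> 0")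
   case True
   then have "\<sigma> * c \<le> \<sigma> * t" "\<sigma> * t \<le> \<sigma> * d" using \<open>t \<in> {c<..<d}\<close> by (auto intro: mult_left_mono)
   then show ?thesis by (auto simp: a'_def b'_def)
  next
   case False
   then have "\<sigma> * d \<le> \<sigma> * t" "\<sigma> * t \<le> \<sigma> * c" using \<open>t \<in> {c<..<d}\<close> by (auto intro: mult_left_mono_neg)
   then show ?thesis by (auto simp: a'_def b'_def)
  qed
  then have "x - \<sigma> * t \<notin> {a<..<b}" using x by auto
  then show "(\<forall>m. X m (x - \<sigma> * t) = 0) \<or> (\<forall>n. \<Theta> n t = 0)" using X by blast
 qed (use \<Theta> in blast)
 ultimately have "supported (\<lambda>i j. moving X \<Theta> \<sigma> j i 0) a' b' c d" using cd by (simp add: supported_def)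
 then show ?thesis by blast
qed

text \<open>The weighted mean of $w(\cdot,t)$ near the point $z+\sigma t$, for a profile \<open>X\<close> concentrated near \<open>z\<close>.\<close>

definition moment :: "(real \<Rightarrow> real \<Rightarrow> real) \<Rightarrow> (real \<Rightarrow> real) \<Rightarrow> real \<Rightarrow> real \<Rightarrow> real" where
 "moment w X \<sigma> t = integral {0..1} (\<lambda>x. w x t * X (x - \<sigma> * t))"

lemma moment_continuous:
 assumes w: "L2cont w" and X: "continuous_on UNIV X"
 shows "continuous_on {0..} (moment w X \<sigma>)" "t \<ge> 0 \<Longrightarrow> (\<lambda>x. w x t * X (x - \<sigma> * t)) integrable_on {0..1}"
proof -
 have c: "continuous_on UNIV (\<lambda>z. X (fst z - \<sigma> * snd z))"
  by (intro continuous_on_compose2[OF X] continuous_intros) auto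
 show "continuous_on {0..} (moment w X \<sigma>)"
  using L2cont_pairing_continuous(1)[OF w, of "\<lambda>x t. X (x - \<sigma> * t)"] c by (simp add: moment_def[abs_def])
 show "t \<ge> 0 \<Longrightarrow> (\<lambda>x. w x t * X (x - \<sigma> * t)) integrable_on {0..1}"
  using L2cont_pairing_continuous(2)[OF w, of "\<lambda>x t. X (x - \<sigma> * t)"] c by (auto intro: absint_int)
qed

text \<open>Evaluation of the pairings with $X(x-\sigma t)\Theta(t)$ and its derivatives.\<close>

lemma pairing_moving:
 assumes w: "L2cont w" and X: "smooth_seq X" and \<Theta>: "smooth_seq \<Theta>"
  and s: "supported (\<lambda>i j. moving X \<Theta> \<sigma> j i 0) a b c d"
 defines "\<eta> \<equiv> moving X \<Theta> \<sigma> 0 0 0"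
 shows "test_fun2 \<eta>"
  "pairing w \<eta> = integral {c..d} (\<lambda>t. moment w (X 0) \<sigma> t * \<Theta> 0 t)"
  "pairing w (dx \<eta>) = integral {c..d} (\<lambda>t. moment w (X 1) \<sigma> t * \<Theta> 0 t)"
  "pairing w (dt \<eta>) = integral {c..d} (\<lambda>t. moment w (X 0) \<sigma> t * \<Theta> 1 t - \<sigma> * (moment w (X 1) \<sigma> t * \<Theta> 0 t))"
  "pairing w (dt (dt \<eta>)) - \<sigma>\<^sup>2 * pairing w (dx (dx \<eta>)) = integral {c..d} (\<lambda>t. moment w (X 0) \<sigma> t * \<Theta> 2 t - 2 * \<sigma> * (moment w (X 1) \<sigma> t * \<Theta> 1 t))"
proof -
 define D where "D i j = moving X \<Theta> \<sigma> j i 0" for i j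
 have D: "smooth2 D" using moving_smooth2[OF X \<Theta>] by (simp add: D_def[abs_def])
 have S: "supported D a b c d" using s by (simp add: D_def[abs_def])
 have cd: "0 < c" "c < d" using S by (auto simp: supported_def)
 have D0: "D 0 0 = \<eta>" by (simp add: D_def \<eta>_def)
 note d = smooth2_deriv[OF D]
 have der: "dx \<eta> = D 1 0" "dt \<eta> = D 0 1" "dt (dt \<eta>) = D 0 2" "dx (dx \<eta>) = D 2 0"
  unfolding D0[symmetric] d by (simp_all add: numeral_2_eq_2)
 note pe = pairing_eq[OF w D S]
 have Xc: "continuous_on UNIV (X m)" for m by (rule smooth_seq_continuous[OF X])
 have inner: "integral {0..1} (\<lambda>x. w x t * (\<Sum>k<N. f k * (X (k) (x - \<sigma> * t) * g k t))) = (\<Sum>k<N. f k * (moment w (X k) \<sigma> t * g k t))"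
  if "t \<ge> 0" for t f g and N :: nat
 proof -
  have "((\<lambda>x. \<Sum>k<N. (f k * g k t) * (w x t * X k (x - \<sigma> * t))) has_integral (\<Sum>k<N. (f k * g k t) * moment w (X k) \<sigma> t)) {0..1}"
   unfolding moment_def
   by (intro has_integral_sum has_integral_mult_right integrable_integral moment_continuous(2)[OF w Xc that]) auto
  then show ?thesis by (intro integral_unique) (simp add: sum_distrib_left algebra_simps)
 qed
 have t0: "t \<ge> 0" if "t \<in> {c..d}" for t using that cd by auto
 have ic: "integral {c..d} F = integral {c..d} F'" if "\<And>t. t \<in> {c..d} \<Longrightarrow> F t = F' t" for F F' :: "real \<Rightarrow> real"
  using that by (rule integral_cong_on)
 show "test_fun2 \<eta>" using test_fun2_I[OF D S, of 0 0] D0 by simp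
 show "pairing w \<eta> = integral {c..d} (\<lambda>t. moment w (X 0) \<sigma> t * \<Theta> 0 t)"
  unfolding D0[symmetric] pe(1)
 proof (rule ic)
  fix t assume "t \<in> {c..d}"
  from inner[OF t0[OF this], where N = 1 and f = "\<lambda>_. 1" and g = "\<lambda>_. \<Theta> 0"]
  show "integral {0..1} (\<lambda>x. w x t * D 0 0 x t) = moment w (X 0) \<sigma> t * \<Theta> 0 t" by (simp add: D_def)
 qed
 show "pairing w (dx \<eta>) = integral {c..d} (\<lambda>t. moment w (X 1) \<sigma> t * \<Theta> 0 t)"
  unfolding der pe(1)
 proof (rule ic)
  fix t assume "t \<in> {c..d}"
  from inner[OF t0[OF this], where N = 2 and f = "\<lambda>k. if k = 1 then 1 else 0" and g = "\<lambda>_. \<Theta> 0"]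
  show "integral {0..1} (\<lambda>x. w x t * D 1 0 x t) = moment w (X 1) \<sigma> t * \<Theta> 0 t"
   by (simp add: D_def numeral_2_eq_2)
 qed
 show "pairing w (dt \<eta>) = integral {c..d} (\<lambda>t. moment w (X 0) \<sigma> t * \<Theta> 1 t - \<sigma> * (moment w (X 1) \<sigma> t * \<Theta> 0 t))"
  unfolding der pe(1)
 proof (rule ic)
  fix t assume "t \<in> {c..d}"
  from inner[OF t0[OF this], where N = 2 and f = "\<lambda>k. if k = 1 then - \<sigma> else 1" and g = "\<lambda>k. \<Theta> (1 - k)"]
  show "integral {0..1} (\<lambda>x. w x t * D 0 1 x t) = moment w (X 0) \<sigma> t * \<Theta> 1 t - \<sigma> * (moment w (X 1) \<sigma> t * \<Theta> 0 t)"
   by (simp add: D_def numeral_2_eq_2 algebra_simps)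
 qed
 have "pairing w (dt (dt \<eta>)) = integral {c..d} (\<lambda>t. (moment w (X 0) \<sigma> t * \<Theta> 2 t - 2 * \<sigma> * (moment w (X 1) \<sigma> t * \<Theta> 1 t)) + \<sigma>\<^sup>2 * (moment w (X 2) \<sigma> t * \<Theta> 0 t))"
  unfolding der(3) pe(1)
 proof (rule ic)
  fix t assume "t \<in> {c..d}"
  from inner[OF t0[OF this], where N = 3 and f = "\<lambda>k. if k = 2 then \<sigma>\<^sup>2 else if k = 1 then - 2 * \<sigma> else 1" and g = "\<lambda>k. \<Theta> (2 - k)"]
  show "integral {0..1} (\<lambda>x. w x t * D 0 2 x t) = (moment w (X 0) \<sigma> t * \<Theta> 2 t - 2 * \<sigma> * (moment w (X 1) \<sigma> t * \<Theta> 1 t)) + \<sigma>\<^sup>2 * (moment w (X 2) \<sigma> t * \<Theta> 0 t)"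
   by (simp add: D_def numeral_2_eq_2 numeral_3_eq_3 power2_eq_square algebra_simps)
 qed
 moreover have "pairing w (dx (dx \<eta>)) = integral {c..d} (\<lambda>t. moment w (X 2) \<sigma> t * \<Theta> 0 t)"
  unfolding der(4) pe(1)
 proof (rule ic)
  fix t assume "t \<in> {c..d}"
  from inner[OF t0[OF this], where N = 3 and f = "\<lambda>k. if k = 2 then 1 else 0" and g = "\<lambda>_. \<Theta> 0"]
  show "integral {0..1} (\<lambda>x. w x t * D 2 0 x t) = moment w (X 2) \<sigma> t * \<Theta> 0 t"
   by (simp add: D_def numeral_2_eq_2 numeral_3_eq_3)
 qed
 moreover have "continuous_on {c..d} (moment w (X m) \<sigma>)" for m
  by (rule continuous_on_subset[OF moment_continuous(1)[OF w Xc]]) (use cd in auto)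
 then have mi: "(\<lambda>t. moment w (X m) \<sigma> t * \<Theta> n t) integrable_on {c..d}" for m n
  by (intro integrable_continuous_real continuous_intros smooth_seq_continuous[OF \<Theta>])
 then have "integral {c..d} (\<lambda>t. (moment w (X 0) \<sigma> t * \<Theta> 2 t - 2 * \<sigma> * (moment w (X 1) \<sigma> t * \<Theta> 1 t)) + \<sigma>\<^sup>2 * (moment w (X 2) \<sigma> t * \<Theta> 0 t))
  = integral {c..d} (\<lambda>t. moment w (X 0) \<sigma> t * \<Theta> 2 t - 2 * \<sigma> * (moment w (X 1) \<sigma> t * \<Theta> 1 t)) + \<sigma>\<^sup>2 * integral {c..d} (\<lambda>t. moment w (X 2) \<sigma> t * \<Theta> 0 t)"
  by (intro integral_unique has_integral_add has_integral_mult_right integrable_integral integrable_diff integrable_on_mult_right)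
 ultimately show "pairing w (dt (dt \<eta>)) - \<sigma>\<^sup>2 * pairing w (dx (dx \<eta>)) = integral {c..d} (\<lambda>t. moment w (X 0) \<sigma> t * \<Theta> 2 t - 2 * \<sigma> * (moment w (X 1) \<sigma> t * \<Theta> 1 t))"
  by simp
qed

definition weak_wave :: "(real \<Rightarrow> real \<Rightarrow> real) \<Rightarrow> (real \<Rightarrow> real \<Rightarrow> real) \<Rightarrow> bool" where
 "weak_wave w wt \<longleftrightarrow> L2cont w \<and> L2cont wt \<and>
   (\<forall>\<eta>. test_fun2 \<eta> \<longrightarrow> pairing w (dt \<eta>) = - pairing wt \<eta>) \<and>
   (\<forall>\<eta>. test_fun2 \<eta> \<longrightarrow> pairing w (dt (dt \<eta>)) = pairing w (dx (dx \<eta>)))"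

text \<open>A profile with support in $(a,b)$ that stays inside $(0,1)$ while it moves with
 velocity \<open>\<sigma>\<close> during $[t_1,t_2]$.\<close>

definition profile :: "(nat \<Rightarrow> real \<Rightarrow> real) \<Rightarrow> real \<Rightarrow> real \<Rightarrow> real \<Rightarrow> real \<Rightarrow> real \<Rightarrow> bool" where
 "profile X a b \<sigma> t1 t2 \<longleftrightarrow> smooth_seq X \<and> a < b \<and> (\<forall>n z. z \<notin> {a<..<b} \<longrightarrow> X n z = 0) \<and>
   (\<forall>t\<in>{t1..t2}. 0 < a + \<sigma> * t \<and> b + \<sigma> * t < 1)"

lemma constant_on_Icc:
 fixes f :: "real \<Rightarrow> real"
 assumes "t1 < t2" "continuous_on {t1..t2} f" "\<And>s t. s \<in> {t1<..<t2} \<Longrightarrow> t \<in> {t1<..<t2} \<Longrightarrow> f s = f t"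
  and "s \<in> {t1..t2}" "t \<in> {t1..t2}"
 shows "f s = f t"
proof -
 define m where "m = (t1 + t2) / 2"
 have m: "m \<in> {t1<..<t2}" using assms(1) by (auto simp: m_def field_simps)
 have "f u = f m" if "u \<in> {t1..t2}" for u
 proof (rule continuous_constant_on_closure[of "{t1<..<t2}" f "f m" u])
  show "continuous_on (closure {t1<..<t2}) f" using assms(1,2) by simp
  show "f x = f m" if "x \<in> {t1<..<t2}" for x using that m by (rule assms(3))
  show "u \<in> closure {t1<..<t2}" using assms(1) that by simp
 qed
 from this[OF assms(4)] this[OF assms(5)] show ?thesis by simp
qed

text \<open>Integration in time of $\frac{d}{dt}\langle w,X\rangle=\langle w_t,X\rangle-\sigma\langle w,X'\rangle$ and of the
 conservation of the Riemann invariant $w_t-\sigma w_x$ along $x-\sigma t=z$, both in the moving frame.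
 They are obtained by testing the weak equations with $X(x-\sigma t)\Theta(t)$ and applying the lemma
 of du Bois-Reymond in \<open>t\<close>.\<close>

lemma moment_derivative:
 assumes w: "weak_wave w wt" and X: "profile X a b \<sigma> t1 t2" and t1: "0 \<le> t1" "t1 < t2"
 shows "t \<in> {t1..t2} \<Longrightarrow> moment w (X 0) \<sigma> t - moment w (X 0) \<sigma> t1 = integral {t1..t} (\<lambda>s. moment wt (X 0) \<sigma> s - \<sigma> * moment w (X 1) \<sigma> s)"
  and "\<sigma>\<^sup>2 = 1 \<Longrightarrow> t \<in> {t1..t2} \<Longrightarrow> moment wt (X 0) \<sigma> t + \<sigma> * moment w (X 1) \<sigma> t = moment wt (X 0) \<sigma> t1 + \<sigma> * moment w (X 1) \<sigma> t1"
proof -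
 have Lw: "L2cont w" and Lwt: "L2cont wt" and e1: "\<And>\<eta>. test_fun2 \<eta> \<Longrightarrow> pairing w (dt \<eta>) = - pairing wt \<eta>"
  and e2: "\<And>\<eta>. test_fun2 \<eta> \<Longrightarrow> pairing w (dt (dt \<eta>)) = pairing w (dx (dx \<eta>))"
  using w by (auto simp: weak_wave_def)
 have sX: "smooth_seq X" and ab: "a < b" and zX: "\<And>n z. z \<notin> {a<..<b} \<Longrightarrow> X n z = 0"
  and path: "\<And>t. t \<in> {t1..t2} \<Longrightarrow> 0 < a + \<sigma> * t \<and> b + \<sigma> * t < 1"
  using X by (auto simp: profile_def)
 have Xc: "continuous_on UNIV (X m)" for m by (rule smooth_seq_continuous[OF sX])
 note mc = moment_continuous(1)[OF Lw Xc, where \<sigma> = \<sigma>] and mtc = moment_continuous(1)[OF Lwt Xc, where \<sigma> = \<sigma>]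
 have mc': "continuous_on S (moment w (X m) \<sigma>)" "continuous_on S (moment wt (X m) \<sigma>)" if "S \<subseteq> {0..}" for S m
  using mc mtc that continuous_on_subset by blast+
 define k where "k s = moment wt (X 0) \<sigma> (max 0 s) - \<sigma> * moment w (X 1) \<sigma> (max 0 s)" for s
 have kc: "continuous_on UNIV k"
  unfolding k_def by (intro continuous_intros continuous_on_compose2[OF mc] continuous_on_compose2[OF mtc]) auto
 obtain U where U: "prim U k" using prim_exists[of k] continuous_absint[OF kc] by blast
 have S: "open_interval {t1<..<t2}" using t1 by simp
 have test: "integral {c..d} (\<lambda>t. moment w (X 0) \<sigma> t * \<Theta> 1 t - \<sigma> * (moment w (X 1) \<sigma> t * \<Theta> 0 t)) = - integral {c..d} (\<lambda>t. moment wt (X 0) \<sigma> t * \<Theta> 0 t)"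
   "\<sigma>\<^sup>2 = 1 \<Longrightarrow> integral {c..d} (\<lambda>t. moment w (X 0) \<sigma> t * \<Theta> 2 t - 2 * \<sigma> * (moment w (X 1) \<sigma> t * \<Theta> 1 t)) = 0"
  if T: "smooth_seq \<Theta>" "c < d" "{c..d} \<subseteq> {t1<..<t2}" "\<And>n x. x \<notin> {c<..<d} \<Longrightarrow> \<Theta> n x = 0" for \<Theta> c d
 proof -
  have cd: "t1 < c" "d < t2" using T(2) subsetD[OF T(3), of c] subsetD[OF T(3), of d] by auto
  have c0: "0 < c" and p: "\<And>t. t \<in> {c..d} \<Longrightarrow> 0 < a + \<sigma> * t \<and> b + \<sigma> * t < 1" using path cd t1 by auto
  from moving_supported[of a b X c d \<Theta> "\<sigma>", OF zX T(4) ab c0 T(2) p]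
  obtain a' b' where s: "supported (\<lambda>i j. moving X \<Theta> \<sigma> j i 0) a' b' c d" by blast
  note pw = pairing_moving[OF Lw sX T(1) s] and pt = pairing_moving[OF Lwt sX T(1) s]
  show "integral {c..d} (\<lambda>t. moment w (X 0) \<sigma> t * \<Theta> 1 t - \<sigma> * (moment w (X 1) \<sigma> t * \<Theta> 0 t)) = - integral {c..d} (\<lambda>t. moment wt (X 0) \<sigma> t * \<Theta> 0 t)"
   using e1[OF pw(1)] pw(4) pt(2) by simp
  show "integral {c..d} (\<lambda>t. moment w (X 0) \<sigma> t * \<Theta> 2 t - 2 * \<sigma> * (moment w (X 1) \<sigma> t * \<Theta> 1 t)) = 0" if "\<sigma>\<^sup>2 = 1"
   using e2[OF pw(1)] pw(5) that by simp
 qed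
 have ii: "(\<lambda>t. moment w (X m) \<sigma> t * \<Theta> n t) integrable_on {c..d}" "(\<lambda>t. moment wt (X m) \<sigma> t * \<Theta> n t) integrable_on {c..d}"
  if T: "smooth_seq \<Theta>" "{c..d} \<subseteq> {t1<..<t2}" for \<Theta> c d m n
 proof -
  have "{c..d} \<subseteq> {0..}" using T(2) t1 by force
  then show "(\<lambda>t. moment w (X m) \<sigma> t * \<Theta> n t) integrable_on {c..d}" "(\<lambda>t. moment wt (X m) \<sigma> t * \<Theta> n t) integrable_on {c..d}"
   by (auto intro!: integrable_continuous_real continuous_intros mc' smooth_seq_continuous[OF T(1)])
 qed
 have sub: "{t1..t2} \<subseteq> {0..}" using t1 by auto
 have const: "moment w (X 0) \<sigma> s - U s = moment w (X 0) \<sigma> t - U t" if "s \<in> {t1..t2}" "t \<in> {t1..t2}" for s t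
 proof (rule constant_on_Icc[OF t1(2) _ _ that, of "\<lambda>t. moment w (X 0) \<sigma> t - U t"])
  show "continuous_on {t1..t2} (\<lambda>t. moment w (X 0) \<sigma> t - U t)"
   by (intro continuous_intros mc'(1)[OF sub] prim_continuous[OF U])
  fix s t assume "s \<in> {t1<..<t2}" "t \<in> {t1<..<t2}"
  then show "moment w (X 0) \<sigma> s - U s = moment w (X 0) \<sigma> t - U t"
  proof (rule du_Bois_Reymond[OF S, of "\<lambda>t. moment w (X 0) \<sigma> t - U t", rotated -2])
   show "continuous_on {t1<..<t2} (\<lambda>t. moment w (X 0) \<sigma> t - U t)"
    using t1 by (intro continuous_intros mc' prim_continuous[OF U]) auto
   fix \<Theta> c d assume T: "smooth_seq \<Theta>" "c < d" "{c..d} \<subseteq> {t1<..<t2}" "\<And>n x. x \<notin> {c<..<d} \<Longrightarrow> \<Theta> n x = 0"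
   have t0: "t \<ge> 0" if "t \<in> {c..d}" for t using subsetD[OF T(3) that] t1 by auto
   have "integral {c..d} (\<lambda>t. U t * \<Theta> 1 t) = - integral {c..d} (\<lambda>t. k t * \<Theta> 0 t)"
    by (rule prim_test[OF U T(1,2,4)])
   also have "integral {c..d} (\<lambda>t. k t * \<Theta> 0 t) = integral {c..d} (\<lambda>t. moment wt (X 0) \<sigma> t * \<Theta> 0 t - \<sigma> * (moment w (X 1) \<sigma> t * \<Theta> 0 t))"
    by (rule integral_cong_on) (use t0 in \<open>auto simp: k_def max_def algebra_simps\<close>)
   also have "\<dots> = integral {c..d} (\<lambda>t. moment wt (X 0) \<sigma> t * \<Theta> 0 t) - \<sigma> * integral {c..d} (\<lambda>t. moment w (X 1) \<sigma> t * \<Theta> 0 t)"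
    by (intro integral_unique has_integral_diff has_integral_mult_right integrable_integral ii[OF T(1,3)])
   finally have 1: "integral {c..d} (\<lambda>t. U t * \<Theta> 1 t) = \<sigma> * integral {c..d} (\<lambda>t. moment w (X 1) \<sigma> t * \<Theta> 0 t) - integral {c..d} (\<lambda>t. moment wt (X 0) \<sigma> t * \<Theta> 0 t)" by simp
   have "integral {c..d} (\<lambda>t. moment w (X 0) \<sigma> t * \<Theta> 1 t - \<sigma> * (moment w (X 1) \<sigma> t * \<Theta> 0 t))
     = integral {c..d} (\<lambda>t. moment w (X 0) \<sigma> t * \<Theta> 1 t) - \<sigma> * integral {c..d} (\<lambda>t. moment w (X 1) \<sigma> t * \<Theta> 0 t)"
    by (intro integral_unique has_integral_diff has_integral_mult_right integrable_integral ii[OF T(1,3)])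
   then have 2: "integral {c..d} (\<lambda>t. moment w (X 0) \<sigma> t * \<Theta> 1 t) = integral {c..d} (\<lambda>t. U t * \<Theta> 1 t)"
    using 1 test(1)[OF T] by simp
   have Ui: "(\<lambda>t. U t * \<Theta> 1 t) integrable_on {c..d}"
    by (intro integrable_continuous_real continuous_intros prim_continuous[OF U] smooth_seq_continuous[OF T(1)])
   show "integral {c..d} (\<lambda>t. (moment w (X 0) \<sigma> t - U t) * \<Theta> 1 t) = 0"
    using 2 integral_diff[OF ii(1)[OF T(1,3), of 0 1] Ui] by (simp add: left_diff_distrib)
  qed
 qed
 show "moment w (X 0) \<sigma> t - moment w (X 0) \<sigma> t1 = integral {t1..t} (\<lambda>s. moment wt (X 0) \<sigma> s - \<sigma> * moment w (X 1) \<sigma> s)" if t: "t \<in> {t1..t2}"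
 proof -
  have "moment w (X 0) \<sigma> t - moment w (X 0) \<sigma> t1 = U t - U t1" using const[of t t1] t by simp
  also have "\<dots> = integral {t1..t} k" using prim_integral[OF U, of t1 t] t by simp
  also have "\<dots> = integral {t1..t} (\<lambda>s. moment wt (X 0) \<sigma> s - \<sigma> * moment w (X 1) \<sigma> s)"
   by (rule integral_cong_on) (use t1 in \<open>auto simp: k_def max_def\<close>)
  finally show ?thesis .
 qed
 show "moment wt (X 0) \<sigma> t + \<sigma> * moment w (X 1) \<sigma> t = moment wt (X 0) \<sigma> t1 + \<sigma> * moment w (X 1) \<sigma> t1"
  if s2: "\<sigma>\<^sup>2 = 1" and t: "t \<in> {t1..t2}"
 proof (rule constant_on_Icc[OF t1(2), of "\<lambda>t. moment wt (X 0) \<sigma> t + \<sigma> * moment w (X 1) \<sigma> t"])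
  show "continuous_on {t1..t2} (\<lambda>t. moment wt (X 0) \<sigma> t + \<sigma> * moment w (X 1) \<sigma> t)"
   by (intro continuous_intros mc'[OF sub])
  fix s t assume "s \<in> {t1<..<t2}" "t \<in> {t1<..<t2}"
  then show "moment wt (X 0) \<sigma> s + \<sigma> * moment w (X 1) \<sigma> s = moment wt (X 0) \<sigma> t + \<sigma> * moment w (X 1) \<sigma> t"
  proof (rule du_Bois_Reymond[OF S, of "\<lambda>t. moment wt (X 0) \<sigma> t + \<sigma> * moment w (X 1) \<sigma> t", rotated -2])
   show "continuous_on {t1<..<t2} (\<lambda>t. moment wt (X 0) \<sigma> t + \<sigma> * moment w (X 1) \<sigma> t)"
    using t1 by (intro continuous_intros mc') auto
   fix \<Theta> c d assume T: "smooth_seq \<Theta>" "c < d" "{c..d} \<subseteq> {t1<..<t2}" "\<And>n x. x \<notin> {c<..<d} \<Longrightarrow> \<Theta> n x = 0"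
   define A B C where "A = integral {c..d} (\<lambda>t. moment w (X 0) \<sigma> t * \<Theta> 2 t)"
    and "B = integral {c..d} (\<lambda>t. moment wt (X 0) \<sigma> t * \<Theta> 1 t)" and "C = integral {c..d} (\<lambda>t. moment w (X 1) \<sigma> t * \<Theta> 1 t)"
   have T': "smooth_seq (\<lambda>n. \<Theta> (Suc n))" "\<And>n x. x \<notin> {c<..<d} \<Longrightarrow> \<Theta> (Suc n) x = 0"
    using smooth_seq_Suc[OF T(1)] T(4) by auto
   have "A - \<sigma> * C = - B"
   proof -
    have "integral {c..d} (\<lambda>t. moment w (X 0) \<sigma> t * \<Theta> 2 t - \<sigma> * (moment w (X 1) \<sigma> t * \<Theta> 1 t)) = A - \<sigma> * C"
     unfolding A_def C_def by (intro integral_unique has_integral_diff has_integral_mult_right integrable_integral ii[OF T(1,3)])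
    then show ?thesis
     using test(1)[of "\<lambda>n. \<Theta> (Suc n)" c d, OF T'(1) T(2,3)] T'(2) unfolding B_def by (simp add: numeral_2_eq_2)
   qed
   moreover have "A - 2 * \<sigma> * C = 0"
   proof -
    have "integral {c..d} (\<lambda>t. moment w (X 0) \<sigma> t * \<Theta> 2 t - 2 * \<sigma> * (moment w (X 1) \<sigma> t * \<Theta> 1 t)) = A - 2 * \<sigma> * C"
     unfolding A_def C_def by (intro integral_unique has_integral_diff has_integral_mult_right integrable_integral ii[OF T(1,3)])
    then show ?thesis using test(2)[OF T s2] by simp
   qed
   ultimately have "B + \<sigma> * C = 0" by (simp add: algebra_simps)
   moreover have "integral {c..d} (\<lambda>t. moment wt (X 0) \<sigma> t * \<Theta> 1 t + \<sigma> * (moment w (X 1) \<sigma> t * \<Theta> 1 t)) = B + \<sigma> * C"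
    unfolding B_def C_def by (intro integral_unique has_integral_add has_integral_mult_right integrable_integral ii[OF T(1,3)])
   ultimately show "integral {c..d} (\<lambda>t. (moment wt (X 0) \<sigma> t + \<sigma> * moment w (X 1) \<sigma> t) * \<Theta> 1 t) = 0"
    by (simp add: algebra_simps)
  qed
 qed (use t t1 in auto)
qed

text \<open>For $W_t=-W_x$ the function itself is the invariant along characteristics of velocity 1.\<close>

lemma transport_moment_constant:
 assumes L: "L2cont W" and e: "\<And>\<eta>. test_fun2 \<eta> \<Longrightarrow> pairing W (dt \<eta>) = - pairing W (dx \<eta>)"
  and X: "profile X a b 1 t1 t2" and t1: "0 \<le> t1" "t1 < t2" and t: "t \<in> {t1..t2}"
 shows "moment W (X 0) 1 t = moment W (X 0) 1 t1"
proof -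
 have sX: "smooth_seq X" and ab: "a < b" and zX: "\<And>n z. z \<notin> {a<..<b} \<Longrightarrow> X n z = 0"
  and path: "\<And>t. t \<in> {t1..t2} \<Longrightarrow> 0 < a + 1 * t \<and> b + 1 * t < 1"
  using X by (auto simp: profile_def)
 have Xc: "continuous_on UNIV (X m)" for m by (rule smooth_seq_continuous[OF sX])
 have mc: "continuous_on S (moment W (X m) 1)" if "S \<subseteq> {0..}" for S m
  using moment_continuous(1)[OF L Xc] that continuous_on_subset by blast
 have S: "open_interval {t1<..<t2}" using t1 by simp
 show ?thesis
 proof (rule constant_on_Icc[OF t1(2), of "moment W (X 0) 1"])
  show "continuous_on {t1..t2} (moment W (X 0) 1)" using t1 by (intro mc) auto
  fix s t assume "s \<in> {t1<..<t2}" "t \<in> {t1<..<t2}"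
  then show "moment W (X 0) 1 s = moment W (X 0) 1 t"
  proof (rule du_Bois_Reymond[OF S, of "moment W (X 0) 1", rotated -2])
   show "continuous_on {t1<..<t2} (moment W (X 0) 1)" using t1 by (intro mc) auto
   fix \<Theta> c d assume T: "smooth_seq \<Theta>" "c < d" "{c..d} \<subseteq> {t1<..<t2}" "\<And>n x. x \<notin> {c<..<d} \<Longrightarrow> \<Theta> n x = 0"
   have cd: "t1 < c" "d < t2" using T(2) subsetD[OF T(3), of c] subsetD[OF T(3), of d] by auto
   have c0: "0 < c" and p: "\<And>t. t \<in> {c..d} \<Longrightarrow> 0 < a + 1 * t \<and> b + 1 * t < 1" using path cd t1 by auto
   from moving_supported[of a b X c d \<Theta> "1", OF zX T(4) ab c0 T(2) p]
   obtain a' b' where s: "supported (\<lambda>i j. moving X \<Theta> 1 j i 0) a' b' c d" by blast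
   note pw = pairing_moving[OF L sX T(1) s]
   have "{c..d} \<subseteq> {0..}" using cd t1 by auto
   then have i: "(\<lambda>t. moment W (X m) 1 t * \<Theta> n t) integrable_on {c..d}" for m n
    by (intro integrable_continuous_real continuous_intros mc smooth_seq_continuous[OF T(1)])
   have "integral {c..d} (\<lambda>t. moment W (X 0) 1 t * \<Theta> 1 t - 1 * (moment W (X 1) 1 t * \<Theta> 0 t))
     = - integral {c..d} (\<lambda>t. moment W (X 1) 1 t * \<Theta> 0 t)"
    using e[OF pw(1)] pw(3,4) by simp
   then show "integral {c..d} (\<lambda>t. moment W (X 0) 1 t * \<Theta> 1 t) = 0"
    using integral_diff[OF i[of 0 1] i[of 1 0]] by simp
  qed
 qed (use t t1 in auto)
qed

section \<open>Uniqueness for the closed loop\<close>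

text \<open>Equality of all local means at two points, for the same mollifiers, gives equality of the values.\<close>

lemma mollifier_limit:
 assumes u: "continuous_on {0..1} u" and v: "continuous_on {0..1} v"
  and x: "0 < x" "x < 1" and y: "0 < y" "y < 1" and d0: "0 < d0"
  and eq: "\<And>M d. 0 < d \<Longrightarrow> d < d0 \<Longrightarrow> smooth_seq M \<Longrightarrow> (\<And>n z. \<bar>z\<bar> \<ge> d \<Longrightarrow> M n z = 0) \<Longrightarrow>
   integral {0..1} (\<lambda>z. u z * M 0 (z - x)) = integral {0..1} (\<lambda>z. v z * M 0 (z - y))"
 shows "u x = (v y :: real)"
proof -
 have "\<bar>u x - v y\<bar> \<le> 0 + e" if e: "e > 0" for e
 proof -
  have at: "\<exists>d>0. \<forall>z. \<bar>z - p\<bar> < d \<longrightarrow> \<bar>f z - f p\<bar> < e / 2"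
   if "continuous_on {0..1} f" "0 < p" "p < 1" for f :: "real \<Rightarrow> real" and p
  proof -
   have "isCont f p" using continuous_on_interior[OF that(1), of p] that(2,3) by simp
   then show ?thesis using e unfolding continuous_at_eps_delta dist_real_def by (meson half_gt_zero)
  qed
  obtain d1 where d1: "d1 > 0" "\<And>z. \<bar>z - x\<bar> < d1 \<Longrightarrow> \<bar>u z - u x\<bar> < e / 2" using at[OF u x] by blast
  obtain d2 where d2: "d2 > 0" "\<And>z. \<bar>z - y\<bar> < d2 \<Longrightarrow> \<bar>v z - v y\<bar> < e / 2" using at[OF v y] by blast
  let ?S = "{d0, d1, d2, x, 1 - x, y, 1 - y}"
  define q where "q = Min ?S"
  have q0: "0 < q" unfolding q_def using d0 d1(1) d2(1) x y by (subst Min_gr_iff) auto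
  have qm: "q \<le> m" if "m \<in> ?S" for m
   unfolding q_def by (rule Min_le) (simp, rule that)
  define d where "d = q / 2"
  have d: "0 < d" using q0 unfolding d_def by linarith
  have dm: "2 * d \<le> m" if "m \<in> ?S" for m
   using qm[OF that] unfolding d_def by linarith
  have dm': "2 * d \<le> d0" "2 * d \<le> d1" "2 * d \<le> d2" "2 * d \<le> x" "2 * d \<le> 1 - x" "2 * d \<le> y" "2 * d \<le> 1 - y"
   by (rule dm, blast)+
  then have dl: "d < d0" "d < d1" "d < d2" "d \<le> x" "d \<le> 1 - x" "d \<le> y" "d \<le> 1 - y" using d by linarith+
  obtain M where M: "smooth_seq M" "\<And>x. 0 \<le> M 0 x" "\<And>n x. \<bar>x\<bar> \<ge> d \<Longrightarrow> M n x = 0" "(M 0 has_integral 1) {-d..d}"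
   using mollifier[OF d] by blast
  have "\<bar>integral {0..1} (\<lambda>z. u z * M 0 (z - x)) - u x\<bar> \<le> e / 2"
   by (rule mollifier_close[OF M d _ _ u less_imp_le[OF d1(2)]]) (use dl in linarith)+
  moreover have "\<bar>integral {0..1} (\<lambda>z. v z * M 0 (z - y)) - v y\<bar> \<le> e / 2"
   by (rule mollifier_close[OF M d _ _ v less_imp_le[OF d2(2)]]) (use dl in linarith)+
  ultimately show ?thesis using eq[OF d dl(1) M(1,3)] by linarith
 qed
 then have "\<bar>u x - v y\<bar> \<le> 0" by (rule field_le_epsilon)
 then show ?thesis by simp
qed

lemma profile_shift:
 assumes "smooth_seq M" "\<And>n z. \<bar>z\<bar> \<ge> d \<Longrightarrow> M n z = 0" "0 < d"
  and "\<And>t. t \<in> {t1..t2} \<Longrightarrow> 0 < p - d + \<sigma> * t \<and> p + d + \<sigma> * t < 1"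
 shows "profile (\<lambda>n z. M n (z - p)) (p - d) (p + d) \<sigma> t1 t2"
 unfolding profile_def
proof (intro conjI allI impI ballI)
 show "smooth_seq (\<lambda>n z. M n (z - p))" by (rule smooth_seq_shift[OF assms(1)])
 show "M n (z - p) = 0" if "z \<notin> {p - d<..<p + d}" for n z
  by (rule assms(2)) (use that in auto)
qed (use assms(3,4) in auto)

text \<open>The initial velocity vanishes in the mean, and up to time \<open>T\<close> the moments of \<open>w\<close> do not move; the
 derivative of a constant moment is the moment of the velocity.\<close>

lemma velocity_zero:
 assumes w: "weak_wave w wt" and z: "\<And>x t. x \<in> {0..1} \<Longrightarrow> t \<in> {0..T} \<Longrightarrow> w x t = 0"
  and i: "AE x in lebesgue_on {0..1}. wt x 0 = 0" and X: "profile X a b 0 0 T" and T: "0 \<le> T"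
 shows "moment wt (X 0) 0 T = 0"
proof (cases "T = 0")
 case True
 have "AE x in lebesgue. x \<in> {0..1} \<longrightarrow> wt x 0 = 0" using i by (simp add: AE_restrict_space_iff)
 then obtain N where N: "N \<in> null_sets lebesgue" "{x. \<not> (x \<in> {0..1} \<longrightarrow> wt x 0 = 0)} \<subseteq> N"
  unfolding eventually_ae_filter by auto
 have "integral {0..1} (\<lambda>x. wt x 0 * X 0 x) = integral {0..1::real} (\<lambda>x. 0)"
  by (rule integral_spike[of N]) (use N in \<open>auto simp: negligible_iff_null_sets\<close>)
 then show ?thesis using True by (simp add: moment_def)
next
 case False
 then have T0: "0 < T" using T by simp
 have sX: "smooth_seq X" using X by (simp add: profile_def)
 have Lwt: "L2cont wt" using w by (simp add: weak_wave_def)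
 have mc: "continuous_on {0..} (moment wt (X 0) 0)" by (rule moment_continuous(1)[OF Lwt smooth_seq_continuous[OF sX]])
 define k where "k s = moment wt (X 0) 0 (max 0 s)" for s
 have kc: "continuous_on UNIV k"
  unfolding k_def by (intro continuous_on_compose2[OF mc] continuous_intros) auto
 obtain U where U: "prim U k" using prim_exists[of k] continuous_absint[OF kc] by blast
 have Uc: "U t = U 0" if t: "t \<in> {0..T}" for t
 proof -
  have "moment w (X 0) 0 s = 0" if "s \<in> {0..T}" for s
  proof -
   have "integral {0..1} (\<lambda>x. w x s * X 0 (x - 0 * s)) = integral {0..1::real} (\<lambda>x. 0)"
    by (rule integral_cong_on) (use that in \<open>simp add: z\<close>)
   then show ?thesis by (simp add: moment_def)
  qed
  then have "integral {0..t} (\<lambda>s. moment wt (X 0) 0 s - 0 * moment w (X 1) 0 s) = 0"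
   using moment_derivative(1)[OF w X _ T0 t] t by simp
  moreover have "integral {0..t} k = integral {0..t} (\<lambda>s. moment wt (X 0) 0 s - 0 * moment w (X 1) 0 s)"
   by (rule integral_cong_on) (simp add: k_def)
  ultimately show ?thesis using prim_integral[OF U, of 0 t] t by simp
 qed
 have "k t = 0" if t: "t \<in> {0<..<T}" for t
 proof -
  have "\<forall>\<^sub>F s in nhds t. U s = U 0"
  proof (rule eventually_nhds_in_open[of "{0<..<T}", THEN eventually_mono])
   show "U s = U 0" if "s \<in> {0<..<T}" for s by (rule Uc) (use that in auto)
  qed (use t in auto)
  then have "(U has_real_derivative 0) (at t)"
   using DERIV_cong_ev[OF refl _ refl, of U "\<lambda>_. U 0" t 0] by simp
  then show ?thesis using prim_deriv[OF U kc, of t] DERIV_unique by blast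
 qed
 then have "k T = 0"
  by (intro continuous_constant_on_closure[of "{0<..<T}" k 0 T]) (use T0 continuous_on_subset[OF kc] in auto)
 then show ?thesis using T by (simp add: k_def max_def)
qed

text \<open>The invariant is zero at time \<open>T\<close>, where position and velocity vanish, and is transported.\<close>

lemma riemann_invariant_zero:
 assumes w: "weak_wave w wt" and z: "\<And>x t. x \<in> {0..1} \<Longrightarrow> t \<in> {0..T} \<Longrightarrow> w x t = 0"
  and i: "AE x in lebesgue_on {0..1}. wt x 0 = 0" and X: "profile X a b \<sigma> T t" and T: "0 \<le> T" "T \<le> t"
  and \<sigma>: "\<sigma>\<^sup>2 = 1"
 shows "moment wt (X 0) \<sigma> t + \<sigma> * moment w (X 1) \<sigma> t = 0"
proof -
 have sX: "smooth_seq X" and ab: "a < b" "\<And>n z. z \<notin> {a<..<b} \<Longrightarrow> X n z = 0" "0 < a + \<sigma> * T" "b + \<sigma> * T < 1"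
  using X T by (auto simp: profile_def)
 have "profile (\<lambda>n z. X n (z - \<sigma> * T)) (a + \<sigma> * T) (b + \<sigma> * T) 0 0 T"
  unfolding profile_def
 proof (intro conjI allI impI ballI)
  show "smooth_seq (\<lambda>n z. X n (z - \<sigma> * T))" by (rule smooth_seq_shift[OF sX])
  show "X n (z - \<sigma> * T) = 0" if "z \<notin> {a + \<sigma> * T<..<b + \<sigma> * T}" for n z
   by (rule ab(2)) (use that in auto)
 qed (use ab in auto)
 from velocity_zero[OF w z i this T(1)] have 1: "moment wt (X 0) \<sigma> T = 0" by (simp add: moment_def)
 have "integral {0..1} (\<lambda>x. w x T * X 1 (x - \<sigma> * T)) = integral {0..1::real} (\<lambda>x. 0)"
  by (rule integral_cong_on) (simp add: z T)
 then have 2: "moment w (X 1) \<sigma> T = 0" by (simp add: moment_def)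
 show ?thesis
 proof (cases "T = t")
  case True then show ?thesis using 1 2 by simp
 next
  case False
  then show ?thesis using moment_derivative(2)[OF w X T(1) _ \<sigma>, of t] T 1 2 by simp
 qed
qed

text \<open>A wave that vanishes up to time \<open>T\<close> carries no signal with velocity $-\sigma$ into the points
 from which the backward characteristic of that velocity reaches time \<open>T\<close> inside $(0,1)$, so
 it is constant along the characteristics of velocity \<open>\<sigma>\<close> there.\<close>

lemma constant_on_characteristic:
 assumes w: "weak_wave w wt" and wc: "\<And>t. t \<ge> 0 \<Longrightarrow> continuous_on {0..1} (\<lambda>x. w x t)"
  and z: "\<And>x t. x \<in> {0..1} \<Longrightarrow> t \<in> {0..T} \<Longrightarrow> w x t = 0"
  and i: "AE x in lebesgue_on {0..1}. wt x 0 = 0" and T: "0 \<le> T" and k: "0 \<le> k" "T \<le> t - k"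
  and \<sigma>: "\<sigma> = 1 \<or> \<sigma> = - 1" and x: "x \<in> {0<..<1}" "x - \<sigma> * k \<in> {0<..<1}" "x + \<sigma> * (t - T) \<in> {0<..<1}"
 shows "w x t = w (x - \<sigma> * k) (t - k)"
proof (cases "k = 0")
 case False
 then have k0: "0 < k" using k by simp
 define lo hi where "lo = min (x - \<sigma> * k) (x + \<sigma> * (t - T))" and "hi = max (x - \<sigma> * k) (x + \<sigma> * (t - T))"
 have lh: "0 < lo" "hi < 1" using x by (auto simp: lo_def hi_def)
 have btw: "lo \<le> x + \<sigma> * q \<and> x + \<sigma> * q \<le> hi" if "- k \<le> q" "q \<le> t - T" for q
  using \<sigma> that by (auto simp: lo_def hi_def)
 have t0: "t \<ge> 0" "t - k \<ge> 0" using T k by auto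
 show ?thesis
 proof (rule mollifier_limit[OF wc[OF t0(1)] wc[OF t0(2)]])
  show "0 < min lo (1 - hi)" using lh by simp
  fix M d assume d: "0 < d" "d < min lo (1 - hi)" and M: "smooth_seq M" "\<And>n z. \<bar>z\<bar> \<ge> d \<Longrightarrow> M n z = 0"
  have dl: "d < lo" "d < 1 - hi" using d by auto
  \<comment> \<open>\<open>Y\<close> is at \<open>x\<close> at time \<open>t\<close> and moves with velocity \<open>\<sigma>\<close>\<close>
  define Y where "Y n z = M n (z - (x - \<sigma> * t))" for n z
  have Y: "profile Y (x - \<sigma> * t - d) (x - \<sigma> * t + d) \<sigma> (t - k) t"
   unfolding Y_def
  proof (rule profile_shift[OF M d(1)])
   fix s assume "s \<in> {t - k..t}"
   then have "lo \<le> x + \<sigma> * (s - t) \<and> x + \<sigma> * (s - t) \<le> hi" using k by (intro btw) auto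
   moreover have "x - \<sigma> * t - d + \<sigma> * s = x + \<sigma> * (s - t) - d" "x - \<sigma> * t + d + \<sigma> * s = x + \<sigma> * (s - t) + d"
    by (simp_all add: algebra_simps)
   ultimately show "0 < x - \<sigma> * t - d + \<sigma> * s \<and> x - \<sigma> * t + d + \<sigma> * s < 1"
    using dl by linarith
  qed
  have inv: "moment wt (Y 0) \<sigma> s - \<sigma> * moment w (Y 1) \<sigma> s = 0" if s: "s \<in> {t - k..t}" for s
  proof -
   \<comment> \<open>\<open>X\<close> moves with velocity $-\sigma$ and meets \<open>Y\<close> at time \<open>s\<close>\<close>
   define X where "X n z = M n (z - (x - \<sigma> * t + 2 * \<sigma> * s))" for n z
   have "profile X (x - \<sigma> * t + 2 * \<sigma> * s - d) (x - \<sigma> * t + 2 * \<sigma> * s + d) (- \<sigma>) T s"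
    unfolding X_def
   proof (rule profile_shift[OF M d(1)])
    fix r assume "r \<in> {T..s}"
    then have "lo \<le> x + \<sigma> * (2 * s - t - r) \<and> x + \<sigma> * (2 * s - t - r) \<le> hi" using s by (intro btw) auto
    moreover have "x - \<sigma> * t + 2 * \<sigma> * s - d + - \<sigma> * r = x + \<sigma> * (2 * s - t - r) - d"
     "x - \<sigma> * t + 2 * \<sigma> * s + d + - \<sigma> * r = x + \<sigma> * (2 * s - t - r) + d"
     by (simp_all add: algebra_simps)
    ultimately show "0 < x - \<sigma> * t + 2 * \<sigma> * s - d + - \<sigma> * r \<and> x - \<sigma> * t + 2 * \<sigma> * s + d + - \<sigma> * r < 1"
     using dl by linarith
   qed
   from riemann_invariant_zero[OF w z i this T] s k \<sigma>
   have "moment wt (X 0) (- \<sigma>) s + - \<sigma> * moment w (X 1) (- \<sigma>) s = 0" by auto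
   moreover have "X n (y - - \<sigma> * s) = Y n (y - \<sigma> * s)" for n y
    by (simp add: X_def Y_def algebra_simps)
   ultimately show ?thesis by (simp add: moment_def)
  qed
  have "integral {t - k..t} (\<lambda>s. moment wt (Y 0) \<sigma> s - \<sigma> * moment w (Y 1) \<sigma> s) = integral {t - k..t} (\<lambda>s. 0)"
   by (rule integral_cong_on) (rule inv)
  then have "moment w (Y 0) \<sigma> t = moment w (Y 0) \<sigma> (t - k)"
   using moment_derivative(1)[OF w Y t0(2), of t] k0 by simp
  then show "integral {0..1} (\<lambda>z. w z t * M 0 (z - x)) = integral {0..1} (\<lambda>z. w z (t - k) * M 0 (z - (x - \<sigma> * k)))"
   by (simp add: moment_def Y_def algebra_simps)
 qed (use x in auto)
qed simp

text \<open>Continuity in time is uniform in \<open>x\<close>, by the supremum bound.\<close>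

lemma continuous_HH_joint:
 assumes c: "continuous_HH (state_at w wt)"
 shows "continuous_on ({0..1} \<times> {0..}) (\<lambda>z. w (fst z) (snd z))" "\<And>t. t \<ge> 0 \<Longrightarrow> continuous_on {0..1} (\<lambda>x. w x t)"
proof -
 note ci = continuous_HH_imp[OF c]
 show cx: "continuous_on {0..1} (\<lambda>x. w x t)" if "t \<ge> 0" for t
  using ci(1)[OF that] by (auto simp: HH_def state_at_def H1_def)
 show "continuous_on ({0..1} \<times> {0..}) (\<lambda>z. w (fst z) (snd z))"
  unfolding continuous_on_iff
 proof (intro ballI allI impI)
  fix z0 :: "real \<times> real" and e :: real assume z0: "z0 \<in> {0..1} \<times> {0..}" and e: "0 < e"
  obtain x0 t0 where z0e: "z0 = (x0, t0)" by (cases z0)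
  have x0: "x0 \<in> {0..1}" "t0 \<ge> 0" using z0 z0e by auto
  have "((\<lambda>s. HHdist (state_at w wt s) (state_at w wt t0)) \<longlongrightarrow> 0) (at t0 within {0..})"
   using c x0 by (simp add: continuous_HH_def)
  then have "\<forall>\<^sub>F s in at t0 within {0..}. HHdist (state_at w wt s) (state_at w wt t0) < e / 4"
   using e by (intro order_tendstoD(2)) auto
  then obtain d1 where d1: "d1 > 0" "\<And>s. s \<ge> 0 \<Longrightarrow> s \<noteq> t0 \<Longrightarrow> \<bar>s - t0\<bar> < d1 \<Longrightarrow> HHdist (state_at w wt s) (state_at w wt t0) < e / 4"
   unfolding eventually_at dist_real_def by auto
  obtain d2 where d2: "d2 > 0" "\<And>x. x \<in> {0..1} \<Longrightarrow> \<bar>x - x0\<bar> < d2 \<Longrightarrow> \<bar>w x t0 - w x0 t0\<bar> < e / 2"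
   using cx[OF x0(2)] x0(1) e unfolding continuous_on_iff dist_real_def by (meson half_gt_zero)
  have tt: "\<bar>w x s - w x t0\<bar> < e / 2" if x: "x \<in> {0..1}" and s: "s \<ge> 0" "\<bar>s - t0\<bar> < d1" for x s
  proof (cases "s = t0")
   case False
   let ?d = "HHdist (state_at w wt s) (state_at w wt t0)"
   have d: "0 \<le> ?d" "?d < e / 4" using d1(2) s False HHdist_bounds(3)[OF ci(1) ci(1)] x0(2) by auto
   have "(w x s - w x t0)\<^sup>2 \<le> 2 * ?d\<^sup>2"
    using HHdist_bounds(1)[OF ci(1)[OF s(1)] ci(1)[OF x0(2)] x] by (simp add: state_at_def)
   also have "\<dots> \<le> (2 * ?d)\<^sup>2" by (simp add: power_mult_distrib)
   finally have "\<bar>w x s - w x t0\<bar> \<le> 2 * ?d" using d abs_le_square_iff[of "w x s - w x t0" "2 * ?d"] by simp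
   then show ?thesis using d by simp
  qed (use e in simp)
  show "\<exists>d>0. \<forall>z\<in>{0..1} \<times> {0..}. dist z z0 < d \<longrightarrow> dist (w (fst z) (snd z)) (w (fst z0) (snd z0)) < e"
  proof (intro exI[of _ "min d1 d2"] conjI ballI impI)
   fix z assume z: "z \<in> {0..1} \<times> {0::real..}" "dist z z0 < min d1 d2"
   obtain x s where ze: "z = (x, s)" by (cases z)
   have "\<bar>x - x0\<bar> \<le> dist z z0" "\<bar>s - t0\<bar> \<le> dist z z0"
    using dist_fst_le[of z z0] dist_snd_le[of z z0] by (simp_all add: ze z0e dist_real_def)
   then have "\<bar>w x s - w x t0\<bar> < e / 2" "\<bar>w x t0 - w x0 t0\<bar> < e / 2"
    using z ze tt[of x s] d2(2)[of x] by auto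
   then have "\<bar>w x s - w x0 t0\<bar> < e" by linarith
   then show "dist (w (fst z) (snd z)) (w (fst z0) (snd z0)) < e" by (simp add: ze z0e dist_real_def)
  qed (use d1 d2 in simp)
 qed
qed

text \<open>Passage to the boundary point of a characteristic.\<close>

lemma characteristic_endpoint:
 fixes w :: "real \<Rightarrow> real \<Rightarrow> real"
 assumes c: "continuous_on ({0..1} \<times> {0..}) (\<lambda>z. w (fst z) (snd z))"
  and K: "0 < K" "K \<le> t" and x: "x \<in> {0..1}" and \<sigma>: "\<sigma> = 1 \<or> \<sigma> = - 1" and e: "x - \<sigma> * K \<in> {0..1}"
  and eq: "\<And>k. 0 \<le> k \<Longrightarrow> k < K \<Longrightarrow> w x t = w (x - \<sigma> * k) (t - k)"
 shows "w x t = w (x - \<sigma> * K) (t - K)"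
proof -
 have "continuous_on {0..K} (\<lambda>k. w (x - \<sigma> * k) (t - k))"
 proof -
  have 1: "continuous_on {0..K} (\<lambda>k. (x - \<sigma> * k, t - k))" by (intro continuous_intros)
  have 2: "(\<lambda>k. (x - \<sigma> * k, t - k)) ` {0..K} \<subseteq> {0..1} \<times> {0..}" using K x \<sigma> e by auto
  from continuous_on_compose2[OF c 1 2] show ?thesis by simp
 qed
 then have cc: "continuous_on (closure {0<..<K}) (\<lambda>k. w (x - \<sigma> * k) (t - k))" using K by simp
 have "w (x - \<sigma> * k) (t - k) = w x t" if "k \<in> {0<..<K}" for k using eq[of k] that by simp
 then have "w (x - \<sigma> * K) (t - K) = w x t"
  by (rule continuous_constant_on_closure[OF cc]) (use K in auto)
 then show ?thesis by simp
qed

text \<open>$w_x(0,\cdot)=-w_t(0,\cdot)$ for a wave that is purely outgoing near $x=0$, in integrated form. As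
 $w(x,t)=w(0,t-x)$, the integral over $[s,r]$ of the difference quotient in \<open>x\<close> is a difference of
 two means of the continuous function $w(0,\cdot)$ over intervals of length \<open>x\<close> ending at \<open>s\<close> and \<open>r\<close>.\<close>

lemma outgoing_trace:
 assumes g: "continuous_on {0..} (\<lambda>t. w 0 t)" and x0: "0 < x0" "x0 \<le> 1"
  and out: "\<And>x t. 0 < x \<Longrightarrow> x < x0 \<Longrightarrow> x \<le> t \<Longrightarrow> t < L \<Longrightarrow> w x t = w 0 (t - x)"
  and tr: "x_trace w 0 \<xi>" and sr: "0 < s" "s \<le> r" "r < L"
 shows "integral {s..r} \<xi> = w 0 s - w 0 r"
proof -
 define g0 where "g0 t = w 0 (max 0 t)" for t
 have g0c: "continuous_on UNIV g0" unfolding g0_def by (intro continuous_on_compose2[OF g] continuous_intros) auto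
 obtain P where P: "prim P g0" using prim_exists[of g0] continuous_absint[OF g0c] by blast
 define q where "q x t = (w x t - w 0 t) / (x - 0)" for x t
 have r0: "0 < r" using sr by simp
 have \<xi>: "\<xi> \<in> L2 {0..r}" using tr r0 by (simp add: x_trace_def L2loc_def)
 have ev: "\<forall>\<^sub>F x in at 0 within {0..1}. (\<lambda>t. q x t - \<xi> t) \<in> L2 {0..r}"
  and lim: "((\<lambda>x. L2norm {0..r} (\<lambda>t. q x t - \<xi> t)) \<longlongrightarrow> 0) (at 0 within {0..1})"
  using tr r0 by (auto simp: x_trace_def tendsto_L2loc_def q_def)
 have sub: "f \<in> L2 {s..r}" if "f \<in> L2 {0..r}" for f by (rule L2_subset[OF that]) (use sr in auto)
 have F1: "((\<lambda>x. integral {s..r} (q x)) \<longlongrightarrow> integral {s..r} \<xi>) (at 0 within {0..1})"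
 proof (rule LIM_zero_cancel, rule Lim_null_comparison)
  show "((\<lambda>x. sqrt r * L2norm {0..r} (\<lambda>t. q x t - \<xi> t)) \<longlongrightarrow> 0) (at 0 within {0..1})"
   by (rule tendsto_mult_right_zero[OF lim])
  show "\<forall>\<^sub>F x in at 0 within {0..1}. norm (integral {s..r} (q x) - integral {s..r} \<xi>) \<le> sqrt r * L2norm {0..r} (\<lambda>t. q x t - \<xi> t)"
   using ev
  proof eventually_elim
   case (elim x)
   let ?D = "\<lambda>t. q x t - \<xi> t"
   have "q x \<in> L2 {0..r}" using L2_add[OF _ elim \<xi>] by simp
   then have i: "q x integrable_on {s..r}" "\<xi> integrable_on {s..r}"
    by (auto intro!: absint_int L2_imp_absint sub \<xi>)
   have "(integral {s..r} ?D)\<^sup>2 \<le> (r - s) * integral {s..r} (\<lambda>t. (?D t)\<^sup>2)"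
    by (rule Cauchy_Schwarz_interval[OF sub[OF elim] sr(2)])
   also have "\<dots> \<le> r * integral {0..r} (\<lambda>t. (?D t)\<^sup>2)"
    using sub[OF elim] elim sr by (intro mult_mono integral_subset_le integral_nonneg) (auto simp: L2_iff)
   finally have "sqrt ((integral {s..r} ?D)\<^sup>2) \<le> sqrt (r * integral {0..r} (\<lambda>t. (?D t)\<^sup>2))" by (rule real_sqrt_le_mono)
   then show ?case using integral_diff[OF i] elim by (simp add: real_sqrt_mult L2norm_integral)
  qed
 qed
 define f where "f x = P (s - x) - P (r - x)" for x
 have F2: "integral {s..r} (q x) = - ((f (0 + x) - f 0) / x)" if x: "0 < x" "x < x0" "x < s" for x
 proof -
  have "prim (\<lambda>t. 1 / x * (P (- x + 1 * t) - P t)) (\<lambda>t. 1 / x * (1 * g0 (- x + 1 * t) - g0 t))"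
   by (intro prim_cmult prim_diff prim_affine P) auto
  from prim_integral[OF this sr(2)] have "integral {s..r} (\<lambda>t. 1 / x * (1 * g0 (- x + 1 * t) - g0 t))
    = 1 / x * (P (- x + 1 * r) - P r) - 1 / x * (P (- x + 1 * s) - P s)" .
  also have "\<dots> = - ((f (0 + x) - f 0) / x)" by (simp add: f_def diff_divide_distrib)
  finally have "integral {s..r} (\<lambda>t. 1 / x * (1 * g0 (- x + 1 * t) - g0 t)) = - ((f (0 + x) - f 0) / x)" .
  moreover have "integral {s..r} (q x) = integral {s..r} (\<lambda>t. 1 / x * (1 * g0 (- x + 1 * t) - g0 t))"
   by (rule integral_cong_on) (use out x sr in \<open>simp add: q_def g0_def\<close>)
  ultimately show ?thesis by simp
 qed
 have dP: "((\<lambda>x. P (y - x)) has_real_derivative - g0 y) (at 0)" for y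
 proof -
  have "((\<lambda>x. P (y - x)) has_real_derivative g0 (y - 0) * (- 1)) (at 0)"
   by (rule DERIV_chain2[where g = "\<lambda>x. y - x"]) (rule prim_deriv[OF P g0c], auto intro!: derivative_eq_intros)
  then show ?thesis by simp
 qed
 have "(f has_real_derivative - g0 s - - g0 r) (at 0)" unfolding f_def by (intro DERIV_diff dP)
 then have "((\<lambda>x. (f (0 + x) - f 0) / x) \<longlongrightarrow> - g0 s - - g0 r) (at 0)" by (simp add: DERIV_def)
 from tendsto_minus[OF this] have "((\<lambda>x. - ((f (0 + x) - f 0) / x)) \<longlongrightarrow> w 0 s - w 0 r) (at 0)"
  using sr r0 by (simp add: g0_def max_def)
 then have F3: "((\<lambda>x. - ((f (0 + x) - f 0) / x)) \<longlongrightarrow> w 0 s - w 0 r) (at 0 within {0..1})"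
  by (rule tendsto_within_subset) simp
 have "((\<lambda>x. integral {s..r} (q x)) \<longlongrightarrow> w 0 s - w 0 r) (at 0 within {0..1})"
 proof (rule Lim_transform_eventually[OF F3])
  show "\<forall>\<^sub>F x in at 0 within {0..1}. - ((f (0 + x) - f 0) / x) = integral {s..r} (q x)"
   unfolding eventually_at using x0 sr F2 by (intro exI[of _ "min x0 s"]) (auto simp: dist_real_def)
 qed
 then show ?thesis using F1 tendsto_unique[OF at_within_01_nontrivial[of 0]] by blast
qed

text \<open>A weak derivative of a continuous function integrates to its increments.\<close>

lemma t_trace_integral:
 assumes b: "t_trace w a b" and c: "continuous_on {0..} (\<lambda>t. w a t)" and sr: "0 < s" "s \<le> r"
 shows "b integrable_on {s..r}" "integral {s..r} b = w a r - w a s"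
proof -
 define \<rho> where "\<rho> t = (if t \<in> {0..} then b t else 0)" for t
 have \<rho>: "\<rho> \<in> locL2" unfolding \<rho>_def by (rule L2loc_extend) (use b in \<open>simp add: t_trace_def\<close>)
 obtain R where R: "prim R \<rho>" using prim_locL2[OF \<rho>] by blast
 have c': "continuous_on {0<..} (\<lambda>t. w a t)" by (rule continuous_on_subset[OF c]) auto
 have "w a r - R r = w a s - R s"
  by (rule weak_deriv_imp_prim[of "{0<..}" "\<lambda>t. w a t" b R \<rho>])
   (use b c' R sr in \<open>auto simp: t_trace_def \<rho>_def\<close>)
 moreover have "integral {s..r} b = integral {s..r} \<rho>"
  by (rule integral_cong_on) (use sr in \<open>simp add: \<rho>_def\<close>)
 ultimately show "integral {s..r} b = w a r - w a s" using prim_integral[OF R sr(2)] by simp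
 show "b integrable_on {s..r}"
  by (rule integrable_eq[OF locL2_int[OF \<rho>]]) (use sr in \<open>simp add: \<rho>_def\<close>)
qed

text \<open>The integrated form of $g'=-lg$ with $g(0)=0$.\<close>

lemma boundary_signal_zero:
 fixes g :: "real \<Rightarrow> real"
 assumes g: "continuous_on {0..} g" "g 0 = 0"
  and eq: "\<And>s r. 0 < s \<Longrightarrow> s \<le> r \<Longrightarrow> r < L \<Longrightarrow> g r - g s = - l * integral {s..r} g"
  and t: "t \<in> {0..<L}"
 shows "g t = 0"
proof -
 define g0 where "g0 t = g (max 0 t)" for t
 have g0c: "continuous_on UNIV g0" unfolding g0_def by (intro continuous_on_compose2[OF g(1)] continuous_intros) auto
 have g0s: "continuous_on S g0" for S by (rule continuous_on_subset[OF g0c]) simp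
 obtain P1 where P1: "prim P1 g0" using prim_exists[of g0] continuous_absint[OF g0c] by blast
 define P where "P t = P1 t + - P1 0" for t
 have P: "prim P g0" unfolding P_def by (rule prim_shift_const[OF P1])
 have P0: "P 0 = 0" by (simp add: P_def)
 define u where "u t = g0 t + l * P t" for t
 have uc: "continuous_on S u" for S unfolding u_def by (intro continuous_intros g0s prim_continuous[OF P])
 have le: "u s = u r" if "0 < s" "s \<le> r" "r < L" for s r
 proof -
  have "integral {s..r} g = integral {s..r} g0"
   by (rule integral_cong_on) (use that in \<open>simp add: g0_def\<close>)
  then have "g r - g s = - l * (P r - P s)" using eq[OF that] prim_integral[OF P that(2)] by simp
  then show ?thesis using that by (simp add: u_def g0_def max_def algebra_simps)
 qed
 have u0: "u s = 0" if s: "s \<in> {0..<L}" for s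
 proof -
  \<comment> \<open>a compact interval inside $[0,L)$ that contains \<open>s\<close>\<close>
  define m where "m = (s + L) / 2"
  have m: "0 < m" "s < m" "m < L" using s by (auto simp: m_def)
  have "u s = u 0"
  proof (rule constant_on_Icc[OF m(1) uc])
   fix p q :: real assume "p \<in> {0<..<m}" "q \<in> {0<..<m}"
   then show "u p = u q"
    using le[of p q] le[of q p, symmetric] m by (metis greaterThanLessThan_iff less_trans linear)
  qed (use m s in auto)
  then show ?thesis by (simp add: u_def P0 g0_def g(2))
 qed
 have "P t = 0"
 proof (cases "t = 0")
  case False
  then have t0: "0 < t" using t by simp
  have "(\<lambda>s. P s * exp (l * s)) t = (\<lambda>s. P s * exp (l * s)) 0"
  proof (rule DERIV_isconst_end[OF t0])
   show "continuous_on {0..t} (\<lambda>s. P s * exp (l * s))"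
    by (intro continuous_intros prim_continuous[OF P])
   fix s assume s: "0 < s" "s < t"
   have "g0 s = - l * P s" using u0[of s] s t by (simp add: u_def)
   then show "((\<lambda>s. P s * exp (l * s)) has_real_derivative 0) (at s)"
    using prim_deriv[OF P g0c, of s] by (auto intro!: derivative_eq_intros)
  qed
  then show ?thesis using P0 by simp
 qed (simp add: P0)
 then show ?thesis using u0[OF t] t by (simp add: u_def g0_def)
qed

text \<open>A solution of the closed loop with zero initial data that vanishes up to time \<open>T\<close> vanishes up
 to time $T+1/2$: by the condition at $x=1$ nothing comes in from the right, so near $x=0$ the
 solution is outgoing, and then the condition at $x=0$ is a linear differential equation for
 the boundary value.\<close>

lemma closed_loop_step:
 assumes \<kappa>: "0 < \<kappa>" and W: "wave_solution w wt"
  and b: "t_trace w 0 b" and tr: "x_trace w 0 (\<lambda>t. \<gamma> * w 0 t + \<kappa> * b t)" and w1: "\<And>t. t \<ge> 0 \<Longrightarrow> w 1 t = 0"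
  and i: "AE x in lebesgue_on {0..1}. wt x 0 = 0" and T: "0 \<le> T"
  and z: "\<And>x t. x \<in> {0..1} \<Longrightarrow> t \<in> {0..T} \<Longrightarrow> w x t = 0"
  and xt: "x \<in> {0..1}" "t \<in> {0..T + 1/2}"
 shows "w x t = 0"
proof -
 have cHH: "continuous_HH (state_at w wt)" using W by (simp add: wave_solution_def)
 note ci = continuous_HH_imp[OF cHH] and cj = continuous_HH_joint[OF cHH]
 have ww: "weak_wave w wt" using W ci(2,3) by (simp add: weak_wave_def wave_solution_def)
 have z': "w x t = 0" if "x \<in> {0..1}" "0 \<le> t" "t \<le> T" for x t using z that by simp
 note char = constant_on_characteristic[OF ww cj(2) z i T]
 have right: "w x t = w 0 (t - x)" if x: "0 < x" "x < 1 - (t - T)" and t: "T \<le> t - x" for x t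
 proof -
  have "w x t = w (x - 1 * x) (t - x)"
  proof (rule characteristic_endpoint[OF cj(1)])
   fix k assume k: "0 \<le> k" "k < x"
   show "w x t = w (x - 1 * k) (t - k)"
    by (rule char) (use x t k T in auto)
  qed (use x t T in auto)
  then show ?thesis by simp
 qed
 have right0: "w x t = 0" if x: "0 < x" "x < 1 - (t - T)" "x < 1" and t: "t - x < T" "0 \<le> t" for x t
 proof (cases "t \<le> T")
  case True then show ?thesis using z' x t by auto
 next
  case False
  have "w x t = w (x - 1 * (t - T)) (t - (t - T))"
   by (rule char) (use x t False T in auto)
  also have "\<dots> = w (x - (t - T)) T"
   by (rule arg_cong2[of _ _ _ _ w]) simp_all
  also have "\<dots> = 0" by (rule z') (use x t False T in auto)
  finally show ?thesis .
 qed
 have left0: "w x t = 0" if x: "0 < x" "x < 1" "t - T < x" and t: "0 \<le> t" for x t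
 proof (cases "t \<le> T")
  case True
  then show ?thesis using z' x t by auto
 next
  case tT: False
  have x0: "0 < x" by (rule x(1))
  show ?thesis
  proof (cases "t - T < 1 - x")
   case True
   have "w x t = w (x - - 1 * (t - T)) (t - (t - T))"
    by (rule char) (use x x0 tT T True in auto)
   also have "\<dots> = w (x + (t - T)) T"
    by (rule arg_cong2[of _ _ _ _ w]) simp_all
   also have "\<dots> = 0" by (rule z') (use x x0 tT T True in auto)
   finally show ?thesis .
  next
   case False
   have "w x t = w (x - - 1 * (1 - x)) (t - (1 - x))"
   proof (rule characteristic_endpoint[OF cj(1)])
    fix k assume k: "0 \<le> k" "k < 1 - x"
    show "w x t = w (x - - 1 * k) (t - k)"
     by (rule char) (use x x0 tT T False k in auto)
   qed (use x x0 tT T False in auto)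
   also have "\<dots> = w 1 (t - (1 - x))"
    by (rule arg_cong2[of _ _ _ _ w]) simp_all
   also have "\<dots> = 0" by (rule w1) (use False T in auto)
   finally show ?thesis .
  qed
 qed
 define L where "L = T + 1/2"
 have L: "0 < L" using T by (simp add: L_def)
 have out: "w x t = w 0 (t - x)" if x: "0 < x" "x < 1/2" "x \<le> t" "t < L" for x t
 proof (cases "T \<le> t - x")
  case True then show ?thesis using right x by (simp add: L_def)
 next
  case False
  then show ?thesis using right0[of x t] x z'[of 0 "t - x"] by (simp add: L_def)
 qed
 have g: "w 0 t = 0" if t: "t \<in> {0..<L}" for t
 proof (rule boundary_signal_zero[OF ci(4) _ _ t, of 0 "\<gamma> / (1 + \<kappa>)"])
  show "w 0 0 = 0" using z' T by simp
  fix s r assume sr: "0 < s" "s \<le> r" "r < L"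
  have w0: "continuous_on {0..} (\<lambda>t. w 0 t)" by (rule ci(4)) simp
  note bi = t_trace_integral[OF b w0 sr(1,2)]
  have "(\<lambda>t. w 0 t) integrable_on {s..r}"
   by (rule integrable_continuous_real, rule continuous_on_subset[OF w0]) (use sr in auto)
  then have A: "((\<lambda>t. \<gamma> * w 0 t + \<kappa> * b t) has_integral \<gamma> * integral {s..r} (\<lambda>t. w 0 t) + \<kappa> * integral {s..r} b) {s..r}"
   by (intro has_integral_add has_integral_mult_right integrable_integral bi(1))
  have B: "integral {s..r} (\<lambda>t. \<gamma> * w 0 t + \<kappa> * b t) = w 0 s - w 0 r"
   by (rule outgoing_trace[OF w0 _ _ _ tr sr, of "1/2"]) (use out in auto)
  have "w 0 s - w 0 r = \<gamma> * integral {s..r} (\<lambda>t. w 0 t) + \<kappa> * (w 0 r - w 0 s)"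
   by (rule trans[OF B[symmetric] integral_unique[OF A[unfolded bi(2)]]])
  then have "(1 + \<kappa>) * (w 0 r - w 0 s) = - \<gamma> * integral {s..r} (\<lambda>t. w 0 t)" by (simp add: algebra_simps)
  then show "w 0 r - w 0 s = - (\<gamma> / (1 + \<kappa>)) * integral {s..r} (w 0)" using \<kappa> by (simp add: field_simps)
 qed simp
 have inner: "w x t = 0" if x: "0 < x" "x < 1" and t: "0 \<le> t" "t < L" for x t
 proof (cases "x < 1/2")
  case True
  show ?thesis
  proof (cases "x \<le> t")
   case True
   then show ?thesis using out[of x t] g[of "t - x"] x t \<open>x < 1/2\<close> by simp
  next
   case False
   then show ?thesis using right0[of x t] x t T \<open>x < 1/2\<close> by (simp add: L_def)
  qed
 next
  case False
  then show ?thesis using left0[of x t] x t by (simp add: L_def)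
 qed
 have "w x t = 0" if x: "x \<in> {0..1}" and t: "t \<in> {0..<L}" for x t
 proof -
  have c: "continuous_on (closure {0<..<1}) (\<lambda>x. w x t)" using cj(2)[of t] t by simp
  show ?thesis
   by (rule continuous_constant_on_closure[OF c]) (use inner x t in auto)
 qed
 note Lz = this
 have "w x s = 0" if "s \<in> {0..L}" for s
 proof -
  have c: "continuous_on (closure {0<..<L}) (\<lambda>s. w x s)" using continuous_on_subset[OF ci(4)[OF xt(1)], of "{0..L}"] L by simp
  show ?thesis
   by (rule continuous_constant_on_closure[OF c]) (use Lz xt(1) that L in auto)
 qed
 then show ?thesis using xt(2) by (simp add: L_def)
qed

text \<open>The difference of two solutions vanishes on $[0,1/2]$, then on $[0,1]$, and so on.\<close>

lemma beta_solution_unique: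
 assumes c: "0 < c0" "c0 < 1" "0 < c1" and B: "beta_solution c0 c1 B \<beta> \<beta>t" and B': "beta_solution c0 c1 B \<beta>' \<beta>t'"
  and xt: "x \<in> {0..1}" "t \<ge> 0"
 shows "\<beta> x t = \<beta>' x t"
proof -
 define \<kappa> \<gamma> where "\<kappa> = c0 / (1 - c0)" and "\<gamma> = c1 / (1 - c0)"
 have k: "0 < \<kappa>" "0 < \<gamma>" using c by (auto simp: \<kappa>_def \<gamma>_def)
 define w where "w x t = 1 * \<beta> x t + (-1) * \<beta>' x t" for x t
 define wt where "wt x t = 1 * \<beta>t x t + (-1) * \<beta>t' x t" for x t
 have W: "wave_solution w wt"
  unfolding w_def[abs_def] wt_def[abs_def]
  by (rule wave_solution_lincomb) (use B B' in \<open>auto simp: beta_solution_def\<close>)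
 then have cHH: "continuous_HH (state_at w wt)" by (simp add: wave_solution_def)
 note ci = continuous_HH_imp[OF cHH]
 obtain b where b: "t_trace \<beta> 0 b" "x_trace \<beta> 0 (\<lambda>t. \<gamma> * \<beta> 0 t + \<kappa> * b t)"
  using B by (auto simp: beta_solution_def \<gamma>_def \<kappa>_def)
 obtain b' where b': "t_trace \<beta>' 0 b'" "x_trace \<beta>' 0 (\<lambda>t. \<gamma> * \<beta>' 0 t + \<kappa> * b' t)"
  using B' by (auto simp: beta_solution_def \<gamma>_def \<kappa>_def)
 have tt: "t_trace w 0 (\<lambda>t. 1 * b t + (-1) * b' t)"
  unfolding w_def[abs_def] by (rule t_trace_lincomb[OF b(1) b'(1)])
 have "x_trace w 0 (\<lambda>t. 1 * (\<gamma> * \<beta> 0 t + \<kappa> * b t) + (-1) * (\<gamma> * \<beta>' 0 t + \<kappa> * b' t))"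
  unfolding w_def[abs_def] by (rule x_trace_lincomb[OF b(2) b'(2)])
 moreover have "(\<lambda>t. 1 * (\<gamma> * \<beta> 0 t + \<kappa> * b t) + (-1) * (\<gamma> * \<beta>' 0 t + \<kappa> * b' t)) = (\<lambda>t. \<gamma> * w 0 t + \<kappa> * (1 * b t + (-1) * b' t))"
  by (simp add: w_def fun_eq_iff algebra_simps)
 ultimately have xtr: "x_trace w 0 (\<lambda>t. \<gamma> * w 0 t + \<kappa> * (1 * b t + (-1) * b' t))" by simp
 have "AE t in lebesgue_on {0..}. \<beta> 1 t = 0" "AE t in lebesgue_on {0..}. \<beta>' 1 t = 0"
  using B B' by (auto simp: beta_solution_def)
 then have "AE t in lebesgue_on {0..}. w 1 t = 0" by eventually_elim (simp add: w_def)
 then have w1: "w 1 t = 0" if "t \<ge> 0" for t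
  using AE_continuous_eq[of "{0..}" "\<lambda>t. w 1 t" "\<lambda>_. 0" t] ci(4)[of 1] that by simp
 have h: "HH_eq (state_at \<beta> \<beta>t 0) B" "HH_eq (state_at \<beta>' \<beta>t' 0) B" using B B' by (auto simp: beta_solution_def)
 then have z0: "w x 0 = 0" if "x \<in> {0..1}" for x using that by (auto simp: HH_eq_def state_at_def w_def)
 have "AE x in lebesgue_on {0..1}. \<beta>t x 0 = snd B x" "AE x in lebesgue_on {0..1}. \<beta>t' x 0 = snd B x"
  using h by (auto simp: HH_eq_def state_at_def)
 then have i: "AE x in lebesgue_on {0..1}. wt x 0 = 0" by eventually_elim (simp add: wt_def)
 have all: "\<forall>x\<in>{0..1}. \<forall>t\<in>{0..real n / 2}. w x t = 0" for n
 proof (induction n)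
  case 0 then show ?case using z0 by simp
 next
  case (Suc n)
  show ?case
  proof (intro ballI)
   fix x t :: real assume x: "x \<in> {0..1}" and t: "t \<in> {0..real (Suc n) / 2}"
   show "w x t = 0"
    by (rule closed_loop_step[OF k(1) W tt xtr w1 i, of "real n / 2"]) (use Suc x t in \<open>auto simp: add_divide_distrib\<close>)
  qed
 qed
 obtain n where "2 * t < real n" using reals_Archimedean2 by blast
 then have "w x t = 0" using all[of n] xt by auto
 then show ?thesis by (simp add: w_def)
qed

section \<open>The flow of the delay equation\<close>

definition flow :: "(real \<Rightarrow> real) \<Rightarrow> (real \<Rightarrow> real) \<Rightarrow> real \<Rightarrow> state" where
 "flow G h t = state_at (disp G) (disp h) t"

lemma flow_HH0: "h \<in> locL2 \<Longrightarrow> prim G h \<Longrightarrow> flow G h t \<in> HH0"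
 using state_repr_HH[OF disp_repr] by (simp add: HH0_iff flow_def) (simp add: state_at_def disp_def)

lemma flow_diff: "lincomb 1 (flow G h t) (-1) (flow K k t) = flow (\<lambda>u. G u - K u) (\<lambda>u. h u - k u) t"
 by (simp add: lincomb_def flow_def state_at_def disp_def fun_eq_iff algebra_simps)

text \<open>The norm of a state in terms of \<open>h\<close>: $(a+b)^2+(a-b)^2=2a^2+2b^2$ for $\phi'\pm\psi$.\<close>

lemma flow_norm:
 assumes h: "h \<in> locL2" and P: "prim G h"
 shows "(HHnorm (flow G h t))\<^sup>2 = 2 * sqint (t - 2) t h + (G t - G (t - 2))\<^sup>2"
  "2 * sqint (t - 2) t h \<le> (HHnorm (flow G h t))\<^sup>2" "(HHnorm (flow G h t))\<^sup>2 \<le> 4 * sqint (t - 2) t h"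
proof -
 have a: "(\<lambda>x. h (t - x)) \<in> locL2" "(\<lambda>x. h (x + (t - 2))) \<in> locL2"
  using locL2_affine[OF h, of "-1" t] locL2_affine[OF h, of 1 "t - 2"] by (simp_all add: add.commute)
 note r = disp_repr[OF h P, of t]
 have rL: "(\<lambda>x. - h (t - x) - h (t + x - 2)) \<in> locL2" "(\<lambda>x. disp h x t) \<in> locL2" using r by (auto simp: state_repr_def)
 have A: "((\<lambda>x. (- h (t - x) - h (t + x - 2))\<^sup>2 + (disp h x t)\<^sup>2) has_integral
   (sqint 0 1 (\<lambda>x. - h (t - x) - h (t + x - 2)) + sqint 0 1 (\<lambda>x. disp h x t))) {0..1}"
  unfolding sqint_def by (intro has_integral_add integrable_integral locL2_sq_int rL)
 have B: "((\<lambda>x. 2 * (h (t - x))\<^sup>2 + 2 * (h (x + (t - 2)))\<^sup>2) has_integral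
   (2 * sqint 0 1 (\<lambda>x. h (t - x)) + 2 * sqint 0 1 (\<lambda>x. h (x + (t - 2))))) {0..1}"
  unfolding sqint_def by (intro has_integral_add has_integral_mult_right integrable_integral locL2_sq_int a)
 have E: "(\<lambda>x. (- h (t - x) - h (t + x - 2))\<^sup>2 + (disp h x t)\<^sup>2) = (\<lambda>x. 2 * (h (t - x))\<^sup>2 + 2 * (h (x + (t - 2)))\<^sup>2)"
  by (simp add: disp_def power2_eq_square fun_eq_iff algebra_simps)
 have "sqint 0 1 (\<lambda>x. - h (t - x) - h (t + x - 2)) + sqint 0 1 (\<lambda>x. disp h x t) = 2 * sqint 0 1 (\<lambda>x. h (t - x)) + 2 * sqint 0 1 (\<lambda>x. h (x + (t - 2)))"
  by (rule has_integral_unique[OF A[unfolded E] B])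
 also have "\<dots> = 2 * sqint (t - 2) t h"
  using sqint_reflect[OF h, of 0 1 t] sqint_shift[OF h, of 0 1 "t - 2"] sqint_combine[OF h, of "t - 2" "t - 1" t] by simp
 finally show *: "(HHnorm (flow G h t))\<^sup>2 = 2 * sqint (t - 2) t h + (G t - G (t - 2))\<^sup>2"
  using state_repr_norm_sq(1)[OF r] by (simp add: flow_def) (simp add: disp_def)
 then show "2 * sqint (t - 2) t h \<le> (HHnorm (flow G h t))\<^sup>2" by simp
 have "(integral {t-2..t} h)\<^sup>2 \<le> (t - (t - 2)) * sqint (t - 2) t h"
  unfolding sqint_def by (rule Cauchy_Schwarz_interval[OF locL2_D[OF h]]) simp
 then show "(HHnorm (flow G h t))\<^sup>2 \<le> 4 * sqint (t - 2) t h" unfolding * using prim_integral[OF P, of "t-2" t] by simp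
qed

text \<open>The incoming wave that represents a given state at time 0.\<close>

lemma flow_initial:
 assumes r: "state_repr U \<Phi> g k" and \<Phi>1: "\<Phi> 1 = 0" and h: "h \<in> locL2" and P: "prim G h"
  and eq: "\<And>x. x \<in> {0<..<1} \<Longrightarrow> h (- x) = (k x - g x) / 2" "\<And>x. x \<in> {0<..<1} \<Longrightarrow> h (x - 2) = - (g x + k x) / 2"
 shows "HH_eq (flow G h 0) U"
proof -
 have PU: "prim \<Phi> g" and u: "\<And>x. x \<in> {0..1} \<Longrightarrow> fst U x = \<Phi> x" and ae: "AE x in lebesgue_on {0..1}. snd U x = k x"
  using r by (auto simp: state_repr_def)
 have PD: "prim (\<lambda>x. disp G x 0) (\<lambda>x. - h (0 - x) - h (0 + x - 2))"
  using disp_repr[OF h P, of 0] by (simp add: state_repr_def)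
 have "disp G x 0 = \<Phi> x" if x: "x \<in> {0..1}" for x
 proof -
  have "integral {x..1} g = integral {x..1} (\<lambda>x. - h (0 - x) - h (0 + x - 2))"
  proof (rule integral_spike[of "{0, 1}"])
   fix y assume "y \<in> {x..1} - {0, 1}"
   then have "y \<in> {0<..<1}" using x by auto
   then show "- h (0 - y) - h (0 + y - 2) = g y" using eq[of y] by simp
  qed simp
  then have "\<Phi> 1 - \<Phi> x = disp G 1 0 - disp G x 0"
   using prim_integral[OF PU, of x 1] prim_integral[OF PD, of x 1] x by simp
  moreover have "disp G 1 0 = 0" by (simp add: disp_def)
  ultimately show ?thesis using \<Phi>1 by simp
 qed
 then have 1: "\<forall>x\<in>{0..1}. fst (flow G h 0) x = fst U x" using u by (simp add: flow_def state_at_def)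
 have "AE x in lebesgue_on {0<..<1}. disp h x 0 = k x"
 proof (rule AE_I2)
  fix x :: real assume "x \<in> space (lebesgue_on {0<..<1})"
  then have x: "x \<in> {0<..<1}" by simp
  have "disp h x 0 = h (- x) - h (x - 2)" by (simp add: disp_def)
  also have "\<dots> = (k x - g x) / 2 + (g x + k x) / 2" unfolding eq(1)[OF x] eq(2)[OF x] by linarith
  also have "\<dots> = k x" by (simp only: diff_divide_distrib add_divide_distrib)
  finally show "disp h x 0 = k x" .
 qed
 then have "AE x in lebesgue_on {0..1}. disp h x 0 = k x" by (rule AE_Ioo_Icc)
 with ae have "AE x in lebesgue_on {0..1}. disp h x 0 = snd U x" by eventually_elim simp
 then show ?thesis using 1 by (simp add: HH_eq_def flow_def state_at_def)
qed

definition initial_wave :: "(real \<Rightarrow> real) \<Rightarrow> (real \<Rightarrow> real) \<Rightarrow> real \<Rightarrow> real" where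
 "initial_wave g k s = (if s \<ge> - 1 then (k (- s) - g (- s)) / 2 else - (g (s + 2) + k (s + 2)) / 2)"

lemma initial_wave_locL2:
 assumes "g \<in> locL2" "k \<in> locL2" shows "initial_wave g k \<in> locL2"
proof -
 have a: "(\<lambda>s. f (- s)) \<in> locL2" "(\<lambda>s. f (s + 2)) \<in> locL2" if "f \<in> locL2" for f
  using locL2_affine[OF that, of "-1" 0] locL2_affine[OF that, of 1 2] by (simp_all add: add.commute)
 have "(\<lambda>s. if s \<ge> - 1 then 1/2 * (k (- s) - g (- s)) else - 1/2 * (g (s + 2) + k (s + 2))) \<in> locL2"
  using a assms by (intro locL2_if locL2_cmult locL2_diff locL2_add) (auto simp flip: atLeast_def)
 moreover have "(\<lambda>s. if s \<ge> - 1 then 1/2 * (k (- s) - g (- s)) else - 1/2 * (g (s + 2) + k (s + 2))) = initial_wave g k"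
 proof -
  have half: "1/2 * x = x / 2" "- 1/2 * x = - x / 2" for x :: real by simp_all
  show ?thesis by (simp only: fun_eq_iff initial_wave_def half) simp
 qed
 ultimately show ?thesis by simp
qed

lemma HH0_delay:
 assumes "U \<in> HH0" obtains G h where "delay_solution c0 c1 G h" "HH_eq (flow G h 0) U"
proof -
 obtain \<Phi> g k where r: "state_repr U \<Phi> g k" using state_repr_exists[OF HH0_HH[OF assms]] .
 have L: "g \<in> locL2" "k \<in> locL2" "\<Phi> 1 = 0" using r assms by (auto simp: state_repr_def HH0_iff)
 obtain G h where d: "delay_solution c0 c1 G h" "\<forall>t<0. h t = initial_wave g k t"
  using delay_existence[OF initial_wave_locL2[OF L(1,2)]] by blast
 have "HH_eq (flow G h 0) U"
  by (rule flow_initial[OF r L(3)]) (use d in \<open>auto simp: delay_solution_def initial_wave_def\<close>)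
 then show ?thesis using that d(1) by blast
qed

text \<open>Regular waves give states in the domain, with $\mathcal A_0$ acting as differentiation.\<close>

lemma flow_dom:
 assumes c: "c0 < 1" and d: "delay_solution c0 c1 G h" and P1: "prim h h1" and h1: "h1 \<in> locL2" and t: "t \<ge> 0"
 shows "flow G h t \<in> dom_A0 c0 c1" "HH_eq (flow h h1 t) (A0 (flow G h t))"
  "\<And>U. HH_eq U (flow G h t) \<Longrightarrow> Cobs U = - 2 * h (t - 1)"
proof -
 have h: "h \<in> locL2" and P: "prim G h" using d by (auto simp: delay_solution_def)
 define s where "s x = - h (t - x) - h (t + x - 2)" for x
 have r: "prim (\<lambda>x. disp G x t) s" "s \<in> locL2"
  using disp_repr[OF h P, of t] by (auto simp: state_repr_def s_def[abs_def])
 have r1: "prim (\<lambda>x. disp h x t) (\<lambda>x. - h1 (t - x) - h1 (t + x - 2))" "(\<lambda>x. - h1 (t - x) - h1 (t + x - 2)) \<in> locL2" "(\<lambda>x. disp h1 x t) \<in> locL2"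
  using disp_repr[OF h1 P1, of t] by (auto simp: state_repr_def)
 have ps: "prim s (\<lambda>x. disp h1 x t)"
 proof -
  have "prim (\<lambda>x. - 1 * h (t + (-1) * x) - h (t - 2 + 1 * x)) (\<lambda>x. - 1 * (- 1 * h1 (t + (-1) * x)) - 1 * h1 (t - 2 + 1 * x))"
   by (intro prim_diff prim_cmult prim_affine[OF P1]) auto
  moreover have "(\<lambda>x. - 1 * h (t + (-1) * x) - h (t - 2 + 1 * x)) = s" by (simp add: s_def fun_eq_iff algebra_simps)
  moreover have "(\<lambda>x. - 1 * (- 1 * h1 (t + (-1) * x)) - 1 * h1 (t - 2 + 1 * x)) = (\<lambda>x. disp h1 x t)"
   by (simp add: disp_def fun_eq_iff algebra_simps)
  ultimately show ?thesis by simp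
 qed
 have sc: "continuous_on {0..1} s" by (rule prim_continuous[OF ps])
 let ?\<phi> = "\<lambda>x. disp G x t"
 have w: "wderiv ?\<phi> x = s x" if "x \<in> {0..1}" for x
  by (rule H1_intro(3)[OF r refl sc that])
 have "wderiv ?\<phi> \<in> H1" by (rule H1_intro(1)[OF ps r1(3) w])
 moreover have "?\<phi> \<in> H1" by (rule H1_intro(1)[OF r refl])
 ultimately have H2: "?\<phi> \<in> H2" by (simp add: H2_def)
 have H1: "(\<lambda>x. disp h x t) \<in> H1" by (rule H1_intro(1)[OF r1(1,2) refl])
 have "wderiv ?\<phi> 0 = c1 / (1 - c0) * disp G 0 t + c0 / (1 - c0) * disp h 0 t"
  using w[of 0] delay_boundary[OF c d t] by (simp add: s_def disp_def)
 then show "flow G h t \<in> dom_A0 c0 c1"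
  using H2 H1 by (simp add: dom_A0_def flow_def state_at_def) (simp add: disp_def)
 have "AE x in lebesgue_on {0..1}. wderiv (wderiv ?\<phi>) x = disp h1 x t" by (rule H1_intro(2)[OF ps r1(3) w])
 then have "AE x in lebesgue_on {0..1}. disp h1 x t = wderiv (wderiv ?\<phi>) x" by eventually_elim simp
 then show "HH_eq (flow h h1 t) (A0 (flow G h t))" by (simp add: HH_eq_def A0_def flow_def state_at_def)
 show "Cobs U = - 2 * h (t - 1)" if U: "HH_eq U (flow G h t)" for U
 proof -
  have "wderiv (fst U) = wderiv ?\<phi>" by (rule wderiv_cong) (use U in \<open>auto simp: HH_eq_def flow_def state_at_def\<close>)
  then have "Cobs U = s 1" using w[of 1] by (simp add: Cobs_def case_prod_beta')
  then show ?thesis by (simp add: s_def)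
 qed
qed

text \<open>Data in the domain come from a wave of class $H^1$: on the two halves of $[-2,0]$ the wave is
 given by $-(\psi+\phi')/2$ and $(\psi-\phi')/2$, and the halves match at $-1$ because $\psi(1)=0$. The wave is built from its
 derivative: \<open>k\<close> solves the delay equation for the differentiated data, and its primitive solves the
 equation itself because it does so at $t=0$, which is the boundary condition of the domain at $x=0$.\<close>

lemma dom_delay:
 assumes c: "c0 < 1" and V: "V \<in> dom_A0 c0 c1"
 obtains G h h1 where "delay_solution c0 c1 G h" "prim h h1" "h1 \<in> locL2" "HH_eq (flow G h 0) V"
proof -
 define \<phi> \<psi> where "\<phi> = fst V" and "\<psi> = snd V"
 have v: "\<phi> \<in> H2" "\<psi> \<in> H1" "\<phi> 1 = 0" "\<psi> 1 = 0" "wderiv \<phi> 0 = c1 / (1 - c0) * \<phi> 0 + c0 / (1 - c0) * \<psi> 0"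
  using V by (auto simp: dom_A0_def \<phi>_def \<psi>_def)
 have \<phi>1: "\<phi> \<in> H1" "wderiv \<phi> \<in> H1" using v(1) by (auto simp: H2_def)
 obtain \<Phi> where \<Phi>: "prim \<Phi> (ext01 (wderiv \<phi>))" "wderiv \<phi> \<in> L2 {0..1}" "\<And>x. x \<in> {0..1} \<Longrightarrow> \<phi> x = \<Phi> x"
  using H1_prim[OF \<phi>1(1)] by blast
 obtain F where F: "prim F (ext01 (wderiv (wderiv \<phi>)))" "wderiv (wderiv \<phi>) \<in> L2 {0..1}" "\<And>x. x \<in> {0..1} \<Longrightarrow> wderiv \<phi> x = F x"
  using H1_prim[OF \<phi>1(2)] by blast
 obtain \<Psi> where \<Psi>: "prim \<Psi> (ext01 (wderiv \<psi>))" "wderiv \<psi> \<in> L2 {0..1}" "\<And>x. x \<in> {0..1} \<Longrightarrow> \<psi> x = \<Psi> x"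
  using H1_prim[OF v(2)] by blast
 define f p where "f = ext01 (wderiv (wderiv \<phi>))" and "p = ext01 (wderiv \<psi>)"
 have fL: "f \<in> locL2" "p \<in> locL2" unfolding f_def p_def using F(2) \<Psi>(2) by (auto intro: ext01_locL2)
 define k1 where "k1 s = (if s \<ge> - 1 then (f (- s) - p (- s)) / 2 else - (f (s + 2) + p (s + 2)) / 2)" for s
 have k1: "k1 \<in> locL2"
 proof -
  have "initial_wave p f = k1" by (simp add: fun_eq_iff initial_wave_def k1_def add.commute)
  then show ?thesis using initial_wave_locL2[OF fL(2,1)] by simp
 qed
 obtain K k where K: "delay_solution c0 c1 K k" "\<forall>t<0. k t = k1 t" using delay_existence[OF k1] by blast
 have kL: "k \<in> locL2" and PK: "prim K k" using K(1) by (auto simp: delay_solution_def)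
 define h where "h t = K t + (- (F 0 + \<Psi> 0) / 2 - K (-2))" for t
 have Ph: "prim h k" unfolding h_def by (rule prim_shift_const[OF PK])
 have hc: "continuous_on UNIV h" by (rule prim_continuous[OF Ph])
 have hL: "h \<in> locL2" by (rule locL2_continuous[OF hc])
 obtain G where PG: "prim G h" using prim_locL2[OF hL] by blast
 have hl: "h s = - (F (s + 2) + \<Psi> (s + 2)) / 2" if s: "s \<in> {-2..-1}" for s
 proof -
  have "prim (\<lambda>s. - 1/2 * (F (2 + 1 * s) + \<Psi> (2 + 1 * s))) (\<lambda>s. - 1/2 * (1 * f (2 + 1 * s) + 1 * p (2 + 1 * s)))"
   unfolding f_def p_def by (intro prim_cmult prim_add prim_affine F \<Psi>) auto
  from prim_integral[OF this, of "-2" s]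
  have "integral {-2..s} (\<lambda>s. - 1/2 * (1 * f (2 + 1 * s) + 1 * p (2 + 1 * s))) = - (F (s + 2) + \<Psi> (s + 2)) / 2 + (F 0 + \<Psi> 0) / 2"
   using s by (simp add: add.commute field_simps)
  moreover have "integral {-2..s} k = integral {-2..s} (\<lambda>s. - 1/2 * (1 * f (2 + 1 * s) + 1 * p (2 + 1 * s)))"
  proof (rule integral_spike[of "{-1}"])
   fix u assume u: "u \<in> {-2..s} - {-1}"
   then have "u < 0" "\<not> - 1 \<le> u" using s by auto
   then have "k u = - (f (u + 2) + p (u + 2)) / 2" using K(2) unfolding k1_def by (simp only: if_False)
   then show "- 1/2 * (1 * f (2 + 1 * u) + 1 * p (2 + 1 * u)) = k u" by (simp only: add.commute[of 2] mult_1)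
  qed simp
  moreover have "integral {-2..s} k = h s - h (-2)" using prim_integral[OF Ph, of "-2" s] s by simp
  moreover have "h (-2) = - (F 0 + \<Psi> 0) / 2" by (simp add: h_def)
  ultimately show ?thesis by linarith
 qed
 have hr: "h s = (\<Psi> (- s) - F (- s)) / 2" if s: "s \<in> {-1..0}" for s
 proof -
  have "prim (\<lambda>s. 1/2 * (\<Psi> (0 + (-1) * s) - F (0 + (-1) * s))) (\<lambda>s. 1/2 * (-1 * p (0 + (-1) * s) - (-1) * f (0 + (-1) * s)))"
   unfolding f_def p_def by (intro prim_cmult prim_diff prim_affine F \<Psi>) auto
  from prim_integral[OF this, of "-1" s]
  have "integral {-1..s} (\<lambda>s. 1/2 * (-1 * p (0 + (-1) * s) - (-1) * f (0 + (-1) * s))) = (\<Psi> (- s) - F (- s)) / 2 - (\<Psi> 1 - F 1) / 2"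
   using s by (simp add: field_simps)
  moreover have "integral {-1..s} k = integral {-1..s} (\<lambda>s. 1/2 * (-1 * p (0 + (-1) * s) - (-1) * f (0 + (-1) * s)))"
  proof (rule integral_spike[of "{0}"])
   fix u assume u: "u \<in> {-1..s} - {0}"
   then have "u < 0" "- 1 \<le> u" using s by auto
   then show "1/2 * (-1 * p (0 + (-1) * u) - (-1) * f (0 + (-1) * u)) = k u" using K(2) by (simp add: k1_def)
  qed simp
  moreover have "h (-1) = (\<Psi> 1 - F 1) / 2" using hl[of "-1"] \<Psi>(3)[of 1] v(4) by simp
  moreover have "integral {-1..s} k = h s - h (-1)" using prim_integral[OF Ph, of "-1" s] s by simp
  ultimately show ?thesis by linarith
 qed
 have r: "state_repr V \<Phi> (ext01 (wderiv \<phi>)) \<Psi>"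
  using \<Phi> \<Psi> ext01_locL2[OF \<Phi>(2)] locL2_continuous[OF prim_continuous[OF \<Psi>(1)]]
  by (auto simp: state_repr_def \<phi>_def \<psi>_def intro!: AE_I2)
 have init: "HH_eq (flow G h 0) V"
 proof (rule flow_initial[OF r _ hL PG])
  show "\<Phi> 1 = 0" using \<Phi>(3)[of 1] v(3) by simp
  fix x :: real assume x: "x \<in> {0<..<1}"
  then show "h (- x) = (\<Psi> x - ext01 (wderiv \<phi>) x) / 2" "h (x - 2) = - (ext01 (wderiv \<phi>) x + \<Psi> x) / 2"
   using hr[of "- x"] hl[of "x - 2"] F(3)[of x] by (auto simp: ext01_def)
 qed
 then have G0: "G 0 - G (-2) = \<phi> 0" by (auto simp: HH_eq_def flow_def state_at_def disp_def \<phi>_def dest: bspec[of _ _ 0])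
 define E where "E t = h t + c1 * (G t - G (-2 + 1 * t)) + (1 - 2 * c0) * h (-2 + 1 * t)" for t
 have PE: "prim E (\<lambda>t. k t + c1 * (h t - 1 * h (-2 + 1 * t)) + (1 - 2 * c0) * (1 * k (-2 + 1 * t)))"
  unfolding E_def by (intro prim_add prim_cmult prim_diff prim_affine Ph PG) auto
 have E0: "E 0 = 0"
 proof -
  have b: "(1 - c0) * F 0 = c1 * \<phi> 0 + c0 * \<Psi> 0"
  proof -
   have F0: "F 0 = c1 / (1 - c0) * \<phi> 0 + c0 / (1 - c0) * \<Psi> 0" using v(5) F(3)[of 0] \<Psi>(3)[of 0] by simp
   have "(1 - c0) * F 0 = ((1 - c0) * (c1 / (1 - c0))) * \<phi> 0 + ((1 - c0) * (c0 / (1 - c0))) * \<Psi> 0"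
    by (simp only: F0 distrib_left mult.assoc)
   then show ?thesis using c by simp
  qed
  have h0: "h 0 = (\<Psi> 0 - F 0) / 2" "h (-2) = - (F 0 + \<Psi> 0) / 2" using hr[of 0] hl[of "-2"] by simp_all
  have "E 0 = h 0 + c1 * (G 0 - G (-2)) + (1 - 2 * c0) * h (-2)" by (simp add: E_def)
  also have "\<dots> = (\<Psi> 0 - F 0) / 2 + c1 * \<phi> 0 + (1 - 2 * c0) * (- (F 0 + \<Psi> 0) / 2)"
   by (simp only: h0 G0)
  also have "\<dots> = c1 * \<phi> 0 + c0 * \<Psi> 0 - (1 - c0) * F 0" by (simp only: diff_divide_distrib add_divide_distrib minus_divide_left[symmetric]) (simp add: algebra_simps)
  finally show ?thesis using b by simp
 qed
 have "E t = 0" if t: "t \<ge> 0" for t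
 proof -
  have "integral {0..t} (\<lambda>t. k t + c1 * (h t - 1 * h (-2 + 1 * t)) + (1 - 2 * c0) * (1 * k (-2 + 1 * t))) = integral {0..t} (\<lambda>t. 0)"
  proof (rule integral_cong_on)
   fix u assume "u \<in> {0..t}"
   then have "k u + c1 * (K u - K (u - 2)) + (1 - 2 * c0) * k (u - 2) = 0" using K(1) by (simp add: delay_solution_def)
   then show "k u + c1 * (h u - 1 * h (-2 + 1 * u)) + (1 - 2 * c0) * (1 * k (-2 + 1 * u)) = 0"
    by (simp add: h_def algebra_simps)
  qed
  then show ?thesis using prim_integral[OF PE t] E0 by simp
 qed
 then have "delay_solution c0 c1 G h" using hL PG by (simp add: delay_solution_def E_def add.commute)
 then show ?thesis using that Ph kL init by blast
qed

text \<open>Averaging in time preserves the delay equation, so the domain is dense.\<close>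

lemma dom_dense:
 assumes c: "c0 < 1" and d: "delay_solution c0 c1 G h" and e: "e > 0"
 shows "\<exists>V\<in>dom_A0 c0 c1. HHdist V (flow G h 0) < e"
proof -
 have h: "h \<in> locL2" and P: "prim G h" using d by (auto simp: delay_solution_def)
 have Gc: "continuous_on UNIV G" by (rule prim_continuous[OF P])
 have GL: "G \<in> locL2" by (rule locL2_continuous[OF Gc])
 obtain Z where Z: "prim Z G" using prim_locL2[OF GL] by blast
 have sh: "steklov k h u = (G (u + k) - G u) / k" "steklov k G u = (Z (u + k) - Z u) / k" for k u
  using steklov_prim[OF P, of k] steklov_prim[OF Z, of k] by simp_all
 have dk: "delay_solution c0 c1 (steklov k G) (steklov k h)" if k: "k > 0" for k
 proof -
  have "steklov k h t + c1 * (steklov k G t - steklov k G (t - 2)) + (1 - 2 * c0) * steklov k h (t - 2) = 0" if t: "t \<ge> 0" for t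
  proof -
   have "prim (\<lambda>u. G u + c1 * (Z u - Z (-2 + 1 * u)) + (1 - 2 * c0) * G (-2 + 1 * u))
     (\<lambda>u. h u + c1 * (G u - 1 * G (-2 + 1 * u)) + (1 - 2 * c0) * (1 * h (-2 + 1 * u)))" (is "prim ?A ?a")
    by (intro prim_add prim_cmult prim_diff prim_affine P Z) auto
   from prim_integral[OF this, of t "t + k"] k
   have "integral {t..t+k} ?a = ?A (t + k) - ?A t" by simp
   moreover have "integral {t..t+k} ?a = integral {t..t+k} (\<lambda>u. 0)"
    by (rule integral_cong_on)
     (use d t in \<open>auto simp: delay_solution_def add.commute\<close>)
   ultimately have "?A (t + k) - ?A t = 0" by simp
   moreover have "steklov k h t + c1 * (steklov k G t - steklov k G (t - 2)) + (1 - 2 * c0) * steklov k h (t - 2)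
     = (?A (t + k) - ?A t) / k"
    unfolding sh using k by (simp add: field_simps)
   ultimately show ?thesis by simp
  qed
  then show ?thesis using prim_steklov[OF P Z] steklov_locL2[OF h] by (simp add: delay_solution_def)
 qed
 have "((\<lambda>k. sqint (-2) 0 (\<lambda>t. steklov k h t - h t)) \<longlongrightarrow> 0) (at_right 0)"
  using steklov_L2[OF h] by (rule filterlim_mono) (auto simp: at_le)
 then have "\<forall>\<^sub>F k in at_right 0. sqint (-2) 0 (\<lambda>t. steklov k h t - h t) < (e / 2)\<^sup>2"
  using e by (intro order_tendstoD(2)) auto
 moreover have "\<forall>\<^sub>F k in at_right (0::real). k > 0" by (simp add: eventually_at_right_less)
 ultimately have "\<exists>k>0. sqint (-2) 0 (\<lambda>t. steklov k h t - h t) < (e / 2)\<^sup>2"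
  using eventually_happens'[OF trivial_limit_at_right_real, of "\<lambda>k. sqint (-2) 0 (\<lambda>t. steklov k h t - h t) < (e / 2)\<^sup>2 \<and> k > 0"]
  by (auto simp: eventually_conj_iff)
 then obtain k where k: "k > 0" "sqint (-2) 0 (\<lambda>t. steklov k h t - h t) < (e / 2)\<^sup>2" by blast
 let ?V = "flow (steklov k G) (steklov k h) 0"
 have "prim (steklov k h) (\<lambda>u. 1 / k * (1 * h (k + 1 * u) - h u))"
 proof -
  have "prim (\<lambda>u. 1 / k * (G (k + 1 * u) - G u)) (\<lambda>u. 1 / k * (1 * h (k + 1 * u) - h u))"
   by (intro prim_cmult prim_diff prim_affine P) auto
  then show ?thesis using sh(1)[of k] by (simp add: add.commute fun_eq_iff[of "steklov k h"] ext[OF sh(1)])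
 qed
 moreover have "(\<lambda>u. 1 / k * (1 * h (k + 1 * u) - h u)) \<in> locL2"
  using locL2_affine[OF h, of 1 k] h by (intro locL2_cmult locL2_diff) auto
 ultimately have dom: "?V \<in> dom_A0 c0 c1" by (rule flow_dom(1)[OF c dk[OF k(1)]]) simp
 have S: "steklov k h \<in> locL2" "prim (steklov k G) (steklov k h)" using dk[OF k(1)] by (auto simp: delay_solution_def)
 have "(HHdist ?V (flow G h 0))\<^sup>2 \<le> 4 * sqint (-2) 0 (\<lambda>t. steklov k h t - h t)"
  using flow_norm(3)[OF locL2_diff[OF S(1) h] prim_diff[OF S(2) P], of 0] by (simp add: HHdist_def flow_diff)
 then have "(HHdist ?V (flow G h 0))\<^sup>2 < e\<^sup>2" using k(2) by (simp add: power_divide)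
 then have "HHdist ?V (flow G h 0) < e" using e by (simp add: power2_less_imp_less)
 then show ?thesis using dom by blast
qed

section \<open>The uniform boundedness principle\<close>

lemma geometric_series_third: "(\<Sum>m. (1/3::real) ^ (m + n)) = 3/2 * (1/3) ^ n" "summable (\<lambda>m. (1/3::real) ^ (m + n))"
proof -
 have "(\<lambda>m. (1/3::real) ^ m * (1/3) ^ n) sums (1 / (1 - 1/3) * (1/3) ^ n)"
  by (intro sums_mult2 geometric_sums) simp
 then show "(\<Sum>m. (1/3::real) ^ (m + n)) = 3/2 * (1/3) ^ n" "summable (\<lambda>m. (1/3::real) ^ (m + n))"
  by (auto simp: power_add sums_iff)
qed

text \<open>Cauchy-Schwarz with the geometric weights.\<close>

lemma weighted_square_summable:
 fixes u a :: "nat \<Rightarrow> real"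
 assumes s: "summable (\<lambda>m. (1/3) ^ m * (u m)\<^sup>2)" and a: "\<And>m. \<bar>a m\<bar> \<le> (1/3) ^ m"
 shows "summable (\<lambda>m. a m * u m)"
  "(\<Sum>m. a (m + n) * u (m + n))\<^sup>2 \<le> 3/2 * (1/3) ^ n * (\<Sum>m. (1/3) ^ (m + n) * (u (m + n))\<^sup>2)"
proof -
 show 1: "summable (\<lambda>m. a m * u m)"
 proof (rule summable_comparison_test')
  show "summable (\<lambda>m. (1/3) ^ m + (1/3) ^ m * (u m)\<^sup>2)"
   using summable_add[OF geometric_series_third(2)[of 0] s] by simp
  fix m
  have "0 \<le> (1 - \<bar>u m\<bar>)\<^sup>2" by simp
  then have "2 * \<bar>u m\<bar> \<le> 1 + (u m)\<^sup>2" by (simp add: power2_diff)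
  then have "\<bar>u m\<bar> \<le> 1 + (u m)\<^sup>2" by simp
  then have "\<bar>a m\<bar> * \<bar>u m\<bar> \<le> (1/3) ^ m * (1 + (u m)\<^sup>2)" using a[of m] by (intro mult_mono) auto
  then show "norm (a m * u m) \<le> (1/3) ^ m + (1/3) ^ m * (u m)\<^sup>2" by (simp add: abs_mult algebra_simps)
 qed
 have sn: "summable (\<lambda>m. (1/3) ^ (m + n) * (u (m + n))\<^sup>2)" using summable_ignore_initial_segment[OF s, of n] .
 let ?A = "\<lambda>N. \<Sum>m<N. a (m + n) * u (m + n)"
 have "(?A N)\<^sup>2 \<le> 3/2 * (1/3) ^ n * (\<Sum>m. (1/3) ^ (m + n) * (u (m + n))\<^sup>2)" for N
 proof -
  have r: "sqrt ((1/3) ^ k) * sqrt ((1/3) ^ k) = (1/3) ^ k" for k :: nat by simp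
  have "\<bar>?A N\<bar> \<le> (\<Sum>m<N. sqrt ((1/3) ^ (m + n)) * (sqrt ((1/3) ^ (m + n)) * \<bar>u (m + n)\<bar>))"
  proof (rule order_trans[OF sum_abs], rule sum_mono)
   fix m
   show "\<bar>a (m + n) * u (m + n)\<bar> \<le> sqrt ((1/3) ^ (m + n)) * (sqrt ((1/3) ^ (m + n)) * \<bar>u (m + n)\<bar>)"
    unfolding mult.assoc[symmetric] r abs_mult using a by (intro mult_right_mono) auto
  qed
  then have "(?A N)\<^sup>2 \<le> (\<Sum>m<N. sqrt ((1/3) ^ (m + n)) * (sqrt ((1/3) ^ (m + n)) * \<bar>u (m + n)\<bar>))\<^sup>2"
   by (intro power2_le_iff_abs_le[THEN iffD2]) (auto intro!: sum_nonneg)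
  also have "\<dots> \<le> (\<Sum>m<N. (sqrt ((1/3) ^ (m + n)))\<^sup>2) * (\<Sum>m<N. (sqrt ((1/3) ^ (m + n)) * \<bar>u (m + n)\<bar>)\<^sup>2)"
   by (rule Cauchy_Schwarz_ineq_sum)
  also have "\<dots> = (\<Sum>m<N. (1/3) ^ (m + n)) * (\<Sum>m<N. (1/3) ^ (m + n) * (u (m + n))\<^sup>2)"
   by (simp add: power_mult_distrib)
  also have "\<dots> \<le> (\<Sum>m. (1/3) ^ (m + n)) * (\<Sum>m. (1/3) ^ (m + n) * (u (m + n))\<^sup>2)"
   by (intro mult_mono sum_le_suminf sn geometric_series_third(2) sum_nonneg suminf_nonneg) auto
  finally show ?thesis by (simp add: geometric_series_third(1))
 qed
 moreover have "(\<lambda>N. (?A N)\<^sup>2) \<longlonglongrightarrow> (\<Sum>m. a (m + n) * u (m + n))\<^sup>2"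
  by (intro tendsto_power summable_LIMSEQ summable_ignore_initial_segment[OF 1])
 ultimately show "(\<Sum>m. a (m + n) * u (m + n))\<^sup>2 \<le> 3/2 * (1/3) ^ n * (\<Sum>m. (1/3) ^ (m + n) * (u (m + n))\<^sup>2)"
  by (intro LIMSEQ_le_const2) auto
qed

text \<open>Completeness of $L^2(-2,0)$, for geometrically convergent series.\<close>

lemma L2_geometric_series:
 assumes u: "\<And>m::nat. u m \<in> locL2" "\<And>m. sqint (-2) 0 (u m) \<le> 1" and a: "\<And>m. \<bar>a m\<bar> \<le> (1/3) ^ m"
 obtains f where "f \<in> locL2" "\<And>n. sqint (-2) 0 (\<lambda>t. (\<Sum>m<n. a m * u m t) - f t) \<le> (3/2 * (1/3) ^ n)\<^sup>2"
proof -
 let ?M = "lebesgue_on {-2..0::real}"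
 have um [measurable]: "u m \<in> borel_measurable ?M" for m using locL2_D[OF u(1)] by (simp add: L2_def)
 define g where "g m t = (1/3) ^ m * (u m t)\<^sup>2" for m t
 have gm [measurable]: "g m \<in> borel_measurable ?M" for m unfolding g_def by measurable
 have g0: "0 \<le> g m t" for m t by (simp add: g_def)
 have gi: "integrable ?M (g m)" for m using locL2_D[OF u(1)[of m], of "-2" 0] unfolding g_def[abs_def] L2_def by simp
 have gl: "integral\<^sup>L ?M (g m) \<le> (1/3) ^ m" for m
 proof -
  have "integral\<^sup>L ?M (g m) = (1/3) ^ m * sqint (-2) 0 (u m)" unfolding g_def sqint_LINT[OF u(1)] by simp
  also have "\<dots> \<le> (1/3) ^ m * 1" by (rule mult_left_mono[OF u(2)]) simp
  finally show ?thesis by simp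
 qed
 have gl0: "0 \<le> integral\<^sup>L ?M (g m)" for m by (rule Bochner_Integration.integral_nonneg) (rule g0)
 have "(\<integral>\<^sup>+t. (\<Sum>m. ennreal (g m t)) \<partial>?M) = (\<Sum>m. \<integral>\<^sup>+t. ennreal (g m t) \<partial>?M)"
  by (rule nn_integral_suminf) measurable
 also have "\<dots> = (\<Sum>m. ennreal (integral\<^sup>L ?M (g m)))" using gi g0 by (simp add: nn_integral_eq_integral)
 also have "\<dots> \<le> (\<Sum>m. ennreal ((1/3) ^ m))" by (intro suminf_le ennreal_leI gl summableI)
 also have "\<dots> = ennreal (\<Sum>m. (1/3) ^ m)" using geometric_series_third(2)[of 0] by (intro suminf_ennreal2) auto
 finally have "(\<integral>\<^sup>+t. (\<Sum>m. ennreal (g m t)) \<partial>?M) \<noteq> \<infinity>" by (auto simp: top_unique)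
 then have "AE t in ?M. (\<Sum>m. ennreal (g m t)) \<noteq> \<infinity>" by (intro nn_integral_PInf_AE) measurable
 then have ae: "AE t in ?M. summable (\<lambda>m. g m t)"
  by eventually_elim (rule summable_suminf_not_top, auto simp: g0)
 define f where "f t = (\<Sum>m. a m * u m t)" for t
 have fm [measurable]: "f \<in> borel_measurable ?M" unfolding f_def by measurable
 define D where "D n t = (\<Sum>m<n. a m * u m t) - f t" for n t
 have Dm [measurable]: "D n \<in> borel_measurable ?M" for n unfolding D_def by measurable
 have D: "D n \<in> L2 {-2..0} \<and> (LINT t|?M. (D n t)\<^sup>2) \<le> (3/2 * (1/3) ^ n)\<^sup>2" for n
 proof -
  let ?S = "\<lambda>t. \<Sum>m. g (m + n) t"
  have sl: "summable (\<lambda>m. integral\<^sup>L ?M (g (m + n)))"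
   by (rule summable_comparison_test'[OF geometric_series_third(2)[of n]]) (use gl gl0 in auto)
  have aen: "AE t in ?M. summable (\<lambda>m. norm (g (m + n) t))"
   using ae
  proof eventually_elim
   case (elim t)
   show ?case using summable_ignore_initial_segment[OF elim, of n] g0 by simp
  qed
  have Si: "integrable ?M ?S" by (rule integrable_suminf[OF gi aen]) (use g0 sl in simp)
  have "integral\<^sup>L ?M ?S = (\<Sum>m. integral\<^sup>L ?M (g (m + n)))"
   by (rule integral_suminf[OF gi aen]) (use g0 sl in simp)
  also have "\<dots> \<le> (\<Sum>m. (1/3) ^ (m + n))" by (intro suminf_le gl sl geometric_series_third(2))
  finally have Sl: "integral\<^sup>L ?M ?S \<le> 3/2 * (1/3) ^ n" by (simp add: geometric_series_third(1))
  have b: "AE t in ?M. (D n t)\<^sup>2 \<le> 3/2 * (1/3) ^ n * ?S t"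
   using ae
  proof eventually_elim
   case (elim t)
   then have s: "summable (\<lambda>m. (1/3) ^ m * (u m t)\<^sup>2)" by (simp add: g_def)
   have "f t = (\<Sum>m. a (m + n) * u (m + n) t) + (\<Sum>m<n. a m * u m t)"
    unfolding f_def by (rule suminf_split_initial_segment[OF weighted_square_summable(1)[OF s a]])
   then have "(D n t)\<^sup>2 = (\<Sum>m. a (m + n) * u (m + n) t)\<^sup>2" by (simp add: D_def)
   then show ?case using weighted_square_summable(2)[OF s a, of n] by (simp add: g_def)
  qed
  have Di: "integrable ?M (\<lambda>t. (D n t)\<^sup>2)"
  proof (rule Bochner_Integration.integrable_bound)
   show "integrable ?M (\<lambda>t. 3/2 * (1/3) ^ n * ?S t)" using Si by simp
   show "AE t in ?M. norm ((D n t)\<^sup>2) \<le> norm (3/2 * (1/3) ^ n * ?S t)" using b by eventually_elim auto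
  qed measurable
  have "(LINT t|?M. (D n t)\<^sup>2) \<le> (LINT t|?M. 3/2 * (1/3) ^ n * ?S t)"
   using Si by (intro integral_mono_AE Di b) simp
  also have "\<dots> = 3/2 * (1/3) ^ n * integral\<^sup>L ?M ?S" by simp
  also have "\<dots> \<le> 3/2 * (1/3) ^ n * (3/2 * (1/3) ^ n)" using Sl by (intro mult_left_mono) auto
  finally show ?thesis using Di Dm[of n] by (simp add: L2_def power2_eq_square)
 qed
 define F where "F t = (if t \<in> {-2..0} then f t else 0)" for t
 have "(\<lambda>t. - 1 * D 0 t) \<in> L2 {-2..0}" using D[of 0] by (intro L2_cmult) auto
 then have "f \<in> L2 {-2..0}" by (simp add: D_def)
 then have FL: "F \<in> locL2" unfolding F_def by (rule locL2_extend)
 moreover have "sqint (-2) 0 (\<lambda>t. (\<Sum>m<n. a m * u m t) - F t) \<le> (3/2 * (1/3) ^ n)\<^sup>2" for n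
 proof -
  have "sqint (-2) 0 (\<lambda>t. (\<Sum>m<n. a m * u m t) - F t) = integral {-2..0} (\<lambda>t. (D n t)\<^sup>2)"
   unfolding sqint_def by (rule integral_cong_on) (simp add: F_def D_def)
  then show ?thesis using D[of n] integral_sq_eq[of "{-2..0}" "D n"] by simp
 qed
 ultimately show ?thesis by (rule that)
qed

text \<open>The argument of the gliding hump, in the form due to Sokal. If the norms \<open>N n\<close> were unbounded, take
 indices along which they exceed $4^k$ and unit vectors $v_k$ on which they are almost attained. Adding
 $\pm3^{-k}v_k$ with the better sign at the $k$-th step gives a value of at least
 $3^{-k}\cdot\frac23\,4^k$ there, and all later steps together change it by at most half of $3^{-k}N$. The
 remainder $(\frac23-\frac12)(4/3)^k$ is unbounded, so the limit contradicts the pointwise bound.\<close>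

lemma uniform_boundedness_L2:
 fixes Q :: "nat \<Rightarrow> (real \<Rightarrow> real) \<Rightarrow> real"
 assumes sub: "\<And>n u v a b. u \<in> locL2 \<Longrightarrow> v \<in> locL2 \<Longrightarrow> Q n (\<lambda>t. a * u t + b * v t) \<le> \<bar>a\<bar> * Q n u + \<bar>b\<bar> * Q n v"
  and bdd: "\<And>n. \<exists>M. \<forall>u\<in>locL2. Q n u \<le> M * sqrt (sqint (-2) 0 u)"
  and pointwise: "\<And>u. u \<in> locL2 \<Longrightarrow> \<exists>K. \<forall>n. Q n u \<le> K"
 shows "\<exists>M. \<forall>n. \<forall>u\<in>locL2. Q n u \<le> M * sqrt (sqint (-2) 0 u)"
proof (rule ccontr)
 assume neg: "\<not> ?thesis"
 let ?n = "\<lambda>u. sqrt (sqint (-2) 0 u)"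
 have z: "(\<lambda>t. 0) \<in> locL2" by (rule locL2_continuous) simp
 define A where "A n = {M. 0 \<le> M \<and> (\<forall>u\<in>locL2. Q n u \<le> M * ?n u)}" for n
 \<comment> \<open>the operator norm; it is attained as a bound\<close>
 define N where "N n = Inf (A n)" for n
 have nn: "0 \<le> ?n u" for u by (simp add: sqint_nonneg)
 have Ane: "A n \<noteq> {}" and Abd: "bdd_below (A n)" for n
 proof -
  obtain M where M: "\<forall>u\<in>locL2. Q n u \<le> M * ?n u" using bdd by blast
  have "Q n u \<le> \<bar>M\<bar> * ?n u" if "u \<in> locL2" for u
  proof -
   have "Q n u \<le> M * ?n u" using M that by blast
   also have "\<dots> \<le> \<bar>M\<bar> * ?n u" by (rule mult_right_mono[OF abs_ge_self nn])
   finally show ?thesis .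
  qed
  then show "A n \<noteq> {}" unfolding A_def using abs_ge_zero[of M] by blast
  show "bdd_below (A n)" by (rule bdd_belowI[of _ 0]) (simp add: A_def)
 qed
 have N0: "0 \<le> N n" for n unfolding N_def by (rule cInf_greatest[OF Ane]) (simp add: A_def)
 have N: "Q n u \<le> N n * ?n u" if u: "u \<in> locL2" for n u
 proof (cases "?n u = 0")
  case True
  then show ?thesis using Ane[of n] u by (auto simp: A_def)
 next
  case False
  then have p: "0 < ?n u" using nn[of u] by simp
  have "Q n u / ?n u \<le> N n"
   unfolding N_def
  proof (rule cInf_greatest[OF Ane])
   fix M assume "M \<in> A n"
   then have "Q n u \<le> M * ?n u" using u by (simp add: A_def)
   then show "Q n u / ?n u \<le> M" using p by (simp add: pos_divide_le_eq)
  qed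
  then show ?thesis using p by (simp add: pos_divide_le_eq)
 qed
 have near: "\<exists>v\<in>locL2. sqint (-2) 0 v = 1 \<and> 2/3 * N n < Q n v" if p: "0 < N n" for n
 proof -
  have "2/3 * N n \<notin> A n" using cInf_lower[OF _ Abd, of "2/3 * N n" n] p unfolding N_def[symmetric] by auto
  then obtain u where u: "u \<in> locL2" "2/3 * N n * ?n u < Q n u" using p unfolding A_def by force
  have "?n u \<noteq> 0" using u N[OF u(1), of n] by auto
  then have un: "0 < ?n u" using nn[of u] by linarith
  define v where "v t = 1 / ?n u * u t" for t
  have v: "v \<in> locL2" unfolding v_def by (rule locL2_cmult[OF u(1)])
  have "sqint (-2) 0 v = (1 / ?n u)\<^sup>2 * sqint (-2) 0 u" unfolding v_def by (rule sqint_cmult)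
  also have "\<dots> = 1" using un by (simp add: power_divide sqint_nonneg)
  finally have v1: "sqint (-2) 0 v = 1" .
  have "(\<lambda>t. ?n u * v t + 0 * v t) = u" using un by (simp add: v_def)
  then have "Q n u \<le> ?n u * Q n v" using sub[OF v v, of n "?n u" 0] un by simp
  with u(2) have "?n u * (2/3 * N n) < ?n u * Q n v" by (simp add: mult.commute)
  then show ?thesis using un v v1 mult_less_cancel_left_pos by blast
 qed
 have "\<exists>n. 4 ^ k < N n" for k :: nat
 proof (rule ccontr)
  assume "\<nexists>n. 4 ^ k < N n"
  then have le: "N n \<le> 4 ^ k" for n by (meson not_less)
  have "Q n u \<le> 4 ^ k * ?n u" if "u \<in> locL2" for n u
   using N[OF that, of n] mult_right_mono[OF le[of n] nn[of u]] by linarith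
  then show False using neg by blast
 qed
 then obtain \<nu> where \<nu>: "\<And>k. 4 ^ k < N (\<nu> k)" by metis
 have Np: "0 < N (\<nu> k)" for k using \<nu>[of k] by (meson less_trans zero_less_numeral zero_less_power)
 obtain v where v: "\<And>k. v k \<in> locL2" "\<And>k. sqint (-2) 0 (v k) = 1" "\<And>k. 2/3 * N (\<nu> k) < Q (\<nu> k) (v k)"
  using near[OF Np] by metis
 have step: "\<exists>y. y \<in> locL2 \<and> (\<exists>c. \<bar>c\<bar> \<le> (1/3) ^ k \<and> y = (\<lambda>t. x t + c * v k t) \<and> (1/3) ^ k * Q (\<nu> k) (v k) \<le> Q (\<nu> k) y)"
  if x: "x \<in> locL2" for x k
 proof -
  define c :: real where "c = (1/3) ^ k"
  have cp: "0 < c" by (simp add: c_def)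
  let ?y = "\<lambda>d t. x t + d * v k t"
  have y: "?y d \<in> locL2" for d by (intro locL2_add x locL2_cmult v)
  have "(\<lambda>t. 1 / (2 * c) * ?y c t + (- 1 / (2 * c)) * ?y (- c) t) = v k"
   using cp by (simp add: fun_eq_iff field_simps)
  then have "Q (\<nu> k) (v k) \<le> \<bar>1 / (2 * c)\<bar> * Q (\<nu> k) (?y c) + \<bar>- 1 / (2 * c)\<bar> * Q (\<nu> k) (?y (- c))"
   using sub[OF y[of c] y[of "- c"], of "\<nu> k" "1 / (2 * c)" "- 1 / (2 * c)"] by simp
  then have "2 * (c * Q (\<nu> k) (v k)) \<le> Q (\<nu> k) (?y c) + Q (\<nu> k) (?y (- c))"
   using cp by (simp add: field_simps)
  then have "c * Q (\<nu> k) (v k) \<le> Q (\<nu> k) (?y c) \<or> c * Q (\<nu> k) (v k) \<le> Q (\<nu> k) (?y (- c))" by linarith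
  moreover have "\<bar>c\<bar> \<le> (1/3) ^ k" "\<bar>- c\<bar> \<le> (1/3) ^ k" using cp by (simp_all add: c_def)
  ultimately show ?thesis using y unfolding c_def[symmetric] by metis
 qed
 have "\<exists>x. \<forall>k. (x k \<in> locL2 \<and> (k = 0 \<longrightarrow> x k = (\<lambda>t. 0))) \<and>
   (\<exists>c. \<bar>c\<bar> \<le> (1/3) ^ k \<and> x (Suc k) = (\<lambda>t. x k t + c * v k t) \<and> (1/3) ^ k * Q (\<nu> k) (v k) \<le> Q (\<nu> k) (x (Suc k)))"
 proof (rule dependent_nat_choice)
  show "\<exists>x. x \<in> locL2 \<and> ((0::nat) = 0 \<longrightarrow> x = (\<lambda>t. 0))" using z by blast
 next
  fix x and k :: nat assume "x \<in> locL2 \<and> (k = 0 \<longrightarrow> x = (\<lambda>t. 0))"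
  then have "x \<in> locL2" by (rule conjunct1)
  from step[OF this, of k] show "\<exists>y. (y \<in> locL2 \<and> (Suc k = 0 \<longrightarrow> y = (\<lambda>t. 0))) \<and>
    (\<exists>c. \<bar>c\<bar> \<le> (1/3) ^ k \<and> y = (\<lambda>t. x t + c * v k t) \<and> (1/3) ^ k * Q (\<nu> k) (v k) \<le> Q (\<nu> k) y)"
   by (simp only: nat.distinct simp_thms)
 qed
 then obtain x where x: "\<And>k. x k \<in> locL2" "x 0 = (\<lambda>t. 0)"
  and xs: "\<And>k. \<exists>c. \<bar>c\<bar> \<le> (1/3) ^ k \<and> x (Suc k) = (\<lambda>t. x k t + c * v k t) \<and> (1/3) ^ k * Q (\<nu> k) (v k) \<le> Q (\<nu> k) (x (Suc k))"
  by blast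
 obtain a where a: "\<And>k. \<bar>a k\<bar> \<le> (1/3) ^ k" "\<And>k. x (Suc k) = (\<lambda>t. x k t + a k * v k t)"
  "\<And>k. (1/3) ^ k * Q (\<nu> k) (v k) \<le> Q (\<nu> k) (x (Suc k))"
  using xs by metis
 have xsum: "x k = (\<lambda>t. \<Sum>m<k. a m * v m t)" for k by (induction k) (simp_all add: x(2) a(2))
 have v2: "sqint (-2) 0 (v k) \<le> 1" for k by (simp add: v(2))
 obtain f where f: "f \<in> locL2" "\<And>n. sqint (-2) 0 (\<lambda>t. (\<Sum>m<n. a m * v m t) - f t) \<le> (3/2 * (1/3) ^ n)\<^sup>2"
  by (rule L2_geometric_series[of v a, OF v(1) v2 a(1)]) (rule that, assumption, blast)
 have big: "(4/3) ^ k / 6 \<le> Q (\<nu> k) f" for k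
 proof -
  let ?d = "\<lambda>t. x (Suc k) t - f t"
  have d: "?d \<in> locL2" by (rule locL2_diff[OF x(1) f(1)])
  have "?n ?d \<le> sqrt ((3/2 * (1/3) ^ Suc k)\<^sup>2)" using f(2)[of "Suc k"] unfolding xsum by (rule real_sqrt_le_mono)
  then have dn: "?n ?d \<le> 1/2 * (1/3) ^ k" by simp
  have "Q (\<nu> k) (x (Suc k)) \<le> Q (\<nu> k) ?d + Q (\<nu> k) f" using sub[OF d f(1), of "\<nu> k" 1 1] by simp
  moreover have "Q (\<nu> k) ?d \<le> N (\<nu> k) * (1/2 * (1/3) ^ k)"
   using N[OF d, of "\<nu> k"] mult_left_mono[OF dn N0[of "\<nu> k"]] by linarith
  moreover have "(1/3) ^ k * (2/3 * N (\<nu> k)) \<le> (1/3) ^ k * Q (\<nu> k) (v k)" using v(3)[of k] by (intro mult_left_mono) auto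
  ultimately have "(1/3) ^ k * (2/3 * N (\<nu> k)) - N (\<nu> k) * (1/2 * (1/3) ^ k) \<le> Q (\<nu> k) f" using a(3)[of k] by linarith
  then have "(1/3) ^ k * N (\<nu> k) / 6 \<le> Q (\<nu> k) f" by (simp add: algebra_simps)
  moreover have "(1/3) ^ k * 4 ^ k \<le> (1/3) ^ k * N (\<nu> k)" using \<nu>[of k] by (intro mult_left_mono) auto
  moreover have "(1/3) ^ k * 4 ^ k = (4/3::real) ^ k" by (simp add: power_mult_distrib[symmetric])
  ultimately show ?thesis by linarith
 qed
 obtain K where K: "\<And>n. Q n f \<le> K" using pointwise[OF f(1)] by blast
 then have "(4/3) ^ k \<le> 6 * K" for k using big[of k] K[of "\<nu> k"] by linarith
 moreover obtain k where "6 * K < (4/3) ^ k" using real_arch_pow[of "4/3" "6 * K"] by auto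
 ultimately show False by (meson not_less)
qed

section \<open>Strongly continuous semigroups on the state space\<close>

lemma HH0_cong: "HH_eq U V \<Longrightarrow> U \<in> HH0 \<Longrightarrow> V \<in> HH0"
 using HH_eq_HH[of U V] by (auto simp: HH0_iff HH_eq_def)

lemma semigroup_HH0: "C0_semigroup T \<Longrightarrow> t \<ge> 0 \<Longrightarrow> U \<in> HH0 \<Longrightarrow> T t U \<in> HH0"
 unfolding C0_semigroup_def by blast

lemma semigroup_lincomb:
 assumes "C0_semigroup T" "t \<ge> 0" "U \<in> HH0" "V \<in> HH0"
 shows "HH_eq (T t (lincomb a U b V)) (lincomb a (T t U) b (T t V))"
 using assms unfolding C0_semigroup_def by blast

lemma semigroup_zero: "C0_semigroup T \<Longrightarrow> U \<in> HH0 \<Longrightarrow> HH_eq (T 0 U) U"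
 unfolding C0_semigroup_def by blast

lemma semigroup_add: "C0_semigroup T \<Longrightarrow> s \<ge> 0 \<Longrightarrow> t \<ge> 0 \<Longrightarrow> U \<in> HH0 \<Longrightarrow> HH_eq (T (s + t) U) (T s (T t U))"
 unfolding C0_semigroup_def by blast

lemma semigroup_bound: "C0_semigroup T \<Longrightarrow> t \<ge> 0 \<Longrightarrow> \<exists>M. \<forall>U\<in>HH0. HHnorm (T t U) \<le> M * HHnorm U"
 unfolding C0_semigroup_def by blast

lemma semigroup_continuous_0:
 assumes C: "C0_semigroup T" and U: "U \<in> HH0"
 shows "((\<lambda>h. HHdist (T h U) U) \<longlongrightarrow> 0) (at 0 within {0..})" "HHdist (T 0 U) U = 0"
proof -
 show "((\<lambda>h. HHdist (T h U) U) \<longlongrightarrow> 0) (at 0 within {0..})"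
  using C U unfolding C0_semigroup_def at_within_Ici_at_right by blast
 show "HHdist (T 0 U) U = 0"
  using HHdist_eq0[OF HH0_HH[OF semigroup_HH0[OF C _ U]] HH0_HH[OF U], of 0] semigroup_zero[OF C U] by simp
qed

lemma semigroup_dist:
 assumes C: "C0_semigroup T" and "t \<ge> 0" "U \<in> HH0" "V \<in> HH0"
 shows "HHdist (T t U) (T t V) = HHnorm (T t (lincomb 1 U (-1) V))"
 unfolding HHdist_def
 by (rule HHnorm_eq[symmetric, OF semigroup_lincomb[OF assms]])
  (rule HH0_HH[OF semigroup_HH0[OF assms(1,2) HH0_lincomb[OF assms(3,4)]]])

lemma semigroup_cong:
 assumes C: "C0_semigroup T" and t: "t \<ge> 0" and U: "U \<in> HH0" and e: "HH_eq U V"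
 shows "HH_eq (T t U) (T t V)"
proof -
 have V: "V \<in> HH0" by (rule HH0_cong[OF e U])
 note TU = HH0_HH[OF semigroup_HH0[OF C t U]] HH0_HH[OF semigroup_HH0[OF C t V]]
 obtain M where M: "\<forall>U\<in>HH0. HHnorm (T t U) \<le> M * HHnorm U" using semigroup_bound[OF C t] by blast
 have "HHdist (T t U) (T t V) \<le> M * HHdist U V"
  unfolding semigroup_dist[OF C t U V] unfolding HHdist_def by (rule M[rule_format, OF HH0_lincomb[OF U V]])
 also have "HHdist U V = 0" using HHdist_eq0[OF HH0_HH[OF U] HH0_HH[OF V]] e by simp
 finally have "HHdist (T t U) (T t V) = 0" using HHdist_nonneg[OF TU] by simp
 then show ?thesis using HHdist_eq0[OF TU] by simp
qed

text \<open>The state with incoming wave \<open>u\<close>, in a form that is linear in \<open>u\<close>.\<close>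

definition initial_state :: "(real \<Rightarrow> real) \<Rightarrow> state" where
 "initial_state u = (\<lambda>x. integral {x - 2..- x} u, \<lambda>x. u (- x) - u (x - 2))"

lemma initial_state_flow: "prim G u \<Longrightarrow> HH_eq (initial_state u) (flow G u 0)"
 using prim_integral[of G u] by (auto simp: HH_eq_def initial_state_def flow_def state_at_def disp_def)

lemma initial_state_HH0:
 assumes u: "u \<in> locL2"
 shows "initial_state u \<in> HH0" "HHnorm (initial_state u) \<le> 2 * sqrt (sqint (-2) 0 u)"
  "sqrt (sqint (-2) 0 u) \<le> HHnorm (initial_state u)"
proof -
 obtain G where G: "prim G u" using prim_locL2[OF u] by blast
 note F = flow_HH0[OF u G, of 0]
 have e: "HH_eq (flow G u 0) (initial_state u)" by (rule HH_eq_sym[OF initial_state_flow[OF G]])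
 show "initial_state u \<in> HH0" by (rule HH0_cong[OF e F])
 have n: "HHnorm (initial_state u) = HHnorm (flow G u 0)" using HHnorm_eq[OF e HH0_HH[OF F]] by simp
 have n0: "0 \<le> HHnorm (initial_state u)" unfolding n by (rule HHnorm_nonneg[OF HH0_HH[OF F]])
 have "HHnorm (initial_state u) \<le> sqrt (4 * sqint (-2) 0 u)"
  using flow_norm(3)[OF u G, of 0] unfolding n by (intro real_le_rsqrt) simp
 then show "HHnorm (initial_state u) \<le> 2 * sqrt (sqint (-2) 0 u)" by (simp add: real_sqrt_mult)
 have "sqint (-2) 0 u \<le> (HHnorm (initial_state u))\<^sup>2"
  using flow_norm(2)[OF u G, of 0] sqint_nonneg[of "-2" 0 u] unfolding n by simp
 then show "sqrt (sqint (-2) 0 u) \<le> HHnorm (initial_state u)" using n0 by (rule real_le_lsqrt[rotated])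
qed

lemma initial_state_lincomb:
 assumes "u \<in> locL2" "v \<in> locL2"
 shows "HH_eq (initial_state (\<lambda>t. a * u t + b * v t)) (lincomb a (initial_state u) b (initial_state v))"
proof -
 have "integral {x..y} (\<lambda>t. a * u t + b * v t) = a * integral {x..y} u + b * integral {x..y} v" for x y
  using locL2_int[OF locL2_cmult[OF assms(1), of a], of x y] locL2_int[OF locL2_cmult[OF assms(2), of b], of x y]
  by (simp add: Henstock_Kurzweil_Integration.integral_add)
 then show ?thesis by (simp add: HH_eq_def initial_state_def lincomb_def algebra_simps)
qed

text \<open>If the norms of \<open>T t\<close> were unbounded near 0, they would be unbounded along a sequence
 tending to 0, on which every orbit is bounded.\<close>

lemma semigroup_bounded_near_0:
 assumes C: "C0_semigroup T"
 shows "\<exists>\<delta>>0. \<exists>M. \<forall>t\<in>{0..\<delta>}. \<forall>U\<in>HH0. HHnorm (T t U) \<le> M * HHnorm U"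
proof (rule ccontr)
 assume neg: "\<not> ?thesis"
 have "\<exists>t U. t \<in> {0..1 / real (Suc n)} \<and> U \<in> HH0 \<and> real n * HHnorm U < HHnorm (T t U)" for n
 proof (rule ccontr)
  assume "\<not> ?thesis"
  then have "\<forall>t\<in>{0..1 / real (Suc n)}. \<forall>U\<in>HH0. HHnorm (T t U) \<le> real n * HHnorm U" by (meson not_less)
  moreover have "0 < 1 / real (Suc n)" by simp
  ultimately show False using neg by blast
 qed
 then obtain \<tau> U where \<tau>: "\<And>n. \<tau> n \<in> {0..1 / real (Suc n)}" and U: "\<And>n. U n \<in> HH0"
  and big: "\<And>n. real n * HHnorm (U n) < HHnorm (T (\<tau> n) (U n))" by metis
 have \<tau>0: "0 \<le> \<tau> n" for n using \<tau>[of n] by simp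
 have \<tau>lim: "\<tau> \<longlonglongrightarrow> 0"
 proof (rule tendsto_sandwich[OF _ _ tendsto_const LIMSEQ_Suc[OF lim_const_over_n[of 1]]])
  show "\<forall>\<^sub>F n in sequentially. 0 \<le> \<tau> n" using \<tau>0 by simp
  show "\<forall>\<^sub>F n in sequentially. \<tau> n \<le> 1 / real (Suc n)" using \<tau> by (intro always_eventually) auto
 qed
 define Q where "Q n u = HHnorm (T (\<tau> n) (initial_state u))" for n u
 have TH: "T (\<tau> n) V \<in> HH" if "V \<in> HH0" for n V using HH0_HH[OF semigroup_HH0[OF C \<tau>0 that]] .
 have "\<exists>M. \<forall>n. \<forall>u\<in>locL2. Q n u \<le> M * sqrt (sqint (-2) 0 u)"
 proof (rule uniform_boundedness_L2)
  fix n :: nat and u v :: "real \<Rightarrow> real" and a b :: real assume u: "u \<in> locL2" and v: "v \<in> locL2"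
  let ?u = "initial_state u" and ?v = "initial_state v"
  note I = initial_state_HH0(1)[OF u] initial_state_HH0(1)[OF v]
  have w: "initial_state (\<lambda>t. a * u t + b * v t) \<in> HH0" using u v by (intro initial_state_HH0(1)) auto
  have "HH_eq (T (\<tau> n) (initial_state (\<lambda>t. a * u t + b * v t))) (lincomb a (T (\<tau> n) ?u) b (T (\<tau> n) ?v))"
   by (rule HH_eq_trans[OF semigroup_cong[OF C \<tau>0 w initial_state_lincomb[OF u v]] semigroup_lincomb[OF C \<tau>0 I]])
  then have "Q n (\<lambda>t. a * u t + b * v t) = HHnorm (lincomb a (T (\<tau> n) ?u) b (T (\<tau> n) ?v))"
   unfolding Q_def by (rule HHnorm_eq[OF _ TH[OF w]])
  also have "lincomb a (T (\<tau> n) ?u) b (T (\<tau> n) ?v) = lincomb 1 (lincomb a (T (\<tau> n) ?u) 0 (T (\<tau> n) ?v)) 1 (lincomb b (T (\<tau> n) ?v) 0 (T (\<tau> n) ?u))"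
   by (simp add: lincomb_def)
  also have "HHnorm \<dots> \<le> HHnorm (lincomb a (T (\<tau> n) ?u) 0 (T (\<tau> n) ?v)) + HHnorm (lincomb b (T (\<tau> n) ?v) 0 (T (\<tau> n) ?u))"
   by (intro HHnorm_triangle HH_lincomb TH I)
  also have "\<dots> = \<bar>a\<bar> * Q n u + \<bar>b\<bar> * Q n v"
   unfolding Q_def by (simp only: HHnorm_scale TH I)
  finally show "Q n (\<lambda>t. a * u t + b * v t) \<le> \<bar>a\<bar> * Q n u + \<bar>b\<bar> * Q n v" .
 next
  fix n
  obtain M where M: "\<forall>U\<in>HH0. HHnorm (T (\<tau> n) U) \<le> M * HHnorm U" using semigroup_bound[OF C \<tau>0] by blast
  have "Q n u \<le> (\<bar>M\<bar> * 2) * sqrt (sqint (-2) 0 u)" if u: "u \<in> locL2" for u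
  proof -
   have "Q n u \<le> M * HHnorm (initial_state u)" unfolding Q_def using M initial_state_HH0(1)[OF u] by blast
   also have "\<dots> \<le> \<bar>M\<bar> * HHnorm (initial_state u)"
    by (rule mult_right_mono[OF abs_ge_self HHnorm_nonneg[OF HH0_HH[OF initial_state_HH0(1)[OF u]]]])
   also have "\<dots> \<le> \<bar>M\<bar> * (2 * sqrt (sqint (-2) 0 u))" by (rule mult_left_mono[OF initial_state_HH0(2)[OF u]]) simp
   finally show ?thesis by simp
  qed
  then show "\<exists>M. \<forall>u\<in>locL2. Q n u \<le> M * sqrt (sqint (-2) 0 u)" by blast
 next
  fix u :: "real \<Rightarrow> real" assume u: "u \<in> locL2"
  let ?U = "initial_state u"
  note I = initial_state_HH0(1)[OF u]
  have "continuous (at 0 within {0..}) (\<lambda>h. HHdist (T h ?U) ?U)"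
   using semigroup_continuous_0[OF C I] by (simp add: continuous_within)
  then have "((\<lambda>h. HHdist (T h ?U) ?U) \<circ> \<tau>) \<longlonglongrightarrow> HHdist (T 0 ?U) ?U"
   unfolding continuous_within_sequentially using \<tau>0 \<tau>lim by auto
  then have "convergent (\<lambda>n. HHdist (T (\<tau> n) ?U) ?U)" by (auto simp: convergent_def o_def)
  then obtain K where K: "\<And>n. norm (HHdist (T (\<tau> n) ?U) ?U) \<le> K" using convergent_imp_Bseq BseqE by metis
  have "Q n u \<le> K + HHnorm ?U" for n
  proof -
   have "T (\<tau> n) ?U = lincomb 1 (lincomb 1 (T (\<tau> n) ?U) (-1) ?U) 1 ?U" by (simp add: lincomb_def)
   then have "Q n u \<le> HHdist (T (\<tau> n) ?U) ?U + HHnorm ?U"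
    unfolding Q_def HHdist_def using HHnorm_triangle[OF HH_lincomb[OF TH[OF I] HH0_HH[OF I]] HH0_HH[OF I], of 1 n "-1"] by simp
   then show ?thesis using K[of n] by simp
  qed
  then show "\<exists>K. \<forall>n. Q n u \<le> K" by blast
 qed
 then obtain M where M: "\<And>n u. u \<in> locL2 \<Longrightarrow> Q n u \<le> M * sqrt (sqint (-2) 0 u)" by blast
 obtain n :: nat where n: "\<bar>M\<bar> < real n" using reals_Archimedean2 by blast
 \<comment> \<open>only the initial values of \<open>h\<close> matter here, so any parameters do\<close>
 obtain G h where d: "delay_solution 0 0 G h" and e: "HH_eq (flow G h 0) (U n)" using HH0_delay[OF U] .
 have h: "h \<in> locL2" "prim G h" using d by (auto simp: delay_solution_def)
 have e': "HH_eq (initial_state h) (U n)" by (rule HH_eq_trans[OF initial_state_flow[OF h(2)] e])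
 note I = initial_state_HH0[OF h(1)]
 have "HHnorm (T (\<tau> n) (U n)) = Q n h"
  unfolding Q_def by (rule HHnorm_eq[symmetric, OF semigroup_cong[OF C \<tau>0 I(1) e'] TH[OF I(1)]])
 also have "\<dots> \<le> M * sqrt (sqint (-2) 0 h)" by (rule M[OF h(1)])
 also have "\<dots> \<le> \<bar>M\<bar> * sqrt (sqint (-2) 0 h)" by (intro mult_right_mono) (auto simp: sqint_nonneg)
 also have "\<dots> \<le> real n * HHnorm (initial_state h)" using n I(3) by (intro mult_mono) (auto simp: sqint_nonneg)
 also have "HHnorm (initial_state h) = HHnorm (U n)" by (rule HHnorm_eq[OF e' HH0_HH[OF I(1)]])
 finally show False using big[of n] by simp
qed

text \<open>By the semigroup property, from a neighbourhood of 0.\<close>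

lemma semigroup_locally_bounded:
 assumes C: "C0_semigroup T"
 obtains M where "M \<ge> 1" "\<And>t U. 0 \<le> t \<Longrightarrow> t \<le> \<tau> \<Longrightarrow> U \<in> HH0 \<Longrightarrow> HHnorm (T t U) \<le> M * HHnorm U"
proof -
 obtain \<delta> K where \<delta>: "\<delta> > 0" and K: "\<And>t U. t \<in> {0..\<delta>} \<Longrightarrow> U \<in> HH0 \<Longrightarrow> HHnorm (T t U) \<le> K * HHnorm U"
  using semigroup_bounded_near_0[OF C] by metis
 define L where "L = max 1 K"
 have L1: "L \<ge> 1" by (simp add: L_def)
 have L: "HHnorm (T t U) \<le> L * HHnorm U" if "t \<in> {0..\<delta>}" "U \<in> HH0" for t U
  using K[OF that] mult_right_mono[of K L "HHnorm U"] HHnorm_nonneg[OF HH0_HH[OF that(2)]] by (simp add: L_def)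
 have *: "\<forall>t U. 0 \<le> t \<and> t \<le> real n * \<delta> \<and> U \<in> HH0 \<longrightarrow> HHnorm (T t U) \<le> L ^ Suc n * HHnorm U" for n
 proof (induction n)
  case 0
  then show ?case using L \<delta> by auto
 next
  case (Suc n)
  show ?case
  proof (intro allI impI)
   fix t U assume a: "0 \<le> t \<and> t \<le> real (Suc n) * \<delta> \<and> U \<in> HH0"
   then have U: "U \<in> HH0" by simp
   show "HHnorm (T t U) \<le> L ^ Suc (Suc n) * HHnorm U"
   proof (cases "t \<le> \<delta>")
    case True
    have "HHnorm (T t U) \<le> L * HHnorm U" using a True by (intro L) auto
    also have "\<dots> \<le> L ^ Suc (Suc n) * HHnorm U"
     using power_increasing[of 1 "Suc (Suc n)" L] L1 by (intro mult_right_mono HHnorm_nonneg HH0_HH U) auto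
    finally show ?thesis .
   next
    case False
    let ?r = "t - \<delta>"
    have r: "0 \<le> ?r" "?r \<le> real n * \<delta>" using a False by (auto simp: algebra_simps)
    have V: "T ?r U \<in> HH0" by (rule semigroup_HH0[OF C r(1) U])
    have "HHnorm (T t U) = HHnorm (T \<delta> (T ?r U))"
     using HHnorm_eq[OF semigroup_add[OF C _ r(1) U, of \<delta>]] HH0_HH[OF semigroup_HH0[OF C _ U]] a \<delta> by simp
    also have "\<dots> \<le> L * HHnorm (T ?r U)" using \<delta> by (intro L V) auto
    also have "\<dots> \<le> L * (L ^ Suc n * HHnorm U)" using L1 by (intro mult_left_mono Suc.IH[rule_format] conjI r U) auto
    finally show ?thesis by simp
   qed
  qed
 qed
 obtain n where "\<tau> < real n * \<delta>" using reals_Archimedean3[OF \<delta>] by blast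
 then have "\<And>t U. 0 \<le> t \<Longrightarrow> t \<le> \<tau> \<Longrightarrow> U \<in> HH0 \<Longrightarrow> HHnorm (T t U) \<le> L ^ Suc n * HHnorm U" using *[of n] by auto
 moreover have "L ^ Suc n \<ge> 1" using L1 by (rule one_le_power)
 ultimately show ?thesis using that by blast
qed

section \<open>The semigroup generated by the operator\<close>

text \<open>On the domain the semigroup is the flow of the delay equation: $s\<mapsto>T(t-s)S(s)V$ has right
 derivative zero.\<close>

lemma semigroup_flow:
 assumes c: "c0 < 1" and S: "semigroup_generated_by_A0 c0 c1 T" and d: "delay_solution c0 c1 G h"
  and P1: "prim h h1" and h1: "h1 \<in> locL2" and t: "t \<ge> 0"
 shows "HH_eq (T t (flow G h 0)) (flow G h t)"
proof -
 have C: "C0_semigroup T" using S by (simp add: semigroup_generated_by_A0_def)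
 have h: "h \<in> locL2" and P: "prim G h" using d by (auto simp: delay_solution_def)
 define F where "F s = flow G h s" for s
 have F: "F s \<in> HH0" for s unfolding F_def by (rule flow_HH0[OF h P])
 have T: "T s U \<in> HH0" if "0 \<le> s" "U \<in> HH0" for s U by (rule semigroup_HH0[OF C that])
 note H = HH0_HH
 obtain M where M1: "M \<ge> 1" and M: "\<And>s U. 0 \<le> s \<Longrightarrow> s \<le> t \<Longrightarrow> U \<in> HH0 \<Longrightarrow> HHnorm (T s U) \<le> M * HHnorm U"
  using semigroup_locally_bounded[OF C] by metis
 have lip: "HHdist (T s U) (T s V) \<le> M * HHdist U V" if "0 \<le> s" "s \<le> t" "U \<in> HH0" "V \<in> HH0" for s U V
  unfolding semigroup_dist[OF C that(1,3,4)] unfolding HHdist_def by (rule M[OF that(1,2) HH0_lincomb[OF that(3,4)]])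
 \<comment> \<open>zero at $s=0$; the claim is that it is zero at $s=t$\<close>
 define N where "N s = HHdist (T (t - s) (F s)) (T t (F 0))" for s
 have TF: "T (t - s) (F s) \<in> HH" if "s \<le> t" for s using T[of "t - s" "F s"] F that H by simp
 have N_diff: "\<bar>N r - N s\<bar> \<le> M * HHdist (F r) (T (r - s) (F s))" if s: "0 \<le> s" "s \<le> r" "r \<le> t" for r s
 proof -
  have z: "T t (F 0) \<in> HH" using H[OF T[OF t F]] .
  have st: "s \<le> t" using s by simp
  have tri: "\<bar>HHdist U W - HHdist V W\<bar> \<le> HHdist U V" if "U \<in> HH" "V \<in> HH" "W \<in> HH" for U V W
   using HHdist_triangle[OF that] HHdist_triangle[OF that(2,1,3)] HHdist_sym[OF that(1,2)] by linarith
  have q: "T (r - s) (F s) \<in> HH0" using s by (intro T F) simp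
  have "\<bar>N r - N s\<bar> \<le> HHdist (T (t - r) (F r)) (T (t - s) (F s))"
   unfolding N_def by (rule tri[OF TF[OF s(3)] TF[OF st] z])
  also have "HH_eq (T (t - s) (F s)) (T (t - r) (T (r - s) (F s)))"
   using semigroup_add[OF C _ _ F, of "t - r" "r - s" s] s by simp
  then have "HHdist (T (t - r) (F r)) (T (t - s) (F s)) = HHdist (T (t - r) (F r)) (T (t - r) (T (r - s) (F s)))"
   by (rule HHdist_cong[OF HH_eq_refl _ TF[OF s(3)] TF[OF st]])
  also have "\<dots> \<le> M * HHdist (F r) (T (r - s) (F s))" using s by (intro lip F q) auto
  finally show ?thesis .
 qed
 have Fcont: "((\<lambda>s. HHdist (F s) (F r)) \<longlongrightarrow> 0) (at r within {0..})" if "r \<ge> 0" for r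
  using disp_wave_solution[OF h P] that unfolding wave_solution_def continuous_HH_def F_def flow_def by blast
 have "continuous_on {0..t} N"
  unfolding continuous_on_def
 proof
  fix r assume r: "r \<in> {0..t}"
  define e where "e k = HHdist (T k (F r)) (F r)" for k
  have ea: "(e \<longlongrightarrow> 0) (at 0 within {0..})" "e 0 = 0" unfolding e_def by (rule semigroup_continuous_0[OF C F])+
  have ab: "filterlim (\<lambda>s. \<bar>s - r\<bar>) (at 0 within {0..}) (at r within {0..t})"
  proof -
   have "((\<lambda>s. \<bar>s - r\<bar>) \<longlongrightarrow> \<bar>r - r\<bar>) (at r within {0..t})" by (intro tendsto_intros)
   then show ?thesis unfolding filterlim_at by (simp add: eventually_at_filter)
  qed
  have e0: "((\<lambda>s. e \<bar>s - r\<bar>) \<longlongrightarrow> 0) (at r within {0..t})" by (rule filterlim_compose[OF ea(1) ab])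
  have f0: "((\<lambda>s. HHdist (F s) (F r)) \<longlongrightarrow> 0) (at r within {0..t})"
   by (rule tendsto_within_subset[OF Fcont]) (use r in auto)
  have bound: "\<bar>N s - N r\<bar> \<le> M * (M * HHdist (F s) (F r) + HHdist (F s) (F r) + e \<bar>s - r\<bar>)" if s: "s \<in> {0..t}" for s
  proof (cases "s \<le> r")
   case True
   have i: "0 \<le> r - s" "r - s \<le> t" using s r True by auto
   have q: "T (r - s) (F s) \<in> HH0" "T (r - s) (F r) \<in> HH0" using i by (auto intro: T F)
   have "HHdist (F r) (T (r - s) (F s)) \<le> HHdist (F r) (T (r - s) (F r)) + HHdist (T (r - s) (F r)) (T (r - s) (F s))"
    by (intro HHdist_triangle H F q)
   also have "HHdist (F r) (T (r - s) (F r)) = e (r - s)" unfolding e_def by (intro HHdist_sym H F q)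
   also have "HHdist (T (r - s) (F r)) (T (r - s) (F s)) \<le> M * HHdist (F r) (F s)" by (intro lip i F)
   also have "HHdist (F r) (F s) = HHdist (F s) (F r)" by (intro HHdist_sym H F)
   finally have "HHdist (F r) (T (r - s) (F s)) \<le> M * HHdist (F s) (F r) + HHdist (F s) (F r) + e (r - s)"
    using HHdist_nonneg[OF H[OF F] H[OF F], of s r] by simp
   then have "M * HHdist (F r) (T (r - s) (F s)) \<le> M * (M * HHdist (F s) (F r) + HHdist (F s) (F r) + e (r - s))"
    using M1 by (intro mult_left_mono) auto
   then show ?thesis using N_diff[of s r] s r True by (simp add: abs_minus_commute)
  next
   case False
   have i: "0 \<le> s - r" using False by simp
   have q: "T (s - r) (F r) \<in> HH0" by (intro T i F)
   have m: "0 \<le> M * HHdist (F s) (F r)"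
    using HHdist_nonneg[OF H[OF F] H[OF F], of s r] M1 by (intro mult_nonneg_nonneg) auto
   have "HHdist (F s) (T (s - r) (F r)) \<le> HHdist (F s) (F r) + HHdist (F r) (T (s - r) (F r))"
    by (intro HHdist_triangle H F q)
   also have "HHdist (F r) (T (s - r) (F r)) = e (s - r)" unfolding e_def by (intro HHdist_sym H F q)
   finally have "HHdist (F s) (T (s - r) (F r)) \<le> M * HHdist (F s) (F r) + HHdist (F s) (F r) + e (s - r)"
    using m by linarith
   then have "M * HHdist (F s) (T (s - r) (F r)) \<le> M * (M * HHdist (F s) (F r) + HHdist (F s) (F r) + e (s - r))"
    using M1 by (intro mult_left_mono) auto
   then show ?thesis using N_diff[of r s] s r False by simp
  qed
  have "((\<lambda>s. M * (M * HHdist (F s) (F r) + HHdist (F s) (F r) + e \<bar>s - r\<bar>)) \<longlongrightarrow> M * (M * 0 + 0 + 0)) (at r within {0..t})"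
   by (intro tendsto_intros e0 f0)
  then have "((\<lambda>s. M * (M * HHdist (F s) (F r) + HHdist (F s) (F r) + e \<bar>s - r\<bar>)) \<longlongrightarrow> 0) (at r within {0..t})" by simp
  moreover have "\<forall>\<^sub>F s in at r within {0..t}. norm (N s - N r) \<le> M * (M * HHdist (F s) (F r) + HHdist (F s) (F r) + e \<bar>s - r\<bar>)"
   unfolding eventually_at_filter by (rule always_eventually) (use bound in auto)
  ultimately have "((\<lambda>s. N s - N r) \<longlongrightarrow> 0) (at r within {0..t})" by (rule Lim_null_comparison[rotated])
  then show "(N \<longlongrightarrow> N r) (at r within {0..t})" by (rule LIM_zero_cancel)
 qed
 moreover have deriv: "\<exists>d>0. \<forall>r. s < r \<and> r < s + d \<and> r \<le> t \<longrightarrow> N r - \<epsilon> * r \<le> N s - \<epsilon> * s"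
  if e: "\<epsilon> > 0" and s: "0 \<le> s" "s < t" for \<epsilon> s
 proof -
  let ?A = "flow h h1 s"
  have A: "?A \<in> HH0" by (rule flow_HH0[OF h1 P1])
  have "((\<lambda>k. HHdist (lincomb (1 / k) (T k (F s)) (- 1 / k) (F s)) ?A) \<longlongrightarrow> 0) (at_right 0)"
  proof (rule iffD2[OF bspec[OF bspec[OF conjunct2[OF S[unfolded semigroup_generated_by_A0_def]] F] A]])
   show "\<exists>U'\<in>dom_A0 c0 c1. HH_eq (F s) U' \<and> HH_eq ?A (A0 U')"
    unfolding F_def by (intro bexI[OF _ flow_dom(1)[OF c d P1 h1 s(1)]] conjI HH_eq_refl flow_dom(2)[OF c d P1 h1 s(1)])
  qed
  moreover have "((\<lambda>k. HHdist (lincomb (1 / k) (F (s + k)) (- 1 / k) (F s)) ?A) \<longlongrightarrow> 0) (at_right 0)"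
  proof -
   have eq: "HHdist (lincomb (1 / k) (F (s + k)) (- 1 / k) (F s)) ?A \<le> 2 * sqrt (sqint (s - 2) s (\<lambda>u. steklov k h1 u - h1 u))" for k
   proof -
    have "lincomb (1 / k) (F (s + k)) (- 1 / k) (F s) = flow (steklov k h) (steklov k h1) s"
     unfolding steklov_prim[OF P, abs_def] steklov_prim[OF P1, abs_def]
     by (simp add: F_def flow_def state_at_def disp_def lincomb_def fun_eq_iff algebra_simps add_divide_distrib diff_divide_distrib)
    then have e1: "HHdist (lincomb (1 / k) (F (s + k)) (- 1 / k) (F s)) ?A
      = HHnorm (flow (\<lambda>u. steklov k h u - h u) (\<lambda>u. steklov k h1 u - h1 u) s)"
     by (simp add: HHdist_def flow_diff)
    have "prim (steklov k h) (steklov k h1)" by (rule prim_steklov[OF P1 P])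
    then have "(HHnorm (flow (\<lambda>u. steklov k h u - h u) (\<lambda>u. steklov k h1 u - h1 u) s))\<^sup>2 \<le> 4 * sqint (s - 2) s (\<lambda>u. steklov k h1 u - h1 u)"
     by (intro flow_norm(3) locL2_diff steklov_locL2 h1 prim_diff P1)
    then show ?thesis unfolding e1 using real_le_rsqrt[of _ "4 * sqint (s - 2) s (\<lambda>u. steklov k h1 u - h1 u)"] by (simp add: real_sqrt_mult)
   qed
   have "((\<lambda>k. 2 * sqrt (sqint (s - 2) s (\<lambda>u. steklov k h1 u - h1 u))) \<longlongrightarrow> 2 * sqrt 0) (at_right 0)"
    by (intro tendsto_intros filterlim_mono[OF steklov_L2[OF h1]]) (auto simp: at_le)
   then have "((\<lambda>k. 2 * sqrt (sqint (s - 2) s (\<lambda>u. steklov k h1 u - h1 u))) \<longlongrightarrow> 0) (at_right 0)" by simp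
   then show ?thesis
   proof (rule Lim_null_comparison[rotated], intro always_eventually allI)
    fix k
    have "0 \<le> HHdist (lincomb (1 / k) (F (s + k)) (- 1 / k) (F s)) ?A" by (intro HHdist_nonneg H HH0_lincomb F A)
    then show "norm (HHdist (lincomb (1 / k) (F (s + k)) (- 1 / k) (F s)) ?A) \<le> 2 * sqrt (sqint (s - 2) s (\<lambda>u. steklov k h1 u - h1 u))"
     using eq[of k] by (simp only: real_norm_def abs_of_nonneg)
   qed
  qed
  ultimately have "((\<lambda>k. M * (HHdist (lincomb (1 / k) (F (s + k)) (- 1 / k) (F s)) ?A
    + HHdist (lincomb (1 / k) (T k (F s)) (- 1 / k) (F s)) ?A)) \<longlongrightarrow> M * (0 + 0)) (at_right 0)"
   by (intro tendsto_intros)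
  then have "\<forall>\<^sub>F k in at_right 0. M * (HHdist (lincomb (1 / k) (F (s + k)) (- 1 / k) (F s)) ?A
    + HHdist (lincomb (1 / k) (T k (F s)) (- 1 / k) (F s)) ?A) < \<epsilon>"
   using e by (intro order_tendstoD(2)) auto
  then obtain b where b: "b > 0" and le: "\<And>k. 0 < k \<Longrightarrow> k < b \<Longrightarrow> M * (HHdist (lincomb (1 / k) (F (s + k)) (- 1 / k) (F s)) ?A
    + HHdist (lincomb (1 / k) (T k (F s)) (- 1 / k) (F s)) ?A) < \<epsilon>"
   unfolding eventually_at_right_field by auto
  have "N r - \<epsilon> * r \<le> N s - \<epsilon> * s" if r: "s < r" "r < s + b" "r \<le> t" for r
  proof -
   define k where "k = r - s"
   have k: "0 < k" "k < b" "r = s + k" using r by (auto simp: k_def)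
   have q: "T k (F s) \<in> HH0" using k by (intro T F) auto
   let ?X = "lincomb (1 / k) (F r) (- 1 / k) (F s)" and ?Y = "lincomb (1 / k) (T k (F s)) (- 1 / k) (F s)"
   have X: "?X \<in> HH" "?Y \<in> HH" by (intro H HH0_lincomb F q)+
   have "lincomb 1 (F r) (-1) (T k (F s)) = lincomb k (lincomb 1 ?X (-1) ?Y) 0 ?X"
    using k(1) by (simp add: lincomb_def fun_eq_iff field_simps)
   then have "HHdist (F r) (T k (F s)) = k * HHdist ?X ?Y"
    using HHnorm_scale[OF HH_lincomb[OF X] X(1), of k 1 "-1"] k(1) by (simp add: HHdist_def)
   also have "\<dots> \<le> k * (HHdist ?X ?A + HHdist ?Y ?A)"
    using HHdist_triangle[OF X(1) H[OF A] X(2)] HHdist_sym[OF X(2) H[OF A]] k(1) by (intro mult_left_mono) auto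
   finally have "M * HHdist (F r) (T k (F s)) \<le> M * (k * (HHdist ?X ?A + HHdist ?Y ?A))" using M1 by (intro mult_left_mono) auto
   also have "\<dots> = k * (M * (HHdist ?X ?A + HHdist ?Y ?A))" by simp
   also have "\<dots> \<le> k * \<epsilon>" using le[OF k(1,2)] k by (intro mult_left_mono) auto
   finally have "N r - N s \<le> k * \<epsilon>" using N_diff[of s r] s r by (simp add: k_def)
   then show ?thesis by (simp add: k_def algebra_simps)
  qed
  then show ?thesis using b by blast
 qed
 ultimately have "N t - \<epsilon> * t \<le> N 0 - \<epsilon> * 0" if "\<epsilon> > 0" for \<epsilon>
  using that by (intro right_nonincreasing[OF t, of "\<lambda>s. N s - \<epsilon> * s"] continuous_intros deriv) auto
 moreover have N0: "N 0 = 0" by (simp add: N_def)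
 ultimately have le: "N t \<le> \<epsilon> * t" if "\<epsilon> > 0" for \<epsilon> using that by fastforce
 have "N t \<le> 0"
 proof (rule field_le_epsilon)
  fix e :: real assume "e > 0"
  have "N t \<le> e / (1 + t) * t" using \<open>e > 0\<close> t by (intro le) auto
  also have "\<dots> \<le> e" using \<open>e > 0\<close> t by (simp add: field_simps)
  finally show "N t \<le> 0 + e" by simp
 qed
 then have "HHdist (T 0 (F t)) (T t (F 0)) = 0" using HHdist_nonneg[OF TF[of t] H[OF T[OF t F]], of 0] by (simp add: N_def)
 then have "HH_eq (T 0 (F t)) (T t (F 0))" using HHdist_eq0[OF H[OF T[OF order_refl F]] H[OF T[OF t F]]] by simp
 then show ?thesis using HH_eq_trans[OF HH_eq_sym semigroup_zero[OF C F]] by (simp add: F_def)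
qed

section \<open>The output function\<close>

text \<open>For data in the domain, \<open>C\<close> is evaluated along the regular flow.\<close>

lemma output_on_domain:
 assumes c: "c0 < 1" and S: "semigroup_generated_by_A0 c0 c1 T" and V: "V \<in> dom_A0 c0 c1"
 obtains G h where "delay_solution c0 c1 G h" "HH_eq (flow G h 0) V" "\<And>t. t \<ge> 0 \<Longrightarrow> Cobs (T t V) = - 2 * h (t - 1)"
proof -
 have C: "C0_semigroup T" using S by (simp add: semigroup_generated_by_A0_def)
 obtain G h h1 where d: "delay_solution c0 c1 G h" "prim h h1" "h1 \<in> locL2" "HH_eq (flow G h 0) V"
  using dom_delay[OF c V] .
 have F: "flow G h 0 \<in> HH0" using d(1) by (intro flow_HH0) (auto simp: delay_solution_def)
 have "Cobs (T t V) = - 2 * h (t - 1)" if t: "t \<ge> 0" for t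
 proof (rule flow_dom(3)[OF c d(1-3) t])
  show "HH_eq (T t V) (flow G h t)"
   by (rule HH_eq_trans[OF HH_eq_sym[OF semigroup_cong[OF C t F d(4)]] semigroup_flow[OF c S d(1-3) t]])
 qed
 then show ?thesis using that d by blast
qed

abbreviation near_in_domain :: "real \<Rightarrow> real \<Rightarrow> state \<Rightarrow> state filter" where
 "near_in_domain c0 c1 B \<equiv> INF \<delta>\<in>{0<..}. principal {V \<in> dom_A0 c0 c1. HHdist V B < \<delta>}"

text \<open>The domain is dense.\<close>

lemma near_in_domain_nontrivial:
 assumes c: "c0 < 1" and B: "B \<in> HH0" shows "near_in_domain c0 c1 B \<noteq> bot"
proof
 assume "near_in_domain c0 c1 B = bot"
 then have "\<forall>\<^sub>F V in near_in_domain c0 c1 B. False" by simp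
 then have "\<exists>\<delta>\<in>{0<..}. \<forall>\<^sub>F V in principal {V \<in> dom_A0 c0 c1. HHdist V B < \<delta>}. False"
 proof (subst (asm) eventually_INF_base)
  fix a b :: real assume "a \<in> {0<..}" "b \<in> {0<..}"
  then show "\<exists>x\<in>{0<..}. principal {V \<in> dom_A0 c0 c1. HHdist V B < x}
    \<le> inf (principal {V \<in> dom_A0 c0 c1. HHdist V B < a}) (principal {V \<in> dom_A0 c0 c1. HHdist V B < b})"
   by (intro bexI[of _ "min a b"]) auto
 qed auto
 then obtain \<delta> where \<delta>: "\<delta> > 0" "\<And>V. V \<in> dom_A0 c0 c1 \<Longrightarrow> \<not> HHdist V B < \<delta>" by (auto simp: eventually_principal)
 obtain G h where d: "delay_solution c0 c1 G h" and e: "HH_eq (flow G h 0) B" using HH0_delay[OF B] .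
 have F: "flow G h 0 \<in> HH" using d by (intro HH0_HH flow_HH0) (auto simp: delay_solution_def)
 obtain V where V: "V \<in> dom_A0 c0 c1" "HHdist V (flow G h 0) < \<delta>" using dom_dense[OF c d \<delta>(1)] by blast
 obtain K k k1 where k: "delay_solution c0 c1 K k" "HH_eq (flow K k 0) V" using dom_delay[OF c V(1)] by metis
 have "flow K k 0 \<in> HH" using k(1) by (intro HH0_HH flow_HH0) (auto simp: delay_solution_def)
 then have "V \<in> HH" by (rule HH_eq_HH[OF k(2)])
 then have "HHdist V (flow G h 0) = HHdist V B" by (intro HHdist_cong e F) auto
 then show False using \<delta>(2)[OF V(1)] V(2) by simp
qed

text \<open>The output on $[0,\tau]$ is the wave on $[-1,\tau-1]$, which depends continuously on its initial values,
 that is on the state.\<close>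

lemma output_tendsto:
 assumes c: "0 < c0" "c0 < 1" "0 < c1" and S: "semigroup_generated_by_A0 c0 c1 T"
  and d: "delay_solution c0 c1 G h" and e: "HH_eq (flow G h 0) B"
 shows "tendsto_L2loc (\<lambda>V t. Cobs (T t V)) (\<lambda>t. - 2 * h (t - 1)) (near_in_domain c0 c1 B)"
 unfolding tendsto_L2loc_def
proof (intro allI impI conjI)
 fix \<tau> :: real assume \<tau>: "\<tau> > 0"
 have FB: "flow G h 0 \<in> HH" using d by (intro HH0_HH flow_HH0) (auto simp: delay_solution_def)
 obtain n :: nat where "\<tau> / 2 \<le> real n" using real_arch_simple[of "\<tau> / 2"] by blast
 then have n: "\<tau> \<le> 2 * real n" by simp
 define L where "L = (1 + real n) * (1 + c1 / (1 - c0))"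
 have L: "0 < L" unfolding L_def using c by (intro mult_pos_pos add_pos_nonneg) auto
 have main: "(\<lambda>t. Cobs (T t V) - (- 2 * h (t - 1))) \<in> L2 {0..\<tau>} \<and>
   L2norm {0..\<tau>} (\<lambda>t. Cobs (T t V) - (- 2 * h (t - 1))) \<le> sqrt (2 * L) * HHdist V B" if V: "V \<in> dom_A0 c0 c1" for V
 proof -
  obtain K k where k: "delay_solution c0 c1 K k" "HH_eq (flow K k 0) V" and out: "\<And>t. t \<ge> 0 \<Longrightarrow> Cobs (T t V) = - 2 * k (t - 1)"
   using output_on_domain[OF c(2) S V] by metis
  have FV: "flow K k 0 \<in> HH" using k(1) by (intro HH0_HH flow_HH0) (auto simp: delay_solution_def)
  define m where "m t = k t - h t" for t
  have D: "delay_solution c0 c1 (\<lambda>t. K t - G t) m" unfolding m_def by (rule delay_diff[OF k(1) d])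
  have mL: "m \<in> locL2" and Pm: "prim (\<lambda>t. K t - G t) m" using D by (auto simp: delay_solution_def)
  have "HHdist V B = HHdist (flow K k 0) (flow G h 0)" by (rule HHdist_cong[OF k(2) e FV FB, symmetric])
  then have dist: "2 * sqint (-2) 0 m \<le> (HHdist V B)\<^sup>2" and d0: "0 \<le> HHdist V B"
   using flow_norm(2)[OF mL Pm, of 0] HHdist_nonneg[OF FV FB] by (simp_all add: HHdist_def flow_diff m_def[abs_def])
  have m1: "(\<lambda>t. m (t + (-1))) \<in> locL2" using locL2_affine[OF mL, of 1 "-1"] by (simp add: add.commute)
  have m2: "(\<lambda>t. - 2 * m (t + (-1))) \<in> locL2" by (rule locL2_cmult[OF m1])
  have ae: "AE t in lebesgue_on {0..\<tau>}. - 2 * m (t + (-1)) = Cobs (T t V) - (- 2 * h (t - 1))"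
   by (rule AE_I2) (simp add: out m_def)
  have "sqint 0 \<tau> (\<lambda>t. - 2 * m (t + (-1))) = 4 * sqint (0 + (-1)) (\<tau> + (-1)) m"
   unfolding sqint_cmult sqint_shift[OF mL] by simp
  also have "\<dots> \<le> 4 * sqint (-2) (2 * real n) m" using n by (intro mult_left_mono sqint_mono[OF mL]) auto
  also have "\<dots> \<le> 4 * (L * sqint (-2) 0 m)" unfolding L_def using delay_local_bound[OF c D, of n] by simp
  also have "\<dots> \<le> 2 * L * (HHdist V B)\<^sup>2" using mult_left_mono[OF dist, of "2 * L"] L by simp
  finally have "sqrt (sqint 0 \<tau> (\<lambda>t. - 2 * m (t + (-1)))) \<le> sqrt (2 * L * (HHdist V B)\<^sup>2)" by (rule real_sqrt_le_mono)
  then have "L2norm {0..\<tau>} (\<lambda>t. - 2 * m (t + (-1))) \<le> sqrt (2 * L) * HHdist V B"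
   using d0 locL2_D[OF m2] by (simp add: L2norm_integral sqint_def real_sqrt_mult)
  then show ?thesis using L2norm_cong_AE[OF _ locL2_D[OF m2] ae] by simp
 qed
 have dom: "\<forall>\<^sub>F V in near_in_domain c0 c1 B. V \<in> dom_A0 c0 c1"
  by (rule eventually_INF1[of 1]) (auto simp: eventually_principal)
 then show "\<forall>\<^sub>F V in near_in_domain c0 c1 B. (\<lambda>t. Cobs (T t V) - (- 2 * h (t - 1))) \<in> L2 {0..\<tau>}"
  by (rule eventually_mono) (use main in blast)
 show "((\<lambda>V. L2norm {0..\<tau>} (\<lambda>t. Cobs (T t V) - (- 2 * h (t - 1)))) \<longlongrightarrow> 0) (near_in_domain c0 c1 B)"
 proof (rule tendstoI)
  fix r :: real assume r: "r > 0"
  define \<delta> where "\<delta> = r / sqrt (2 * L)"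
  have \<delta>: "\<delta> > 0" using r L by (simp add: \<delta>_def)
  have "\<forall>\<^sub>F V in near_in_domain c0 c1 B. V \<in> dom_A0 c0 c1 \<and> HHdist V B < \<delta>"
   using \<delta> by (intro eventually_INF1[of \<delta>]) (auto simp: eventually_principal)
  then show "\<forall>\<^sub>F V in near_in_domain c0 c1 B. dist (L2norm {0..\<tau>} (\<lambda>t. Cobs (T t V) - (- 2 * h (t - 1)))) 0 < r"
  proof eventually_elim
   case (elim V)
   have m: "(\<lambda>t. Cobs (T t V) - (- 2 * h (t - 1))) \<in> L2 {0..\<tau>}"
    "L2norm {0..\<tau>} (\<lambda>t. Cobs (T t V) - (- 2 * h (t - 1))) \<le> sqrt (2 * L) * HHdist V B"
    using main elim by auto
   have "sqrt (2 * L) * HHdist V B < r" using elim L by (simp add: \<delta>_def field_simps)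
   then have "L2norm {0..\<tau>} (\<lambda>t. Cobs (T t V) - (- 2 * h (t - 1))) < r" using m(2) by linarith
   moreover have "0 \<le> L2norm {0..\<tau>} (\<lambda>t. Cobs (T t V) - (- 2 * h (t - 1)))" by (rule L2norm_nonneg[OF _ m(1)]) simp
   ultimately show ?case by (simp only: dist_real_def diff_zero abs_of_nonneg)
  qed
 qed
qed

lemma output_function_unique:
 assumes c: "0 < c0" "c0 < 1" "0 < c1" and S: "semigroup_generated_by_A0 c0 c1 T"
  and d: "delay_solution c0 c1 G h" and e: "HH_eq (flow G h 0) B"
 shows "output_function c0 c1 T B (\<lambda>t. - 2 * h (t - 1))"
  and "output_function c0 c1 T B y \<Longrightarrow> AE t in lebesgue_on {0..}. - 2 * h (t - 1) = y t"
proof -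
 have h: "h \<in> locL2" "prim G h" using d by (auto simp: delay_solution_def)
 have "(\<lambda>t. h (t - 1)) \<in> locL2" using locL2_affine[OF h(1), of 1 "-1"] by simp
 then have L: "(\<lambda>t. - 2 * h (t - 1)) \<in> L2loc" by (intro locL2_L2loc locL2_cmult)
 show "output_function c0 c1 T B (\<lambda>t. - 2 * h (t - 1))"
  unfolding output_function_def by (intro conjI L output_tendsto[OF c S d e])
 have B: "B \<in> HH0" by (rule HH0_cong[OF e flow_HH0[OF h]])
 show "AE t in lebesgue_on {0..}. - 2 * h (t - 1) = y t" if y: "output_function c0 c1 T B y"
  using y unfolding output_function_def
  by (intro tendsto_L2loc_unique[OF near_in_domain_nontrivial[OF c(2) B] output_tendsto[OF c S d e]]) blast
qed

text \<open>The trace at 1 of any solution, read off from the explicit one.\<close>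

lemma beta_solution_trace:
 assumes c: "0 < c0" "c0 < 1" "0 < c1" and d: "delay_solution c0 c1 G h" and e: "HH_eq (flow G h 0) B"
  and \<beta>: "beta_solution c0 c1 B \<beta> \<beta>t"
 shows "x_trace \<beta> 1 (\<lambda>t. - 2 * h (t - 1))"
proof -
 have h: "h \<in> locL2" "prim G h" using d by (auto simp: delay_solution_def)
 have b: "beta_solution c0 c1 B (disp G) (disp h)"
  using disp_beta_solution[OF c(1,2) d] e by (simp add: flow_def)
 show ?thesis
  by (rule x_trace_cong[OF x_trace_disp(2)[OF h]]) (auto intro: beta_solution_unique[OF c b \<beta>])
qed

theorem output_function_properties:
 assumes c: "0 < c0" "c0 < 1" "0 < c1" and S: "semigroup_generated_by_A0 c0 c1 T" and B: "B \<in> HH0"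
 shows "(\<exists>y. output_function c0 c1 T B y) \<and> (\<exists>\<beta> \<beta>t. beta_solution c0 c1 B \<beta> \<beta>t) \<and>
  (\<forall>y. output_function c0 c1 T B y \<longrightarrow> y \<in> L2 {0..} \<and> (\<forall>\<beta> \<beta>t. beta_solution c0 c1 B \<beta> \<beta>t \<longrightarrow> x_trace \<beta> 1 y))"
proof -
 obtain G h where d: "delay_solution c0 c1 G h" and e: "HH_eq (flow G h 0) B" using HH0_delay[OF B] .
 note U = output_function_unique[OF c S d e]
 have "beta_solution c0 c1 B (disp G) (disp h)"
  using disp_beta_solution[OF c(1,2) d] e by (simp add: flow_def)
 moreover have "y \<in> L2 {0..} \<and> (\<forall>\<beta> \<beta>t. beta_solution c0 c1 B \<beta> \<beta>t \<longrightarrow> x_trace \<beta> 1 y)"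
  if y: "output_function c0 c1 T B y" for y
 proof (intro conjI allI impI)
  show "y \<in> L2 {0..}" by (rule L2_cong_AE(1)[OF _ delay_output_L2[OF c d] U(2)[OF y]]) simp
  fix \<beta> \<beta>t assume "beta_solution c0 c1 B \<beta> \<beta>t"
  from x_trace_cong[OF beta_solution_trace[OF c d e this] U(2)[OF y]] show "x_trace \<beta> 1 y" by simp
 qed
 ultimately show ?thesis using U(1) by blast
qed

section \<open>The transport equation\<close>

text \<open>The average over \<open>x\<close> of $\Phi(0)^2\le2\Phi(x)^2+2(\int_0^xg)^2$.\<close>

lemma sobolev_endpoint:
 assumes P: "prim \<Phi> g" and g: "g \<in> locL2"
 shows "(\<Phi> 0)\<^sup>2 \<le> 2 * sqint 0 1 \<Phi> + 2 * sqint 0 1 g"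
proof -
 have \<Phi>: "\<Phi> \<in> locL2" by (rule locL2_continuous[OF prim_continuous[OF P]])
 have pt: "(\<Phi> 0)\<^sup>2 \<le> 2 * (\<Phi> x)\<^sup>2 + 2 * sqint 0 1 g" if x: "x \<in> {0..1}" for x
 proof -
  have "(\<Phi> x - \<Phi> 0)\<^sup>2 \<le> (x - 0) * sqint 0 x g"
   using Cauchy_Schwarz_interval[OF locL2_D[OF g], of 0 x] prim_integral[OF P, of 0 x] x by (simp add: sqint_def)
  also have "\<dots> \<le> 1 * sqint 0 1 g" using x by (intro mult_mono sqint_mono[OF g] sqint_nonneg) auto
  finally have "(\<Phi> x - \<Phi> 0)\<^sup>2 \<le> sqint 0 1 g" by simp
  moreover have "0 \<le> (2 * \<Phi> x - \<Phi> 0)\<^sup>2" by simp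
  ultimately show ?thesis by (simp add: power2_eq_square algebra_simps)
 qed
 have i: "((\<lambda>x. 2 * (\<Phi> x)\<^sup>2 + 2 * sqint 0 1 g) has_integral 2 * sqint 0 1 \<Phi> + 2 * sqint 0 1 g) {0..1}"
  unfolding sqint_def[of 0 1 \<Phi>]
  using has_integral_add[OF has_integral_mult_right[OF integrable_integral[OF locL2_sq_int[OF \<Phi>, of 0 1]], of 2] has_integral_const_real[of "2 * sqint 0 1 g" 0 1]]
  by simp
 have "((\<lambda>x::real. (\<Phi> 0)\<^sup>2) has_integral (\<Phi> 0)\<^sup>2) {0..1}" using has_integral_const_real[of "(\<Phi> 0)\<^sup>2" 0 1] by simp
 then show ?thesis by (rule has_integral_le[OF _ i pt])
qed

text \<open>A solution of $W_t=-W_x$ in $C(0,\infty;H^1(0,1))$ is a solution of the wave equation with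
 $W_t$ in $C(0,\infty;L^2(0,1))$.\<close>

lemma transport_wave_solution:
 assumes W: "transport_solution W"
 defines "Wt \<equiv> \<lambda>x t. - wderiv (\<lambda>x. W x t) x"
 shows "wave_solution W Wt"
proof -
 have c1: "continuous_H1 W" and eq: "\<And>\<eta>. test_fun2 \<eta> \<Longrightarrow> pairing W (dt \<eta>) = - pairing W (dx \<eta>)"
  using W by (auto simp: transport_solution_def)
 define g where "g s = ext01 (wderiv (\<lambda>x. W x s))" for s
 have repr: "\<exists>\<Phi>. state_repr (state_at W Wt s) \<Phi> (g s) (\<lambda>x. - g s x)" if s: "s \<ge> 0" for s
 proof -
  have H: "(\<lambda>x. W x s) \<in> H1" using c1 s by (auto simp: continuous_H1_def)
  obtain \<Phi> where "prim \<Phi> (ext01 (wderiv (\<lambda>x. W x s)))" "wderiv (\<lambda>x. W x s) \<in> L2 {0..1}" "\<And>x. x \<in> {0..1} \<Longrightarrow> W x s = \<Phi> x"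
   using H1_prim[OF H] by blast
  then have "state_repr (state_at W Wt s) \<Phi> (g s) (\<lambda>x. - g s x)"
   unfolding state_repr_def g_def state_at_def fst_conv snd_conv
   by (intro conjI ballI AE_I2 ext01_locL2 locL2_minus) (auto simp: Wt_def ext01_def)
  then show ?thesis by blast
 qed
 have dist: "HHdist (state_at W Wt s) (state_at W Wt t) \<le> 2 * H1norm (\<lambda>x. W x s - W x t)" if st: "s \<ge> 0" "t \<ge> 0" for s t
 proof -
  obtain \<Phi> where r: "state_repr (state_at W Wt s) \<Phi> (g s) (\<lambda>x. - g s x)" using repr[OF st(1)] by blast
  obtain \<Psi> where r': "state_repr (state_at W Wt t) \<Psi> (g t) (\<lambda>x. - g t x)" using repr[OF st(2)] by blast
  let ?D = "\<lambda>x. W x s - W x t"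
  define P p where "P x = 1 * \<Phi> x + (-1) * \<Psi> x" and "p x = 1 * g s x + (-1) * g t x" for x
  have R: "state_repr (lincomb 1 (state_at W Wt s) (-1) (state_at W Wt t)) P p (\<lambda>x. 1 * (- g s x) + (-1) * (- g t x))"
   unfolding P_def[abs_def] p_def[abs_def] by (rule state_repr_lincomb[OF r r'])
  have PP: "prim P p" "p \<in> locL2" and DP: "\<And>x. x \<in> {0..1} \<Longrightarrow> ?D x = P x"
   using R by (auto simp: state_repr_def state_at_def lincomb_def)
  have PL: "P \<in> locL2" by (rule locL2_continuous[OF prim_continuous[OF PP(1)]])
  have "AE x in lebesgue_on {0..1}. P x = ?D x" by (rule AE_I2) (simp add: DP)
  note d = L2_cong_AE[OF interval01_sets locL2_D[OF PL] this]
  have "AE x in lebesgue_on {0..1}. wderiv ?D x = p x" by (rule H1_intro(2)[OF PP DP])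
  then have "AE x in lebesgue_on {0..1}. p x = wderiv ?D x" by eventually_elim simp
  note d' = L2_cong_AE[OF interval01_sets locL2_D[OF PP(2)] this]
  have n: "H1norm ?D = sqrt (sqint 0 1 P + sqint 0 1 p)"
   unfolding H1norm_def integral_sq_eq[OF interval01_sets d(1)] integral_sq_eq[OF interval01_sets d'(1)] d(2) d'(2) sqint_def ..
  have "(HHdist (state_at W Wt s) (state_at W Wt t))\<^sup>2 = sqint 0 1 p + sqint 0 1 (\<lambda>x. (-1) * p x) + (P 0)\<^sup>2"
   unfolding HHdist_def state_repr_norm_sq(1)[OF R] by (simp add: p_def algebra_simps)
  also have "\<dots> \<le> 4 * (sqint 0 1 P + sqint 0 1 p)"
   unfolding sqint_cmult using sobolev_endpoint[OF PP] sqint_nonneg[of 0 1 P] by simp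
  finally have "HHdist (state_at W Wt s) (state_at W Wt t) \<le> sqrt (4 * (sqint 0 1 P + sqint 0 1 p))" by (rule real_le_rsqrt)
  also have "\<dots> = 2 * sqrt (sqint 0 1 P + sqint 0 1 p)" by (simp only: real_sqrt_mult real_sqrt_four)
  finally show ?thesis unfolding n .
 qed
 have HH: "state_at W Wt t \<in> HH" if "t \<ge> 0" for t using repr[OF that] state_repr_HH by blast
 have cHH: "continuous_HH (state_at W Wt)"
  unfolding continuous_HH_def
 proof (intro allI impI conjI HH)
  fix t :: real assume t: "t \<ge> 0"
  have "((\<lambda>s. H1norm (\<lambda>x. W x s - W x t)) \<longlongrightarrow> 0) (at t within {0..})" using c1 t by (auto simp: continuous_H1_def)
  then have lim: "((\<lambda>s. 2 * H1norm (\<lambda>x. W x s - W x t)) \<longlongrightarrow> 0) (at t within {0..})"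
   by (rule tendsto_mult_right_zero)
  show "((\<lambda>s. HHdist (state_at W Wt s) (state_at W Wt t)) \<longlongrightarrow> 0) (at t within {0..})"
  proof (rule Lim_null_comparison[OF _ lim])
   show "\<forall>\<^sub>F s in at t within {0..}. norm (HHdist (state_at W Wt s) (state_at W Wt t)) \<le> 2 * H1norm (\<lambda>x. W x s - W x t)"
    unfolding eventually_at_filter using dist HHdist_nonneg[OF HH HH] t by (intro always_eventually) auto
  qed
 qed
 note ci = continuous_HH_imp[OF cHH]
 have 1: "pairing W (dt \<eta>) = - pairing Wt \<eta>" if t: "test_fun2 \<eta>" for \<eta>
 proof -
  have "pairing W (dx \<eta>) = - pairing (\<lambda>x t. (-1) * Wt x t + 0 * Wt x t) \<eta>"
  proof (rule pairing_dx[OF ci(2) L2cont_lincomb[OF ci(3) ci(3)] t])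
   fix s :: real assume "s \<ge> 0"
   then obtain \<Phi> where r: "state_repr (state_at W Wt s) \<Phi> (g s) (\<lambda>x. - g s x)" using repr by blast
   then have "AE x in lebesgue_on {0..1}. Wt x s = - g s x" by (simp add: state_repr_def state_at_def)
   then have "AE x in lebesgue_on {0..1}. (-1) * Wt x s + 0 * Wt x s = g s x" by eventually_elim simp
   then show "\<exists>\<Phi> k. prim \<Phi> k \<and> (\<forall>x\<in>{0..1}. W x s = \<Phi> x) \<and> (AE x in lebesgue_on {0..1}. (-1) * Wt x s + 0 * Wt x s = k x)"
    using r by (intro exI[of _ \<Phi>] exI[of _ "g s"]) (simp add: state_repr_def state_at_def)
  qed
  then show ?thesis using eq[OF t] unfolding pairing_lincomb[OF ci(3) ci(3) t] by simp
 qed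
 have 2: "pairing W (dt (dt \<eta>)) = pairing W (dx (dx \<eta>))" if t: "test_fun2 \<eta>" for \<eta>
 proof -
  note d = test_fun2_derivs[OF t]
  show ?thesis using eq[OF d(2)] eq[OF d(1)] d(3) by simp
 qed
 show ?thesis using cHH 1 2 W by (simp add: wave_solution_def transport_solution_def)
qed

text \<open>\<open>W\<close> is constant along the characteristics that enter at $x=0$.\<close>

lemma transport_outgoing:
 assumes W: "transport_solution W" and x: "0 < x" "x < 1" "x \<le> t"
 shows "W x t = W 0 (t - x)"
proof -
 have cHH: "continuous_HH (state_at W (\<lambda>x t. - wderiv (\<lambda>x. W x t) x))"
  using transport_wave_solution[OF W] by (simp add: wave_solution_def)
 note ci = continuous_HH_imp[OF cHH] and cj = continuous_HH_joint[OF cHH]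
 have eq: "\<And>\<eta>. test_fun2 \<eta> \<Longrightarrow> pairing W (dt \<eta>) = - pairing W (dx \<eta>)" using W by (auto simp: transport_solution_def)
 have "W x t = W (x - 1 * x) (t - x)"
 proof (rule characteristic_endpoint[OF cj(1)])
  fix k assume k: "0 \<le> k" "k < x"
  show "W x t = W (x - 1 * k) (t - k)"
  proof (cases "k = 0")
   case False
   then have k0: "0 < k" using k by simp
   have t0: "t \<ge> 0" "t - k \<ge> 0" using x k by auto
   show ?thesis
   proof (rule mollifier_limit[OF cj(2)[OF t0(1)] cj(2)[OF t0(2)]])
    show "0 < min (x - k) (1 - x)" using x k by simp
    fix M d assume d: "0 < d" "d < min (x - k) (1 - x)" and M: "smooth_seq M" "\<And>n z. \<bar>z\<bar> \<ge> d \<Longrightarrow> M n z = 0"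
    define Y where "Y n z = M n (z - (x - t))" for n z
    have Y: "profile Y (x - t - d) (x - t + d) 1 (t - k) t"
     unfolding Y_def by (rule profile_shift[OF M d(1)]) (use d in auto)
    have "moment W (Y 0) 1 t = moment W (Y 0) 1 (t - k)"
     by (rule transport_moment_constant[OF ci(2) eq Y t0(2)]) (use k0 in auto)
    then show "integral {0..1} (\<lambda>z. W z t * M 0 (z - x)) = integral {0..1} (\<lambda>z. W z (t - k) * M 0 (z - (x - 1 * k)))"
     by (simp add: moment_def Y_def algebra_simps)
   qed (use x k in auto)
  qed simp
 qed (use x in auto)
 then show ?thesis by simp
qed

lemma transport_trace:
 assumes W: "transport_solution W" and \<xi>: "x_trace W 0 \<xi>" and b: "t_trace W 0 b"
 shows "AE t in lebesgue_on {0..}. b t = - \<xi> t"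
proof -
 have cHH: "continuous_HH (state_at W (\<lambda>x t. - wderiv (\<lambda>x. W x t) x))"
  using transport_wave_solution[OF W] by (simp add: wave_solution_def)
 have Wc: "continuous_on {0..} (\<lambda>t. W 0 t)" using continuous_HH_imp(4)[OF cHH] by simp
 have \<xi>L: "\<xi> \<in> L2loc" using \<xi> by (simp add: x_trace_def)
 define \<rho> where "\<rho> t = (if t \<in> {0..} then \<xi> t else 0)" for t
 have \<rho>: "\<rho> \<in> locL2" unfolding \<rho>_def by (rule L2loc_extend[OF \<xi>L])
 obtain R where R: "prim R \<rho>" using prim_locL2[OF \<rho>] by blast
 have le: "W 0 s + R s = W 0 r + R r" if "0 < s" "s \<le> r" for s r
 proof -
  have "integral {s..r} \<rho> = integral {s..r} \<xi>"
   by (rule integral_cong_on) (use that in \<open>simp add: \<rho>_def\<close>)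
  also have "\<dots> = W 0 s - W 0 r"
   by (rule outgoing_trace[OF Wc _ _ _ \<xi> that, of 1 "r + 1"]) (use transport_outgoing[OF W] in auto)
  finally show ?thesis using prim_integral[OF R that(2)] by simp
 qed
 have Rc: "prim (\<lambda>t. (-1) * R t + (W 0 1 + R 1)) (\<lambda>t. (-1) * \<rho> t)" by (intro prim_shift_const prim_cmult R)
 have Wr: "W 0 t = (-1) * R t + (W 0 1 + R 1)" if "t > 0" for t 
 proof -
  have "W 0 t + R t = W 0 1 + R 1"
   using le[of t 1] le[of 1 t, symmetric] that by (metis linear zero_less_one)
  then show ?thesis by linarith
 qed
 have "t_trace W 0 (\<lambda>t. (-1) * \<rho> t)" by (rule t_trace_prim[where w = W and a = 0, OF Rc locL2_cmult[OF \<rho>] Wr])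
 from t_trace_unique[OF b this] have 1: "AE t in lebesgue_on {0..}. b t = (-1) * \<rho> t" by simp
 have "AE t in lebesgue_on {0..}. \<rho> t = \<xi> t" by (rule AE_I2) (simp add: \<rho>_def)
 with 1 show ?thesis by eventually_elim simp
qed

section \<open>The error of the estimator\<close>

lemma wave_solution_boundary:
 assumes "wave_solution w wt"
 shows "x \<in> {0..1} \<Longrightarrow> continuous_on {0..} (\<lambda>t. w x t)" "state_at w wt 0 \<in> HH"
proof -
 have "continuous_HH (state_at w wt)" using assms by (simp add: wave_solution_def)
 note c = continuous_HH_imp[OF this]
 show "x \<in> {0..1} \<Longrightarrow> continuous_on {0..} (\<lambda>t. w x t)" by (rule c(4))
 show "state_at w wt 0 \<in> HH" by (rule c(1)) simp
qed

text \<open>In $z-w+v+W$ the unknown input \<open>u\<close> and the term $W_x(1,\cdot)$ cancel at $x=1$, where the condition for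
 \<open>z\<close> makes the value zero. At $x=0$ the boundary value is $z+(1-c_0)(v-w)$, since
 $W=-c_0(v-w)$, and the transport equation replaces $W_x$ by $-W_t=c_0(v_t-w_t)$; the factors $1-c_0$ cancel the
 denominators in the condition for \<open>z\<close>, so \<open>z-w+v+W\<close> satisfies the same condition.\<close>

lemma estimator_error:
 assumes c: "0 < c0" "c0 < 1" "0 < c1" and p: "plant_solution q f d u w wt"
  and e: "estimator_solution c0 c1 q u w v vt z zt W" and Fh: "x_trace z 1 Fhat"
 defines "\<beta> \<equiv> \<lambda>x t. z x t - (w x t - v x t - W x t)"
 shows "x_trace \<beta> 1 (\<lambda>t. Fhat t - total_disturbance f d w wt t)"
  "\<exists>\<beta>t. state_at \<beta> \<beta>t 0 \<in> HH0 \<and> beta_solution c0 c1 (state_at \<beta> \<beta>t 0) \<beta> \<beta>t"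
proof -
 define \<kappa> \<gamma> where "\<kappa> = c0 / (1 - c0)" and "\<gamma> = c1 / (1 - c0)"
 have \<kappa>\<gamma>: "\<gamma> * (1 - c0) = c1" "\<kappa> * (1 - c0) = c0" using c by (simp_all add: \<kappa>_def \<gamma>_def)
 have w: "wave_solution w wt" "x_trace w 0 (\<lambda>t. - q * w 0 t)" "x_trace w 1 (\<lambda>t. u t + total_disturbance f d w wt t)"
  using p by (auto simp: plant_solution_def)
 have v: "wave_solution v vt" "x_trace v 0 (\<lambda>t. - q * w 0 t + c1 * (v 0 t - w 0 t))" and z: "wave_solution z zt"
  and z1: "AE t in lebesgue_on {0..}. z 1 t = - v 1 t + w 1 t - W 1 t" and W: "transport_solution W"
  and W0: "AE t in lebesgue_on {0..}. W 0 t = - c0 * (v 0 t - w 0 t)"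
  using e by (auto simp: estimator_solution_def)
 obtain g where g: "x_trace W 1 g" "x_trace v 1 (\<lambda>t. u t - g t)" using e by (auto simp: estimator_solution_def)
 obtain bz where bz: "t_trace z 0 bz" "x_trace z 0 (\<lambda>t. \<gamma> * z 0 t + \<kappa> * bz t)"
  using e by (auto simp: estimator_solution_def \<gamma>_def \<kappa>_def)
 obtain bw where bw: "t_trace w 0 bw" using w(1) by (auto simp: wave_solution_def)
 obtain bv where bv: "t_trace v 0 bv" using v(1) by (auto simp: wave_solution_def)
 obtain \<xi> bW where bW: "x_trace W 0 \<xi>" "t_trace W 0 bW" using W by (auto simp: transport_solution_def)
 define Wt where "Wt x t = - wderiv (\<lambda>x. W x t) x" for x t
 have ws: "wave_solution W Wt" unfolding Wt_def by (rule transport_wave_solution[OF W])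
 define \<beta>t where "\<beta>t x t = 1 * (1 * zt x t + (-1) * wt x t) + 1 * (1 * vt x t + 1 * Wt x t)" for x t
 have \<beta>: "\<beta> = (\<lambda>x t. 1 * (1 * z x t + (-1) * w x t) + 1 * (1 * v x t + 1 * W x t))"
  by (simp add: \<beta>_def fun_eq_iff)
 have \<beta>w: "wave_solution \<beta> \<beta>t"
  unfolding \<beta> \<beta>t_def[abs_def] by (intro wave_solution_lincomb z w(1) v(1) ws)
 have "x_trace \<beta> 1 (\<lambda>t. 1 * (1 * Fhat t + (-1) * (u t + total_disturbance f d w wt t)) + 1 * (1 * (u t - g t) + 1 * g t))"
  unfolding \<beta> by (intro x_trace_lincomb Fh w(3) g)
 then show tr1: "x_trace \<beta> 1 (\<lambda>t. Fhat t - total_disturbance f d w wt t)" by simp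
 have cont: "continuous_on {0..} (\<lambda>t. w 0 t)" "continuous_on {0..} (\<lambda>t. v 0 t)" "continuous_on {0..} (\<lambda>t. W 0 t)" "continuous_on {0..} (\<lambda>t. \<beta> 1 t)"
  using wave_solution_boundary[OF w(1)] wave_solution_boundary[OF v(1)] wave_solution_boundary[OF ws] wave_solution_boundary[OF \<beta>w] by simp_all
 have W0': "W 0 t = - c0 * v 0 t + c0 * w 0 t" if "t \<ge> 0" for t
 proof -
  have "AE t in lebesgue_on {0..}. W 0 t = - c0 * v 0 t + c0 * w 0 t" using W0 by eventually_elim (simp add: algebra_simps)
  moreover have "continuous_on {0..} (\<lambda>t. - c0 * v 0 t + c0 * w 0 t)" by (intro continuous_intros cont)
  ultimately show ?thesis
   using AE_continuous_eq[of "{0..}" "\<lambda>t. W 0 t" "\<lambda>t. - c0 * v 0 t + c0 * w 0 t" t] cont(3) that by simp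
 qed
 have "t_trace (\<lambda>x t. - c0 * v x t + c0 * w x t) 0 (\<lambda>t. - c0 * bv t + c0 * bw t)" by (rule t_trace_lincomb[OF bv bw])
 from t_trace_unique[OF bW(2) this] have bW': "AE t in lebesgue_on {0..}. bW t = - c0 * bv t + c0 * bw t"
  using W0' by simp
 define b where "b t = 1 * (1 * bz t + (-1) * bw t) + 1 * (1 * bv t + 1 * bW t)" for t
 have bt: "t_trace \<beta> 0 b"
  unfolding \<beta> b_def[abs_def] by (intro t_trace_lincomb bz(1) bw bv bW(2))
 have "x_trace \<beta> 0 (\<lambda>t. 1 * (1 * (\<gamma> * z 0 t + \<kappa> * bz t) + (-1) * (- q * w 0 t)) + 1 * (1 * (- q * w 0 t + c1 * (v 0 t - w 0 t)) + 1 * \<xi> t))"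
  unfolding \<beta> by (intro x_trace_lincomb bz(2) w(2) v(2) bW(1))
 moreover have "AE t in lebesgue_on {0..}. 1 * (1 * (\<gamma> * z 0 t + \<kappa> * bz t) + (-1) * (- q * w 0 t))
   + 1 * (1 * (- q * w 0 t + c1 * (v 0 t - w 0 t)) + 1 * \<xi> t) = \<gamma> * \<beta> 0 t + \<kappa> * b t"
  using W0 bW' transport_trace[OF W bW]
 proof eventually_elim
  case (elim t)
  have "\<gamma> * \<beta> 0 t = \<gamma> * z 0 t + (\<gamma> * (1 - c0)) * (v 0 t - w 0 t)" unfolding \<beta>_def elim(1) by (simp add: algebra_simps)
  moreover have "\<kappa> * b t = \<kappa> * bz t + (\<kappa> * (1 - c0)) * (bv t - bw t)" unfolding b_def elim(2) by (simp add: algebra_simps)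
  moreover have "\<xi> t = c0 * (bv t - bw t)" using elim(2,3) by (simp add: algebra_simps)
  ultimately show ?case unfolding \<kappa>\<gamma> by simp
 qed
 ultimately have tr0: "x_trace \<beta> 0 (\<lambda>t. \<gamma> * \<beta> 0 t + \<kappa> * b t)" by (rule x_trace_cong) auto
 have b1: "AE t in lebesgue_on {0..}. \<beta> 1 t = 0" using z1 by eventually_elim (simp add: \<beta>_def)
 have "\<beta> 1 0 = 0" using AE_continuous_eq[of "{0..}" "\<lambda>t. \<beta> 1 t" "\<lambda>_. 0" 0] b1 cont(4) by simp
 moreover have "state_at \<beta> \<beta>t 0 \<in> HH" by (rule wave_solution_boundary(2)[OF \<beta>w])
 ultimately have "state_at \<beta> \<beta>t 0 \<in> HH0" by (simp add: HH0_iff) (simp add: state_at_def)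
 moreover have "beta_solution c0 c1 (state_at \<beta> \<beta>t 0) \<beta> \<beta>t"
  unfolding beta_solution_def \<gamma>_def[symmetric] \<kappa>_def[symmetric] using \<beta>w bt tr0 b1 by auto
 ultimately show "\<exists>\<beta>t. state_at \<beta> \<beta>t 0 \<in> HH0 \<and> beta_solution c0 c1 (state_at \<beta> \<beta>t 0) \<beta> \<beta>t" by blast
qed

lemma beta_trace_L2:
 assumes c: "0 < c0" "c0 < 1" "0 < c1" and B: "B \<in> HH0" and \<beta>: "beta_solution c0 c1 B \<beta> \<beta>t" and y: "x_trace \<beta> 1 y"
 shows "y \<in> L2 {0..}"
proof -
 obtain G h where d: "delay_solution c0 c1 G h" and e: "HH_eq (flow G h 0) B" using HH0_delay[OF B] .
 have "AE t in lebesgue_on {0..}. - 2 * h (t - 1) = y t"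
  using x_trace_unique[OF beta_solution_trace[OF c d e \<beta>] y] by simp
 then show ?thesis by (intro L2_cong_AE(1)[OF _ delay_output_L2[OF c d]]) simp_all
qed

theorem mainTheorem3:
  fixes c0 c1 q :: real
  assumes "0 < c0" "c0 < 1" "c1 > 0" "q > 0"
  shows
    "(\<forall>T. semigroup_generated_by_A0 c0 c1 T \<longrightarrow>
        (\<forall>B\<in>HH0.
           (\<exists>y. output_function c0 c1 T B y) \<and>
           (\<exists>\<beta> \<beta>t. beta_solution c0 c1 B \<beta> \<beta>t) \<and>
           (\<forall>y. output_function c0 c1 T B y \<longrightarrow>
              y \<in> L2 {0..} \<and>
              (\<forall>\<beta> \<beta>t. beta_solution c0 c1 B \<beta> \<beta>t \<longrightarrow> x_trace \<beta> 1 y)))) \<and>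
     (\<forall>f d u w wt v vt z zt W Fhat.
        well_defined_on_HH f \<and> u \<in> L2loc \<and>
        plant_solution q f d u w wt \<and>
        estimator_solution c0 c1 q u w v vt z zt W \<and>
        x_trace z 1 Fhat \<longrightarrow>
        (let F = total_disturbance f d w wt;
             p = (\<lambda>x t. w x t - v x t - W x t);
             \<beta> = (\<lambda>x t. z x t - p x t)
         in (\<lambda>t. Fhat t - F t) \<in> L2 {0..} \<and>
            x_trace \<beta> 1 (\<lambda>t. Fhat t - F t) \<and>
            (\<exists>\<beta>t. state_at \<beta> \<beta>t 0 \<in> HH0 \<and>
                   beta_solution c0 c1 (state_at \<beta> \<beta>t 0) \<beta> \<beta>t)))"
proof (rule conjI)
 show "\<forall>T. semigroup_generated_by_A0 c0 c1 T \<longrightarrow>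
    (\<forall>B\<in>HH0.
      (\<exists>y. output_function c0 c1 T B y) \<and>
      (\<exists>\<beta> \<beta>t. beta_solution c0 c1 B \<beta> \<beta>t) \<and>
      (\<forall>y. output_function c0 c1 T B y \<longrightarrow>
       y \<in> L2 {0..} \<and>
       (\<forall>\<beta> \<beta>t. beta_solution c0 c1 B \<beta> \<beta>t \<longrightarrow> x_trace \<beta> 1 y)))"
  by (intro allI impI ballI output_function_properties assms(1-3))
 show "\<forall>f d u w wt v vt z zt W Fhat.
    well_defined_on_HH f \<and> u \<in> L2loc \<and>
    plant_solution q f d u w wt \<and>
    estimator_solution c0 c1 q u w v vt z zt W \<and>
    x_trace z 1 Fhat \<longrightarrow>
    (let F = total_disturbance f d w wt;
       p = (\<lambda>x t. w x t - v x t - W x t);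
       \<beta> = (\<lambda>x t. z x t - p x t)
     in (\<lambda>t. Fhat t - F t) \<in> L2 {0..} \<and>
      x_trace \<beta> 1 (\<lambda>t. Fhat t - F t) \<and>
      (\<exists>\<beta>t. state_at \<beta> \<beta>t 0 \<in> HH0 \<and>
          beta_solution c0 c1 (state_at \<beta> \<beta>t 0) \<beta> \<beta>t))"
  unfolding Let_def
 proof (intro allI impI, elim conjE)
  fix f d u w wt v vt z zt W Fhat
  assume p: "plant_solution q f d u w wt" and e: "estimator_solution c0 c1 q u w v vt z zt W" and F: "x_trace z 1 Fhat"
  note E = estimator_error[OF assms(1-3) p e F]
  from E(2) obtain \<beta>t where "state_at (\<lambda>x t. z x t - (w x t - v x t - W x t)) \<beta>t 0 \<in> HH0"
   "beta_solution c0 c1 (state_at (\<lambda>x t. z x t - (w x t - v x t - W x t)) \<beta>t 0) (\<lambda>x t. z x t - (w x t - v x t - W x t)) \<beta>t"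
   by (elim exE conjE)
  from beta_trace_L2[OF assms(1-3) this E(1)]
  show "(\<lambda>t. Fhat t - total_disturbance f d w wt t) \<in> L2 {0..} \<and>
    x_trace (\<lambda>x t. z x t - (w x t - v x t - W x t)) 1 (\<lambda>t. Fhat t - total_disturbance f d w wt t) \<and>
    (\<exists>\<beta>t. state_at (\<lambda>x t. z x t - (w x t - v x t - W x t)) \<beta>t 0 \<in> HH0 \<and>
     beta_solution c0 c1 (state_at (\<lambda>x t. z x t - (w x t - v x t - W x t)) \<beta>t 0) (\<lambda>x t. z x t - (w x t - v x t - W x t)) \<beta>t)"
   by (intro conjI E)
 qed
qed

end
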